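(* Provided that $C_{\mathrm{Nit}}$ is chosen sufficiently large, there exists a constant $C_{\mathrm{coer}}>0$ such that $$\mathscr{A}_{\mathrm{stb}}(\boldsymbol{u}_h,\boldsymbol{u}_h)\ \ge\ C_{\mathrm{coer}}\,|||\boldsymbol{u}_h|||^2\qquad\text{for all }\boldsymbol{u}_h\in\mathring{\boldsymbol{\mathcal{V}}}_h,$$ where $$|||\boldsymbol{u}_h|||^2=2\nu(\nabla^s\boldsymbol{u}_h,\nabla^s\boldsymbol{u}_h)+2\nu\frac{C_{\mathrm{Nit}}}{h}\|\boldsymbol{u}_h\|^2_{\mathbf{L}^2(\mathcal{E}_\partial)}+\big\|\eta^{1/2}[\![\partial_{\boldsymbol{n}}^{\alpha'+1}\boldsymbol{u}_h]\!]\big\|^2_{\mathbf{L}^2(\mathcal{E}_0)} .$$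
   Context: Conventions. $d\in\{2,3\}$. $(\cdot,\cdot)$ is the $L^2(\Omega)$ inner product of scalar, vector or tensor fields, $(\cdot,\cdot)_{\partial\Omega}$ and $(\cdot,\cdot)_e$ are the $L^2$ inner products on $\partial\Omega$ and on a facet $e$. $(\nabla\boldsymbol{a})_{ij}=\partial a_j/\partial x_i$, $\nabla^s\boldsymbol{a}=\frac12(\nabla\boldsymbol{a}+(\nabla\boldsymbol{a})^T)$, $\boldsymbol{C}:\boldsymbol{D}=C_{ij}D_{ij}$. $\mathbf{H}^1_{\boldsymbol{n}}(\Omega)=\{\boldsymbol{u}\in H^1(\Omega)^d : \boldsymbol{u}\cdot\boldsymbol{n}=0 \text{ on }\partial\Omega\}$ (trace sense). Mesh and spline spaces. $\hat\Omega\subset\mathbb{R}^d$ is a box with a tensor-product mesh $\hat{\mathcal{T}}_h$ given by unique knots $\zeta_{i,1}<\dots<\zeta_{i,n_i}$ in each direction $i$. The physical domain is $\Omega=\mathcal{F}(\hat\Omega)$ for an invertible parametrization $\mathcal{F}$, as smooth as needed for the expressions below to be defined; $\mathcal{T}_h=\{\mathcal{F}(\hat K):\hat K\in\hat{\mathcal{T}}_h\}$ is quasi-uniform with mesh size $h$ (there is $C>0$ with $Ch\le \mathrm{diam}(K)\le h/C$ for all $K\in\mathcal{T}_h$). $\mathcal{B}^{k_1,\dots,k_d}_{\boldsymbol{\alpha}_1,\dots,\boldsymbol{\alpha}_d}$ is the tensor product of the univariate spline spaces of piecewise polynomials of degree $k_i$ on the mesh $\{\zeta_{i,j}\}_j$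 having $\alpha_{i,j}$ continuous derivatives at each interior knot $\zeta_{i,j}$, with $\boldsymbol{\alpha}_i=[-1,\alpha_{i,2},\dots,\alpha_{i,n_i-1},-1]$; $\boldsymbol{\alpha}_i-1$ denotes $[-1,\alpha_{i,2}-1,\dots,\alpha_{i,n_i-1}-1,-1]$. Fix integers $k'\ge1$ and $\alpha'\ge0$ and take $k_i=k'+1$ for all $i$ and $\alpha_{i,j}=\alpha'+1$ at all interior knots. With $\iota(\boldsymbol{v})=\det(D\mathcal{F})(D\mathcal{F})^{-1}(\boldsymbol{v}\circ\mathcal{F})$, the divergence-conforming B-spline velocity space $\boldsymbol{\mathcal{V}}_h$ is the set of $\boldsymbol{v}\in\mathbf{H}^1_{\boldsymbol{n}}(\Omega)$ with $\iota(\boldsymbol{v})\in\mathcal{B}^{k_1,k_2-1,k_3-1}_{\boldsymbol{\alpha}_1,\boldsymbol{\alpha}_2-1,\boldsymbol{\alpha}_3-1}\times\mathcal{B}^{k_1-1,k_2,k_3-1}_{\boldsymbol{\alpha}_1-1,\boldsymbol{\alpha}_2,\boldsymbol{\alpha}_3-1}\times\mathcal{B}^{k_1-1,k_2-1,k_3}_{\boldsymbol{\alpha}_1-1,\boldsymbol{\alpha}_2-1,\boldsymbol{\alpha}_3}$ if $d=3$, and $\iota(\boldsymbol{v})\in\mathcal{B}^{k_1,k_2-1}_{\boldsymbol{\alpha}_1,\boldsymbol{\alpha}_2-1}\times\mathcal{B}^{k_1-1,k_2}_{\boldsymbol{\alpha}_1-1,\boldsymbol{\alpha}_2}$ if $d=2$.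 $\mathring{\boldsymbol{\mathcal{V}}}_h=\{\boldsymbol{v}_h\in\boldsymbol{\mathcal{V}}_h:\nabla\cdot\boldsymbol{v}_h=0\text{ in }\Omega\}$. Facets and jumps. $\mathcal{E}_0$ is the set of interior facets ($(d-1)$-dimensional intersections $e=\partial K_1\cap\partial K_2$ of distinct elements), with unit normal $\boldsymbol{n}$ pointing out of $K_1$; $[\![\phi]\!]=\phi^+-\phi^-$ is the difference of the limits of $\phi$ on $e$ from $K_1$ and $K_2$. $\mathcal{E}_\partial$ is the set of boundary facets $e=\partial K\cap\partial\Omega$, on which $\boldsymbol{n}$ is the outward unit normal. For $\mathcal{E}\in\{\mathcal{E}_0,\mathcal{E}_\partial\}$, $\|\cdot\|^2_{\mathbf{L}^2(\mathcal{E})}=\sum_{e\in\mathcal{E}}\|\cdot\|^2_{\mathbf{L}^2(e)}$. $\partial_{\boldsymbol{n}}=\boldsymbol{n}\cdot\nabla$ and $\partial_{\boldsymbol{n}}^{\alpha'+1}$ is its $(\alpha'+1)$-fold iterate. Forms. With viscosity $\nu>0$, a dimensionless Nitsche constant $C_{\mathrm{Nit}}>0$ and a dimensionless parameter $\gamma\ge0$, $$J_h(\boldsymbol{u},\boldsymbol{v})=\sum_{e\in\mathcal{E}_0}\big(\eta\,[\![\partial_{\boldsymbol{n}}^{\alpha'+1}\boldsymbol{u}]\!],[\![\partial_{\boldsymbol{n}}^{\alpha'+1}\boldsymbol{v}]\!]\big)_e,\qquad \eta=\gamma\min\{|\boldsymbol{u}|h/\nu,\,1\}\,h^{2\alpha'+2}\,|\boldsymbol{u}\cdot\boldsymbol{n}|$$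 ($\eta$ is evaluated with the first argument of $J_h$; in $|||\boldsymbol{u}_h|||$ it is evaluated with $\boldsymbol{u}_h$), $$A_h(\boldsymbol{u},\boldsymbol{v})=(2\nu\nabla^s\boldsymbol{u},\nabla^s\boldsymbol{v})-(2\nu\boldsymbol{n}\cdot\nabla^s\boldsymbol{u},\boldsymbol{v})_{\partial\Omega}-(2\nu\boldsymbol{n}\cdot\nabla^s\boldsymbol{v},\boldsymbol{u})_{\partial\Omega}+\Big(2\nu\tfrac{C_{\mathrm{Nit}}}{h}\boldsymbol{u},\boldsymbol{v}\Big)_{\partial\Omega}+J_h(\boldsymbol{u},\boldsymbol{v}),$$ $$C(\boldsymbol{w};\boldsymbol{u},\boldsymbol{v})=-(\boldsymbol{w}\otimes\boldsymbol{u},\nabla\boldsymbol{v}),\qquad \mathscr{A}_{\mathrm{stb}}(\boldsymbol{u},\boldsymbol{v})=A_h(\boldsymbol{u},\boldsymbol{v})+C(\boldsymbol{u};\boldsymbol{u},\boldsymbol{v}).$$ "$C_{\mathrm{Nit}}$ sufficiently large" means: there is a threshold $C_0>0$ such that the assertion holds whenever $C_{\mathrm{Nit}}\ge C_0$. *)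

theory Defs
  imports "HOL-Analysis.Analysis" "HOL-Computational_Algebra.Polynomial"
begin

section \<open>Derivatives and regularity\<close>

text \<open>\<open>C\<^sup>m\<close> regularity; intended for open \<open>S\<close> only.\<close>

fun Ck_on :: "nat \<Rightarrow> ('a::real_normed_vector \<Rightarrow> 'b::real_normed_vector) \<Rightarrow> 'a set \<Rightarrow> bool" where
  "Ck_on 0 f S \<longleftrightarrow> continuous_on S f"
| "Ck_on (Suc m) f S \<longleftrightarrow>
     f differentiable_on S \<and> (\<forall>v. Ck_on m (\<lambda>x. frechet_derivative f (at x) v) S)"

text \<open>\<open>(grad a x)\<^sub>i\<^sub>j = \<partial>a\<^sub>j/\<partial>x\<^sub>i\<close> is the transpose of the Jacobian matrix.  It is a pointwise
  derivative.  The discrete velocities below are continuous and smooth inside every element, so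
  it is defined off the (null) mesh skeleton and represents the weak gradient.\<close>

definition grad :: "(real^'d \<Rightarrow> real^'d) \<Rightarrow> real^'d \<Rightarrow> real^'d^'d" where
  "grad a x = transpose (jacobian a (at x))"

definition sym_grad :: "(real^'d \<Rightarrow> real^'d) \<Rightarrow> real^'d \<Rightarrow> real^'d^'d" where
  "sym_grad a x = (1/2) *\<^sub>R (grad a x + transpose (grad a x))"

definition divergence :: "(real^'d \<Rightarrow> real^'d) \<Rightarrow> real^'d \<Rightarrow> real" where
  "divergence a x = trace (grad a x)"

text \<open>\<open>(n \<bullet> \<nabla>)\<^sup>m a\<close> for a direction \<open>n\<close> that is held fixed during the iteration; at a point of a
  curved facet \<open>n\<close> is the normal at that point.\<close>

definition dir_deriv :: "real^'d \<Rightarrow> nat \<Rightarrow> (real^'d \<Rightarrow> real^'d) \<Rightarrow> real^'d \<Rightarrow> real^'d" where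
  "dir_deriv n m a = ((\<lambda>w y. frechet_derivative w (at y) n) ^^ m) a"

definition outer :: "real^'d \<Rightarrow> real^'d \<Rightarrow> real^'d^'d" where
  "outer a b = (\<chi> i j. a $ i * b $ j)"


section \<open>The parametrized domain\<close>

text \<open>The parametric box is \<open>cbox lo hi\<close>.\<close>

definition parametrization ::
    "nat \<Rightarrow> (real^'d \<Rightarrow> real^'d) \<Rightarrow> real^'d \<Rightarrow> real^'d \<Rightarrow> bool" where
  "parametrization m F lo hi \<longleftrightarrow>
     (\<forall>i. lo $ i < hi $ i) \<and>
     (\<exists>U. open U \<and> cbox lo hi \<subseteq> U \<and> Ck_on m F U) \<and>
     inj_on F (cbox lo hi) \<and>
     (\<forall>x\<in>cbox lo hi. det (jacobian F (at x)) \<noteq> 0)"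

definition phys_domain :: "(real^'d \<Rightarrow> real^'d) \<Rightarrow> real^'d \<Rightarrow> real^'d \<Rightarrow> (real^'d) set" where
  "phys_domain F lo hi = F ` box lo hi"

text \<open>For a cell \<open>cbox a b\<close> of the parametric box, a direction \<open>i\<close> and a side \<open>s\<close>, the following
  describe the image under \<open>F\<close> of the face \<open>x\<^sub>i = b\<^sub>i\<close> (\<open>s = True\<close>) or \<open>x\<^sub>i = a\<^sub>i\<close>
  (\<open>s = False\<close>).  The surface measure is that of the parametrized hypersurface: its density is the
  square root of the Gram determinant of the \<open>d - 1\<close> tangent vectors \<open>\<partial>\<^sub>k F\<close>, \<open>k \<noteq> i\<close>
  (row and column \<open>i\<close> of the matrix are padded by the identity).  The completion makes the values
  of an integrand on edges of a facet irrelevant.\<close>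

definition face_point :: "'d \<Rightarrow> real \<Rightarrow> ('d \<Rightarrow> real) \<Rightarrow> real^'d" where
  "face_point i c y = (\<chi> k. if k = i then c else y k)"

definition surface_density :: "(real^'d \<Rightarrow> real^'d) \<Rightarrow> 'd \<Rightarrow> real^'d \<Rightarrow> real" where
  "surface_density F i x =
     sqrt (det (\<chi> k l. if k = i \<or> l = i then (if k = l then 1 else 0)
                  else column k (jacobian F (at x)) \<bullet> column l (jacobian F (at x))))"

definition face_measure ::
    "(real^'d \<Rightarrow> real^'d) \<Rightarrow> real^'d \<Rightarrow> real^'d \<Rightarrow> 'd \<Rightarrow> bool \<Rightarrow> (real^'d) measure" where
  "face_measure F a b i s =
     (let c = (if s then b $ i else a $ i) in
      completion (distr
        (density
          (restrict_space (\<Pi>\<^sub>M k\<in>-{i}. lborel) (\<Pi>\<^sub>E k\<in>-{i}. {a $ k .. b $ k}))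
          (\<lambda>y. ennreal (surface_density F i (face_point i c y))))
        borel (\<lambda>y. F (face_point i c y))))"

text \<open>Row \<open>i\<close> of \<open>(DF)\<^sup>-\<^sup>1\<close> is the gradient of the \<open>i\<close>-th parametric coordinate as a
  function on the physical domain.  Hence it is orthogonal to the images of the faces
  \<open>x\<^sub>i = const\<close> and points towards larger \<open>x\<^sub>i\<close>.\<close>

definition unit_normal ::
    "(real^'d \<Rightarrow> real^'d) \<Rightarrow> real^'d \<Rightarrow> real^'d \<Rightarrow> 'd \<Rightarrow> bool \<Rightarrow> real^'d \<Rightarrow> real^'d" where
  "unit_normal F lo hi i s x =
     (if s then 1 else -1) *\<^sub>R
       sgn (row i (matrix_inv (jacobian F (at (inv_into (cbox lo hi) F x)))))"

text \<open>Integral over the boundary of the domain; the integrand receives the outward unit normal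
  and the point.\<close>

definition boundary_integral ::
    "(real^'d \<Rightarrow> real^'d) \<Rightarrow> real^'d \<Rightarrow> real^'d \<Rightarrow> (real^'d \<Rightarrow> real^'d \<Rightarrow> real) \<Rightarrow> real" where
  "boundary_integral F lo hi f =
     (\<Sum>i\<in>UNIV. \<Sum>s\<in>UNIV. LINT x|face_measure F lo hi i s. f (unit_normal F lo hi i s x) x)"


section \<open>Sobolev spaces\<close>

definition square_integrable :: "'a measure \<Rightarrow> ('a \<Rightarrow> 'b::euclidean_space) \<Rightarrow> bool" where
  "square_integrable M f \<longleftrightarrow> f \<in> borel_measurable M \<and> integrable M (\<lambda>x. (norm (f x))\<^sup>2)"

text \<open>Test functions are compactly supported and \<open>C\<^sup>1\<close>; by mollification this is the same as
  testing with smooth functions.\<close>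

definition test_function :: "(real^'d) set \<Rightarrow> (real^'d \<Rightarrow> real) \<Rightarrow> bool" where
  "test_function \<Omega> \<phi> \<longleftrightarrow>
     Ck_on 1 \<phi> UNIV \<and> (\<exists>K. compact K \<and> K \<subseteq> \<Omega> \<and> (\<forall>x. x \<notin> K \<longrightarrow> \<phi> x = 0))"

definition weak_grad ::
    "(real^'d) set \<Rightarrow> (real^'d \<Rightarrow> real^'d) \<Rightarrow> (real^'d \<Rightarrow> real^'d^'d) \<Rightarrow> bool" where
  "weak_grad \<Omega> u G \<longleftrightarrow>
     (\<forall>\<phi> i j. test_function \<Omega> \<phi> \<longrightarrow>
        (LINT x|lebesgue_on \<Omega>. u x $ j * frechet_derivative \<phi> (at x) (axis i 1)) =
        - (LINT x|lebesgue_on \<Omega>. G x $ i $ j * \<phi> x))"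

definition H1 :: "(real^'d) set \<Rightarrow> (real^'d \<Rightarrow> real^'d) set" where
  "H1 \<Omega> = {u. square_integrable (lebesgue_on \<Omega>) u \<and>
              (\<exists>G. square_integrable (lebesgue_on \<Omega>) G \<and> weak_grad \<Omega> u G)}"

text \<open>\<open>has_trace F lo hi u g\<close>: \<open>u\<close> lies in \<open>H\<^sup>1\<close> and \<open>g\<close> is its trace in \<open>L\<^sup>2\<close> of the boundary,
  i.e. the limit of the boundary values of functions that are \<open>C\<^sup>1\<close> up to the boundary and converge
  to \<open>u\<close> in \<open>H\<^sup>1\<close>.\<close>

definition has_trace ::
    "(real^'d \<Rightarrow> real^'d) \<Rightarrow> real^'d \<Rightarrow> real^'d \<Rightarrow>
     (real^'d \<Rightarrow> real^'d) \<Rightarrow> (real^'d \<Rightarrow> real^'d) \<Rightarrow> bool" where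
  "has_trace F lo hi u g \<longleftrightarrow>
     u \<in> H1 (phys_domain F lo hi) \<and>
     (\<forall>i s. square_integrable (face_measure F lo hi i s) g) \<and>
     (\<exists>G w. square_integrable (lebesgue_on (phys_domain F lo hi)) G \<and> weak_grad (phys_domain F lo hi) u G \<and>
        (\<forall>k::nat. \<exists>U. open U \<and> F ` cbox lo hi \<subseteq> U \<and> Ck_on 1 (w k) U) \<and>
        (\<lambda>k. LINT x|lebesgue_on (phys_domain F lo hi).
               (norm (w k x - u x))\<^sup>2 + (norm (grad (w k) x - G x))\<^sup>2) \<longlonglongrightarrow> 0 \<and>
        (\<lambda>k. boundary_integral F lo hi (\<lambda>n x. (norm (w k x - g x))\<^sup>2)) \<longlonglongrightarrow> 0)"

definition H1n ::
    "(real^'d \<Rightarrow> real^'d) \<Rightarrow> real^'d \<Rightarrow> real^'d \<Rightarrow> (real^'d \<Rightarrow> real^'d) set" where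
  "H1n F lo hi = {u. \<exists>g. has_trace F lo hi u g \<and>
     (\<forall>i s. AE x in face_measure F lo hi i s. g x \<bullet> unit_normal F lo hi i s x = 0)}"


section \<open>Meshes\<close>

text \<open>\<open>\<zeta> i\<close> is the list of the unique knots in direction \<open>i\<close>; a cell is given by the positions of its
  lower knots.\<close>

definition knots :: "real^'d \<Rightarrow> real^'d \<Rightarrow> ('d \<Rightarrow> real list) \<Rightarrow> bool" where
  "knots lo hi \<zeta> \<longleftrightarrow>
     (\<forall>i. 2 \<le> length (\<zeta> i) \<and> sorted_wrt (<) (\<zeta> i) \<and> hd (\<zeta> i) = lo $ i \<and> last (\<zeta> i) = hi $ i)"

definition cells :: "('d \<Rightarrow> real list) \<Rightarrow> ('d \<Rightarrow> nat) set" where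
  "cells \<zeta> = {j. \<forall>i. Suc (j i) < length (\<zeta> i)}"

definition cell_lo :: "('d \<Rightarrow> real list) \<Rightarrow> ('d \<Rightarrow> nat) \<Rightarrow> real^'d" where
  "cell_lo \<zeta> j = (\<chi> i. \<zeta> i ! j i)"

definition cell_hi :: "('d \<Rightarrow> real list) \<Rightarrow> ('d \<Rightarrow> nat) \<Rightarrow> real^'d" where
  "cell_hi \<zeta> j = (\<chi> i. \<zeta> i ! Suc (j i))"

definition element ::
    "(real^'d \<Rightarrow> real^'d) \<Rightarrow> ('d \<Rightarrow> real list) \<Rightarrow> ('d \<Rightarrow> nat) \<Rightarrow> (real^'d) set" where
  "element F \<zeta> j = F ` cbox (cell_lo \<zeta> j) (cell_hi \<zeta> j)"

definition quasi_uniform ::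
    "(real^'d \<Rightarrow> real^'d) \<Rightarrow> ('d \<Rightarrow> real list) \<Rightarrow> real \<Rightarrow> real \<Rightarrow> bool" where
  "quasi_uniform F \<zeta> C h \<longleftrightarrow>
     (\<forall>j\<in>cells \<zeta>. C * h \<le> diameter (element F \<zeta> j) \<and> diameter (element F \<zeta> j) \<le> h / C)"

text \<open>Every single mesh has an aspect ratio bounded by some \<open>\<sigma>\<close>, so this excludes no mesh; \<open>\<sigma>\<close>
  and \<open>C\<close> are the parameters through which constants may depend on the mesh.  A two-sided bound
  on diameters alone does not bound the thickness of the elements in the direction normal to the
  boundary, which enters the trace inequality behind the Nitsche terms.\<close>

definition shape_regular ::
    "(real^'d \<Rightarrow> real^'d) \<Rightarrow> ('d \<Rightarrow> real list) \<Rightarrow> real \<Rightarrow> bool" where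
  "shape_regular F \<zeta> \<sigma> \<longleftrightarrow>
     (\<forall>j\<in>cells \<zeta>. \<exists>x. cball x (diameter (element F \<zeta> j) / \<sigma>) \<subseteq> element F \<zeta> j)"

text \<open>The pair \<open>(j, i)\<close> stands for the facet between the cell \<open>j\<close>, which plays the role of
  \<open>K\<^sub>1\<close>, and its upper neighbour in direction \<open>i\<close>.  The opposite orientation of a facet changes
  the sign of \<open>n\<close> and of the jumps, which leaves the facet terms below unchanged.\<close>

definition interior_facets :: "('d \<Rightarrow> real list) \<Rightarrow> (('d \<Rightarrow> nat) \<times> 'd) set" where
  "interior_facets \<zeta> = {(j, i). j \<in> cells \<zeta> \<and> Suc (Suc (j i)) < length (\<zeta> i)}"

definition boundary_facets :: "('d \<Rightarrow> real list) \<Rightarrow> (('d \<Rightarrow> nat) \<times> 'd \<times> bool) set" where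
  "boundary_facets \<zeta> =
     {(j, i, s). j \<in> cells \<zeta> \<and> (if s then Suc (Suc (j i)) = length (\<zeta> i) else j i = 0)}"

definition interior_facet_sum ::
    "(real^'d \<Rightarrow> real^'d) \<Rightarrow> ('d \<Rightarrow> real list) \<Rightarrow>
     (('d \<Rightarrow> nat) \<Rightarrow> 'd \<Rightarrow> real^'d \<Rightarrow> real) \<Rightarrow> real" where
  "interior_facet_sum F \<zeta> f =
     (\<Sum>(j, i)\<in>interior_facets \<zeta>.
        LINT x|face_measure F (cell_lo \<zeta> j) (cell_hi \<zeta> j) i True. f j i x)"

definition boundary_facet_sum ::
    "(real^'d \<Rightarrow> real^'d) \<Rightarrow> ('d \<Rightarrow> real list) \<Rightarrow> (real^'d \<Rightarrow> real) \<Rightarrow> real" where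
  "boundary_facet_sum F \<zeta> f =
     (\<Sum>(j, i, s)\<in>boundary_facets \<zeta>.
        LINT x|face_measure F (cell_lo \<zeta> j) (cell_hi \<zeta> j) i s. f x)"


section \<open>Spline spaces\<close>

text \<open>Degree \<open>k\<close> and \<open>r\<close> continuous derivatives at every interior knot (no condition at the two
  end knots).  Only values between the end knots matter.\<close>

definition spline_space :: "nat \<Rightarrow> nat \<Rightarrow> real list \<Rightarrow> (real \<Rightarrow> real) set" where
  "spline_space k r ts = {f. \<exists>p :: nat \<Rightarrow> real poly.
     (\<forall>j. Suc j < length ts \<longrightarrow>
        degree (p j) \<le> k \<and> (\<forall>t\<in>{ts ! j .. ts ! Suc j}. f t = poly (p j) t)) \<and>
     (\<forall>j. Suc (Suc j) < length ts \<longrightarrow>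
        (\<forall>m\<le>r. poly ((pderiv ^^ m) (p j)) (ts ! Suc j) =
                poly ((pderiv ^^ m) (p (Suc j))) (ts ! Suc j)))}"

text \<open>Finite sums of products of univariate splines.\<close>

definition tensor_spline_space ::
    "real^'d \<Rightarrow> real^'d \<Rightarrow> ('d \<Rightarrow> nat) \<Rightarrow> ('d \<Rightarrow> nat) \<Rightarrow> ('d \<Rightarrow> real list) \<Rightarrow>
     (real^'d \<Rightarrow> real) set" where
  "tensor_spline_space lo hi k r \<zeta> = {g. \<exists>N (f :: nat \<Rightarrow> 'd \<Rightarrow> real \<Rightarrow> real).
     (\<forall>q<N. \<forall>i. f q i \<in> spline_space (k i) (r i) (\<zeta> i)) \<and>
     (\<forall>x\<in>cbox lo hi. g x = (\<Sum>q<N. \<Prod>i\<in>UNIV. f q i (x $ i)))}"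

definition pullback ::
    "(real^'d \<Rightarrow> real^'d) \<Rightarrow> (real^'d \<Rightarrow> real^'d) \<Rightarrow> real^'d \<Rightarrow> real^'d" where
  "pullback F v x =
     det (jacobian F (at x)) *\<^sub>R (matrix_inv (jacobian F (at x)) *v v (F x))"

text \<open>Component \<open>c\<close> of the pullback has degree \<open>k' + 1\<close> and regularity \<open>\<alpha>' + 1\<close> in direction
  \<open>c\<close>, and degree \<open>k'\<close> and regularity \<open>\<alpha>'\<close> in the other directions.  Splines are prescribed
  pointwise on the closed box, so that a velocity is the representative of its class that is
  continuous up to the boundary.\<close>

definition velocity_space ::
    "nat \<Rightarrow> nat \<Rightarrow> (real^'d \<Rightarrow> real^'d) \<Rightarrow> real^'d \<Rightarrow> real^'d \<Rightarrow> ('d \<Rightarrow> real list) \<Rightarrow>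
     (real^'d \<Rightarrow> real^'d) set" where
  "velocity_space k' \<alpha>' F lo hi \<zeta> = {v \<in> H1n F lo hi. \<forall>c.
     (\<lambda>x. pullback F v x $ c) \<in> tensor_spline_space lo hi
        (\<lambda>i. if i = c then k' + 1 else k') (\<lambda>i. if i = c then \<alpha>' + 1 else \<alpha>') \<zeta>}"

definition div_free_velocity_space ::
    "nat \<Rightarrow> nat \<Rightarrow> (real^'d \<Rightarrow> real^'d) \<Rightarrow> real^'d \<Rightarrow> real^'d \<Rightarrow> ('d \<Rightarrow> real list) \<Rightarrow>
     (real^'d \<Rightarrow> real^'d) set" where
  "div_free_velocity_space k' \<alpha>' F lo hi \<zeta> = {v \<in> velocity_space k' \<alpha>' F lo hi \<zeta>.
     AE x in lebesgue_on (phys_domain F lo hi). divergence v x = 0}"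


section \<open>Forms\<close>

definition jump ::
    "(real^'d \<Rightarrow> real^'d) \<Rightarrow> ('d \<Rightarrow> real list) \<Rightarrow> ('d \<Rightarrow> nat) \<Rightarrow> 'd \<Rightarrow>
     (real^'d \<Rightarrow> real^'d) \<Rightarrow> real^'d \<Rightarrow> real^'d" where
  "jump F \<zeta> j i \<phi> x =
     Lim (at x within interior (element F \<zeta> j)) \<phi> -
     Lim (at x within interior (element F \<zeta> (j(i := Suc (j i))))) \<phi>"

definition jump_normal_deriv ::
    "nat \<Rightarrow> (real^'d \<Rightarrow> real^'d) \<Rightarrow> real^'d \<Rightarrow> real^'d \<Rightarrow> ('d \<Rightarrow> real list) \<Rightarrow>
     (real^'d \<Rightarrow> real^'d) \<Rightarrow> ('d \<Rightarrow> nat) \<Rightarrow> 'd \<Rightarrow> real^'d \<Rightarrow> real^'d" where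
  "jump_normal_deriv \<alpha>' F lo hi \<zeta> u j i x =
     jump F \<zeta> j i (dir_deriv (unit_normal F lo hi i True x) (\<alpha>' + 1) u) x"

definition stab_weight ::
    "nat \<Rightarrow> real \<Rightarrow> real \<Rightarrow> real \<Rightarrow> real^'d \<Rightarrow> real^'d \<Rightarrow> real" where
  "stab_weight \<alpha>' h \<nu> \<gamma> n u =
     \<gamma> * min (norm u * h / \<nu>) 1 * h ^ (2 * \<alpha>' + 2) * \<bar>u \<bullet> n\<bar>"

definition J_form ::
    "nat \<Rightarrow> (real^'d \<Rightarrow> real^'d) \<Rightarrow> real^'d \<Rightarrow> real^'d \<Rightarrow> ('d \<Rightarrow> real list) \<Rightarrow>
     real \<Rightarrow> real \<Rightarrow> real \<Rightarrow> (real^'d \<Rightarrow> real^'d) \<Rightarrow> (real^'d \<Rightarrow> real^'d) \<Rightarrow> real" where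
  "J_form \<alpha>' F lo hi \<zeta> h \<nu> \<gamma> u v =
     interior_facet_sum F \<zeta> (\<lambda>j i x.
       stab_weight \<alpha>' h \<nu> \<gamma> (unit_normal F lo hi i True x) (u x) *
       (jump_normal_deriv \<alpha>' F lo hi \<zeta> u j i x \<bullet> jump_normal_deriv \<alpha>' F lo hi \<zeta> v j i x))"

text \<open>Boundary values of \<open>sym_grad u\<close> are limits from inside the domain; they exist at every
  point in the relative interior of a boundary facet.\<close>

definition normal_sym_grad ::
    "(real^'d) set \<Rightarrow> (real^'d \<Rightarrow> real^'d) \<Rightarrow> real^'d \<Rightarrow> real^'d \<Rightarrow> real^'d" where
  "normal_sym_grad \<Omega> u n x = n v* Lim (at x within \<Omega>) (sym_grad u)"

definition A_form ::
    "nat \<Rightarrow> (real^'d \<Rightarrow> real^'d) \<Rightarrow> real^'d \<Rightarrow> real^'d \<Rightarrow> ('d \<Rightarrow> real list) \<Rightarrow>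
     real \<Rightarrow> real \<Rightarrow> real \<Rightarrow> real \<Rightarrow> (real^'d \<Rightarrow> real^'d) \<Rightarrow> (real^'d \<Rightarrow> real^'d) \<Rightarrow> real" where
  "A_form \<alpha>' F lo hi \<zeta> h \<nu> \<gamma> CNit u v =
     (let \<Omega> = phys_domain F lo hi in
      (LINT x|lebesgue_on \<Omega>. (2 * \<nu>) *\<^sub>R sym_grad u x \<bullet> sym_grad v x)
      - boundary_integral F lo hi (\<lambda>n x. (2 * \<nu>) *\<^sub>R normal_sym_grad \<Omega> u n x \<bullet> v x)
      - boundary_integral F lo hi (\<lambda>n x. (2 * \<nu>) *\<^sub>R normal_sym_grad \<Omega> v n x \<bullet> u x)
      + boundary_integral F lo hi (\<lambda>n x. (2 * \<nu> * (CNit / h)) *\<^sub>R u x \<bullet> v x)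
      + J_form \<alpha>' F lo hi \<zeta> h \<nu> \<gamma> u v)"

definition convection_form ::
    "(real^'d) set \<Rightarrow> (real^'d \<Rightarrow> real^'d) \<Rightarrow> (real^'d \<Rightarrow> real^'d) \<Rightarrow>
     (real^'d \<Rightarrow> real^'d) \<Rightarrow> real" where
  "convection_form \<Omega> w u v = - (LINT x|lebesgue_on \<Omega>. outer (w x) (u x) \<bullet> grad v x)"

definition A_stb ::
    "nat \<Rightarrow> (real^'d \<Rightarrow> real^'d) \<Rightarrow> real^'d \<Rightarrow> real^'d \<Rightarrow> ('d \<Rightarrow> real list) \<Rightarrow>
     real \<Rightarrow> real \<Rightarrow> real \<Rightarrow> real \<Rightarrow> (real^'d \<Rightarrow> real^'d) \<Rightarrow> (real^'d \<Rightarrow> real^'d) \<Rightarrow> real" where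
  "A_stb \<alpha>' F lo hi \<zeta> h \<nu> \<gamma> CNit u v =
     A_form \<alpha>' F lo hi \<zeta> h \<nu> \<gamma> CNit u v + convection_form (phys_domain F lo hi) u u v"

definition energy_norm_sq ::
    "nat \<Rightarrow> (real^'d \<Rightarrow> real^'d) \<Rightarrow> real^'d \<Rightarrow> real^'d \<Rightarrow> ('d \<Rightarrow> real list) \<Rightarrow>
     real \<Rightarrow> real \<Rightarrow> real \<Rightarrow> real \<Rightarrow> (real^'d \<Rightarrow> real^'d) \<Rightarrow> real" where
  "energy_norm_sq \<alpha>' F lo hi \<zeta> h \<nu> \<gamma> CNit u =
     2 * \<nu> * (LINT x|lebesgue_on (phys_domain F lo hi). sym_grad u x \<bullet> sym_grad u x)
     + 2 * \<nu> * (CNit / h) * boundary_facet_sum F \<zeta> (\<lambda>x. (norm (u x))\<^sup>2)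
     + interior_facet_sum F \<zeta> (\<lambda>j i x.
         (norm (sqrt (stab_weight \<alpha>' h \<nu> \<gamma> (unit_normal F lo hi i True x) (u x)) *\<^sub>R
                jump_normal_deriv \<alpha>' F lo hi \<zeta> u j i x))\<^sup>2)"

end

theory Submission
  imports Defs
begin

text \<open>
  The form is tested with \<open>v = u\<close>, so the three terms of the energy norm appear in it verbatim; the third
  one, the stabilization, is nonnegative because its weight is.  What has to be explained
  is why the convection term vanishes and why the two consistency terms
  \<open>X = \<integral>\<^sub>\<partial>\<^sub>\<Omega> (n \<bullet> \<nabla>\<^sup>s u) \<bullet> u\<close> are dominated.

  \<^emph>\<open>Convection\<close> (\<open>convection_zero\<close>).  With \<open>\<psi> = |u|\<^sup>2 / 2\<close> the term is \<open>- \<integral> u \<bullet> \<nabla>\<psi>\<close>, which vanishes by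
  integration by parts since \<open>u\<close> is solenoidal and tangential.  Tangentiality is known only for the
  \<open>L\<^sup>2\<close> trace of \<open>u\<close>, so the parts formula is applied to the smooth fields that define the trace, and the
  limit is taken in it.  This needs that the weak gradient, too, has trace zero; that follows by testing
  with compactly supported functions.

  \<^emph>\<open>Consistency terms.\<close>  By Young's inequality
  \<open>2 X \<le> \<epsilon> \<integral>\<^sub>\<partial>\<^sub>\<Omega> |\<nabla>\<^sup>s u|\<^sup>2 + \<epsilon>\<^sup>-\<^sup>1 \<integral>\<^sub>\<partial>\<^sub>\<Omega> |u|\<^sup>2\<close> with \<open>\<epsilon>\<close> a small multiple of \<open>h\<close>, so a discrete trace
  inequality for \<open>\<nabla>\<^sup>s u\<close> is what is needed.  On a curved element \<open>\<nabla>\<^sup>s u\<close> is not a polynomial in parametric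
  coordinates: it is \<open>\<Sum> a\<^sub>i (\<partial>\<^sub>i u') + b u'\<close> with the spline pullback \<open>u'\<close> and coefficients depending on the
  geometry.  Replacing \<open>a\<^sub>i\<close> by its value at a corner of the cell and dropping \<open>b\<close> leaves a polynomial, at the cost
  of an error of size \<open>h |\<nabla>u'| + |u'|\<close>, which by the inverse inequality is bounded by \<open>|u'|\<close> in \<open>L\<^sup>2\<close>
  (\<open>local_trace_inequality\<close>).  Summing over the cells along the boundary gives
  \<open>h \<integral>\<^sub>\<partial>\<^sub>\<Omega> |\<nabla>\<^sup>s u|\<^sup>2 \<le> c (\<integral> |\<nabla>\<^sup>s u|\<^sup>2 + \<integral> |u|\<^sup>2)\<close> (\<open>discrete_trace_inequality\<close>).

  The additional \<open>\<integral> |u|\<^sup>2\<close> is removed by a Korn type inequality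
  \<open>\<integral> |u|\<^sup>2 \<le> c (\<integral> |\<nabla>\<^sup>s u|\<^sup>2 + \<integral>\<^sub>\<partial>\<^sub>\<Omega> |u|\<^sup>2)\<close> (\<open>korn_inequality\<close>).  For solenoidal fields it has an elementary
  proof: the divergence of \<open>(x \<bullet> u) u + |u|\<^sup>2 x / 2\<close> is \<open>(1 + d/2) |u|\<^sup>2\<close> plus a term with \<open>\<nabla>\<^sup>s u\<close>.  Since \<open>h\<close> is
  bounded in terms of the domain, both boundary integrals of \<open>|u|\<^sup>2\<close> are at most a multiple of the penalty term.
  A penalty constant beyond that multiple yields the coercivity constant \<open>1/2\<close>.

  All integrals are computed in the parametric box, over which a discrete velocity is continuous and piecewise
  \<open>C\<^sup>1\<close> off finitely many coordinate hyperplanes.  There the divergence theorem is Fubini's theorem together with the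
  fundamental theorem of calculus along coordinate lines and the Piola identity.
\<close>

section \<open>Slices of Lebesgue measure and change of variables\<close>

lemma borel_measurable_vec_lambda:
  assumes "\<And>k. (\<lambda>x. f x k) \<in> borel_measurable M"
  shows "(\<lambda>x. (\<chi> k. f x k) :: real^'d) \<in> borel_measurable M"
  unfolding borel_measurable_euclidean_space[where 'c="real^'d"]
  using assms by (auto simp: Basis_vec_def inner_axis)

lemma prod_Basis_vec: "(\<Prod>b\<in>(Basis::(real^'d) set). f b) = (\<Prod>k\<in>UNIV. f (axis k 1))"
proof -
  have "(Basis::(real^'d) set) = range (\<lambda>k. axis k 1)"
    by (auto simp: Basis_vec_def)
  moreover have "inj (\<lambda>k::'d. axis k (1::real))"
    by (auto simp: inj_on_def axis_eq_axis)
  ultimately show ?thesis using prod.reindex[of "\<lambda>k::'d. axis k (1::real)" UNIV f] by (metis (no_types, lifting) comp_apply prod.cong)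
qed

lemma box_le_vec:
  fixes l u :: "real^'d"
  assumes "\<And>b. b \<in> Basis \<Longrightarrow> l \<bullet> b \<le> u \<bullet> b" shows "l $ k \<le> u $ k"
  using assms[of "axis k 1"] by (simp add: inner_axis axis_in_Basis_iff)

lemma emeasure_lborel_box_vec:
  fixes l u :: "real^'d"
  assumes "\<And>k. l $ k \<le> u $ k"
  shows "emeasure lborel (box l u) = ennreal (\<Prod>k\<in>UNIV. u $ k - l $ k)"
proof -
  have "emeasure lborel (box l u) = ennreal (\<Prod>b\<in>Basis. (u - l) \<bullet> b)"
    by (rule emeasure_lborel_box) (use assms in \<open>auto simp: Basis_vec_def inner_axis\<close>)
  then show ?thesis by (simp add: prod_Basis_vec inner_axis)
qed

text \<open>Fubini's theorem is available for products indexed by functions; this identity carries it over to vectors.\<close>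

lemma lborel_vec_eq_distr_PiM:
  "(lborel :: (real^'d) measure) = distr (\<Pi>\<^sub>M k\<in>UNIV. lborel) borel (\<lambda>y. \<chi> k. y k)"
proof (rule lborel_eqI)
  interpret product_sigma_finite "\<lambda>_::'d. lborel :: real measure" ..
  have meas: "(\<lambda>y. \<chi> k. y k) \<in> (\<Pi>\<^sub>M k\<in>(UNIV::'d set). (lborel::real measure)) \<rightarrow>\<^sub>M borel"
    by (rule borel_measurable_vec_lambda) measurable
  fix l u :: "real^'d"
  assume "\<And>b. b \<in> Basis \<Longrightarrow> l \<bullet> b \<le> u \<bullet> b"
  then have le: "l $ k \<le> u $ k" for k
    by (rule box_le_vec)
  have pre: "(\<lambda>y. \<chi> k. y k) -` box l u \<inter> space (\<Pi>\<^sub>M k\<in>(UNIV::'d set). (lborel::real measure))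
      = (\<Pi>\<^sub>E k\<in>UNIV. {l $ k <..< u $ k})"
    by (auto simp: mem_box_cart space_PiM PiE_def Pi_def)
  have "emeasure (distr (\<Pi>\<^sub>M k\<in>(UNIV::'d set). lborel) borel (\<lambda>y. \<chi> k. y k)) (box l u)
      = (\<Prod>k\<in>UNIV. ennreal (u $ k - l $ k))"
    by (subst emeasure_distr[OF meas]) (auto simp: pre emeasure_PiM le)
  also have "\<dots> = ennreal (\<Prod>k\<in>UNIV. u $ k - l $ k)"
    using le by (simp add: prod_ennreal)
  also have "(\<Prod>k\<in>UNIV. u $ k - l $ k) = (\<Prod>b\<in>Basis. (u - l) \<bullet> b)"
    by (simp add: prod_Basis_vec inner_axis)
  finally show "emeasure (distr (\<Pi>\<^sub>M k\<in>(UNIV::'d set). lborel) borel (\<lambda>y. \<chi> k. y k)) (box l u)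
      = (\<Prod>b\<in>Basis. (u - l) \<bullet> b)" .
qed simp

abbreviation (input) slice_measure :: "'d \<Rightarrow> ('d \<Rightarrow> real) measure" where
  "slice_measure i \<equiv> \<Pi>\<^sub>M k\<in>-{i}. lborel"

lemma face_point_nth [simp]: "face_point i t y $ k = (if k = i then t else y k)"
  by (simp add: face_point_def)

lemma measurable_face_point_pair [measurable]:
  "(\<lambda>p. face_point i (fst p) (snd p)) \<in> borel \<Otimes>\<^sub>M slice_measure i \<rightarrow>\<^sub>M (borel :: (real^'d) measure)"
  unfolding face_point_def
proof (rule borel_measurable_vec_lambda)
  fix k
  show "(\<lambda>p. if k = i then fst p else snd p k) \<in> borel \<Otimes>\<^sub>M slice_measure i \<rightarrow>\<^sub>M borel"
    by (cases "k = i") simp_all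
qed

lemma measurable_face_point [measurable]:
  "(\<lambda>y. face_point i t y) \<in> slice_measure i \<rightarrow>\<^sub>M (borel :: (real^'d) measure)"
  by (rule measurable_compose[OF _ measurable_face_point_pair, of "\<lambda>y. (t, y)", simplified]) simp

text \<open>Fubini with one coordinate singled out: \<open>y\<close> collects the other coordinates and \<open>t\<close> runs along the line in
  direction \<open>i\<close>.  This is also the form in which the surface measure of a face is given.\<close>

lemma nn_integral_slices:
  fixes f :: "real^'d \<Rightarrow> ennreal"
  assumes [measurable]: "f \<in> borel_measurable borel"
  shows "(\<integral>\<^sup>+x. f x \<partial>lborel) = (\<integral>\<^sup>+y. \<integral>\<^sup>+t. f (face_point i t y) \<partial>lborel \<partial>slice_measure i)"
proof -
  interpret product_sigma_finite "\<lambda>_::'d. lborel :: real measure" ..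
  have meas[measurable]: "(\<lambda>y. \<chi> k. y k) \<in> (\<Pi>\<^sub>M k\<in>(UNIV::'d set). (lborel::real measure)) \<rightarrow>\<^sub>M borel"
    by (rule borel_measurable_vec_lambda) measurable
  have U: "insert i (-{i}) = UNIV" by auto
  have "(\<integral>\<^sup>+x. f x \<partial>lborel) = (\<integral>\<^sup>+y. f (\<chi> k. y k) \<partial>(\<Pi>\<^sub>M k\<in>insert i (-{i}). lborel))"
    unfolding U by (subst lborel_vec_eq_distr_PiM, subst nn_integral_distr) measurable
  also have "\<dots> = (\<integral>\<^sup>+y. \<integral>\<^sup>+t. f (\<chi> k. (y(i := t)) k) \<partial>lborel \<partial>slice_measure i)"
    by (rule product_nn_integral_insert) (auto simp: U)
  also have "(\<lambda>y t. f (\<chi> k. (y(i := t)) k)) = (\<lambda>y t. f (face_point i t y))"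
    by (simp add: face_point_def fun_upd_def)
  finally show ?thesis .
qed

lemma integral_slices:
  fixes f :: "real^'d \<Rightarrow> real"
  assumes int: "integrable lborel f"
  shows "(\<integral>x. f x \<partial>lborel) = (\<integral>y. \<integral>t. f (face_point i t y) \<partial>lborel \<partial>slice_measure i)"
    and "integrable (slice_measure i) (\<lambda>y. \<integral>t. f (face_point i t y) \<partial>lborel)"
proof -
  interpret product_sigma_finite "\<lambda>_::'d. lborel :: real measure" ..
  have [measurable]: "f \<in> borel_measurable borel" using int by auto
  have meas[measurable]: "(\<lambda>y. \<chi> k. y k) \<in> (\<Pi>\<^sub>M k\<in>(UNIV::'d set). (lborel::real measure)) \<rightarrow>\<^sub>M borel"
    by (rule borel_measurable_vec_lambda) measurable
  have U: "insert i (-{i}) = UNIV" by auto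
  have int': "integrable (\<Pi>\<^sub>M k\<in>insert i (-{i}). lborel) (\<lambda>y. f (\<chi> k. y k))"
    unfolding U using int by (subst (asm) lborel_vec_eq_distr_PiM, subst (asm) integrable_distr_eq) auto
  have "(\<integral>x. f x \<partial>lborel) = (\<integral>y. f (\<chi> k. y k) \<partial>(\<Pi>\<^sub>M k\<in>insert i (-{i}). lborel))"
    unfolding U by (subst lborel_vec_eq_distr_PiM, subst integral_distr) measurable
  also have "\<dots> = (\<integral>y. \<integral>t. f (\<chi> k. (y(i := t)) k) \<partial>lborel \<partial>slice_measure i)"
    by (rule product_integral_insert[OF _ _ int']) auto
  also have "(\<lambda>y t. f (\<chi> k. (y(i := t)) k)) = (\<lambda>y t. f (face_point i t y))"
    by (simp add: face_point_def fun_upd_def)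
  finally show "(\<integral>x. f x \<partial>lborel) = (\<integral>y. \<integral>t. f (face_point i t y) \<partial>lborel \<partial>slice_measure i)" .
  have meas2: "(\<lambda>(y,t). f (face_point i t y)) \<in> slice_measure i \<Otimes>\<^sub>M lborel \<rightarrow>\<^sub>M borel"
    using measurable_compose[OF measurable_pair_swap' [of "slice_measure i" "borel::real measure"]
      measurable_compose[OF measurable_face_point_pair, of f borel i]]
    by (simp add: split_beta')
  show "integrable (slice_measure i) (\<lambda>y. \<integral>t. f (face_point i t y) \<partial>lborel)"
  proof (rule integrableI_bounded)
    show "(\<lambda>y. \<integral>t. f (face_point i t y) \<partial>lborel) \<in> borel_measurable (slice_measure i)"
      by (rule lborel.borel_measurable_lebesgue_integral[OF meas2])
    have "(\<integral>\<^sup>+y. ennreal (norm (\<integral>t. f (face_point i t y) \<partial>lborel)) \<partial>slice_measure i)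
        \<le> (\<integral>\<^sup>+y. \<integral>\<^sup>+t. ennreal (norm (f (face_point i t y))) \<partial>lborel \<partial>slice_measure i)"
    proof (rule nn_integral_mono)
      fix y
      show "ennreal (norm (\<integral>t. f (face_point i t y) \<partial>lborel))
          \<le> (\<integral>\<^sup>+t. ennreal (norm (f (face_point i t y))) \<partial>lborel)"
      proof (cases "integrable lborel (\<lambda>t. f (face_point i t y))")
        case True then show ?thesis using integral_norm_bound_ennreal by blast
      next
        case False then show ?thesis by (simp add: not_integrable_integral_eq)
      qed
    qed
    also have "\<dots> = (\<integral>\<^sup>+x. ennreal (norm (f x)) \<partial>lborel)"
      by (rule nn_integral_slices[symmetric]) simp
    also have "\<dots> < \<infinity>" using int by (simp add: integrable_iff_bounded)
    finally show "(\<integral>\<^sup>+y. ennreal (norm (\<integral>t. f (face_point i t y) \<partial>lborel)) \<partial>slice_measure i) < \<infinity>" .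
  qed
qed

text \<open>The general change of variables theorem is stated for index types that are well-ordered.  An arbitrary index type with
  two or three elements is related to a numeral type by a bijection \<open>\<pi>\<close>, along which measure, integral and determinant
  are transported.\<close>

definition rename_index :: "('d \<Rightarrow> 'm) \<Rightarrow> real^'m \<Rightarrow> real^'d" where
  "rename_index \<pi> x = (\<chi> i. x $ \<pi> i)"

lemma rename_index_inverse:
  assumes "bij \<pi>"
  shows "rename_index \<pi> (rename_index (inv \<pi>) x) = x" "rename_index (inv \<pi>) (rename_index \<pi> y) = y"
  using assms by (simp_all add: rename_index_def vec_eq_iff bij_is_inj bij_is_surj surj_f_inv_f)

lemma bounded_linear_rename_index: "bounded_linear (rename_index \<pi>)"
  by (rule linear_conv_bounded_linear[THEN iffD1])
    (auto intro!: linearI simp: vec_eq_iff rename_index_def)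

lemma borel_measurable_rename_index [measurable]: "rename_index \<pi> \<in> borel \<rightarrow>\<^sub>M borel"
  by (intro borel_measurable_continuous_onI bounded_linear.continuous_on[OF bounded_linear_rename_index] continuous_on_id)

lemma lborel_rename_index:
  fixes \<pi> :: "'d::finite \<Rightarrow> 'm::finite"
  assumes "bij \<pi>"
  shows "(lborel :: (real^'d) measure) = distr lborel borel (rename_index \<pi>)"
proof (rule lborel_eqI)
  fix l u :: "real^'d"
  assume "\<And>b. b \<in> Basis \<Longrightarrow> l \<bullet> b \<le> u \<bullet> b"
  then have le: "l $ k \<le> u $ k" for k
    by (rule box_le_vec)
  have pre: "rename_index \<pi> -` box l u = box (rename_index (inv \<pi>) l) (rename_index (inv \<pi>) u)"
    using assms by (auto simp: rename_index_def mem_box_cart)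
      (metis bij_inv_eq_iff, metis bij_inv_eq_iff, (metis inv_f_f bij_is_inj)+)
  have "emeasure (distr lborel borel (rename_index \<pi>)) (box l u)
      = ennreal (\<Prod>k\<in>UNIV. rename_index (inv \<pi>) u $ k - rename_index (inv \<pi>) l $ k)"
    by (subst emeasure_distr) (auto simp: pre emeasure_lborel_box_vec rename_index_def le)
  also have "(\<Prod>k\<in>UNIV. rename_index (inv \<pi>) u $ k - rename_index (inv \<pi>) l $ k) = (\<Prod>k\<in>UNIV. u $ k - l $ k)"
    unfolding rename_index_def vec_lambda_beta
    by (rule prod.reindex_bij_betw) (use assms in \<open>simp add: bij_imp_bij_inv\<close>)
  also have "ennreal \<dots> = emeasure lborel (box l u)" by (simp add: emeasure_lborel_box_vec le)
  also have "emeasure lborel (box l u) = ennreal (\<Prod>b\<in>Basis. (u - l) \<bullet> b)"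
    using le by (simp add: emeasure_lborel_box_vec prod_Basis_vec inner_axis)
  finally show "emeasure (distr lborel borel (rename_index \<pi>)) (box l u) = (\<Prod>b\<in>Basis. (u - l) \<bullet> b)" .
qed simp

lemma lebesgue_rename_index:
  fixes \<pi> :: "'d::finite \<Rightarrow> 'm::finite"
  assumes "bij \<pi>"
  shows "(lebesgue :: (real^'d) measure) = distr lebesgue lebesgue (rename_index \<pi>)"
    and "rename_index \<pi> \<in> lebesgue \<rightarrow>\<^sub>M (lebesgue :: (real^'d) measure)"
proof -
  have eq: "distr lebesgue lborel (rename_index \<pi>) = (lborel :: (real^'d) measure)"
  proof -
    have "distr lebesgue lborel (rename_index \<pi>) = distr lborel lborel (rename_index \<pi> :: _ \<Rightarrow> real^'d)"
      by (rule distr_completion) simp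
    also have "\<dots> = distr lborel borel (rename_index \<pi>)" by (rule distr_cong) auto
    finally show ?thesis using lborel_rename_index[OF assms] by simp
  qed
  show "rename_index \<pi> \<in> lebesgue \<rightarrow>\<^sub>M (lebesgue :: (real^'d) measure)"
    by (rule completion.measurable_completion2) (simp_all add: eq measurable_completion)
  show "(lebesgue :: (real^'d) measure) = distr lebesgue lebesgue (rename_index \<pi>)"
    by (subst completion.completion_distr_eq[symmetric]) (simp_all add: eq measurable_completion)
qed

lemma absolutely_integrable_rename_index:
  fixes \<pi> :: "'d::finite \<Rightarrow> 'm::finite" and f :: "real^'d \<Rightarrow> real"
  assumes "bij \<pi>" and f: "f absolutely_integrable_on S"
  shows "(\<lambda>x. f (rename_index \<pi> x)) absolutely_integrable_on (rename_index \<pi> -` S)"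
    and "integral (rename_index \<pi> -` S) (\<lambda>x. f (rename_index \<pi> x)) = integral S f"
proof -
  let ?h = "\<lambda>x. indicator S x *\<^sub>R f x"
  have ind: "indicator S (rename_index \<pi> x) = (indicator (rename_index \<pi> -` S) x :: real)" for x
    by (auto simp: indicator_def)
  have int: "integrable lebesgue ?h" using f by (simp add: set_integrable_def)
  then have "integrable (distr lebesgue lebesgue (rename_index \<pi>)) ?h"
    using lebesgue_rename_index(1)[OF assms(1)] by simp
  then have "integrable lebesgue (\<lambda>x. ?h (rename_index \<pi> x))"
    by (rule integrable_distr[OF lebesgue_rename_index(2)[OF assms(1)]])
  then show *: "(\<lambda>x. f (rename_index \<pi> x)) absolutely_integrable_on (rename_index \<pi> -` S)"
    by (simp add: set_integrable_def ind)
  have "integral S f = (LINT x:S|lebesgue. f x)"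
    using set_lebesgue_integral_eq_integral(2)[OF f] by simp
  also have "\<dots> = integral\<^sup>L (distr lebesgue lebesgue (rename_index \<pi>)) ?h"
    using lebesgue_rename_index(1)[OF assms(1)] by (simp add: set_lebesgue_integral_def)
  also have "\<dots> = (\<integral>x. ?h (rename_index \<pi> x) \<partial>lebesgue)"
    by (rule integral_distr[OF lebesgue_rename_index(2)[OF assms(1)]]) (use int in auto)
  also have "\<dots> = (LINT x:(rename_index \<pi> -` S)|lebesgue. f (rename_index \<pi> x))"
    by (simp add: set_lebesgue_integral_def ind)
  also have "\<dots> = integral (rename_index \<pi> -` S) (\<lambda>x. f (rename_index \<pi> x))"
    using set_lebesgue_integral_eq_integral(2)[OF *] by simp
  finally show "integral (rename_index \<pi> -` S) (\<lambda>x. f (rename_index \<pi> x)) = integral S f" by simp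
qed

lemma evenperm_conjugate:
  assumes "bij \<pi>" "permutation p"
  shows "evenperm (inv \<pi> \<circ> p \<circ> \<pi>) \<longleftrightarrow> evenperm p"
proof -
  have conj: "swapidseq n (inv \<pi> \<circ> p \<circ> \<pi>)" if "swapidseq n p" for n p
    using that
  proof induction
    case id
    have "inv \<pi> \<circ> id \<circ> \<pi> = id" using inv_f_f[OF bij_is_inj[OF assms(1)]] by (simp add: fun_eq_iff)
    then show ?case by (simp only: swapidseq.id)
  next
    case (comp_Suc n p a b)
    have "inv \<pi> \<circ> (Transposition.transpose a b \<circ> p) \<circ> \<pi>
        = Transposition.transpose (inv \<pi> a) (inv \<pi> b) \<circ> (inv \<pi> \<circ> p \<circ> \<pi>)"
    proof -
      have "inj (inv \<pi>)" using assms(1) by (simp add: bij_imp_bij_inv bij_is_inj)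
      then have "inv \<pi> (Transposition.transpose a b y) = Transposition.transpose (inv \<pi> a) (inv \<pi> b) (inv \<pi> y)" for y
        by (simp add: Transposition.transpose_def inj_eq)
      moreover have "\<pi> (inv \<pi> y) = y" for y
        using assms(1) by (simp add: bij_is_surj surj_f_inv_f)
      ultimately show ?thesis by (simp add: fun_eq_iff)
    qed
    moreover have "inv \<pi> a \<noteq> inv \<pi> b"
      using comp_Suc.hyps assms(1) by (metis bij_inv_eq_iff)
    ultimately show ?case
      using swapidseq.comp_Suc[OF comp_Suc.IH] by metis
  qed
  obtain n where "swapidseq n p" using assms(2) by (auto simp: permutation_def)
  then show ?thesis using conj evenperm_unique by metis
qed

text \<open>Conjugating permutations by \<open>\<pi>\<close> preserves their sign, so the Leibniz sums agree term by term.\<close>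

lemma det_rename_index:
  fixes A :: "real^'d^'d" and \<pi> :: "'d \<Rightarrow> 'm::finite"
  assumes "bij \<pi>"
  shows "det (\<chi> a b. A $ inv \<pi> a $ inv \<pi> b :: real^'m^'m) = det A"
proof -
  have inj: "inv \<pi> (\<pi> x) = x" and surj: "\<pi> (inv \<pi> y) = y" for x y
    using assms by (auto simp: bij_is_inj bij_is_surj surj_f_inv_f)
  have summand: "of_int (sign (\<pi> \<circ> p \<circ> inv \<pi>)) * (\<Prod>a\<in>UNIV. A $ inv \<pi> a $ inv \<pi> ((\<pi> \<circ> p \<circ> inv \<pi>) a))
      = of_int (sign p) * (\<Prod>a\<in>UNIV. A $ a $ p a)" if "p permutes UNIV" for p
  proof -
    have "permutation p" using that finite[of "UNIV::'d set"] by (auto simp: permutation_permutes) 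
    then have "sign (inv (inv \<pi>) \<circ> p \<circ> inv \<pi>) = sign p"
      using evenperm_conjugate[of "inv \<pi>" p] assms by (simp add: sign_def bij_imp_bij_inv)
    moreover have "inv (inv \<pi>) = \<pi>" using assms by (rule inv_inv_eq)
    moreover have "(\<Prod>a\<in>UNIV. A $ inv \<pi> a $ p (inv \<pi> a)) = (\<Prod>a\<in>UNIV. A $ a $ p a)"
      by (rule prod.reindex_bij_betw[of "inv \<pi>" UNIV UNIV "\<lambda>a. A $ a $ p a"])
         (use assms in \<open>simp add: bij_imp_bij_inv\<close>)
    ultimately show ?thesis by (simp add: inj)
  qed
  show ?thesis unfolding det_def vec_lambda_beta
  proof (rule sum.reindex_bij_witness[where j="\<lambda>q. inv \<pi> \<circ> q \<circ> \<pi>" and i="\<lambda>p. \<pi> \<circ> p \<circ> inv \<pi>"])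
    fix q :: "'m \<Rightarrow> 'm" assume "q \<in> {p. p permutes UNIV}"
    then have q: "bij q" by (simp add: permutes_bij)
    show q': "inv \<pi> \<circ> q \<circ> \<pi> \<in> {p. p permutes UNIV}"
    proof -
      have "bij (inv \<pi> \<circ> q \<circ> \<pi>)" using q assms by (intro bij_comp bij_imp_bij_inv)
      then show ?thesis by (auto intro!: bij_imp_permutes)
    qed
    show e: "\<pi> \<circ> (inv \<pi> \<circ> q \<circ> \<pi>) \<circ> inv \<pi> = q" by (auto simp: surj)
    show "of_int (sign (inv \<pi> \<circ> q \<circ> \<pi>)) * (\<Prod>i\<in>UNIV. A $ i $ (inv \<pi> \<circ> q \<circ> \<pi>) i) =
         of_int (sign q) * (\<Prod>i\<in>UNIV. A $ inv \<pi> i $ inv \<pi> (q i))"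
      using summand[of "inv \<pi> \<circ> q \<circ> \<pi>"] q' unfolding e by simp
  next
    fix p :: "'d \<Rightarrow> 'd" assume "p \<in> {p. p permutes UNIV}"
    then have "bij p" by (simp add: permutes_bij)
    then have "bij (\<pi> \<circ> p \<circ> inv \<pi>)" using assms by (intro bij_comp bij_imp_bij_inv)
    then show "\<pi> \<circ> p \<circ> inv \<pi> \<in> {p. p permutes UNIV}" by (auto intro!: bij_imp_permutes)
    show "inv \<pi> \<circ> (\<pi> \<circ> p \<circ> inv \<pi>) \<circ> \<pi> = p" by (auto simp: inj)
  qed
qed

lemma change_of_variables_real:
  fixes f :: "real^'m::{finite,wellorder} \<Rightarrow> real" and g :: "real^'m::_ \<Rightarrow> real^'m::_"
  assumes "S \<in> sets lebesgue" "\<And>x. x \<in> S \<Longrightarrow> (g has_derivative g' x) (at x within S)" "inj_on g S"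
  shows "(\<lambda>x. \<bar>det (matrix (g' x))\<bar> * f (g x)) absolutely_integrable_on S \<and>
     integral S (\<lambda>x. \<bar>det (matrix (g' x))\<bar> * f (g x)) = b
     \<longleftrightarrow> f absolutely_integrable_on (g ` S) \<and> integral (g ` S) f = b"
  using has_absolute_integral_change_of_variables[OF assms, of "\<lambda>x. (\<chi> i. f x) :: real^1" "vec b"]
  unfolding absolutely_integrable_on_1_iff integral_on_1_eq
  by (simp add: vec_eq_iff)

lemma change_of_variables_transport:
  fixes f :: "real^'d \<Rightarrow> real" and g :: "real^'d \<Rightarrow> real^'d"
    and \<pi> :: "'d \<Rightarrow> 'm::{finite,wellorder}"
  assumes bij: "bij \<pi>" and S: "S \<in> sets lebesgue"
    and der: "\<And>x. x \<in> S \<Longrightarrow> (g has_derivative g' x) (at x within S)" and inj: "inj_on g S"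
    and int: "(\<lambda>x. \<bar>det (matrix (g' x))\<bar> * f (g x)) absolutely_integrable_on S"
  shows "f absolutely_integrable_on (g ` S)"
    and "integral (g ` S) f = integral S (\<lambda>x. \<bar>det (matrix (g' x))\<bar> * f (g x))"
proof -
  define T :: "(real, 'm) vec \<Rightarrow> real^'d" where "T = rename_index \<pi>"
  define T' :: "real^'d \<Rightarrow> (real, 'm) vec" where "T' = rename_index (inv \<pi>)"
  have bij': "bij (inv \<pi>)" using bij by (rule bij_imp_bij_inv)
  have TT [simp]: "T (T' x) = x" "T' (T y) = y" for x y
    using rename_index_inverse[OF bij] by (auto simp: T_def T'_def)
  have lT: "bounded_linear T" "bounded_linear T'"
    by (auto simp: T_def T'_def bounded_linear_rename_index)
  define R where "R = T -` S"
  have TR: "T ` R = S" unfolding R_def by (rule surj_image_vimage_eq) (metis TT(1) surjI)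
  have R: "R \<in> sets lebesgue"
    using measurable_sets[OF lebesgue_rename_index(2)[OF bij] S] by (simp add: R_def T_def)
  define G where "G = T' \<circ> g \<circ> T"
  define G' where "G' x = T' \<circ> g' (T x) \<circ> T" for x
  have derG: "(G has_derivative G' x) (at x within R)" if "x \<in> R" for x
  proof -
    have "(g has_derivative g' (T x)) (at (T x) within T ` R)"
      unfolding TR by (rule der) (use that in \<open>simp add: R_def\<close>)
    then have "(g \<circ> T has_derivative g' (T x) \<circ> T) (at x within R)"
      by (rule diff_chain_within[OF bounded_linear_imp_has_derivative[OF lT(1)]])
    from bounded_linear.has_derivative[OF lT(2) this]
    show ?thesis unfolding G_def G'_def by (simp add: o_def)
  qed
  have injG: "inj_on G R"
  proof (rule inj_onI)
    fix x y assume "x \<in> R" "y \<in> R" "G x = G y"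
    then have "T' (g (T x)) = T' (g (T y))" and S: "T x \<in> S" "T y \<in> S"
      by (simp_all add: G_def R_def)
    then have "g (T x) = g (T y)" by (metis TT(1))
    then have "T x = T y" using inj S by (simp add: inj_on_def)
    then show "x = y" using TT(2) by metis
  qed
  have detG: "det (matrix (G' x)) = det (matrix (g' (T x)))" for x
  proof -
    have ax: "T (axis b 1) = axis (inv \<pi> b) 1" for b
    proof -
      have "\<pi> i = b \<longleftrightarrow> i = inv \<pi> b" for i
        using bij by (metis bij_inv_eq_iff)
      then show ?thesis by (simp add: T_def rename_index_def vec_eq_iff axis_def)
    qed
    have "matrix (G' x) = (\<chi> a b. matrix (g' (T x)) $ inv \<pi> a $ inv \<pi> b)"
      by (simp add: vec_eq_iff matrix_def G'_def ax T'_def rename_index_def)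
    then show ?thesis by (simp add: det_rename_index[OF bij])
  qed
  have GR: "G ` R = T -` (g ` S)"
  proof -
    have "T ` (G ` R) = g ` S" unfolding TR[symmetric] by (simp add: G_def image_image)
    moreover have "T -` (T ` A) = A" for A
      by (rule inj_vimage_image_eq) (metis TT(2) injI)
    ultimately show ?thesis by metis
  qed
  have "(\<lambda>x. \<bar>det (matrix (G' x))\<bar> * f (T (G x))) absolutely_integrable_on R"
    "integral R (\<lambda>x. \<bar>det (matrix (G' x))\<bar> * f (T (G x))) = integral S (\<lambda>x. \<bar>det (matrix (g' x))\<bar> * f (g x))"
    using absolutely_integrable_rename_index[OF bij int] unfolding R_def T_def[symmetric] detG
    by (simp_all add: G_def)
  with change_of_variables_real[OF R derG injG, of "\<lambda>x. f (T x)" "integral S (\<lambda>x. \<bar>det (matrix (g' x))\<bar> * f (g x))"]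
  have *: "(\<lambda>x. f (T x)) absolutely_integrable_on (G ` R)"
    "integral (G ` R) (\<lambda>x. f (T x)) = integral S (\<lambda>x. \<bar>det (matrix (g' x))\<bar> * f (g x))"
    by auto
  have pre: "T' -` (G ` R) = g ` S" unfolding GR by auto
  from absolutely_integrable_rename_index[OF bij' *(1)] *(2)
  show "f absolutely_integrable_on (g ` S)"
    "integral (g ` S) f = integral S (\<lambda>x. \<bar>det (matrix (g' x))\<bar> * f (g x))"
    unfolding T'_def[symmetric] pre by simp_all
qed

text \<open>The restriction on the dimension enters only through the numeral types \<open>2\<close> and \<open>3\<close> to which the index type is transported.\<close>

lemma change_of_variables_vec:
  fixes f :: "real^'d \<Rightarrow> real" and g :: "real^'d \<Rightarrow> real^'d"
  assumes card: "CARD('d) \<in> {2, 3}" and "S \<in> sets lebesgue"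
    and "\<And>x. x \<in> S \<Longrightarrow> (g has_derivative g' x) (at x within S)" and "inj_on g S"
    and "(\<lambda>x. \<bar>det (matrix (g' x))\<bar> * f (g x)) absolutely_integrable_on S"
  shows "f absolutely_integrable_on (g ` S)"
    and "integral (g ` S) f = integral S (\<lambda>x. \<bar>det (matrix (g' x))\<bar> * f (g x))"
proof -
  have "f absolutely_integrable_on (g ` S) \<and>
    integral (g ` S) f = integral S (\<lambda>x. \<bar>det (matrix (g' x))\<bar> * f (g x))"
  proof (cases "CARD('d) = 2")
    case True
    then have "\<exists>\<pi> :: 'd \<Rightarrow> 2. bij \<pi>"
      by (intro finite_same_card_bij) auto
    then show ?thesis using change_of_variables_transport[OF _ assms(2-5)] by blast
  next
    case False
    then have "\<exists>\<pi> :: 'd \<Rightarrow> 3. bij \<pi>"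
      using card by (intro finite_same_card_bij) auto
    then show ?thesis using change_of_variables_transport[OF _ assms(2-5)] by blast
  qed
  then show "f absolutely_integrable_on (g ` S)"
    and "integral (g ` S) f = integral S (\<lambda>x. \<bar>det (matrix (g' x))\<bar> * f (g x))"
    by auto
qed

section \<open>Partial derivatives and the Piola identity\<close>

definition pd :: "'d \<Rightarrow> (real^'d \<Rightarrow> real) \<Rightarrow> real^'d \<Rightarrow> real" where
  "pd i f x = frechet_derivative f (at x) (axis i 1)"

text \<open>Componentwise description of \<open>C\<^sup>1\<close>; partial derivatives rather than Frechet derivatives are what the
  coordinate computations use.\<close>

definition C1 :: "(real^'d) set \<Rightarrow> (real^'d \<Rightarrow> real) \<Rightarrow> bool" where
  "C1 S f \<longleftrightarrow> (\<forall>x\<in>S. f differentiable (at x)) \<and> (\<forall>i. continuous_on S (pd i f))"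

lemma pd_eqI: "(f has_derivative f') (at x) \<Longrightarrow> pd i f x = f' (axis i 1)"
  unfolding pd_def using frechet_derivative_at by metis

lemma vec_sum_axis: "(\<Sum>i\<in>UNIV. (h $ i) *\<^sub>R axis i 1) = (h :: real^'d)"
  by (simp add: vec_eq_iff axis_def if_distrib[of "\<lambda>x. _ * x"] cong: if_cong)

lemma has_derivative_pd:
  assumes "f differentiable (at x)"
  shows "(f has_derivative (\<lambda>h. \<Sum>i\<in>UNIV. h $ i * pd i f x)) (at x)"
proof -
  let ?D = "frechet_derivative f (at x)"
  have D: "(f has_derivative ?D) (at x)" using assms by (simp add: frechet_derivative_works)
  interpret linear ?D using D by (rule has_derivative_linear)
  have "?D h = (\<Sum>i\<in>UNIV. h $ i * pd i f x)" for h
  proof -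
    have "?D h = ?D (\<Sum>i\<in>UNIV. (h $ i) *\<^sub>R axis i 1)" by (simp only: vec_sum_axis)
    then show ?thesis by (simp add: sum scale pd_def)
  qed
  then have "?D = (\<lambda>h. \<Sum>i\<in>UNIV. h $ i * pd i f x)" by auto
  then show ?thesis using D by simp
qed

lemma
  assumes f: "f differentiable (at x)" and g: "g differentiable (at x)"
  shows pd_add: "pd i (\<lambda>x. f x + g x) x = pd i f x + pd i g x"
    and pd_diff: "pd i (\<lambda>x. f x - g x) x = pd i f x - pd i g x"
    and pd_mult: "pd i (\<lambda>x. f x * g x) x = pd i f x * g x + f x * pd i g x"
proof -
  note D = f[unfolded frechet_derivative_works] g[unfolded frechet_derivative_works]
  show "pd i (\<lambda>x. f x + g x) x = pd i f x + pd i g x"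
    using pd_eqI[OF has_derivative_add[OF D]] by (simp add: pd_def)
  show "pd i (\<lambda>x. f x - g x) x = pd i f x - pd i g x"
    using pd_eqI[OF has_derivative_diff[OF D]] by (simp add: pd_def)
  show "pd i (\<lambda>x. f x * g x) x = pd i f x * g x + f x * pd i g x"
    using pd_eqI[OF has_derivative_mult[OF D]] by (simp add: pd_def)
qed

lemma pd_const [simp]: "pd i (\<lambda>x. c) x = 0"
  by (simp add: pd_def)

lemma pd_cmult: "f differentiable (at x) \<Longrightarrow> pd i (\<lambda>x. c * f x) x = c * pd i f x"
  using pd_mult[of "\<lambda>x. c" x f i] by simp

lemma pd_sum:
  assumes "\<And>a. a \<in> I \<Longrightarrow> f a differentiable (at x)"
  shows "pd i (\<lambda>x. \<Sum>a\<in>I. f a x) x = (\<Sum>a\<in>I. pd i (f a) x)"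
proof (rule pd_eqI[THEN trans])
  show "((\<lambda>x. \<Sum>a\<in>I. f a x) has_derivative (\<lambda>h. \<Sum>a\<in>I. frechet_derivative (f a) (at x) h)) (at x)"
    using assms by (intro has_derivative_sum) (simp add: frechet_derivative_works)
qed (simp add: pd_def)

lemma pd_prod:
  assumes "\<And>a. a \<in> I \<Longrightarrow> f a differentiable (at x)"
  shows "pd i (\<lambda>x. \<Prod>a\<in>I. f a x) x = (\<Sum>a\<in>I. pd i (f a) x * (\<Prod>b\<in>I - {a}. f b x))"
proof (rule pd_eqI[THEN trans])
  show "((\<lambda>x. \<Prod>a\<in>I. f a x) has_derivative
      (\<lambda>h. \<Sum>a\<in>I. frechet_derivative (f a) (at x) h * (\<Prod>b\<in>I - {a}. f b x))) (at x)"
    using assms by (intro has_derivative_prod) (simp add: frechet_derivative_works)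
qed (simp add: pd_def)

lemma differentiable_nth [simp]: "(\<lambda>x. x $ k) differentiable (at (x::real^'d))"
  by (intro bounded_linear_imp_differentiable bounded_linear_vec_nth)

lemma pd_nth: "pd i (\<lambda>x. x $ k) x = (if i = k then 1 else 0)"
  by (rule pd_eqI[THEN trans, OF bounded_linear_imp_has_derivative[OF bounded_linear_vec_nth]])
    (auto simp: axis_def)

lemma pd_inverse:
  assumes f: "f differentiable (at x)" and nz: "f x \<noteq> 0"
  shows "pd i (\<lambda>x. inverse (f x)) x = - pd i f x / (f x)\<^sup>2"
proof (rule pd_eqI[THEN trans])
  show "((\<lambda>x. inverse (f x)) has_derivative (\<lambda>h. - (inverse (f x) * frechet_derivative f (at x) h * inverse (f x)))) (at x)"
    using f nz by (intro Deriv.has_derivative_inverse) (simp_all add: frechet_derivative_works)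
qed (simp add: pd_def divide_simps power2_eq_square)

lemma differentiable_prod:
  fixes f :: "'a \<Rightarrow> 'b::real_normed_vector \<Rightarrow> real"
  assumes "\<And>a. a \<in> I \<Longrightarrow> f a differentiable (at x)"
  shows "(\<lambda>x. \<Prod>a\<in>I. f a x) differentiable (at x)"
proof -
  have "((\<lambda>x. \<Prod>a\<in>I. f a x) has_derivative
      (\<lambda>h. \<Sum>a\<in>I. frechet_derivative (f a) (at x) h * (\<Prod>b\<in>I - {a}. f b x))) (at x)"
    using assms by (intro has_derivative_prod) (simp add: frechet_derivative_works)
  then show ?thesis by (auto simp: differentiable_def)
qed

lemma C1_differentiable: "C1 S f \<Longrightarrow> x \<in> S \<Longrightarrow> f differentiable (at x)"
  by (simp add: C1_def)

lemma C1_continuous_pd: "C1 S f \<Longrightarrow> continuous_on S (pd i f)"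
  by (simp add: C1_def)

lemma C1_continuous_on: "C1 S f \<Longrightarrow> continuous_on S f"
  by (auto simp: C1_def intro!: continuous_at_imp_continuous_on differentiable_imp_continuous_within)

lemma C1_subset: "C1 S f \<Longrightarrow> T \<subseteq> S \<Longrightarrow> C1 T f"
  unfolding C1_def using continuous_on_subset by blast

lemma pd_cong:
  assumes "open S" "x \<in> S" "\<And>y. y \<in> S \<Longrightarrow> f y = g y"
  shows "pd i f x = pd i g x" "f differentiable (at x) \<longleftrightarrow> g differentiable (at x)"
proof -
  have *: "(f has_derivative D) (at x) \<longleftrightarrow> (g has_derivative D) (at x)" for D
    using has_derivative_transform_within_open[OF _ assms(1,2)] assms(3) by metis
  then show "pd i f x = pd i g x" by (simp add: pd_def frechet_derivative_def)
  show "f differentiable (at x) \<longleftrightarrow> g differentiable (at x)" by (simp add: differentiable_def *)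
qed

lemma C1_cong:
  assumes "open S" "C1 S f" "\<And>y. y \<in> S \<Longrightarrow> g y = f y"
  shows "C1 S g"
  unfolding C1_def
proof (intro conjI allI ballI)
  show "g differentiable (at x)" if "x \<in> S" for x
    using pd_cong(2)[OF assms(1) that assms(3)] assms(2) that by (simp add: C1_def)
  show "continuous_on S (pd i g)" for i
  proof (rule continuous_on_eq[OF C1_continuous_pd[OF assms(2)]])
    show "pd i f x = pd i g x" if "x \<in> S" for x
      by (rule pd_cong(1)[OF assms(1) that assms(3)[symmetric]])
  qed
qed

lemma C1_const [intro, simp]: "C1 S (\<lambda>x. c)"
  by (simp add: C1_def cong: continuous_on_cong)

lemma C1_nth [intro, simp]: "C1 S (\<lambda>x. x $ k)"
  by (simp add: C1_def pd_nth cong: continuous_on_cong)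

lemma C1_add [intro]: "C1 S f \<Longrightarrow> C1 S g \<Longrightarrow> C1 S (\<lambda>x. f x + g x)"
  by (simp add: C1_def pd_add continuous_on_add cong: continuous_on_cong)

lemma C1_diff [intro]: "C1 S f \<Longrightarrow> C1 S g \<Longrightarrow> C1 S (\<lambda>x. f x - g x)"
  by (simp add: C1_def pd_diff continuous_on_diff cong: continuous_on_cong)

lemma C1_mult [intro]:
  assumes "C1 S f" "C1 S g" shows "C1 S (\<lambda>x. f x * g x)"
proof -
  have "continuous_on S f" "continuous_on S g" using assms by (auto intro: C1_continuous_on)
  with assms show ?thesis
    by (simp add: C1_def pd_mult continuous_on_add continuous_on_mult cong: continuous_on_cong)
qed

lemma C1_sum [intro]: "(\<And>a. a \<in> I \<Longrightarrow> C1 S (f a)) \<Longrightarrow> C1 S (\<lambda>x. \<Sum>a\<in>I. f a x)"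
  by (induction I rule: infinite_finite_induct) auto

lemma C1_prod [intro]:
  "(\<And>a. a \<in> I \<Longrightarrow> C1 S (f a)) \<Longrightarrow> C1 S (\<lambda>x. \<Prod>a\<in>I. f a x)"
  by (induction I rule: infinite_finite_induct) auto

lemma C1_inverse [intro]:
  assumes "C1 S f" "\<And>x. x \<in> S \<Longrightarrow> f x \<noteq> 0" shows "C1 S (\<lambda>x. inverse (f x))"
proof -
  have c: "continuous_on S f" using assms by (auto intro: C1_continuous_on)
  have "continuous_on S (pd i (\<lambda>x. inverse (f x)))" for i
  proof (rule continuous_on_eq)
    show "continuous_on S (\<lambda>x. - pd i f x / (f x)\<^sup>2)"
      using assms(2) by (intro continuous_intros c C1_continuous_pd assms) auto
    show "- pd i f x / (f x)\<^sup>2 = pd i (\<lambda>x. inverse (f x)) x" if "x \<in> S" for x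
      using pd_inverse[OF C1_differentiable[OF assms(1) that] assms(2)[OF that]] by simp
  qed
  then show ?thesis using assms by (auto simp: C1_def)
qed

lemma C1_divide [intro]:
  assumes "C1 S f" "C1 S g" "\<And>x. x \<in> S \<Longrightarrow> g x \<noteq> 0" shows "C1 S (\<lambda>x. f x / g x)"
  using C1_mult[OF assms(1) C1_inverse[OF assms(2,3)]] by (simp add: divide_inverse)

lemma C1_det_matrix [intro]:
  assumes "\<And>a b. C1 S (\<lambda>x. A x $ a $ b)" shows "C1 S (\<lambda>x. det (A x :: real^'n^'n))"
  unfolding det_def by (intro C1_sum C1_mult C1_const C1_prod assms)

lemma DERIV_coordinate_line:
  assumes "f differentiable (at (x + s *\<^sub>R axis i 1))"
  shows "DERIV (\<lambda>s. f (x + s *\<^sub>R axis i 1)) s :> pd i f (x + s *\<^sub>R axis i 1)"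
proof -
  let ?p = "x + s *\<^sub>R axis i 1"
  have l: "((\<lambda>s. x + s *\<^sub>R axis i 1) has_derivative (\<lambda>t. t *\<^sub>R axis i 1)) (at s)"
    by (auto intro!: derivative_eq_intros)
  have "((\<lambda>s. f (x + s *\<^sub>R axis i 1)) has_derivative
      (\<lambda>t. frechet_derivative f (at ?p) (t *\<^sub>R axis i 1))) (at s)"
    using diff_chain_at[OF l, of f] assms by (simp add: frechet_derivative_works o_def)
  moreover have "frechet_derivative f (at ?p) (t *\<^sub>R axis i 1) = t * pd i f ?p" for t
    using linear_scale[OF linear_frechet_derivative[OF assms]] by (simp add: pd_def)
  ultimately show ?thesis by (simp add: has_field_derivative_def mult.commute[of _ "pd i f ?p"])
qed

text \<open>The mean value theorem applied twice to the second difference, first in direction \<open>i\<close> and then in direction \<open>j\<close>.\<close>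

lemma second_difference:
  fixes x :: "real^'d"
  assumes C1: "C1 (ball x r) f" "C1 (ball x r) (pd i f)" and t: "0 < t" "2 * t < r"
  shows "\<exists>s1 s2. 0 < s1 \<and> s1 < t \<and> 0 < s2 \<and> s2 < t \<and>
    f (x + t *\<^sub>R axis i 1 + t *\<^sub>R axis j 1) - f (x + t *\<^sub>R axis j 1) - f (x + t *\<^sub>R axis i 1) + f x
    = t * t * pd j (pd i f) (x + s1 *\<^sub>R axis i 1 + s2 *\<^sub>R axis j 1)"
proof -
  have inb: "x + a *\<^sub>R axis i 1 + b *\<^sub>R axis j 1 \<in> ball x r" if "0 \<le> a" "a \<le> t" "0 \<le> b" "b \<le> t" for a b
  proof -
    have "norm (a *\<^sub>R axis i 1 + b *\<^sub>R axis j 1 :: real^'d) \<le> a + b"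
      using that norm_triangle_ineq[of "a *\<^sub>R axis i 1 :: real^'d" "b *\<^sub>R axis j 1"] by simp
    moreover have "dist x (x + a *\<^sub>R axis i 1 + b *\<^sub>R axis j 1) = norm (a *\<^sub>R axis i 1 + b *\<^sub>R axis j 1 :: real^'d)"
      by (subst dist_commute) (simp add: dist_norm)
    ultimately show ?thesis using that t by simp
  qed
  let ?\<phi> = "\<lambda>s. f ((x + t *\<^sub>R axis j 1) + s *\<^sub>R axis i 1) - f (x + s *\<^sub>R axis i 1)"
  have "\<exists>z>0. z < t \<and> ?\<phi> t - ?\<phi> 0 = (t - 0) *
    (pd i f ((x + t *\<^sub>R axis j 1) + z *\<^sub>R axis i 1) - pd i f (x + z *\<^sub>R axis i 1))"
  proof (rule MVT2[OF t(1)])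
    fix s assume s: "0 \<le> s" "s \<le> t"
    show "DERIV ?\<phi> s :> pd i f ((x + t *\<^sub>R axis j 1) + s *\<^sub>R axis i 1) - pd i f (x + s *\<^sub>R axis i 1)"
      using inb[of s t] inb[of s 0] s t
      by (intro DERIV_diff DERIV_coordinate_line C1_differentiable[OF C1(1)]) (auto simp: add_ac)
  qed
  then obtain s1 where s1: "0 < s1" "s1 < t" and e1: "?\<phi> t - ?\<phi> 0 = t *
    (pd i f ((x + s1 *\<^sub>R axis i 1) + t *\<^sub>R axis j 1) - pd i f (x + s1 *\<^sub>R axis i 1))"
    by (auto simp: add_ac)
  let ?\<psi> = "\<lambda>s. pd i f ((x + s1 *\<^sub>R axis i 1) + s *\<^sub>R axis j 1)"
  have "\<exists>z>0. z < t \<and> ?\<psi> t - ?\<psi> 0 = (t - 0) * pd j (pd i f) ((x + s1 *\<^sub>R axis i 1) + z *\<^sub>R axis j 1)"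
  proof (rule MVT2[OF t(1)])
    fix s assume s: "0 \<le> s" "s \<le> t"
    show "DERIV ?\<psi> s :> pd j (pd i f) ((x + s1 *\<^sub>R axis i 1) + s *\<^sub>R axis j 1)"
      using inb[of s1 s] s s1 by (intro DERIV_coordinate_line C1_differentiable[OF C1(2)]) auto
  qed
  then obtain s2 where s2: "0 < s2" "s2 < t" and e2: "?\<psi> t - ?\<psi> 0 = t * pd j (pd i f) ((x + s1 *\<^sub>R axis i 1) + s2 *\<^sub>R axis j 1)"
    by auto
  have "f (x + t *\<^sub>R axis i 1 + t *\<^sub>R axis j 1) - f (x + t *\<^sub>R axis j 1) - f (x + t *\<^sub>R axis i 1) + f x
     = ?\<phi> t - ?\<phi> 0" by (simp add: add_ac)
  also have "\<dots> = t * (?\<psi> t - ?\<psi> 0)" using e1 by simp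
  also have "\<dots> = t * t * pd j (pd i f) (x + s1 *\<^sub>R axis i 1 + s2 *\<^sub>R axis j 1)"
    by (simp only: e2 mult.assoc)
  finally show ?thesis using s1 s2 by blast
qed

text \<open>The second difference quotient is symmetric in \<open>i\<close> and \<open>j\<close>, and by the mean value form above its limit is
  either of the mixed derivatives.\<close>

lemma pd_commute:
  fixes x :: "real^'d"
  assumes "open U" "x \<in> U" and C1: "C1 U f" "\<And>i. C1 U (pd i f)"
  shows "pd i (pd j f) x = pd j (pd i f) x"
proof (rule ccontr)
  let ?a = "pd i (pd j f)" and ?b = "pd j (pd i f)"
  assume "?a x \<noteq> ?b x"
  define \<epsilon> where "\<epsilon> = \<bar>?a x - ?b x\<bar> / 2"
  have "\<epsilon> > 0" using \<open>?a x \<noteq> ?b x\<close> by (simp add: \<epsilon>_def)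
  obtain r where r: "r > 0" "ball x r \<subseteq> U" using assms by (auto simp: open_contains_ball)
  have cont: "continuous (at x) ?a" "continuous (at x) ?b"
    using assms C1_continuous_pd[OF C1(2)] by (auto simp: continuous_on_eq_continuous_at)
  obtain d1 where d1: "d1 > 0" "\<And>y. dist y x < d1 \<Longrightarrow> \<bar>?a y - ?a x\<bar> < \<epsilon>"
    using cont(1) \<open>\<epsilon> > 0\<close> unfolding continuous_at_eps_delta dist_real_def by meson
  obtain d2 where d2: "d2 > 0" "\<And>y. dist y x < d2 \<Longrightarrow> \<bar>?b y - ?b x\<bar> < \<epsilon>"
    using cont(2) \<open>\<epsilon> > 0\<close> unfolding continuous_at_eps_delta dist_real_def by meson
  define t where "t = min r (min d1 d2) / 4"
  have t: "0 < t" "2 * t < r" "2 * t < d1" "2 * t < d2" using r d1 d2 by (auto simp: t_def)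
  have near: "dist (x + a *\<^sub>R axis k 1 + b *\<^sub>R axis l 1) x < 2 * t"
    if "0 < a" "a < t" "0 < b" "b < t" for a b k l
  proof -
    have "dist (x + a *\<^sub>R axis k 1 + b *\<^sub>R axis l 1) x = norm (a *\<^sub>R axis k 1 + b *\<^sub>R axis l 1 :: real^'d)"
      by (simp add: dist_norm)
    also have "\<dots> \<le> a + b"
      using that norm_triangle_ineq[of "a *\<^sub>R axis k 1 :: real^'d" "b *\<^sub>R axis l 1"] by simp
    finally show ?thesis using that by simp
  qed
  have C1b: "C1 (ball x r) f" "\<And>i. C1 (ball x r) (pd i f)"
    using C1 C1_subset r(2) by blast+
  obtain s1 s2 where s: "0 < s1" "s1 < t" "0 < s2" "s2 < t" and e1:
    "f (x + t *\<^sub>R axis i 1 + t *\<^sub>R axis j 1) - f (x + t *\<^sub>R axis j 1) - f (x + t *\<^sub>R axis i 1) + f x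
    = t * t * ?b (x + s1 *\<^sub>R axis i 1 + s2 *\<^sub>R axis j 1)"
    using second_difference[OF C1b t(1,2)] by blast
  obtain s3 s4 where s': "0 < s3" "s3 < t" "0 < s4" "s4 < t" and e2:
    "f (x + t *\<^sub>R axis j 1 + t *\<^sub>R axis i 1) - f (x + t *\<^sub>R axis i 1) - f (x + t *\<^sub>R axis j 1) + f x
    = t * t * ?a (x + s3 *\<^sub>R axis j 1 + s4 *\<^sub>R axis i 1)"
    using second_difference[OF C1b t(1,2)] by blast
  have "t * t * ?b (x + s1 *\<^sub>R axis i 1 + s2 *\<^sub>R axis j 1) = t * t * ?a (x + s3 *\<^sub>R axis j 1 + s4 *\<^sub>R axis i 1)"
  proof -
    have "x + t *\<^sub>R axis j 1 + t *\<^sub>R axis i 1 = x + t *\<^sub>R axis i 1 + t *\<^sub>R axis j 1" by (simp add: add_ac)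
    then show ?thesis using e1 e2 by (smt (verit))
  qed
  then have "?b (x + s1 *\<^sub>R axis i 1 + s2 *\<^sub>R axis j 1) = ?a (x + s3 *\<^sub>R axis j 1 + s4 *\<^sub>R axis i 1)"
    using t by (metis less_irrefl mult_cancel_left mult_eq_0_iff)
  moreover have "\<bar>?b (x + s1 *\<^sub>R axis i 1 + s2 *\<^sub>R axis j 1) - ?b x\<bar> < \<epsilon>"
    using near[OF s] t by (intro d2) (rule less_trans)
  moreover have "\<bar>?a (x + s3 *\<^sub>R axis j 1 + s4 *\<^sub>R axis i 1) - ?a x\<bar> < \<epsilon>"
    using near[OF s'] t by (intro d1) (rule less_trans)
  ultimately have "\<bar>?a x - ?b x\<bar> < \<epsilon> + \<epsilon>" by (smt (verit))
  then show False by (simp add: \<epsilon>_def)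
qed

text \<open>Write row \<open>a\<close> of \<open>B\<close> as a combination of the rows of \<open>A\<close>, with coefficients read off from \<open>B K\<close>; all rows but row \<open>a\<close> of
  \<open>A\<close> contribute a determinant with a repeated row.\<close>

lemma det_row_combination:
  fixes A B :: "real^'n^'n"
  assumes KA: "K ** A = mat 1"
  shows "det (\<chi> k. if k = a then B $ a else A $ k) = (\<Sum>b\<in>UNIV. B $ a $ b * K $ b $ a) * det A"
proof -
  define x :: "real^'n" where "x = (\<chi> l. \<Sum>b\<in>UNIV. B $ a $ b * K $ b $ l)"
  have KA': "(\<Sum>l\<in>UNIV. K $ b $ l * A $ l $ c) = (if b = c then 1 else 0)" for b c
    using KA by (simp add: vec_eq_iff matrix_matrix_mult_def mat_def)
  have "(\<Sum>l\<in>UNIV. x $ l *s row l A) $ c = B $ a $ c" for c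
  proof -
    have "(\<Sum>l\<in>UNIV. x $ l *s row l A) $ c = (\<Sum>l\<in>UNIV. \<Sum>b\<in>UNIV. B $ a $ b * (K $ b $ l * A $ l $ c))"
      by (simp add: x_def row_def sum_distrib_right mult.assoc)
    also have "\<dots> = (\<Sum>b\<in>UNIV. B $ a $ b * (\<Sum>l\<in>UNIV. K $ b $ l * A $ l $ c))"
      by (subst sum.swap) (simp add: sum_distrib_left)
    also have "\<dots> = B $ a $ c" by (simp add: KA' if_distrib[of "\<lambda>x. _ * x"] cong: if_cong)
    finally show ?thesis .
  qed
  then have "(\<Sum>l\<in>UNIV. x $ l *s row l A) = B $ a" by (simp add: vec_eq_iff)
  then have "(\<chi> k. if k = a then B $ a else A $ k) = (\<chi> k. if k = a then (\<Sum>l\<in>UNIV. x $ l *s row l A) else row k A)"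
    by (simp add: vec_eq_iff row_def)
  then have "det (\<chi> k. if k = a then B $ a else A $ k) = x $ a * det A"
    using cramer_lemma_transpose[of a x A] by simp
  then show ?thesis by (simp add: x_def)
qed

text \<open>Jacobi's formula.  The determinant is multilinear in the rows, so its derivative is a sum in which one row at a time is
  differentiated.\<close>

lemma pd_det:
  fixes A :: "real^'d \<Rightarrow> real^'n^'n"
  assumes dA: "\<And>a b. (\<lambda>x. A x $ a $ b) differentiable (at x)" and KA: "K ** A x = mat 1"
  shows "pd i (\<lambda>x. det (A x)) x = det (A x) * (\<Sum>a\<in>UNIV. \<Sum>b\<in>UNIV. K $ b $ a * pd i (\<lambda>x. A x $ a $ b) x)"
proof -
  define B :: "real^'n^'n" where "B = (\<chi> a b. pd i (\<lambda>x. A x $ a $ b) x)"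
  have "pd i (\<lambda>x. det (A x)) x = (\<Sum>p | p permutes UNIV. of_int (sign p) * pd i (\<lambda>x. \<Prod>a\<in>UNIV. A x $ a $ p a) x)"
    unfolding det_def
    by (subst pd_sum) (auto intro!: sum.cong pd_cmult differentiable_mult differentiable_prod dA)
  also have "\<dots> = (\<Sum>p | p permutes UNIV. \<Sum>a\<in>UNIV. of_int (sign p) * (B $ a $ p a * (\<Prod>b\<in>UNIV - {a}. A x $ b $ p b)))"
    by (simp add: pd_prod dA B_def sum_distrib_left)
  also have "\<dots> = (\<Sum>a\<in>UNIV. \<Sum>p | p permutes UNIV. of_int (sign p) * (B $ a $ p a * (\<Prod>b\<in>UNIV - {a}. A x $ b $ p b)))"
    by (rule sum.swap)
  also have "\<dots> = (\<Sum>a\<in>UNIV. det (\<chi> k. if k = a then B $ a else A x $ k))"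
  proof (intro sum.cong refl)
    fix a :: 'n
    have "(\<Prod>k\<in>UNIV. (if k = a then B $ a else A x $ k) $ p k) = B $ a $ p a * (\<Prod>b\<in>UNIV - {a}. A x $ b $ p b)" for p
      by (subst prod.remove[of UNIV a]) (auto intro!: prod.cong)
    then show "(\<Sum>p | p permutes UNIV. of_int (sign p) * (B $ a $ p a * (\<Prod>b\<in>UNIV - {a}. A x $ b $ p b)))
      = det (\<chi> k. if k = a then B $ a else A x $ k)"
      by (simp add: det_def)
  qed
  also have "\<dots> = (\<Sum>a\<in>UNIV. (\<Sum>b\<in>UNIV. B $ a $ b * K $ b $ a) * det (A x))"
    by (simp add: det_row_combination[OF KA])
  finally show ?thesis
    by (simp add: B_def sum_distrib_left sum_distrib_right mult_ac)
qed

lemma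
  fixes A :: "real^'n^'n"
  assumes "det A \<noteq> 0"
  shows matrix_mul_inv_right: "A ** matrix_inv A = mat 1"
    and matrix_mul_inv_left: "matrix_inv A ** A = mat 1"
proof -
  have "\<exists>B. A ** B = mat 1 \<and> B ** A = mat 1"
    using assms unfolding invertible_det_nz[symmetric] invertible_def .
  from someI_ex[OF this] show "A ** matrix_inv A = mat 1" "matrix_inv A ** A = mat 1"
    unfolding matrix_inv_def by auto
qed

text \<open>Cramer's rule exhibits the entries of the inverse as quotients of determinants, hence as \<open>C\<^sup>1\<close> functions.\<close>

lemma matrix_inv_cramer:
  fixes A :: "real^'n^'n"
  assumes "det A \<noteq> 0"
  shows "matrix_inv A $ a $ b = det (\<chi> k l. if l = a then (if k = b then 1 else 0) else A $ k $ l) / det A"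
proof -
  have inv: "A ** matrix_inv A = mat 1"
    by (rule matrix_mul_inv_right[OF assms])
  have e: "A *v column b (matrix_inv A) = axis b 1"
  proof -
    have "(A *v column b (matrix_inv A)) $ k = (A ** matrix_inv A) $ k $ b" for k
      by (simp add: matrix_vector_mult_def column_def matrix_matrix_mult_def)
    then show ?thesis by (simp add: inv vec_eq_iff mat_def axis_def)
  qed
  then have "det (\<chi> k l. if l = a then (axis b 1 :: real^'n) $ k else A $ k $ l) = matrix_inv A $ a $ b * det A"
    using cramer_lemma[where A=A and x="column b (matrix_inv A)" and k=a] unfolding e by (simp add: column_def)
  moreover have "(\<chi> k l. if l = a then (axis b 1 :: real^'n) $ k else A $ k $ l)
      = (\<chi> k l. if l = a then (if k = b then 1 else 0) else A $ k $ l)"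
    by (simp add: vec_eq_iff axis_def)
  ultimately show ?thesis using assms by (simp add: field_simps)
qed

lemma C1_matrix_inv:
  fixes A :: "real^'d \<Rightarrow> real^'n^'n"
  assumes "open S" and C1: "\<And>a b. C1 S (\<lambda>x. A x $ a $ b)" and nz: "\<And>x. x \<in> S \<Longrightarrow> det (A x) \<noteq> 0"
  shows "C1 S (\<lambda>x. matrix_inv (A x) $ a $ b)"
proof (rule C1_cong[OF \<open>open S\<close>])
  show "C1 S (\<lambda>x. det (\<chi> k l. if l = a then (if k = b then 1 else 0) else A x $ k $ l) / det (A x))"
  proof (intro C1_divide C1_det_matrix nz)
    fix a' b'
    show "C1 S (\<lambda>x. (\<chi> k l. if l = a then if k = b then 1 else 0 else A x $ k $ l) $ a' $ b')"
      using C1[of a' b'] by (cases "b' = a"; cases "a' = b") auto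
  qed (auto intro: C1)
qed (auto simp: matrix_inv_cramer nz)

lemma pd_matrix_inv:
  fixes A :: "real^'d \<Rightarrow> real^'n^'n"
  assumes "open S" "x \<in> S" and C1: "\<And>a b. C1 S (\<lambda>x. A x $ a $ b)" and nz: "\<And>x. x \<in> S \<Longrightarrow> det (A x) \<noteq> 0"
  shows "pd i (\<lambda>x. matrix_inv (A x) $ a $ e) x =
    - (\<Sum>b\<in>UNIV. \<Sum>c\<in>UNIV. matrix_inv (A x) $ a $ b * pd i (\<lambda>x. A x $ b $ c) x * matrix_inv (A x) $ c $ e)"
proof -
  define K where "K y = matrix_inv (A y)" for y
  have C1K: "C1 S (\<lambda>x. K x $ a $ b)" for a b
    unfolding K_def by (rule C1_matrix_inv[OF assms(1) C1 nz])
  have KA: "(\<Sum>b\<in>UNIV. K y $ a $ b * A y $ b $ c) = (if a = c then 1 else 0)" if "y \<in> S" for y c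
  proof -
    have "K y ** A y = mat 1" unfolding K_def
      by (rule matrix_mul_inv_left) (simp add: nz that)
    then show ?thesis by (simp add: vec_eq_iff matrix_matrix_mult_def mat_def)
  qed
  have AK: "(\<Sum>c\<in>UNIV. A x $ b $ c * K x $ c $ e) = (if b = e then 1 else 0)" for b
  proof -
    have "A x ** K x = mat 1" unfolding K_def
      by (rule matrix_mul_inv_right) (simp add: nz assms(2))
    then show ?thesis by (simp add: vec_eq_iff matrix_matrix_mult_def mat_def)
  qed
  note d = C1_differentiable[OF C1 assms(2)] C1_differentiable[OF C1K assms(2)]
  have "(\<Sum>b\<in>UNIV. pd i (\<lambda>x. K x $ a $ b) x * A x $ b $ c) = - (\<Sum>b\<in>UNIV. K x $ a $ b * pd i (\<lambda>x. A x $ b $ c) x)" for c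
  proof -
    have "0 = pd i (\<lambda>y. if a = c then 1 else 0) x" by simp
    also have "\<dots> = pd i (\<lambda>y. \<Sum>b\<in>UNIV. K y $ a $ b * A y $ b $ c) x"
      by (rule pd_cong(1)[OF assms(1,2)]) (simp add: KA)
    also have "\<dots> = (\<Sum>b\<in>UNIV. pd i (\<lambda>x. K x $ a $ b) x * A x $ b $ c + K x $ a $ b * pd i (\<lambda>x. A x $ b $ c) x)"
      by (subst pd_sum) (auto intro!: differentiable_mult d simp: pd_mult d)
    finally show ?thesis by (simp add: sum.distrib)
  qed
  then have "(\<Sum>c\<in>UNIV. (\<Sum>b\<in>UNIV. pd i (\<lambda>x. K x $ a $ b) x * A x $ b $ c) * K x $ c $ e)
    = - (\<Sum>c\<in>UNIV. \<Sum>b\<in>UNIV. K x $ a $ b * pd i (\<lambda>x. A x $ b $ c) x * K x $ c $ e)"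
    by (simp add: sum_distrib_right sum_negf)
  moreover have "(\<Sum>c\<in>UNIV. (\<Sum>b\<in>UNIV. pd i (\<lambda>x. K x $ a $ b) x * A x $ b $ c) * K x $ c $ e)
    = (\<Sum>b\<in>UNIV. pd i (\<lambda>x. K x $ a $ b) x * (\<Sum>c\<in>UNIV. A x $ b $ c * K x $ c $ e))"
    unfolding sum_distrib_right sum_distrib_left by (subst sum.swap) (simp add: mult_ac)
  moreover have "\<dots> = pd i (\<lambda>x. K x $ a $ e) x"
    by (simp add: AK if_distrib[of "\<lambda>x. _ * x"] cong: if_cong)
  ultimately show ?thesis unfolding K_def[symmetric] by (subst sum.swap) simp
qed

text \<open>The rows of the cofactor matrix of a Jacobian are divergence free: Jacobi's formula and the derivative of the inverse
  produce two double sums in the second derivatives of \<open>F\<close> that cancel because mixed derivatives commute.\<close>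

lemma piola_identity:
  fixes F :: "real^'d \<Rightarrow> real^'d"
  defines "J \<equiv> \<lambda>x. (\<chi> a b. pd b (\<lambda>x. F x $ a) x) :: real^'d^'d"
  assumes "open S" "x \<in> S"
    and F: "\<And>a. C1 S (\<lambda>x. F x $ a)" "\<And>a b. C1 S (pd b (\<lambda>x. F x $ a))"
    and nz: "\<And>x. x \<in> S \<Longrightarrow> det (J x) \<noteq> 0"
  shows "(\<Sum>i\<in>UNIV. pd i (\<lambda>x. det (J x) * matrix_inv (J x) $ i $ c) x) = 0"
proof -
  define K where "K y = matrix_inv (J y)" for y
  define H where "H a b i = pd i (pd b (\<lambda>x. F x $ a)) x" for a b i
  have H: "H a b i = H a i b" for a b i
    unfolding H_def by (rule pd_commute[OF assms(2,3) F])
  have C1J: "C1 S (\<lambda>x. J x $ a $ b)" for a b unfolding J_def using F(2) by simp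
  have pdJ: "pd i (\<lambda>x. J x $ a $ b) x = H a b i" for i a b by (simp add: J_def H_def)
  have C1K: "C1 S (\<lambda>x. K x $ a $ b)" for a b
    unfolding K_def by (rule C1_matrix_inv[OF assms(2) C1J nz])
  have KJ: "K x ** J x = mat 1" unfolding K_def
    by (rule matrix_mul_inv_left) (simp add: nz assms(3))
  note d = C1_differentiable[OF C1J assms(3)] C1_differentiable[OF C1K assms(3)]
    C1_differentiable[OF C1_det_matrix[OF C1J] assms(3)]
  have "pd i (\<lambda>x. det (J x) * K x $ i $ c) x =
      det (J x) * ((\<Sum>a\<in>UNIV. \<Sum>b\<in>UNIV. K x $ b $ a * H a b i * K x $ i $ c)
        - (\<Sum>b\<in>UNIV. \<Sum>a\<in>UNIV. K x $ i $ b * H b a i * K x $ a $ c))" for i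
    by (simp add: pd_mult d pd_det[OF d(1) KJ] pdJ sum_distrib_right mult.assoc right_diff_distrib
       pd_matrix_inv[OF assms(2,3) C1J nz, folded K_def])
  then have "(\<Sum>i\<in>UNIV. pd i (\<lambda>x. det (J x) * K x $ i $ c) x) =
    det (J x) * ((\<Sum>i\<in>UNIV. \<Sum>a\<in>UNIV. \<Sum>b\<in>UNIV. K x $ b $ a * H a b i * K x $ i $ c)
      - (\<Sum>i\<in>UNIV. \<Sum>b\<in>UNIV. \<Sum>a\<in>UNIV. K x $ i $ b * H b a i * K x $ a $ c))"
    by (simp add: sum_distrib_left sum_subtractf right_diff_distrib)
  moreover have "(\<Sum>i\<in>UNIV. \<Sum>b\<in>UNIV. \<Sum>a\<in>UNIV. K x $ i $ b * H b a i * K x $ a $ c)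
    = (\<Sum>a\<in>UNIV. \<Sum>b\<in>UNIV. \<Sum>i\<in>UNIV. K x $ i $ b * H b a i * K x $ a $ c)"
    by (subst sum.swap, subst (2) sum.swap, subst sum.swap) simp
  moreover have "\<dots> = (\<Sum>i\<in>UNIV. \<Sum>a\<in>UNIV. \<Sum>b\<in>UNIV. K x $ b $ a * H a b i * K x $ i $ c)"
    using H by (intro sum.cong refl) metis
  ultimately show ?thesis unfolding K_def by simp
qed

section \<open>Inverse inequalities for univariate polynomials\<close>

text \<open>Equivalence of norms on polynomials of bounded degree, by induction on the degree: the divided difference
  \<open>(p - p(a)) / (x - a)\<close> has smaller degree and is bounded on the right half of the interval.\<close>

lemma poly_coeff_le_sup:
  fixes a b :: real
  assumes "a < b"
  shows "\<exists>c>0. \<forall>p M. degree p \<le> n \<longrightarrow> (\<forall>x\<in>{a..b}. \<bar>poly p x\<bar> \<le> M) \<longrightarrow> (\<forall>i. \<bar>coeff p i\<bar> \<le> c * M)"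
  using assms
proof (induction n arbitrary: a)
  case 0
  have "\<bar>coeff p i\<bar> \<le> 1 * M" if "degree p \<le> 0" "\<forall>x\<in>{a..b}. \<bar>poly p x\<bar> \<le> M" for p :: "real poly" and M i
  proof -
    obtain k where p: "p = [:k:]" using \<open>degree p \<le> 0\<close> by (auto elim: degree_eq_zeroE)
    have "\<bar>k\<bar> \<le> M" using that(2)[rule_format, of a] 0 by (simp add: p)
    then show ?thesis by (cases i) (auto simp: p)
  qed
  then show ?case using zero_less_one by blast
next
  case (Suc n)
  define m where "m = (a + b) / 2"
  have m: "a < m" "m < b" using Suc.prems by (auto simp: m_def)
  obtain c where c: "c > 0" and IH: "\<And>q M i. degree q \<le> n \<Longrightarrow> (\<And>x. x \<in> {m..b} \<Longrightarrow> \<bar>poly q x\<bar> \<le> M) \<Longrightarrow> \<bar>coeff q i\<bar> \<le> c * M"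
    using Suc.IH[OF m(2)] by blast
  define C where "C = 1 + (\<bar>a\<bar> + 1) * (c * (2 / (m - a)))"
  have "\<bar>coeff p i\<bar> \<le> C * M" if deg: "degree p \<le> Suc n" and le: "\<And>x. x \<in> {a..b} \<Longrightarrow> \<bar>poly p x\<bar> \<le> M" for p :: "real poly" and M i
  proof -
    define q where "q = synthetic_div p a"
    have p: "p = [:-a, 1:] * q + [:poly p a:]" by (simp only: q_def synthetic_div_correct')
    have "poly p x = (x - a) * poly q x + poly p a" for x
      by (subst p) (simp add: algebra_simps)
    have q: "\<bar>coeff q i\<bar> \<le> c * (2 * M / (m - a))" for i
    proof (rule IH)
      show "degree q \<le> n" using deg by (simp add: q_def degree_synthetic_div)
      fix x assume x: "x \<in> {m..b}"
      have "(m - a) * \<bar>poly q x\<bar> \<le> (x - a) * \<bar>poly q x\<bar>"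
        using x by (intro mult_right_mono) auto
      also have "\<dots> = \<bar>poly p x - poly p a\<bar>"
        using x m \<open>poly p x = (x - a) * poly q x + poly p a\<close> by (simp add: abs_mult)
      also have "\<dots> \<le> 2 * M" using le[of x] le[of a] x m by auto
      finally show "\<bar>poly q x\<bar> \<le> 2 * M / (m - a)" using m by (simp add: field_simps)
    qed
    have M: "\<bar>poly p a\<bar> \<le> M" using le[of a] m by auto
    have "coeff p i = - a * coeff q i + (if i = 0 then 0 else coeff q (i - 1)) + (if i = 0 then poly p a else 0)"
      by (subst p) (cases i; simp)
    then have "\<bar>coeff p i\<bar> \<le> \<bar>a\<bar> * \<bar>coeff q i\<bar> + \<bar>coeff q (i - 1)\<bar> + \<bar>poly p a\<bar>"
      by (auto simp flip: abs_mult)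
    also have "\<dots> \<le> \<bar>a\<bar> * (c * (2 * M / (m - a))) + c * (2 * M / (m - a)) + M"
      using M q by (intro add_mono mult_left_mono) auto
    also have "\<dots> = C * M" by (simp add: C_def algebra_simps add_divide_distrib)
    finally show ?thesis .
  qed
  moreover have "C > 0" using c m by (auto simp: C_def intro!: add_pos_nonneg)
  ultimately show ?case by blast
qed

lemma poly_antiderivative:
  fixes p :: "real poly"
  shows "\<exists>g. pderiv g = p \<and> degree g \<le> Suc (degree p)"
proof (intro exI conjI)
  let ?g = "\<Sum>i\<le>degree p. monom (coeff p i / real (Suc i)) (Suc i)"
  show "degree ?g \<le> Suc (degree p)"
    by (rule degree_sum_le) (auto intro: order_trans[OF degree_monom_le])
  show "pderiv ?g = p"
  proof (rule poly_eqI)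
    fix n
    have "coeff ?g (Suc n) = (\<Sum>i\<le>degree p. if i = n then coeff p i / real (Suc i) else 0)"
      by (simp add: coeff_sum)
    also have "\<dots> = coeff p n / real (Suc n)"
      by (auto simp: coeff_eq_0)
    finally show "coeff (pderiv ?g) n = coeff p n" by (simp add: coeff_pderiv)
  qed
qed

lemma poly_has_integral:
  fixes g :: "real poly"
  assumes "a \<le> b" shows "(poly (pderiv g) has_integral poly g b - poly g a) {a..b}"
  by (rule fundamental_theorem_of_calculus[OF assms])
    (auto simp: has_real_derivative_iff_has_vector_derivative[symmetric] intro: DERIV_subset poly_DERIV)

lemma poly_integrable_on: "poly p integrable_on {a..b::real}"
  by (intro integrable_continuous_real continuous_intros)

text \<open>The antiderivative of \<open>p\<close> vanishing at \<open>0\<close> is bounded on \<open>[0,1]\<close> by the \<open>L\<^sup>2\<close> norm of \<open>p\<close>, so its coefficients are, and these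
  are those of \<open>p\<close> up to bounded factors.\<close>

lemma poly_coeff_le_L2:
  "\<exists>c>0. \<forall>p m. degree p \<le> n \<longrightarrow> 0 < m \<longrightarrow> integral {0..1} (poly (p * p)) \<le> m\<^sup>2 \<longrightarrow> (\<forall>i. \<bar>coeff p i\<bar> \<le> c * (m::real))"
proof -
  obtain c where c: "c > 0" and bd: "\<And>p M i. degree p \<le> Suc n \<Longrightarrow> (\<And>x. x \<in> {0..1::real} \<Longrightarrow> \<bar>poly p x\<bar> \<le> M) \<Longrightarrow> \<bar>coeff p i\<bar> \<le> c * M"
    using poly_coeff_le_sup[of 0 "1::real" "Suc n"] by (auto simp: Ball_def)
  have "\<bar>coeff p i\<bar> \<le> (real (Suc n) * c) * m"
    if deg: "degree p \<le> n" and m: "0 < m" and I: "integral {0..1} (poly (p * p)) \<le> m\<^sup>2" for p :: "real poly" and m i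
  proof (cases "i \<le> n")
    case False
    then show ?thesis using deg c m by (simp add: coeff_eq_0)
  next
    case True
    obtain g0 where g0: "pderiv g0 = p" "degree g0 \<le> Suc (degree p)" using poly_antiderivative by blast
    define g where "g = g0 - [:poly g0 0:]"
    have g: "pderiv g = p" "degree g \<le> Suc n" "poly g 0 = 0"
      using g0 deg by (auto simp: g_def pderiv_diff intro!: degree_diff_le)
    have "\<bar>poly g x\<bar> \<le> m" if x: "x \<in> {0..1}" for x
    proof -
      have gi: "integral {0..x} (poly p) = poly g x"
        using poly_has_integral[of 0 x g] x g by (simp add: integral_unique)
      let ?u = "\<lambda>t. (poly (p * p) t / m + m) / 2"
      have ui: "?u integrable_on {0..s}" for s by (intro integrable_continuous_real continuous_intros) (use m in auto)
      have ab: "\<bar>poly p t\<bar> \<le> ?u t" for t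
      proof -
        have "0 \<le> (\<bar>poly p t\<bar> - m)\<^sup>2" by simp
        then have "2 * m * \<bar>poly p t\<bar> \<le> (poly p t)\<^sup>2 + m\<^sup>2" by (simp add: power2_diff mult_ac)
        then show ?thesis using m by (simp add: field_simps power2_eq_square)
      qed
      have "norm (integral {0..x} (poly p)) \<le> integral {0..x} ?u"
        by (rule integral_norm_bound_integral[OF poly_integrable_on ui]) (use ab in auto)
      also have "\<dots> \<le> integral {0..1} ?u"
        using x m by (intro integral_subset_le ui) auto
      also have "\<dots> = (integral {0..1} (poly (p * p)) / m + m) / 2"
      proof -
        have "((\<lambda>t. (poly (p * p) t / m + m) / 2) has_integral (integral {0..1} (poly (p * p)) / m + (1 - 0) *\<^sub>R m) / 2) {0..1}"
          by (intro has_integral_divide has_integral_add integrable_integral poly_integrable_on has_integral_const_real)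
            (use has_integral_const_real[of m 0 1] in auto)
        from integral_unique[OF this, unfolded diff_zero scaleR_one] show ?thesis .
      qed
      also have "\<dots> \<le> m" using I m by (simp add: field_simps power2_eq_square)
      finally show ?thesis by (simp add: gi)
    qed
    from bd[OF g(2) this, of "Suc i"] have *: "\<bar>coeff g (Suc i)\<bar> \<le> c * m" by auto
    have "\<bar>coeff p i\<bar> = real (Suc i) * \<bar>coeff g (Suc i)\<bar>"
      unfolding g(1)[symmetric] by (simp add: coeff_pderiv abs_mult)
    also have "\<dots> \<le> real (Suc n) * (c * m)" using * True by (intro mult_mono) auto
    finally show ?thesis by (simp add: mult.assoc)
  qed
  moreover have "real (Suc n) * c > 0" using c by simp
  ultimately show ?thesis by blast
qed

lemma poly_abs_le_coeff:
  fixes p :: "real poly"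
  assumes "degree p \<le> n" "\<And>i. \<bar>coeff p i\<bar> \<le> K" "0 \<le> t" "t \<le> 1"
  shows "\<bar>poly p t\<bar> \<le> (real n + 1) * K"
proof -
  have K: "K \<ge> 0" using assms(2)[of 0] by linarith
  have "\<bar>poly p t\<bar> \<le> (\<Sum>i\<le>degree p. \<bar>coeff p i * t ^ i\<bar>)"
    unfolding poly_altdef by (rule sum_abs)
  also have "\<dots> \<le> (\<Sum>i\<le>degree p. K)"
  proof (rule sum_mono)
    fix i
    have "\<bar>coeff p i\<bar> * \<bar>t ^ i\<bar> \<le> K * 1"
      using assms K by (intro mult_mono) (auto simp: power_le_one)
    then show "\<bar>coeff p i * t ^ i\<bar> \<le> K" by (simp add: abs_mult)
  qed
  also have "\<dots> \<le> (real n + 1) * K" using assms(1) K by (simp add: mult_right_mono)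
  finally show ?thesis .
qed

text \<open>On \<open>[0,1]\<close> this is equivalence of norms; the powers of \<open>b - a\<close> come from rescaling the interval.\<close>

lemma poly_inverse_inequality:
  "\<exists>c>0. \<forall>p::real poly. \<forall>a b. degree p \<le> n \<longrightarrow> a < b \<longrightarrow> (\<forall>t\<in>{a..b}.
     (poly p t)\<^sup>2 \<le> c / (b - a) * integral {a..b} (\<lambda>t. (poly p t)\<^sup>2) \<and>
     (poly (pderiv p) t)\<^sup>2 \<le> c / (b - a) ^ 3 * integral {a..b} (\<lambda>t. (poly p t)\<^sup>2))"
proof -
  obtain c where c: "c > 0" and bd: "\<And>p m i. degree p \<le> n \<Longrightarrow> 0 < m \<Longrightarrow> integral {0..1} (poly (p * p)) \<le> m\<^sup>2 \<Longrightarrow> \<bar>coeff p i\<bar> \<le> c * (m::real)"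
    using poly_coeff_le_L2[of n] by auto
  define D where "D = (real n + 1) * (real (Suc n) * c)"
  have D: "D > 0" using c by (simp add: D_def)
  have unit: "(poly p s)\<^sup>2 \<le> D\<^sup>2 * I \<and> (poly (pderiv p) s)\<^sup>2 \<le> D\<^sup>2 * I"
    if deg: "degree p \<le> n" and s: "0 \<le> s" "s \<le> 1" and I: "I = integral {0..1} (poly (p * p))" for p :: "real poly" and s I
  proof -
    have I0: "I \<ge> 0" unfolding I by (rule integral_nonneg[OF poly_integrable_on]) simp
    have le: "(poly p s)\<^sup>2 \<le> (D * m)\<^sup>2 \<and> (poly (pderiv p) s)\<^sup>2 \<le> (D * m)\<^sup>2" if m: "m > 0" "I \<le> m\<^sup>2" for m
    proof -
      have co: "\<bar>coeff p i\<bar> \<le> c * m" for i using bd[OF deg m(1)] m(2) I by auto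
      have "\<bar>coeff (pderiv p) i\<bar> \<le> real (Suc n) * c * m" for i
      proof (cases "Suc i \<le> n")
        case True
        then have "real (Suc i) * \<bar>coeff p (Suc i)\<bar> \<le> real (Suc n) * (c * m)"
          using co by (intro mult_mono) auto
        then show ?thesis by (simp add: coeff_pderiv abs_mult mult.assoc)
      next
        case False
        then have "coeff p (Suc i) = 0" using deg by (simp add: coeff_eq_0)
        then show ?thesis using c m by (simp add: coeff_pderiv)
      qed
      moreover have "degree (pderiv p) \<le> n" using deg by (simp add: degree_pderiv)
      ultimately have 1: "\<bar>poly (pderiv p) s\<bar> \<le> D * m"
        using poly_abs_le_coeff[of "pderiv p" n "real (Suc n) * c * m" s] s by (simp add: D_def mult.assoc)
      have "\<bar>coeff p i\<bar> \<le> real (Suc n) * c * m" for i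
      proof -
        have "1 * (c * m) \<le> real (Suc n) * (c * m)" using c m by (intro mult_right_mono) auto
        then show ?thesis using co[of i] by (simp add: mult.assoc)
      qed
      then have 2: "\<bar>poly p s\<bar> \<le> D * m"
        using poly_abs_le_coeff[of p n "real (Suc n) * c * m" s] s deg by (simp add: D_def mult.assoc)
      show ?thesis using 1 2 abs_le_square_iff[of _ "D * m"] D m by simp
    qed
    have "(poly p s)\<^sup>2 \<le> D\<^sup>2 * I + e \<and> (poly (pderiv p) s)\<^sup>2 \<le> D\<^sup>2 * I + e" if e: "e > 0" for e
    proof -
      have "I + e / D\<^sup>2 > 0" using I0 e D by (auto intro!: add_nonneg_pos)
      then have "(poly p s)\<^sup>2 \<le> (D * sqrt (I + e / D\<^sup>2))\<^sup>2 \<and> (poly (pderiv p) s)\<^sup>2 \<le> (D * sqrt (I + e / D\<^sup>2))\<^sup>2"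
        using e D by (intro le) auto
      moreover have "(D * sqrt (I + e / D\<^sup>2))\<^sup>2 = D\<^sup>2 * I + e"
        using \<open>I + e / D\<^sup>2 > 0\<close> D by (simp add: power_mult_distrib field_simps)
      ultimately show ?thesis by simp
    qed
    then show ?thesis using field_le_epsilon by blast
  qed
  have "(poly p t)\<^sup>2 \<le> D\<^sup>2 / (b - a) * integral {a..b} (\<lambda>t. (poly p t)\<^sup>2) \<and>
     (poly (pderiv p) t)\<^sup>2 \<le> D\<^sup>2 / (b - a) ^ 3 * integral {a..b} (\<lambda>t. (poly p t)\<^sup>2)"
    if deg: "degree p \<le> n" and ab: "a < b" and t: "t \<in> {a..b}" for p :: "real poly" and a b t
  proof -
    define q where "q = pcompose p [:a, b - a:]"
    define s where "s = (t - a) / (b - a)"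
    have s: "0 \<le> s" "s \<le> 1" "a + (b - a) * s = t" using ab t by (auto simp: s_def)
    have q: "poly q x = poly p (a + (b - a) * x)" for x by (simp add: q_def poly_pcompose mult.commute)
    have dq: "poly (pderiv q) x = (b - a) * poly (pderiv p) (a + (b - a) * x)" for x
      by (simp add: q_def pderiv_pcompose poly_pcompose pderiv_pCons mult.commute)
    have degq: "degree q \<le> n" using deg by (simp add: q_def degree_pcompose)
    obtain G where G: "pderiv G = p * p" using poly_antiderivative by blast
    have "(poly (p * p) has_integral poly G b - poly G a) {a..b}"
      using poly_has_integral[of a b G] ab G by simp
    then have Ip: "integral {a..b} (\<lambda>t. (poly p t)\<^sup>2) = poly G b - poly G a"
    proof -
      have "(\<lambda>t. (poly p t)\<^sup>2) = poly (p * p)" by (auto simp: power2_eq_square)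
      then show ?thesis
        using integral_unique[OF \<open>(poly (p * p) has_integral poly G b - poly G a) {a..b}\<close>] by simp
    qed
    define H where "H = smult (1 / (b - a)) (pcompose G [:a, b - a:])"
    have "pderiv H = q * q"
      using ab G unfolding H_def q_def
      by (simp add: pderiv_smult pderiv_pcompose pderiv_pCons pcompose_mult)
    then have "(poly (q * q) has_integral poly H 1 - poly H 0) {0..1}"
      using poly_has_integral[of 0 1 H] by simp
    then have Iq: "integral {0..1} (poly (q * q)) = 1 / (b - a) * integral {a..b} (\<lambda>t. (poly p t)\<^sup>2)"
      unfolding Ip by (simp add: integral_unique H_def poly_pcompose diff_divide_distrib)
    from unit[OF degq s(1,2) refl] have
      1: "(poly p t)\<^sup>2 \<le> D\<^sup>2 * (1 / (b - a) * integral {a..b} (\<lambda>t. (poly p t)\<^sup>2))" and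
      2: "((b - a) * poly (pderiv p) t)\<^sup>2 \<le> D\<^sup>2 * (1 / (b - a) * integral {a..b} (\<lambda>t. (poly p t)\<^sup>2))"
      unfolding Iq q dq s(3) by auto
    from 2 have "(b - a)\<^sup>2 * (poly (pderiv p) t)\<^sup>2 \<le> D\<^sup>2 * (1 / (b - a) * integral {a..b} (\<lambda>t. (poly p t)\<^sup>2))"
      by (simp add: power_mult_distrib)
    then have "(poly (pderiv p) t)\<^sup>2 \<le> D\<^sup>2 * (1 / (b - a) * integral {a..b} (\<lambda>t. (poly p t)\<^sup>2)) / (b - a)\<^sup>2"
      using ab by (simp add: field_simps)
    also have "\<dots> = D\<^sup>2 / (b - a) ^ 3 * integral {a..b} (\<lambda>t. (poly p t)\<^sup>2)"
      by (simp add: power3_eq_cube power2_eq_square)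
    finally show ?thesis using 1 by simp
  qed
  moreover have "D\<^sup>2 > 0" using D by simp
  ultimately show ?thesis by blast
qed

section \<open>The curved box and piecewise smooth functions\<close>

lemma AE_slice_coordinate:
  fixes i k :: "'d::finite"
  assumes "k \<noteq> i" "finite Z"
  shows "AE y in slice_measure i. y k \<notin> Z"
proof -
  interpret product_sigma_finite "\<lambda>_::'d. lborel :: real measure" ..
  have "AE y in slice_measure i. y k \<noteq> c" for c
  proof (rule AE_I)
    let ?N = "\<Pi>\<^sub>E l\<in>-{i}. if l = k then {c} else UNIV"
    show "{y \<in> space (slice_measure i). \<not> y k \<noteq> c} \<subseteq> ?N"
      by (auto simp: space_PiM PiE_iff extensional_def split: if_splits)
    have "emeasure (slice_measure i) ?N = (\<Prod>l\<in>-{i}. emeasure lborel (if l = k then {c} else UNIV))"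
      by (rule emeasure_PiM) auto
    also have "\<dots> = 0"
      by (subst prod.remove[of _ k]) (use assms in auto)
    finally show "emeasure (slice_measure i) ?N = 0" .
    show "?N \<in> sets (slice_measure i)" by (rule sets_PiM_I_finite) auto
  qed
  then have "AE y in slice_measure i. \<forall>c\<in>Z. y k \<noteq> c"
    using assms(2) by (simp add: AE_finite_all)
  then show ?thesis by eventually_elim auto
qed

lemma AE_slice_coordinates:
  fixes i :: "'d::finite"
  assumes "\<And>k. finite (Z k)"
  shows "AE y in slice_measure i. \<forall>k. k \<noteq> i \<longrightarrow> y k \<notin> Z k"
proof -
  have "AE y in slice_measure i. \<forall>k\<in>-{i}. y k \<notin> Z k"
    by (subst AE_finite_all) (auto intro: AE_slice_coordinate assms)
  then show ?thesis by eventually_elim auto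
qed

lemma (in complete_measure) measurable_AE_eq:
  fixes f :: "'a \<Rightarrow> 'b::topological_space"
  assumes h: "h \<in> borel_measurable M" and ae: "AE x in M. f x = h x"
  shows "f \<in> borel_measurable M"
proof (rule measurableI)
  fix B :: "'b set" assume "B \<in> sets borel"
  with h have "h -` B \<inter> space M \<in> sets M" by (rule measurable_sets)
  then show "f -` B \<inter> space M \<in> sets M"
  proof (rule in_sets_AE[rotated])
    show "AE x in M. x \<in> h -` B \<inter> space M \<longleftrightarrow> x \<in> f -` B \<inter> space M"
      using ae by eventually_elim auto
  qed auto
qed auto

locale curved_box =
  fixes F :: "real^'d \<Rightarrow> real^'d" and lo hi :: "real^'d" and S :: "(real^'d) set"
  assumes card: "CARD('d) \<in> {2, 3}"
    and lo_less_hi: "\<And>i. lo $ i < hi $ i"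
    and open_S: "open S" and box_subset_S: "cbox lo hi \<subseteq> S"
    and C1_F: "\<And>a. C1 S (\<lambda>x. F x $ a)"
    and C1_pd_F: "\<And>a b. C1 S (pd b (\<lambda>x. F x $ a))"
    and det_nz: "\<And>x. x \<in> S \<Longrightarrow> det (\<chi> a b. pd b (\<lambda>x. F x $ a) x) \<noteq> 0"
    and inj_F: "inj_on F (cbox lo hi)"
begin

abbreviation (input) Q :: "(real^'d) set" where "Q \<equiv> cbox lo hi"
abbreviation (input) \<Omega> :: "(real^'d) set" where "\<Omega> \<equiv> phys_domain F lo hi"

definition J :: "real^'d \<Rightarrow> real^'d^'d" where "J x = (\<chi> a b. pd b (\<lambda>x. F x $ a) x)"
definition K :: "real^'d \<Rightarrow> real^'d^'d" where "K x = matrix_inv (J x)"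

lemma box_in_S: "x \<in> box lo hi \<Longrightarrow> x \<in> S" "x \<in> Q \<Longrightarrow> x \<in> S"
  using box_subset_S box_subset_cbox by blast+

lemma det_J_nz: "x \<in> S \<Longrightarrow> det (J x) \<noteq> 0" using det_nz by (simp add: J_def)

lemma F_has_derivative:
  assumes "x \<in> S" shows "(F has_derivative (\<lambda>h. J x *v h)) (at x)"
proof -
  have "((\<lambda>x. F x \<bullet> axis k 1) has_derivative (\<lambda>h. (J x *v h) \<bullet> axis k 1)) (at x)" for k
    using has_derivative_pd[OF C1_differentiable[OF C1_F[of k] assms]]
    by (simp add: inner_axis J_def matrix_vector_mult_def mult.commute)
  note comp = this
  show ?thesis
  proof (rule has_derivative_componentwise_within[THEN iffD2], rule ballI)
    fix b :: "real^'d" assume "b \<in> Basis"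
    then obtain k where "b = axis k 1" by (auto simp: Basis_vec_def)
    then show "((\<lambda>x. F x \<bullet> b) has_derivative (\<lambda>h. (J x *v h) \<bullet> b)) (at x)" using comp by simp
  qed
qed

lemma jacobian_F: "x \<in> S \<Longrightarrow> jacobian F (at x) = J x"
  unfolding jacobian_def using frechet_derivative_at[OF F_has_derivative, of x]
  by (metis matrix_of_matrix_vector_mul)

lemma C1_J: "C1 S (\<lambda>x. J x $ a $ b)" unfolding J_def using C1_pd_F by simp

lemma C1_K: "C1 S (\<lambda>x. K x $ a $ b)"
  unfolding K_def by (rule C1_matrix_inv[OF open_S C1_J det_J_nz])

lemma C1_det: "C1 S (\<lambda>x. det (J x))" by (intro C1_det_matrix C1_J)

lemma JK: "x \<in> S \<Longrightarrow> J x ** K x = mat 1" and KJ: "x \<in> S \<Longrightarrow> K x ** J x = mat 1"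
  unfolding K_def using matrix_mul_inv_right matrix_mul_inv_left det_J_nz by auto

lemma KJ_nth: "x \<in> S \<Longrightarrow> (\<Sum>b\<in>UNIV. K x $ a $ b * J x $ b $ c) = (if a = c then 1 else 0)"
  using KJ[of x] by (simp add: vec_eq_iff matrix_matrix_mult_def mat_def)

lemma JK_nth: "x \<in> S \<Longrightarrow> (\<Sum>b\<in>UNIV. J x $ a $ b * K x $ b $ c) = (if a = c then 1 else 0)"
  using JK[of x] by (simp add: vec_eq_iff matrix_matrix_mult_def mat_def)

lemma piola: "x \<in> S \<Longrightarrow> (\<Sum>i\<in>UNIV. pd i (\<lambda>x. det (J x) * K x $ i $ c) x) = 0"
  unfolding K_def J_def by (rule piola_identity[OF open_S _ C1_F C1_pd_F det_nz])

lemma continuous_F: "continuous_on S F"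
  by (intro continuous_at_imp_continuous_on ballI has_derivative_continuous[OF F_has_derivative])

lemma continuous_F_Q: "continuous_on Q F"
  by (rule continuous_on_subset[OF continuous_F box_subset_S])

lemma compact_FQ: "compact (F ` Q)" by (intro compact_continuous_image continuous_F_Q compact_cbox)

text \<open>Invariance of domain.\<close>

lemma open_Omega: "open \<Omega>"
  unfolding phys_domain_def
  using continuous_F_Q inj_F box_subset_cbox
  by (intro invariance_of_domain) (auto intro: continuous_on_subset inj_on_subset)

lemma bounded_Omega: "bounded \<Omega>"
  unfolding phys_domain_def
  by (rule bounded_subset[OF compact_imp_bounded[OF compact_FQ] image_mono[OF box_subset_cbox]])

definition G :: "real^'d \<Rightarrow> real^'d" where "G = inv_into Q F"

lemma G_F [simp]: "x \<in> Q \<Longrightarrow> G (F x) = x" unfolding G_def by (simp add: inj_F)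

lemma continuous_G: "continuous_on (F ` Q) G"
  by (rule continuous_on_inv[OF continuous_F_Q compact_cbox]) auto

text \<open>The Jacobian determinant has no zero on the connected box, hence a constant sign.\<close>

lemma det_sign: obtains \<sigma> where "\<sigma> = 1 \<or> \<sigma> = -1" "\<And>x. x \<in> Q \<Longrightarrow> \<bar>det (J x)\<bar> = \<sigma> * det (J x)"
proof -
  have c: "continuous_on Q (\<lambda>x. det (J x))"
    by (rule continuous_on_subset[OF C1_continuous_on[OF C1_det] box_subset_S])
  have conn: "connected ((\<lambda>x. det (J x)) ` Q)"
    by (intro connected_continuous_image c convex_connected) simp
  have nz: "0 \<notin> (\<lambda>x. det (J x)) ` Q" using det_J_nz box_in_S by force
  have "(\<forall>x\<in>Q. det (J x) > 0) \<or> (\<forall>x\<in>Q. det (J x) < 0)"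
  proof (rule ccontr)
    assume "\<not> ?thesis"
    then obtain x y where "x \<in> Q" "y \<in> Q" "det (J x) \<le> 0" "det (J y) \<ge> 0" by force
    then have "0 \<in> (\<lambda>x. det (J x)) ` Q"
      using connectedD_interval[OF conn, of "det (J x)" "det (J y)" 0] by auto
    with nz show False by simp
  qed
  then show ?thesis
  proof
    assume "\<forall>x\<in>Q. det (J x) > 0" then show ?thesis by (intro that[of 1]) auto
  next
    assume "\<forall>x\<in>Q. det (J x) < 0" then show ?thesis by (intro that[of "-1"]) auto
  qed
qed

text \<open>The open box without finitely many coordinate hyperplanes \<open>x\<^sub>k \<in> Z k\<close>.  With \<open>Z\<close> the knots this is the union of the
  open cells.\<close>

definition off_skeleton :: "('d \<Rightarrow> real set) \<Rightarrow> (real^'d) set" where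
  "off_skeleton Z = {x \<in> box lo hi. \<forall>k. x $ k \<notin> Z k}"

abbreviation (input) "Off \<equiv> off_skeleton"

lemma O_subset: "Off Z \<subseteq> box lo hi" "Off Z \<subseteq> Q" "Off Z \<subseteq> S"
  using box_subset_S box_subset_cbox by (auto simp: off_skeleton_def)

lemma open_O: assumes "\<And>k. finite (Z k)" shows "open (Off Z)"
proof -
  have "open ((\<lambda>x. x $ k) -` (- Z k) :: (real^'d) set)" for k
    using assms[of k] by (intro open_vimage) (auto intro: finite_imp_closed continuous_intros)
  then have "open (\<Inter>k\<in>UNIV. (\<lambda>x. x $ k) -` (- Z k) :: (real^'d) set)" by (intro open_INT) auto
  moreover have "Off Z = box lo hi \<inter> (\<Inter>k\<in>UNIV. (\<lambda>x. x $ k) -` (- Z k))"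
    by (auto simp: off_skeleton_def)
  ultimately show ?thesis by (simp only: open_Int open_box)
qed

lemma negligible_skeleton:
  assumes "\<And>k. finite (Z k)" shows "negligible (Q - Off Z)"
proof (rule negligible_subset)
  show "negligible (\<Union>k\<in>UNIV. \<Union>c\<in>insert (lo $ k) (insert (hi $ k) (Z k)). {x :: real^'d. axis k 1 \<bullet> x = c})"
    using assms by (intro negligible_Union finite_imageI finite) (auto intro!: negligible_Union negligible_hyperplane simp: axis_eq_0_iff)
  show "Q - Off Z \<subseteq> (\<Union>k\<in>UNIV. \<Union>c\<in>insert (lo $ k) (insert (hi $ k) (Z k)). {x. axis k 1 \<bullet> x = c})"
    by (auto simp: off_skeleton_def mem_box_cart inner_axis' less_le) metis+
qed

text \<open>The regularity of discrete velocities: continuous up to the boundary, \<open>C\<^sup>1\<close> with bounded derivatives off the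
  skeleton \<open>Z\<close>.\<close>

definition PW :: "('d \<Rightarrow> real set) \<Rightarrow> (real^'d \<Rightarrow> real) \<Rightarrow> bool" where
  "PW Z f \<longleftrightarrow> continuous_on Q f \<and> C1 (Off Z) f \<and> (\<forall>i. bounded (pd i f ` Off Z))"

text \<open>The class to which derivatives of piecewise smooth functions belong: bounded and continuous off the skeleton, with
  arbitrary values on it.\<close>

definition BM :: "('d \<Rightarrow> real set) \<Rightarrow> (real^'d \<Rightarrow> real) \<Rightarrow> bool" where
  "BM Z f \<longleftrightarrow> continuous_on (Off Z) f \<and> bounded (f ` Off Z)"

lemma BM_iff: "BM Z f \<longleftrightarrow> continuous_on (Off Z) f \<and> (\<exists>B. \<forall>x\<in>Off Z. \<bar>f x\<bar> \<le> B)"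
  by (auto simp: BM_def bounded_iff)

lemma BM_const [intro, simp]: "BM Z (\<lambda>x. c)" by (auto simp: BM_iff)

lemma BM_cong: "BM Z f \<Longrightarrow> (\<And>x. x \<in> Off Z \<Longrightarrow> g x = f x) \<Longrightarrow> BM Z g"
  by (auto simp: BM_def cong: continuous_on_cong image_cong)

lemma BM_add [intro]: assumes "BM Z f" "BM Z g" shows "BM Z (\<lambda>x. f x + g x)"
proof -
  obtain A B where "\<And>x. x \<in> Off Z \<Longrightarrow> \<bar>f x\<bar> \<le> A" "\<And>x. x \<in> Off Z \<Longrightarrow> \<bar>g x\<bar> \<le> B"
    using assms by (auto simp: BM_iff)
  then have "\<bar>f x + g x\<bar> \<le> A + B" if "x \<in> Off Z" for x
    using that by (intro order_trans[OF abs_triangle_ineq add_mono])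
  then show ?thesis using assms by (auto simp: BM_iff intro!: continuous_intros)
qed

lemma BM_mult [intro]: assumes "BM Z f" "BM Z g" shows "BM Z (\<lambda>x. f x * g x)"
proof -
  obtain A B where AB: "\<And>x. x \<in> Off Z \<Longrightarrow> \<bar>f x\<bar> \<le> A" "\<And>x. x \<in> Off Z \<Longrightarrow> \<bar>g x\<bar> \<le> B"
    using assms by (auto simp: BM_iff)
  have "\<bar>f x * g x\<bar> \<le> A * B" if "x \<in> Off Z" for x
    using AB[OF that] unfolding abs_mult by (intro mult_mono) auto
  then show ?thesis using assms by (auto simp: BM_iff intro!: continuous_intros)
qed

lemma BM_minus [intro]: "BM Z f \<Longrightarrow> BM Z (\<lambda>x. - f x)"
  using BM_mult[of Z "\<lambda>x. -1" f] by simp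

lemma BM_diff [intro]: "BM Z f \<Longrightarrow> BM Z g \<Longrightarrow> BM Z (\<lambda>x. f x - g x)"
  using BM_add[of Z f "\<lambda>x. - g x"] by auto

lemma BM_sum [intro]: "(\<And>a. a \<in> I \<Longrightarrow> BM Z (f a)) \<Longrightarrow> BM Z (\<lambda>x. \<Sum>a\<in>I. f a x)"
  by (induction I rule: infinite_finite_induct) auto

lemma BM_power [intro]: "BM Z f \<Longrightarrow> BM Z (\<lambda>x. f x ^ n)"
  by (induction n) auto

lemma BM_continuous: assumes "continuous_on Q f" shows "BM Z f"
proof -
  have "bounded (f ` Q)" by (intro compact_imp_bounded compact_continuous_image assms compact_cbox)
  then show ?thesis unfolding BM_def
    by (intro conjI continuous_on_subset[OF assms O_subset(2)] bounded_subset[OF _ image_mono[OF O_subset(2)]])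
qed

lemma BM_abs [intro]: "BM Z f \<Longrightarrow> BM Z (\<lambda>x. \<bar>f x\<bar>)"
  by (auto simp: BM_iff intro!: continuous_intros)

lemma BM_C1S: "C1 S f \<Longrightarrow> BM Z f" "C1 S f \<Longrightarrow> BM Z (pd i f)"
  by (rule BM_continuous, rule continuous_on_subset[OF _ box_subset_S], erule C1_continuous_on C1_continuous_pd)+

lemma BM_K: "BM Z (\<lambda>x. K x $ a $ b)" by (rule BM_C1S[OF C1_K])
lemma BM_det: "BM Z (\<lambda>x. det (J x))" by (rule BM_C1S[OF C1_det])

lemma PW_BM: "PW Z f \<Longrightarrow> BM Z f" by (simp add: PW_def BM_continuous)
lemma PW_BM_pd: "PW Z f \<Longrightarrow> BM Z (pd i f)" by (simp add: PW_def BM_def C1_continuous_pd)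
lemma PW_continuous: "PW Z f \<Longrightarrow> continuous_on Q f" by (simp add: PW_def)
lemma PW_differentiable: "PW Z f \<Longrightarrow> x \<in> Off Z \<Longrightarrow> f differentiable (at x)" by (simp add: PW_def C1_def)

lemma PW_alt: "PW Z f \<longleftrightarrow> continuous_on Q f \<and> C1 (Off Z) f \<and> (\<forall>i. BM Z (pd i f))"
  by (auto simp: PW_def BM_def C1_continuous_pd)

lemma PW_const [intro, simp]: "PW Z (\<lambda>x. c)"
  by (auto simp: PW_alt intro: BM_cong[OF BM_const])

lemma PW_add [intro]: "PW Z f \<Longrightarrow> PW Z g \<Longrightarrow> PW Z (\<lambda>x. f x + g x)"
  unfolding PW_alt
  by (auto intro!: continuous_intros intro: BM_cong[OF BM_add] simp: pd_add C1_differentiable)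

lemma PW_mult [intro]: "PW Z f \<Longrightarrow> PW Z g \<Longrightarrow> PW Z (\<lambda>x. f x * g x)"
proof -
  assume fg: "PW Z f" "PW Z g"
  have "BM Z (\<lambda>x. pd i f x * g x + f x * pd i g x)" for i
    by (intro BM_add BM_mult PW_BM_pd[OF fg(1)] PW_BM_pd[OF fg(2)] PW_BM[OF fg(1)] PW_BM[OF fg(2)])
  then have "BM Z (pd i (\<lambda>x. f x * g x))" for i
    by (rule BM_cong) (use fg in \<open>auto simp: pd_mult PW_differentiable\<close>)
  then show ?thesis using fg unfolding PW_alt by (auto intro!: continuous_intros)
qed

lemma PW_sum [intro]: "(\<And>a. a \<in> I \<Longrightarrow> PW Z (f a)) \<Longrightarrow> PW Z (\<lambda>x. \<Sum>a\<in>I. f a x)"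
  by (induction I rule: infinite_finite_induct) auto

lemma PW_power [intro]: "PW Z f \<Longrightarrow> PW Z (\<lambda>x. f x ^ n)"
  by (induction n) auto

lemma PW_C1: "C1 T f \<Longrightarrow> Q \<subseteq> T \<Longrightarrow> PW Z f"
  unfolding PW_alt
  by (intro conjI allI BM_continuous continuous_on_subset[OF C1_continuous_on, of T f]
      continuous_on_subset[OF C1_continuous_pd, of T f])
    (auto intro: C1_subset[of T] dest: subsetD[OF O_subset(2)])

lemma PW_C1S [intro]: "C1 S f \<Longrightarrow> PW Z f"
  by (rule PW_C1[OF _ box_subset_S])

lemma PW_cong:
  assumes fin: "\<And>k. finite (Z k)" and f: "PW Z f" and eq: "\<And>x. x \<in> Q \<Longrightarrow> g x = f x"
  shows "PW Z g"
proof -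
  have eq': "\<And>x. x \<in> Off Z \<Longrightarrow> g x = f x" using eq O_subset(2) by blast
  have "pd i g x = pd i f x" if "x \<in> Off Z" for i x
    by (rule pd_cong(1)[OF open_O[OF fin] that eq'])
  then have "BM Z (pd i g)" for i using BM_cong[OF PW_BM_pd[OF f]] by metis
  moreover have "C1 (Off Z) g" using f by (intro C1_cong[OF open_O[OF fin] _ eq']) (auto simp: PW_def)
  moreover have "continuous_on Q g" using f eq by (auto simp: PW_def cong: continuous_on_cong)
  ultimately show ?thesis by (simp add: PW_alt)
qed

text \<open>The partial derivative in direction \<open>a\<close> of the physical domain, as a function of the parametric point.\<close>

definition phd :: "'d \<Rightarrow> (real^'d \<Rightarrow> real) \<Rightarrow> real^'d \<Rightarrow> real" where
  "phd a f x = (\<Sum>i\<in>UNIV. pd i f x * K x $ i $ a)"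

lemma BM_phd [intro]: "PW Z f \<Longrightarrow> BM Z (phd a f)"
  unfolding phd_def by (intro BM_sum BM_mult PW_BM_pd BM_K)

lemma phd_add: "f differentiable (at x) \<Longrightarrow> g differentiable (at x) \<Longrightarrow>
   phd a (\<lambda>x. f x + g x) x = phd a f x + phd a g x"
  by (simp add: phd_def pd_add distrib_right sum.distrib)

lemma phd_mult: "f differentiable (at x) \<Longrightarrow> g differentiable (at x) \<Longrightarrow>
   phd a (\<lambda>x. f x * g x) x = phd a f x * g x + f x * phd a g x"
  by (simp add: phd_def pd_mult distrib_right sum.distrib sum_distrib_left sum_distrib_right mult_ac ring_distribs)

lemma phd_cmult: "f differentiable (at x) \<Longrightarrow> phd a (\<lambda>x. c * f x) x = c * phd a f x"
  using phd_mult[of "\<lambda>x. c" x f a] by (simp add: phd_def)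

lemma phd_sum: "(\<And>b. b \<in> I \<Longrightarrow> f b differentiable (at x)) \<Longrightarrow>
   phd a (\<lambda>x. \<Sum>b\<in>I. f b x) x = (\<Sum>b\<in>I. phd a (f b) x)"
  by (simp add: phd_def pd_sum sum_distrib_right) (rule sum.swap)

lemma phd_F: "x \<in> S \<Longrightarrow> phd a (\<lambda>x. F x $ b) x = (if a = b then 1 else 0)"
  using JK_nth[of x b a] by (simp add: phd_def J_def)

lemma G_has_derivative:
  assumes "x \<in> box lo hi" shows "(G has_derivative (\<lambda>h. K x *v h)) (at (F x))"
proof (rule has_derivative_inverse_strong[OF open_box assms])
  show "continuous_on (box lo hi) F" using continuous_F_Q box_subset_cbox continuous_on_subset by blast
  show "G (F y) = y" if "y \<in> box lo hi" for y using that box_subset_cbox by (intro G_F) blast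
  show "(F has_derivative (\<lambda>h. J x *v h)) (at x)" using assms by (intro F_has_derivative box_in_S)
  show "(\<lambda>h. J x *v h) \<circ> (\<lambda>h. K x *v h) = id"
    using JK[OF box_in_S(1)[OF assms]] by (auto simp: matrix_vector_mul_assoc)
qed

lemma physical_derivative:
  fixes w :: "real^'d \<Rightarrow> real"
  assumes x: "x \<in> box lo hi" and f: "f differentiable (at x)"
    and N: "open N" "x \<in> N" "\<And>y. y \<in> N \<Longrightarrow> y \<in> box lo hi \<Longrightarrow> w (F y) = f y"
  shows "w differentiable (at (F x))" and "pd a w (F x) = phd a f x"
proof -
  have GF: "G (F x) = x" using x box_subset_cbox by (intro G_F) blast
  have D: "(f has_derivative (\<lambda>h. \<Sum>i\<in>UNIV. h $ i * pd i f x)) (at (G (F x)))"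
    unfolding GF by (rule has_derivative_pd[OF f])
  have 1: "((f \<circ> G) has_derivative (\<lambda>h. \<Sum>i\<in>UNIV. h $ i * pd i f x) \<circ> (\<lambda>h. K x *v h)) (at (F x))"
    by (rule diff_chain_at[OF G_has_derivative[OF x] D])
  let ?N = "F ` (box lo hi \<inter> N)"
  have "open ?N"
    using continuous_F_Q inj_F box_subset_cbox N(1)
    by (intro invariance_of_domain) (auto intro: continuous_on_subset inj_on_subset)
  moreover have "F x \<in> ?N" using x N by blast
  moreover have "(f \<circ> G) y = w y" if yN: "y \<in> ?N" for y
  proof -
    obtain z where z: "y = F z" "z \<in> box lo hi" "z \<in> N" using yN by auto
    have "G (F z) = z" using z box_subset_cbox by (intro G_F) blast
    then show ?thesis using z N(3) by simp
  qed
  ultimately have 2: "(w has_derivative (\<lambda>h. \<Sum>i\<in>UNIV. h $ i * pd i f x) \<circ> (\<lambda>h. K x *v h)) (at (F x))"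
    using has_derivative_transform_within_open[OF 1] by blast
  then show "w differentiable (at (F x))" by (auto simp: differentiable_def)
  have "(K x *v axis a 1) $ i = K x $ i $ a" for i by (simp add: matrix_vector_mult_basis column_def)
  then show "pd a w (F x) = phd a f x" using pd_eqI[OF 2] by (simp add: phd_def mult.commute)
qed

end

section \<open>Volume integrals and integration along coordinate lines\<close>

lemma DERIV_face_point:
  assumes "f differentiable (at (face_point i t y :: real^'d))"
  shows "DERIV (\<lambda>t. f (face_point i t y)) t :> pd i f (face_point i t y)"
proof -
  have e: "face_point i t y = face_point i 0 y + t *\<^sub>R axis i 1" for t
    by (auto simp: vec_eq_iff axis_def)
  show ?thesis using DERIV_coordinate_line[of f "face_point i 0 y" t i] assms unfolding e[symmetric] .
qed

lemma continuous_face_point: "continuous_on A (\<lambda>t. face_point i t y :: real^'d)"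
  unfolding face_point_def
proof (rule continuous_on_vec_lambda)
  show "continuous_on A (\<lambda>t. if k = i then t else y k)" for k by (cases "k = i") simp_all
qed

context curved_box
begin

text \<open>The integral over the physical domain, pulled back to the box.\<close>

definition vint :: "('d \<Rightarrow> real set) \<Rightarrow> (real^'d \<Rightarrow> real) \<Rightarrow> real" where
  "vint Z f = (LBINT x. indicator (Off Z) x * (\<bar>det (J x)\<bar> * f x))"

lemma integrable_BM:
  assumes fin: "\<And>k. finite (Z k)" and f: "BM Z f"
  shows "integrable lborel (\<lambda>x. indicator (Off Z) x * f x)"
proof -
  obtain B where B: "\<And>x. x \<in> Off Z \<Longrightarrow> \<bar>f x\<bar> \<le> B" using f by (auto simp: BM_iff)
  have O: "Off Z \<in> sets borel" using open_O[OF fin] by auto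
  have "(\<lambda>x. indicator (Off Z) x *\<^sub>R f x) \<in> borel_measurable borel"
    using f O by (intro borel_measurable_continuous_on_indicator) (auto simp: BM_def)
  then have "integrable lborel (\<lambda>x. indicator (Off Z) x *\<^sub>R (indicator (Off Z) x *\<^sub>R f x))"
  proof (intro integrableI_bounded_set_indicator[where B=B])
    have "emeasure lborel (Off Z) \<le> emeasure lborel (box lo hi)"
      by (intro emeasure_mono O_subset) auto
    also have "\<dots> < \<infinity>" by (rule emeasure_lborel_box_finite)
    finally show "emeasure lborel (Off Z) < \<infinity>" .
  qed (use O B in auto)
  moreover have "indicator (Off Z) x *\<^sub>R (indicator (Off Z) x *\<^sub>R f x) = indicator (Off Z) x * f x" for x
    by (auto simp: indicator_def)
  ultimately show ?thesis by (simp only:)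
qed

lemma BM_abs_det: "BM Z (\<lambda>x. \<bar>det (J x)\<bar>)" by (intro BM_abs BM_det)

lemma integrable_vint:
  assumes "\<And>k. finite (Z k)" and "BM Z f"
  shows "integrable lborel (\<lambda>x. indicator (Off Z) x * (\<bar>det (J x)\<bar> * f x))"
  by (rule integrable_BM[OF assms(1) BM_mult[OF BM_abs_det assms(2)]])

lemma vint_add:
  assumes "\<And>k. finite (Z k)" "BM Z f" "BM Z g"
  shows "vint Z (\<lambda>x. f x + g x) = vint Z f + vint Z g"
  unfolding vint_def distrib_left
  by (intro Bochner_Integration.integral_add integrable_vint assms)

lemma vint_cmult: "vint Z (\<lambda>x. c * f x) = c * vint Z f"
proof -
  have "indicator (Off Z) x * (\<bar>det (J x)\<bar> * (c * f x)) = c * (indicator (Off Z) x * (\<bar>det (J x)\<bar> * f x))" for x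
    by simp
  then show ?thesis by (simp only: vint_def integral_mult_right_zero)
qed

lemma vint_mono:
  assumes "\<And>k. finite (Z k)" "BM Z f" "BM Z g" "\<And>x. x \<in> Off Z \<Longrightarrow> f x \<le> g x"
  shows "vint Z f \<le> vint Z g"
  unfolding vint_def using assms(4)
  by (intro integral_mono integrable_vint assms) (auto simp: indicator_def intro: mult_left_mono)

lemma vint_cong: "(\<And>x. x \<in> Off Z \<Longrightarrow> f x = g x) \<Longrightarrow> vint Z f = vint Z g"
  unfolding vint_def by (intro Bochner_Integration.integral_cong) (auto simp: indicator_def)

lemma vint_nonneg: "(\<And>x. x \<in> Off Z \<Longrightarrow> 0 \<le> f x) \<Longrightarrow> 0 \<le> vint Z f"
  unfolding vint_def by (intro integral_nonneg_AE) (auto simp: indicator_def)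

lemma
  fixes f :: "real^'d \<Rightarrow> real"
  assumes fin: "\<And>k. finite (Z k)" and fh: "BM Z fh" and eq: "\<And>x. x \<in> Off Z \<Longrightarrow> f (F x) = fh x"
  shows integrable_Omega: "integrable (lebesgue_on \<Omega>) f"
    and integral_Omega: "(LINT x|lebesgue_on \<Omega>. f x) = vint Z fh"
proof -
  let ?h = "\<lambda>x. \<bar>det (J x)\<bar> * f (F x)"
  have ind: "indicator (Off Z) x *\<^sub>R ?h x = indicator (Off Z) x * (\<bar>det (J x)\<bar> * fh x)" for x
    by (auto simp: indicator_def eq)
  have O: "Off Z \<in> sets lebesgue" using open_O[OF fin] by auto
  have int: "?h absolutely_integrable_on Off Z"
    unfolding set_integrable_def ind
    using integrable_vint[OF fin fh] by (subst integrable_completion) auto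
  have I: "integral (Off Z) ?h = vint Z fh"
  proof -
    have "integral (Off Z) ?h = (LINT x:Off Z|lebesgue. ?h x)"
      using set_lebesgue_integral_eq_integral(2)[OF int] by simp
    also have "\<dots> = vint Z fh"
      unfolding set_lebesgue_integral_def ind vint_def
      using integrable_vint[OF fin fh] by (subst integral_completion) auto
    finally show ?thesis .
  qed
  have det: "det (matrix (\<lambda>h. J x *v h)) = det (J x)" for x by simp
  have der: "(F has_derivative (\<lambda>h. J x *v h)) (at x within Off Z)" if "x \<in> Off Z" for x
    by (rule has_derivative_at_withinI[OF F_has_derivative[OF subsetD[OF O_subset(3) that]]])
  have inj: "inj_on F (Off Z)" by (rule inj_on_subset[OF inj_F O_subset(2)])
  note cov = change_of_variables_vec[OF card O der inj, of f, unfolded det, OF _ int]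
  have cov: "f absolutely_integrable_on (F ` Off Z)" "integral (F ` Off Z) f = vint Z fh"
    using cov I by auto
  have neg: "negligible (F ` (Q - Off Z))"
  proof (rule negligible_differentiable_image_negligible[OF order_refl negligible_skeleton[OF fin]])
    show "F differentiable_on Q - Off Z"
      unfolding differentiable_on_def differentiable_def
      using has_derivative_at_withinI[OF F_has_derivative[OF box_in_S(2)]] by blast
  qed
  have n1: "negligible {x \<in> F ` Off Z - \<Omega>. f x \<noteq> 0}"
    using O_subset(1) by (auto simp: phys_domain_def intro!: negligible_subset[OF negligible_empty])
  have n2: "negligible {x \<in> \<Omega> - F ` Off Z. f x \<noteq> 0}"
    by (rule negligible_subset[OF neg]) (use subsetD[OF box_subset_cbox, of _ lo hi] in \<open>auto simp: phys_domain_def intro!: imageI\<close>)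
  have "f absolutely_integrable_on \<Omega>"
    using absolutely_integrable_spike_set_eq[OF n1 n2] cov(1) by simp
  then show int': "integrable (lebesgue_on \<Omega>) f"
    using open_Omega by (subst integrable_restrict_space) (auto simp: set_integrable_def)
  have "(LINT x|lebesgue_on \<Omega>. f x) = integral \<Omega> f"
    by (rule lebesgue_integral_eq_integral[OF int']) (use open_Omega in auto)
  also have "\<dots> = integral (F ` Off Z) f"
    by (rule integral_spike_set[OF n2 n1])
  finally show "(LINT x|lebesgue_on \<Omega>. f x) = vint Z fh" using cov(2) by simp
qed

definition face :: "'d \<Rightarrow> ('d \<Rightarrow> real) set" where
  "face i = (\<Pi>\<^sub>E k\<in>-{i}. {lo $ k .. hi $ k})"

abbreviation (input) "end_coord i s \<equiv> (if s then hi $ i else lo $ i)"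

lemma face_sets [measurable]: "face i \<in> sets (slice_measure i)"
  unfolding face_def by (rule sets_PiM_I_finite) auto

lemma emeasure_face_finite: "emeasure (slice_measure i) (face i) < \<infinity>"
proof -
  interpret product_sigma_finite "\<lambda>_::'d. lborel :: real measure" ..
  have "emeasure (slice_measure i) (face i) = (\<Prod>k\<in>-{i}. emeasure lborel {lo $ k .. hi $ k})"
    unfolding face_def by (rule emeasure_PiM) auto
  also have "\<dots> < \<infinity>"
    using less_imp_le[OF lo_less_hi] by (simp add: prod_ennreal)
  finally show ?thesis .
qed

lemma face_point_Q: "y \<in> face i \<Longrightarrow> lo $ i \<le> t \<Longrightarrow> t \<le> hi $ i \<Longrightarrow> face_point i t y \<in> Q"
  by (auto simp: face_def mem_box_cart PiE_iff)

lemma face_point_end_Q: "y \<in> face i \<Longrightarrow> face_point i (end_coord i s) y \<in> Q"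
  using less_imp_le[OF lo_less_hi[of i]] by (intro face_point_Q) auto

lemma integrable_face:
  fixes g :: "real^'d \<Rightarrow> real"
  assumes meas: "(\<lambda>x. indicator Q x * g x) \<in> borel_measurable borel" and bd: "\<And>x. x \<in> Q \<Longrightarrow> \<bar>g x\<bar> \<le> B"
  shows "integrable (slice_measure i) (\<lambda>y. indicator (face i) y * g (face_point i (end_coord i s) y))"
proof -
  let ?g = "\<lambda>y. (\<lambda>x. indicator Q x * g x) (face_point i (end_coord i s) y)"
  have "integrable (slice_measure i) (\<lambda>y. indicator (face i) y *\<^sub>R ?g y)"
  proof (intro integrableI_bounded_set_indicator[where B=B] AE_I2 impI)
    show "?g \<in> borel_measurable (slice_measure i)"
      by (rule measurable_compose[OF measurable_face_point meas])
    show "norm (?g y) \<le> B" if "y \<in> face i" for y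
      using bd[OF face_point_end_Q[OF that, of s]] face_point_end_Q[OF that, of s] by simp
  qed (use emeasure_face_finite in auto)
  moreover have "indicator (face i) y *\<^sub>R ?g y = indicator (face i) y * g (face_point i (end_coord i s) y)" for y
    using face_point_end_Q[of y i s] by (auto simp: indicator_def)
  ultimately show ?thesis by (simp only:)
qed

lemma integrable_face_continuous:
  fixes g :: "real^'d \<Rightarrow> real"
  assumes "continuous_on Q g"
  shows "integrable (slice_measure i) (\<lambda>y. indicator (face i) y * g (face_point i (end_coord i s) y))"
proof -
  have "bounded (g ` Q)" by (intro compact_imp_bounded compact_continuous_image assms compact_cbox)
  then obtain B where "\<And>x. x \<in> Q \<Longrightarrow> \<bar>g x\<bar> \<le> B" by (auto simp: bounded_iff)
  moreover have "(\<lambda>x. indicator Q x * g x) \<in> borel_measurable borel"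
    using borel_measurable_continuous_on_indicator[OF _ assms] by simp
  ultimately show ?thesis by (rule integrable_face[rotated])
qed

text \<open>Along almost every line in direction \<open>i\<close> the function is continuous and differentiable off finitely many
  points, so the fundamental theorem of calculus applies there and Fubini does the rest.\<close>

lemma integral_pd:
  assumes fin: "\<And>k. finite (Z k)" and g: "PW Z g"
  shows "(LBINT x. indicator (Off Z) x * pd i g x) =
    (\<integral>y. indicator (face i) y * g (face_point i (hi $ i) y) \<partial>slice_measure i) -
    (\<integral>y. indicator (face i) y * g (face_point i (lo $ i) y) \<partial>slice_measure i)"
proof -
  let ?h = "\<lambda>x. indicator (Off Z) x * pd i g x"
  have int: "integrable lborel ?h" by (rule integrable_BM[OF fin PW_BM_pd[OF g]])
  obtain B where B: "\<And>x. x \<in> Off Z \<Longrightarrow> \<bar>pd i g x\<bar> \<le> B"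
    using PW_BM_pd[OF g, of i] by (auto simp: BM_iff)
  note int_face = integrable_face_continuous[OF PW_continuous[OF g], of i]
  have "(LBINT x. ?h x) = (\<integral>y. \<integral>t. ?h (face_point i t y) \<partial>lborel \<partial>slice_measure i)"
    by (rule integral_slices(1)[OF int])
  also have "\<dots> = (\<integral>y. indicator (face i) y * g (face_point i (hi $ i) y)
      - indicator (face i) y * g (face_point i (lo $ i) y) \<partial>slice_measure i)"
  proof (rule integral_cong_AE)
    show "(\<lambda>y. \<integral>t. ?h (face_point i t y) \<partial>lborel) \<in> borel_measurable (slice_measure i)"
      using integral_slices(2)[OF int] by (rule borel_measurable_integrable)
    show "(\<lambda>y. indicator (face i) y * g (face_point i (hi $ i) y)
        - indicator (face i) y * g (face_point i (lo $ i) y)) \<in> borel_measurable (slice_measure i)"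
      using borel_measurable_integrable[OF int_face[of True]] borel_measurable_integrable[OF int_face[of False]]
      by simp
    have "AE y in slice_measure i. \<forall>k. k \<noteq> i \<longrightarrow> y k \<notin> insert (lo $ k) (insert (hi $ k) (Z k))"
      by (rule AE_slice_coordinates) (simp add: fin)
    then have "AE y in slice_measure i. y \<in> space (slice_measure i) \<and> (\<forall>k. k \<noteq> i \<longrightarrow> y k \<notin> insert (lo $ k) (insert (hi $ k) (Z k)))"
      by (simp add: AE_conj_iff AE_space)
    then show "AE y in slice_measure i. (\<integral>t. ?h (face_point i t y) \<partial>lborel) =
      indicator (face i) y * g (face_point i (hi $ i) y) - indicator (face i) y * g (face_point i (lo $ i) y)"
    proof eventually_elim
      fix y assume y: "y \<in> space (slice_measure i) \<and> (\<forall>k. k \<noteq> i \<longrightarrow> y k \<notin> insert (lo $ k) (insert (hi $ k) (Z k)))"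
      show "(\<integral>t. ?h (face_point i t y) \<partial>lborel) =
        indicator (face i) y * g (face_point i (hi $ i) y) - indicator (face i) y * g (face_point i (lo $ i) y)"
      proof (cases "y \<in> face i")
        case False
        then obtain k where k: "k \<noteq> i" "y k \<notin> {lo $ k .. hi $ k}"
          using y by (auto simp: face_def space_PiM PiE_iff)
        have "face_point i t y \<notin> Off Z" for t
        proof
          assume "face_point i t y \<in> Off Z"
          then have "face_point i t y \<in> Q" using O_subset(2) by blast
          then have "face_point i t y $ k \<in> {lo $ k .. hi $ k}" unfolding mem_box_cart atLeastAtMost_iff by blast
          with k show False by simp
        qed
        then show ?thesis using False by simp
      next
        case True
        have O_iff: "face_point i t y \<in> Off Z \<longleftrightarrow> t \<in> {lo $ i <..< hi $ i} - Z i" for t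
        proof -
          have k: "lo $ k < y k \<and> y k < hi $ k \<and> y k \<notin> Z k" if "k \<noteq> i" for k
            using True y that by (force simp: face_def PiE_iff less_le)
          show ?thesis
            unfolding off_skeleton_def mem_box_cart mem_Collect_eq face_point_nth
            using k by (auto split: if_splits dest: spec[of _ i])
        qed
        have "((\<lambda>t. pd i g (face_point i t y)) has_integral g (face_point i (hi $ i) y) - g (face_point i (lo $ i) y))
            {lo $ i .. hi $ i}"
        proof (rule fundamental_theorem_of_calculus_interior_strong[OF fin[of i] less_imp_le[OF lo_less_hi]])
          fix t assume "t \<in> {lo $ i <..< hi $ i} - Z i"
          then have "face_point i t y \<in> Off Z" by (simp add: O_iff)
          from DERIV_face_point[OF PW_differentiable[OF g this]]
          show "((\<lambda>t. g (face_point i t y)) has_vector_derivative pd i g (face_point i t y)) (at t)"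
            by (simp add: has_real_derivative_iff_has_vector_derivative)
        next
          show "continuous_on {lo $ i .. hi $ i} (\<lambda>t. g (face_point i t y))"
            by (rule continuous_on_compose2[OF PW_continuous[OF g] continuous_face_point])
               (auto intro: face_point_Q[OF True])
        qed
        then have "((\<lambda>t. ?h (face_point i t y)) has_integral g (face_point i (hi $ i) y) - g (face_point i (lo $ i) y))
            {lo $ i .. hi $ i}"
          by (rule has_integral_spike_finite[of "insert (lo $ i) (insert (hi $ i) (Z i))", rotated 2])
            (auto simp: fin O_iff)
        then have hi: "((\<lambda>t. ?h (face_point i t y)) has_integral g (face_point i (hi $ i) y) - g (face_point i (lo $ i) y)) UNIV"
          by (rule has_integral_on_superset) (auto simp: O_iff)
        have "integrable lborel (\<lambda>t. indicator {lo $ i .. hi $ i} t *\<^sub>R ?h (face_point i t y))"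
        proof (rule integrableI_bounded_set_indicator[where B="\<bar>B\<bar>"])
          have "(\<lambda>t. face_point i t y) \<in> borel \<rightarrow>\<^sub>M (borel :: (real^'d) measure)"
            by (intro borel_measurable_continuous_onI continuous_face_point)
          from measurable_compose[OF this borel_measurable_integrable[OF int, simplified]]
          show "(\<lambda>t. ?h (face_point i t y)) \<in> borel_measurable lborel" by simp
          show "AE t in lborel. t \<in> {lo $ i .. hi $ i} \<longrightarrow> norm (?h (face_point i t y)) \<le> \<bar>B\<bar>"
            using B by (auto simp: indicator_def intro: order_trans[OF _ abs_ge_self])
        qed (auto simp: emeasure_lborel_Icc_eq)
        moreover have "indicator {lo $ i .. hi $ i} t *\<^sub>R ?h (face_point i t y) = ?h (face_point i t y)" for t
          by (auto simp: indicator_def O_iff)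
        ultimately have "integrable lborel (\<lambda>t. ?h (face_point i t y))" by (simp only:)
        from has_integral_integral_lborel[OF this] hi have "(\<integral>t. ?h (face_point i t y) \<partial>lborel) = g (face_point i (hi $ i) y) - g (face_point i (lo $ i) y)"
          by (rule has_integral_unique)
        then show ?thesis using True by simp
      qed
    qed
  qed
  also have "\<dots> = (\<integral>y. indicator (face i) y * g (face_point i (hi $ i) y) \<partial>slice_measure i) -
    (\<integral>y. indicator (face i) y * g (face_point i (lo $ i) y) \<partial>slice_measure i)"
    using int_face[of True] int_face[of False] by (intro Bochner_Integration.integral_diff) auto
  finally show ?thesis .
qed

end

section \<open>Surface integrals and the divergence theorem\<close>

lemma det_bordered_eq:
  fixes B :: "real^'n^'n"
  shows "det (\<chi> k l. if k = i \<or> l = i then (if k = l then 1 else 0) else B $ k $ l)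
       = det (\<chi> k l. if l = i then (if k = i then 1 else 0) else B $ k $ l)" (is "det ?M = det ?N")
  unfolding det_def
proof (intro sum.cong refl)
  fix p :: "'n \<Rightarrow> 'n" assume "p \<in> {p. p permutes UNIV}"
  then have bij: "bij p" by (simp add: permutes_bij)
  have "(\<Prod>k\<in>UNIV. ?M $ k $ p k) = (\<Prod>k\<in>UNIV. ?N $ k $ p k)"
  proof (cases "p i = i")
    case True
    then have "p k = i \<longleftrightarrow> k = i" for k using bij by (metis bij_pointE)
    then show ?thesis by (intro prod.cong) (auto simp: True)
  next
    case False
    obtain k where k: "p k = i" using bij by (metis bij_pointE)
    with False have "k \<noteq> i" by auto
    then have "?M $ k $ p k = 0" "?N $ k $ p k = 0" using k by auto
    then show ?thesis by (metis (no_types, lifting) UNIV_I finite prod_zero)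
  qed
  then show "of_int (sign p) * (\<Prod>k\<in>UNIV. ?M $ k $ p k) = of_int (sign p) * (\<Prod>k\<in>UNIV. ?N $ k $ p k)"
    by simp
qed

text \<open>The square root of the Gram determinant of the tangent vectors of a face is \<open>|det A|\<close> times the length of the
  \<open>i\<close>-th row of the inverse: by Cramer's rule it is, up to the determinant of the full Gram matrix, the \<open>i\<close>-th diagonal entry of the
  inverse Gram matrix \<open>K K\<^sup>T\<close>.\<close>

lemma gram_minor:
  fixes A K :: "real^'n^'n"
  assumes AK: "A ** K = mat 1" and KA: "K ** A = mat 1"
  shows "det (\<chi> k l. if k = i \<or> l = i then (if k = l then 1 else 0) else column k A \<bullet> column l A)
    = (det A)\<^sup>2 * (norm (row i K))\<^sup>2"
proof -
  define B where "B = transpose A ** A"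
  define x where "x = K *v (transpose K *v axis i 1)"
  have Bnth: "B $ k $ l = column k A \<bullet> column l A" for k l
    by (simp add: B_def matrix_matrix_mult_def transpose_def column_def inner_vec_def)
  have Bx: "B *v x = axis i 1"
  proof -
    have "B *v x = transpose A *v ((A ** K) *v (transpose K *v axis i 1))"
      by (simp add: B_def x_def matrix_vector_mul_assoc matrix_mul_assoc)
    also have "\<dots> = transpose (K ** A) *v axis i 1"
      by (simp only: AK matrix_vector_mul_lid matrix_vector_mul_assoc matrix_transpose_mul matrix_mul_lid)
    finally show ?thesis by (simp add: KA transpose_mat)
  qed
  have x: "x $ i = (norm (row i K))\<^sup>2"
    by (simp add: x_def matrix_vector_mult_def transpose_def row_def power2_norm_eq_inner inner_vec_def axis_def
        if_distrib[of "\<lambda>x. _ * x"] cong: if_cong)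
  have "det (\<chi> k l. if l = i then (if k = i then 1 else 0) else B $ k $ l) = det (\<chi> k l. if l = i then (B *v x) $ k else B $ k $ l)"
    unfolding Bx by (rule arg_cong[where f=det]) (simp add: vec_eq_iff axis_def)
  also have "\<dots> = x $ i * det B" by (rule cramer_lemma)
  also have "det B = (det A)\<^sup>2" by (simp add: B_def det_mul det_transpose power2_eq_square)
  finally have "det (\<chi> k l. if k = i \<or> l = i then (if k = l then 1 else 0) else B $ k $ l) = (det A)\<^sup>2 * (norm (row i K))\<^sup>2"
    unfolding det_bordered_eq[of i B] by (simp add: x mult.commute)
  then show ?thesis unfolding Bnth .
qed

context curved_box
begin

text \<open>By the Gram determinant formula above, the surface density of the faces orthogonal to direction \<open>i\<close>.\<close>

definition dens :: "'d \<Rightarrow> real^'d \<Rightarrow> real" where "dens i x = \<bar>det (J x)\<bar> * norm (row i (K x))"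

definition nrm :: "'d \<Rightarrow> bool \<Rightarrow> real^'d \<Rightarrow> real^'d" where
  "nrm i s x = (if s then 1 else -1) *\<^sub>R sgn (row i (K x))"

text \<open>The surface integral over the image of a face, pulled back to the face.\<close>

definition fint :: "'d \<Rightarrow> bool \<Rightarrow> (real^'d \<Rightarrow> real) \<Rightarrow> real" where
  "fint i s g = (\<integral>y. indicator (face i) y *
     (dens i (face_point i (end_coord i s) y) * g (face_point i (end_coord i s) y)) \<partial>slice_measure i)"

lemma surface_density_eq: "x \<in> S \<Longrightarrow> surface_density F i x = dens i x"
  unfolding surface_density_def jacobian_F gram_minor[OF JK KJ] dens_def
  by (simp add: real_sqrt_mult)

lemma dens_nonneg: "0 \<le> dens i x" by (simp add: dens_def)

lemma continuous_row_K: "continuous_on Q (\<lambda>x. row i (K x))"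
proof -
  have "continuous_on Q (\<lambda>x. \<chi> b. K x $ i $ b)"
    by (rule continuous_on_vec_lambda) (rule continuous_on_subset[OF C1_continuous_on[OF C1_K] box_subset_S])
  then show ?thesis by (simp add: row_def)
qed

lemma continuous_det_J: "continuous_on Q (\<lambda>x. det (J x))"
  by (rule continuous_on_subset[OF C1_continuous_on[OF C1_det] box_subset_S])

lemma continuous_dens: "continuous_on Q (dens i)"
  unfolding dens_def by (intro continuous_intros continuous_row_K continuous_det_J)

lemma row_K_nz: "x \<in> S \<Longrightarrow> row i (K x) \<noteq> 0"
proof
  assume x: "x \<in> S" and "row i (K x) = 0"
  then have "K x $ i $ b = 0" for b by (simp add: row_def vec_eq_iff)
  then show False using KJ_nth[OF x, of i i] by simp
qed

lemma norm_nrm: "x \<in> S \<Longrightarrow> norm (nrm i s x) = 1"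
  by (simp add: nrm_def norm_sgn row_K_nz)

lemma continuous_nrm: "continuous_on Q (\<lambda>x. nrm i s x $ c)"
proof -
  have "continuous_on Q (\<lambda>x. sgn (row i (K x)))"
    unfolding sgn_div_norm using row_K_nz box_in_S(2)
    by (intro continuous_intros continuous_row_K) auto
  then show ?thesis unfolding nrm_def
    by (intro bounded_linear.continuous_on[OF bounded_linear_vec_nth] continuous_on_scaleR continuous_on_const)
qed

lemma unit_normal_F: "x \<in> Q \<Longrightarrow> unit_normal F lo hi i s (F x) = nrm i s x"
  using G_F[of x] by (simp add: unit_normal_def nrm_def K_def jacobian_F box_in_S G_def)

lemma
  fixes f gh :: "real^'d \<Rightarrow> real"
  assumes fin: "\<And>k. finite (Z k)" and meas: "(\<lambda>x. indicator Q x * gh x) \<in> borel_measurable borel"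
    and bd: "\<And>x. x \<in> Q \<Longrightarrow> \<bar>gh x\<bar> \<le> B"
    and eq: "\<And>y. y \<in> face i \<Longrightarrow> (\<And>k. k \<noteq> i \<Longrightarrow> y k \<notin> Z k) \<Longrightarrow>
       f (F (face_point i (end_coord i s) y)) = gh (face_point i (end_coord i s) y)"
  shows integrable_face_measure: "integrable (face_measure F lo hi i s) f"
    and integral_face_measure: "(LINT x|face_measure F lo hi i s. f x) = fint i s gh"
proof -
  let ?c = "end_coord i s"
  let ?P = "\<lambda>y. F (face_point i ?c y)"
  define R where "R = restrict_space (slice_measure i) (face i)"
  define D where "D = density R (\<lambda>y. ennreal (dens i (face_point i ?c y)))"
  define M where "M = distr D borel ?P"
  have inQ: "face_point i ?c y \<in> Q" if "y \<in> face i" for y by (rule face_point_end_Q[OF that])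
  have spR: "space R = face i" using sets.sets_into_space[OF face_sets] by (auto simp: R_def space_restrict_space)
  have FM: "face_measure F lo hi i s = completion M"
  proof -
    have "density R (\<lambda>y. ennreal (surface_density F i (face_point i ?c y))) = D"
      unfolding D_def
    proof (rule density_cong)
      have ds: "surface_density F i (face_point i ?c y) = dens i (face_point i ?c y)" if "y \<in> space R" for y
        using inQ that spR box_in_S(2) surface_density_eq by auto
      have m: "(\<lambda>y. dens i (face_point i ?c y)) \<in> borel_measurable R"
      proof -
        have "(\<lambda>x. indicator Q x *\<^sub>R dens i x) \<in> borel_measurable borel"
          by (rule borel_measurable_continuous_on_indicator[OF _ continuous_dens]) simp
        then have "(\<lambda>y. indicator Q (face_point i ?c y) *\<^sub>R dens i (face_point i ?c y)) \<in> borel_measurable (slice_measure i)"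
          by (rule measurable_compose[OF measurable_face_point])
        then have "(\<lambda>y. indicator Q (face_point i ?c y) *\<^sub>R dens i (face_point i ?c y)) \<in> borel_measurable R"
          unfolding R_def by (rule measurable_restrict_space1)
        then show ?thesis by (rule measurable_cong[THEN iffD1, rotated]) (use inQ spR in auto)
      qed
      then show "(\<lambda>y. ennreal (dens i (face_point i ?c y))) \<in> borel_measurable R" by simp
      show "(\<lambda>y. ennreal (surface_density F i (face_point i ?c y))) \<in> borel_measurable R"
        using m by (subst measurable_cong[where g="\<lambda>y. ennreal (dens i (face_point i ?c y))"]) (auto simp: ds)
      show "AE y in R. ennreal (surface_density F i (face_point i ?c y)) = ennreal (dens i (face_point i ?c y))"
        using ds by (intro AE_I2) simp
    qed
    then show ?thesis
      unfolding face_measure_def Let_def M_def R_def face_def by simp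
  qed
  have mF: "(\<lambda>x. indicator Q x *\<^sub>R F x) \<in> borel_measurable borel"
    by (rule borel_measurable_continuous_on_indicator[OF _ continuous_F_Q]) simp
  have mP: "?P \<in> R \<rightarrow>\<^sub>M borel"
  proof -
    have "(\<lambda>y. indicator Q (face_point i ?c y) *\<^sub>R F (face_point i ?c y)) \<in> borel_measurable (slice_measure i)"
      by (rule measurable_compose[OF measurable_face_point mF])
    then have "(\<lambda>y. indicator Q (face_point i ?c y) *\<^sub>R F (face_point i ?c y)) \<in> borel_measurable R"
      unfolding R_def by (rule measurable_restrict_space1)
    then show ?thesis by (rule measurable_cong[THEN iffD1, rotated]) (use inQ spR in auto)
  qed
  then have mP': "?P \<in> D \<rightarrow>\<^sub>M borel" by (simp add: D_def cong: measurable_cong_sets)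
  have mdens: "(\<lambda>y. dens i (face_point i ?c y)) \<in> borel_measurable R"
  proof -
    have "(\<lambda>x. indicator Q x *\<^sub>R dens i x) \<in> borel_measurable borel"
      by (rule borel_measurable_continuous_on_indicator[OF _ continuous_dens]) simp
    then have "(\<lambda>y. indicator Q (face_point i ?c y) *\<^sub>R dens i (face_point i ?c y)) \<in> borel_measurable R"
      unfolding R_def by (intro measurable_restrict_space1) (rule measurable_compose[OF measurable_face_point])
    then show ?thesis by (rule measurable_cong[THEN iffD1, rotated]) (use inQ spR in auto)
  qed
  \<comment> \<open>a Borel representative of \<open>f\<close>\<close>
  define G' where "G' x = indicator (F ` Q) x *\<^sub>R G x" for x
  define h where "h x = indicator (F ` Q) x * (indicator Q (G' x) * gh (G' x))" for x
  have FQ: "F ` Q \<in> sets borel" using compact_FQ by (simp add: compact_imp_closed)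
  have mG: "G' \<in> borel_measurable borel"
    unfolding G'_def by (rule borel_measurable_continuous_on_indicator[OF FQ continuous_G])
  have mh: "h \<in> borel_measurable borel"
    unfolding h_def using FQ by (intro borel_measurable_times[OF _ measurable_compose[OF mG meas]]) auto
  have hP: "h (?P y) = gh (face_point i ?c y)" if "y \<in> face i" for y
    using inQ[OF that] by (simp add: h_def G'_def)
  define A where "A = {x \<in> F ` Q. G' x $ i = ?c \<and> (\<forall>k. k \<noteq> i \<longrightarrow> G' x $ k \<notin> Z k)}"
  have A: "A \<in> sets borel"
  proof -
    have mk: "(\<lambda>x. G' x $ k) \<in> borel_measurable borel" for k
      by (rule measurable_compose[OF mG borel_measurable_continuous_onI])
        (intro bounded_linear.continuous_on[OF bounded_linear_vec_nth] continuous_on_id)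
    have "{x. G' x $ i = ?c} \<in> sets borel" using measurable_sets[OF mk, of "{?c}" i] by (simp add: vimage_def)
    moreover have "{x. G' x $ k \<in> - Z k} \<in> sets borel" for k
      using measurable_sets[OF mk, of "- Z k" k] fin[of k] by (simp add: vimage_def finite_imp_closed open_Compl borel_open)
    moreover have "A = F ` Q \<inter> {x. G' x $ i = ?c} \<inter> (\<Inter>k\<in>UNIV. if k = i then UNIV else {x. G' x $ k \<in> - Z k})"
      by (auto simp: A_def split: if_splits)
    ultimately show ?thesis using FQ by (auto intro!: sets.Int sets.finite_INT)
  qed
  have fh: "f x = h x" if xA: "x \<in> A" for x
  proof -
    obtain z where z: "z \<in> Q" "x = F z" using xA by (auto simp: A_def)
    then have Gx: "G' x = z" by (simp add: G'_def)
    define y where "y = restrict (\<lambda>k. z $ k) (-{i})"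
    have y: "y \<in> face i" using z(1) by (auto simp: y_def face_def mem_box_cart)
    have fp: "face_point i ?c y = z" using xA Gx by (auto simp: vec_eq_iff y_def A_def)
    have "f (?P y) = gh (face_point i ?c y)"
      by (rule eq[OF y]) (use xA Gx in \<open>auto simp: A_def y_def\<close>)
    then show ?thesis using hP[OF y] fp z by simp
  qed
  have "AE x in M. x \<in> A"
  proof -
    have "AE y in slice_measure i. \<forall>k. k \<noteq> i \<longrightarrow> y k \<notin> Z k"
      by (rule AE_slice_coordinates[OF fin])
    then have "AE y in slice_measure i. y \<in> face i \<longrightarrow> ?P y \<in> A"
    proof eventually_elim
      case (elim y)
      show ?case
      proof
        assume y: "y \<in> face i"
        then have "G' (?P y) = face_point i ?c y" using inQ by (simp add: G'_def)
        then show "?P y \<in> A" using inQ[OF y] elim by (auto simp: A_def)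
      qed
    qed
    then have "AE y in R. ?P y \<in> A" unfolding R_def by (subst AE_restrict_space_iff) auto
    then have "AE y in D. ?P y \<in> A" unfolding D_def using mdens by (subst AE_density) auto
    then show ?thesis unfolding M_def using A by (subst AE_distr_iff[OF mP']) auto
  qed
  then have "AE x in M. f x = h x" by eventually_elim (rule fh)
  then have ae: "AE x in completion M. f x = h x" by (rule AE_completion)
  have mh': "h \<in> borel_measurable M" using mh by (simp add: M_def)
  have mf: "f \<in> borel_measurable (completion M)"
    by (rule completion.measurable_AE_eq[OF measurable_completion[OF mh'] ae])
  have hP': "indicator (face i) y *\<^sub>R (dens i (face_point i ?c y) *\<^sub>R h (?P y))
     = indicator (face i) y * (dens i (face_point i ?c y) * gh (face_point i ?c y))" for y
    using hP[of y] by (auto simp: indicator_def)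
  have int: "integrable (slice_measure i) (\<lambda>y. indicator (face i) y * (dens i (face_point i ?c y) * gh (face_point i ?c y)))"
  proof -
    obtain C where C: "\<And>x. x \<in> Q \<Longrightarrow> \<bar>dens i x\<bar> \<le> C"
      using compact_imp_bounded[OF compact_continuous_image[OF continuous_dens[of i] compact_cbox]] by (auto simp: bounded_iff)
    show ?thesis
    proof (rule integrable_face[of "\<lambda>x. dens i x * gh x"])
      have "(\<lambda>x. indicator Q x *\<^sub>R dens i x) \<in> borel_measurable borel"
        by (rule borel_measurable_continuous_on_indicator[OF _ continuous_dens]) simp
      from borel_measurable_times[OF this meas]
      have "(\<lambda>x. indicator Q x *\<^sub>R dens i x * (indicator Q x * gh x)) \<in> borel_measurable borel" .
      moreover have "indicator Q x *\<^sub>R dens i x * (indicator Q x * gh x) = indicator Q x * (dens i x * gh x)" for x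
        by (auto simp: indicator_def)
      ultimately show "(\<lambda>x. indicator Q x * (dens i x * gh x)) \<in> borel_measurable borel" by (simp only:)
      show "\<bar>dens i x * gh x\<bar> \<le> C * B" if "x \<in> Q" for x
        using C[OF that] bd[OF that] unfolding abs_mult by (intro mult_mono) auto
    qed
  qed
  have mhP: "(\<lambda>y. h (?P y)) \<in> borel_measurable R" by (rule measurable_compose[OF mP mh])
  have "integrable D (\<lambda>y. h (?P y))"
    unfolding D_def
  proof (subst integrable_density[OF mhP mdens AE_I2[OF dens_nonneg]])
    show "integrable R (\<lambda>y. dens i (face_point i ?c y) *\<^sub>R h (?P y))"
      unfolding R_def using int unfolding hP'[symmetric] by (subst integrable_restrict_space) auto
  qed
  then have ih: "integrable M h"
    unfolding M_def by (subst integrable_distr_eq[OF mP' mh])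
  then have "integrable (completion M) h" by (subst integrable_completion[OF mh'])
  then show "integrable (face_measure F lo hi i s) f"
    unfolding FM using ae by (subst integrable_cong_AE[OF mf measurable_completion[OF mh']]) auto
  have "(LINT x|completion M. f x) = (LINT x|completion M. h x)"
    by (rule integral_cong_AE[OF mf measurable_completion[OF mh'] ae])
  also have "\<dots> = (LINT x|M. h x)" by (rule integral_completion[OF mh'])
  also have "\<dots> = (LINT y|D. h (?P y))" unfolding M_def by (rule integral_distr[OF mP' mh])
  also have "\<dots> = (LINT y|R. dens i (face_point i ?c y) *\<^sub>R h (?P y))"
    unfolding D_def by (rule integral_density[OF mhP mdens AE_I2[OF dens_nonneg]])
  also have "\<dots> = fint i s gh"
    unfolding R_def fint_def
  proof (subst integral_restrict_space)
    show "face i \<inter> space (slice_measure i) \<in> sets (slice_measure i)" by (intro sets.Int face_sets sets.top)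
  qed (simp only: hP')
  finally show "(LINT x|face_measure F lo hi i s. f x) = fint i s gh" unfolding FM .
qed

lemma
  fixes f gh :: "real^'d \<Rightarrow> real"
  assumes gh: "continuous_on Q gh" and eq: "\<And>x. x \<in> Q \<Longrightarrow> f (F x) = gh x"
  shows integrable_face_measure_continuous: "integrable (face_measure F lo hi i s) f"
    and integral_face_measure_continuous: "(LINT x|face_measure F lo hi i s. f x) = fint i s gh"
proof -
  have "bounded (gh ` Q)" by (intro compact_imp_bounded compact_continuous_image gh compact_cbox)
  then obtain B where B: "\<And>x. x \<in> Q \<Longrightarrow> \<bar>gh x\<bar> \<le> B" by (auto simp: bounded_iff)
  have m: "(\<lambda>x. indicator Q x * gh x) \<in> borel_measurable borel"
    using borel_measurable_continuous_on_indicator[OF _ gh] by simp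
  have e: "f (F (face_point i (end_coord i s) y)) = gh (face_point i (end_coord i s) y)" if "y \<in> face i" for y
    by (rule eq[OF face_point_end_Q[OF that]])
  show "integrable (face_measure F lo hi i s) f" "(LINT x|face_measure F lo hi i s. f x) = fint i s gh"
    using integrable_face_measure[of "\<lambda>_. {}" gh B i f s] integral_face_measure[of "\<lambda>_. {}" gh B i f s] m B e by auto
qed

text \<open>Apply integration along coordinate lines to the Piola transform \<open>W\<^sub>i = \<Sum>\<^sub>c det J K\<^sub>i\<^sub>c V\<^sub>c\<close>.  Its parametric
  divergence is \<open>det J\<close> times the physical divergence of \<open>V\<close> by the Piola identity, and its value on a face is surface density times
  normal component.\<close>

lemma divergence_theorem:
  assumes fin: "\<And>k. finite (Z k)" and V: "\<And>c. PW Z (V c)"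
  shows "vint Z (\<lambda>x. \<Sum>c\<in>UNIV. phd c (V c) x) =
    (\<Sum>i\<in>UNIV. \<Sum>s\<in>UNIV. fint i s (\<lambda>x. \<Sum>c\<in>UNIV. V c x * nrm i s x $ c))"
proof -
  obtain \<sigma> where \<sigma>: "\<sigma> = 1 \<or> \<sigma> = -1" "\<And>x. x \<in> Q \<Longrightarrow> \<bar>det (J x)\<bar> = \<sigma> * det (J x)"
    by (rule det_sign) (rule that, assumption, assumption)
  define N where "N i c x = det (J x) * K x $ i $ c" for i c x
  have C1N: "C1 S (N i c)" for i c unfolding N_def by (intro C1_mult C1_det C1_K)
  define W where "W i x = (\<Sum>c\<in>UNIV. N i c x * V c x)" for i x
  have PWW: "PW Z (W i)" for i unfolding W_def by (intro PW_sum PW_mult PW_C1S C1N V)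
  have pt: "\<bar>det (J x)\<bar> * (\<Sum>c\<in>UNIV. phd c (V c) x) = \<sigma> * (\<Sum>i\<in>UNIV. pd i (W i) x)" if x: "x \<in> Off Z" for x
  proof -
    have xS: "x \<in> S" "x \<in> Q" using x O_subset(2,3) by blast+
    note d = C1_differentiable[OF C1N xS(1)] PW_differentiable[OF V x]
    have "pd i (W i) x = (\<Sum>c\<in>UNIV. pd i (N i c) x * V c x + N i c x * pd i (V c) x)" for i
      unfolding W_def by (subst pd_sum) (auto intro!: differentiable_mult d simp: pd_mult d)
    then have "(\<Sum>i\<in>UNIV. pd i (W i) x) = (\<Sum>i\<in>UNIV. \<Sum>c\<in>UNIV. pd i (N i c) x * V c x) + (\<Sum>i\<in>UNIV. \<Sum>c\<in>UNIV. N i c x * pd i (V c) x)"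
      by (simp add: sum.distrib)
    moreover have "(\<Sum>i\<in>UNIV. \<Sum>c\<in>UNIV. pd i (N i c) x * V c x) = (\<Sum>c\<in>UNIV. (\<Sum>i\<in>UNIV. pd i (N i c) x) * V c x)"
      by (subst sum.swap) (simp add: sum_distrib_right)
    moreover have "(\<Sum>i\<in>UNIV. pd i (N i c) x) = 0" for c unfolding N_def by (rule piola[OF xS(1)])
    moreover have "(\<Sum>i\<in>UNIV. \<Sum>c\<in>UNIV. N i c x * pd i (V c) x) = det (J x) * (\<Sum>c\<in>UNIV. phd c (V c) x)"
      by (subst sum.swap) (simp add: N_def phd_def sum_distrib_left mult_ac)
    ultimately show ?thesis using \<sigma>(2)[OF xS(2)] by simp
  qed
  have "vint Z (\<lambda>x. \<Sum>c\<in>UNIV. phd c (V c) x) = (LBINT x. \<Sum>i\<in>UNIV. \<sigma> * (indicator (Off Z) x * pd i (W i) x))"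
    unfolding vint_def
  proof (intro Bochner_Integration.integral_cong refl)
    fix x
    show "indicator (Off Z) x * (\<bar>det (J x)\<bar> * (\<Sum>c\<in>UNIV. phd c (V c) x)) = (\<Sum>i\<in>UNIV. \<sigma> * (indicator (Off Z) x * pd i (W i) x))"
      by (cases "x \<in> Off Z") (simp_all add: pt sum_distrib_left[symmetric])
  qed
  also have "\<dots> = (\<Sum>i\<in>UNIV. \<sigma> * (LBINT x. indicator (Off Z) x * pd i (W i) x))"
    by (subst Bochner_Integration.integral_sum)
       (auto intro!: integrable_BM[OF fin PW_BM_pd[OF PWW]] integrable_mult_right)
  also have "\<dots> = (\<Sum>i\<in>UNIV. \<Sum>s\<in>UNIV. fint i s (\<lambda>x. \<Sum>c\<in>UNIV. V c x * nrm i s x $ c))"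
  proof (rule sum.cong[OF refl])
    fix i
    have f: "fint i s (\<lambda>x. \<Sum>c\<in>UNIV. V c x * nrm i s x $ c) =
      (if s then \<sigma> else - \<sigma>) * (\<integral>y. indicator (face i) y * W i (face_point i (end_coord i s) y) \<partial>slice_measure i)" for s
    proof -
      have "indicator (face i) y * (dens i (face_point i (end_coord i s) y) *
          (\<Sum>c\<in>UNIV. V c (face_point i (end_coord i s) y) * nrm i s (face_point i (end_coord i s) y) $ c))
        = (if s then \<sigma> else - \<sigma>) * (indicator (face i) y * W i (face_point i (end_coord i s) y))" for y
      proof (cases "y \<in> face i")
        case True
        define x where "x = face_point i (end_coord i s) y"
        have x: "x \<in> Q" unfolding x_def by (rule face_point_end_Q[OF True])
        have "norm (row i (K x)) * sgn (row i (K x)) $ c = K x $ i $ c" for c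
          using row_K_nz[OF box_in_S(2)[OF x], of i] by (simp add: sgn_div_norm row_def)
        then have "dens i x * nrm i s x $ c = (if s then \<sigma> else - \<sigma>) * N i c x" for c
          by (simp add: dens_def nrm_def N_def \<sigma>(2)[OF x] mult.assoc)
        then have "dens i x * (\<Sum>c\<in>UNIV. V c x * nrm i s x $ c) = (if s then \<sigma> else - \<sigma>) * W i x"
        proof -
          have "dens i x * (\<Sum>c\<in>UNIV. V c x * nrm i s x $ c) = (\<Sum>c\<in>UNIV. (dens i x * nrm i s x $ c) * V c x)"
            by (simp add: sum_distrib_left mult_ac)
          also have "\<dots> = (\<Sum>c\<in>UNIV. (if s then \<sigma> else - \<sigma>) * N i c x * V c x)"
            by (simp only: \<open>\<And>c. dens i x * nrm i s x $ c = (if s then \<sigma> else - \<sigma>) * N i c x\<close>)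
          also have "\<dots> = (if s then \<sigma> else - \<sigma>) * W i x"
            unfolding W_def sum_distrib_left by (simp only: mult.assoc)
          finally show ?thesis .
        qed
        then show ?thesis using True unfolding x_def by simp
      qed simp
      then show ?thesis unfolding fint_def by (simp only: integral_mult_right_zero)
    qed
    show "\<sigma> * (LBINT x. indicator (Off Z) x * pd i (W i) x) = (\<Sum>s\<in>UNIV. fint i s (\<lambda>x. \<Sum>c\<in>UNIV. V c x * nrm i s x $ c))"
      unfolding integral_pd[OF fin PWW] UNIV_bool by (simp add: f right_diff_distrib)
  qed
  finally show ?thesis .
qed

end

section \<open>Approximation of continuous functions by test functions\<close>

lemma linear_frechet_sum_pd:
  assumes "f differentiable (at x)"
  shows "frechet_derivative f (at x) v = (\<Sum>i\<in>UNIV. v $ i * pd i f x)"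
  using frechet_derivative_at[OF has_derivative_pd[OF assms]] by metis

lemma Ck_on_1_iff_C1:
  assumes "open S" shows "Ck_on 1 f S \<longleftrightarrow> C1 S (f :: real^'d \<Rightarrow> real)"
proof
  assume "Ck_on 1 f S"
  then have d: "\<And>x. x \<in> S \<Longrightarrow> f differentiable (at x)" and c: "\<And>v. continuous_on S (\<lambda>x. frechet_derivative f (at x) v)"
    using assms by (auto simp: One_nat_def differentiable_on_eq_differentiable_at)
  then show "C1 S f" by (simp add: C1_def pd_def[abs_def])
next
  assume *: "C1 S f"
  have "continuous_on S (\<lambda>x. frechet_derivative f (at x) v)" for v
  proof (rule continuous_on_eq)
    show "continuous_on S (\<lambda>x. \<Sum>i\<in>UNIV. v $ i * pd i f x)"
      by (intro continuous_intros C1_continuous_pd[OF *])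
    show "(\<Sum>i\<in>UNIV. v $ i * pd i f x) = frechet_derivative f (at x) v" if "x \<in> S" for x
      using linear_frechet_sum_pd[OF C1_differentiable[OF * that]] by simp
  qed
  then show "Ck_on 1 f S"
    using * assms by (auto simp: One_nat_def differentiable_on_eq_differentiable_at C1_def)
qed

lemma C1_Un:
  assumes "open S" "open T" "C1 S f" "C1 T f" shows "C1 (S \<union> T) f"
  using assms unfolding C1_def by (auto intro: continuous_on_open_Un)

lemma C1_polynomial_function:
  "real_polynomial_function p \<Longrightarrow> C1 S (p :: real^'d \<Rightarrow> real)"
proof (induction rule: real_polynomial_function.induct)
  case (linear f)
  then have "(f has_derivative f) (at x)" for x by (rule bounded_linear_imp_has_derivative)
  then have "pd i f x = f (axis i 1)" "f differentiable (at x)" for i x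
    by (auto simp: differentiable_def pd_eqI)
  then have "pd i f = (\<lambda>x. f (axis i 1))" for i by auto
  with \<open>\<And>x. f differentiable (at x)\<close> show ?case by (simp add: C1_def)
qed auto

lemma C1_positive_part_square:
  assumes "C1 S f" shows "C1 S (\<lambda>x. (max 0 (f x))\<^sup>2)"
proof -
  have D: "DERIV (\<lambda>t. (max 0 t)\<^sup>2) t :> 2 * max 0 t" for t :: real
  proof (cases "t = 0")
    case False
    then consider "t > 0" | "t < 0" by linarith
    then show ?thesis
    proof cases
      case 1
      have "DERIV (\<lambda>t. t\<^sup>2) t :> 2 * max 0 t" using 1 by (auto intro!: derivative_eq_intros)
      then show ?thesis
        by (rule has_field_derivative_transform_within_open[of _ _ _ "{0<..}"]) (use 1 in auto)
    next
      case 2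
      have "DERIV (\<lambda>t. 0) t :> 2 * max 0 t" using 2 by (auto intro!: derivative_eq_intros)
      then show ?thesis
        by (rule has_field_derivative_transform_within_open[of _ _ _ "{..<0}"]) (use 2 in auto)
    qed
  next
    case True
    have "((\<lambda>h::real. (max 0 h)\<^sup>2 / h) \<longlongrightarrow> 0) (at 0)"
    proof (rule Lim_null_comparison)
      show "((\<lambda>h::real. \<bar>h\<bar>) \<longlongrightarrow> 0) (at 0)" using tendsto_rabs[OF tendsto_ident_at, of 0 UNIV] by simp
      show "\<forall>\<^sub>F h in at (0::real). norm ((max 0 h)\<^sup>2 / h) \<le> \<bar>h\<bar>"
        by (rule always_eventually) (auto simp: max_def power2_eq_square)
    qed
    then show ?thesis unfolding True by (simp add: DERIV_def)
  qed
  have pd: "pd i (\<lambda>x. (max 0 (f x))\<^sup>2) x = 2 * max 0 (f x) * pd i f x" "(\<lambda>x. (max 0 (f x))\<^sup>2) differentiable (at x)"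
    if "x \<in> S" for i x
  proof -
    have "((\<lambda>t. (max 0 t)\<^sup>2) has_derivative (\<lambda>h. 2 * max 0 (f x) * h)) (at (f x))"
      using D[of "f x"] by (simp add: has_field_derivative_def)
    from diff_chain_at[OF has_derivative_pd[OF C1_differentiable[OF assms that]] this]
    have *: "((\<lambda>x. (max 0 (f x))\<^sup>2) has_derivative (\<lambda>h. 2 * max 0 (f x) * (\<Sum>i\<in>UNIV. h $ i * pd i f x))) (at x)"
      by (simp add: o_def)
    show "(\<lambda>x. (max 0 (f x))\<^sup>2) differentiable (at x)" using * by (auto simp: differentiable_def)
    show "pd i (\<lambda>x. (max 0 (f x))\<^sup>2) x = 2 * max 0 (f x) * pd i f x"
      using pd_eqI[OF *, of i] by (simp add: axis_def if_distrib[of "\<lambda>x. x * _"] cong: if_cong)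
  qed
  have c: "continuous_on S (\<lambda>x. 2 * max 0 (f x) * pd i f x)" for i
    by (intro continuous_intros C1_continuous_on[OF assms] C1_continuous_pd[OF assms])
  have "continuous_on S (pd i (\<lambda>x. (max 0 (f x))\<^sup>2))" for i
    by (rule continuous_on_eq[OF c[of i]]) (simp add: pd)
  then show ?thesis using pd by (simp add: C1_def)
qed

text \<open>Multiply the square root of \<open>\<psi>\<close> by a continuous cut-off, approximate the product uniformly by a polynomial, subtract the
  error bound and square the positive part.  The subtraction makes the result vanish wherever the cut-off does and keeps it below
  \<open>\<psi>\<close>; squaring the positive part makes it \<open>C\<^sup>1\<close>.\<close>

lemma test_function_approximation:
  fixes \<psi> :: "real^'d \<Rightarrow> real"
  assumes "open \<Omega>" "bounded \<Omega>" and \<psi>: "continuous_on (closure \<Omega>) \<psi>" "\<And>x. x \<in> closure \<Omega> \<Longrightarrow> 0 \<le> \<psi> x"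
  obtains \<phi> :: "nat \<Rightarrow> real^'d \<Rightarrow> real" where
    "\<And>n. test_function \<Omega> (\<phi> n)"
    "\<And>n x. x \<in> \<Omega> \<Longrightarrow> 0 \<le> \<phi> n x \<and> \<phi> n x \<le> \<psi> x"
    "\<And>x. x \<in> \<Omega> \<Longrightarrow> (\<lambda>n. \<phi> n x) \<longlonglongrightarrow> \<psi> x"
proof -
  have "continuous_on (closure \<Omega>) (\<lambda>x. sqrt (\<psi> x))" by (intro continuous_intros \<psi>)
  then obtain r where r: "continuous_on UNIV r" "\<And>x. x \<in> closure \<Omega> \<Longrightarrow> r x = sqrt (\<psi> x)"
    using Tietze_unbounded[of "closure \<Omega>" "\<lambda>x. sqrt (\<psi> x)" UNIV] by auto
  obtain R where R: "\<Omega> \<subseteq> ball 0 R"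
    using bounded_subset_ballD[OF assms(2), of 0] by blast
  have nU: "- \<Omega> \<noteq> {}" 
  proof
    assume "- \<Omega> = {}"
    then have "\<Omega> = UNIV" by auto
    then show False using assms(2) by (simp add: not_bounded_UNIV)
  qed
  define d where "d x = infdist x (- \<Omega>)" for x
  have contd: "continuous_on UNIV d" unfolding d_def by (intro continuous_intros)
  define cut where "cut n x = max 0 (min 1 (real n * d x - 1))" for n x
  define f where "f n x = cut n x * r x" for n x
  define Kn where "Kn n = {x. real n * d x \<ge> 1}" for n
  have Kn_sub: "Kn n \<subseteq> \<Omega>" for n
  proof
    fix x assume "x \<in> Kn n"
    then have "d x \<noteq> 0" by (auto simp: Kn_def)
    then show "x \<in> \<Omega>" unfolding d_def using infdist_zero[of x "- \<Omega>"] by blast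
  qed
  have closedKn: "closed (Kn n)" for n unfolding Kn_def
    by (intro closed_Collect_le continuous_intros contd)
  have compactKn: "compact (Kn n)" for n
    using closedKn Kn_sub bounded_subset[OF assms(2)] compact_eq_bounded_closed by blast
  have f0: "f n x = 0" if "x \<notin> Kn n" for n x using that by (auto simp: f_def cut_def Kn_def)
  have rpos: "0 \<le> r x" if "x \<in> \<Omega>" for x using r(2)[of x] \<psi>(2)[of x] subsetD[OF closure_subset that] by simp
  have contf: "continuous_on UNIV (f n)" for n unfolding f_def cut_def
    by (intro continuous_intros contd r)
  define e where "e n = inverse (real (Suc n))" for n
  have e: "e n > 0" for n by (simp add: e_def)
  have "\<exists>p. real_polynomial_function p \<and> (\<forall>x\<in>cball 0 R. \<bar>f n x - p x\<bar> < e n)" for n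
    using Stone_Weierstrass_real_polynomial_function[OF compact_cball continuous_on_subset[OF contf] e] by (metis subset_UNIV)
  then obtain p where p: "\<And>n. real_polynomial_function (p n)" "\<And>n x. x \<in> cball 0 R \<Longrightarrow> \<bar>f n x - p n x\<bar> < e n"
    by metis
  define \<phi> where "\<phi> n x = (if x \<in> ball 0 R then (max 0 (p n x - e n))\<^sup>2 else 0)" for n x
  have \<phi>0: "\<phi> n x = 0" if "x \<notin> Kn n" for n x
  proof (cases "x \<in> ball 0 R")
    case True
    then have "p n x < e n" using p(2)[of x n] f0[OF that] by auto
    then show ?thesis by (simp add: \<phi>_def)
  qed (simp add: \<phi>_def)
  have C1\<phi>: "C1 UNIV (\<phi> n)" for n
  proof -
    have "C1 (ball 0 R) (\<lambda>x. (max 0 (p n x - e n))\<^sup>2)"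
      by (intro C1_positive_part_square C1_diff C1_polynomial_function p C1_const)
    then have 1: "C1 (ball 0 R) (\<phi> n)" by (rule C1_cong[OF open_ball]) (simp add: \<phi>_def)
    have 2: "C1 (- Kn n) (\<phi> n)"
      by (rule C1_cong[OF _ C1_const[of _ 0]]) (use closedKn \<phi>0 in auto)
    have "ball 0 R \<union> - Kn n = UNIV" using Kn_sub R by blast
    then show ?thesis using C1_Un[OF _ _ 1 2] closedKn by auto
  qed
  have test: "test_function \<Omega> (\<phi> n)" for n
    unfolding test_function_def
  proof (intro conjI exI allI impI)
    show "Ck_on 1 (\<phi> n) UNIV" using C1\<phi> Ck_on_1_iff_C1[OF open_UNIV] by blast
    show "compact (Kn n)" "Kn n \<subseteq> \<Omega>" by (rule compactKn, rule Kn_sub)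
    show "\<phi> n x = 0" if "x \<notin> Kn n" for x by (rule \<phi>0[OF that])
  qed
  have cut01: "0 \<le> cut n x" "cut n x \<le> 1" for n x by (auto simp: cut_def)
  have bd: "0 \<le> \<phi> n x \<and> \<phi> n x \<le> \<psi> x" if x: "x \<in> \<Omega>" for n x
  proof -
    have xc: "x \<in> closure \<Omega>" using x closure_subset by (rule subsetD[rotated])
    have rx: "r x = sqrt (\<psi> x)" "0 \<le> \<psi> x" by (rule r(2)[OF xc], rule \<psi>(2)[OF xc])
    have "p n x - e n \<le> f n x" using p(2)[of x n] subsetD[OF R x] by auto
    also have "f n x \<le> r x" using cut01[of n x] rpos[OF x] unfolding f_def by (simp add: mult_left_le_one_le)
    finally have "max 0 (p n x - e n) \<le> sqrt (\<psi> x)" using rx by auto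
    then have "(max 0 (p n x - e n))\<^sup>2 \<le> (sqrt (\<psi> x))\<^sup>2" by (intro power_mono) auto
    then show ?thesis using rx by (auto simp: \<phi>_def)
  qed
  have lim: "(\<lambda>n. \<phi> n x) \<longlonglongrightarrow> \<psi> x" if x: "x \<in> \<Omega>" for x
  proof -
    have xc: "x \<in> closure \<Omega>" using x closure_subset by (rule subsetD[rotated])
    have rx: "r x = sqrt (\<psi> x)" "0 \<le> \<psi> x" by (rule r(2)[OF xc], rule \<psi>(2)[OF xc])
    have xb: "x \<in> ball 0 R" using x R by blast
    have dpos: "d x > 0"
    proof -
      have "x \<notin> closure (- \<Omega>)" using x assms(1) by (simp add: closure_complement interior_open)
      then show ?thesis unfolding d_def using infdist_pos_not_in_closed in_closure_iff_infdist_zero[OF nU] infdist_nonneg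
        by (metis less_eq_real_def)
    qed
    obtain N :: nat where N: "real N * d x \<ge> 2" using reals_Archimedean3[OF dpos] less_imp_le by blast
    have ff: "f n x = r x" if "n \<ge> N" for n
    proof -
      have "real N * d x \<le> real n * d x" using that dpos by (intro mult_right_mono) auto
      then show ?thesis using N by (simp add: f_def cut_def)
    qed
    have e0: "e \<longlonglongrightarrow> 0" unfolding e_def by (rule LIMSEQ_inverse_real_of_nat)
    have "(\<lambda>n. p n x - e n) \<longlonglongrightarrow> r x"
    proof (rule real_tendsto_sandwich)
      show "\<forall>\<^sub>F n in sequentially. r x - 2 * e n \<le> p n x - e n"
        using eventually_ge_at_top[of N]
      proof eventually_elim
        case (elim n) then show ?case using p(2)[of x n] ff[of n] xb by auto
      qed
      show "\<forall>\<^sub>F n in sequentially. p n x - e n \<le> r x"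
        using eventually_ge_at_top[of N]
      proof eventually_elim
        case (elim n) then show ?case using p(2)[of x n] ff[of n] xb by auto
      qed
      show "(\<lambda>n. r x - 2 * e n) \<longlonglongrightarrow> r x" 
      proof -
        have "(\<lambda>n. r x - 2 * e n) \<longlonglongrightarrow> r x - 2 * 0" by (intro tendsto_intros e0)
        then show ?thesis by simp
      qed
    qed auto
    then have "(\<lambda>n. (max 0 (p n x - e n))\<^sup>2) \<longlonglongrightarrow> (max 0 (r x))\<^sup>2" by (intro tendsto_intros)
    moreover have "(max 0 (r x))\<^sup>2 = \<psi> x" using rx by simp
    ultimately show ?thesis using xb by (simp add: \<phi>_def)
  qed
  show ?thesis by (rule that[OF test bd lim])
qed

lemma
  fixes q :: "'a \<Rightarrow> real"
  assumes "finite_measure M" and q: "q \<in> borel_measurable M" and b: "b \<in> borel_measurable M"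
    and bd: "\<And>x. x \<in> space M \<Longrightarrow> \<bar>b x\<bar> \<le> B"
    and le: "\<And>x. x \<in> space M \<Longrightarrow> (q x)\<^sup>2 \<le> e x" and e: "integrable M e"
  shows integrable_mult_bounded: "integrable M (\<lambda>x. q x * b x)"
    and integral_mult_bounded: "0 < t \<Longrightarrow>
      \<bar>\<integral>x. q x * b x \<partial>M\<bar> \<le> \<bar>B\<bar> * (t * measure M (space M) + (\<integral>x. e x \<partial>M) / t)"
proof -
  interpret finite_measure M by fact
  have B: "\<bar>b x\<bar> \<le> \<bar>B\<bar>" if "x \<in> space M" for x using bd[OF that] by linarith
  have qb: "\<bar>q x * b x\<bar> \<le> \<bar>B\<bar> * (t + e x / t)" if x: "x \<in> space M" and t: "t > 0" for x t
  proof -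
    have "0 \<le> (\<bar>q x\<bar> - t)\<^sup>2" by simp
    then have "2 * (\<bar>q x\<bar> * t) \<le> (q x)\<^sup>2 + t\<^sup>2" by (simp add: power2_diff)
    moreover have "(q x)\<^sup>2 \<le> e x" by (rule le[OF x])
    moreover have "0 \<le> \<bar>q x\<bar> * t" using t by simp
    ultimately have "\<bar>q x\<bar> * t \<le> e x + t\<^sup>2" by linarith
    then have "\<bar>q x\<bar> \<le> t + e x / t" using t by (simp add: field_simps power2_eq_square)
    then have "\<bar>b x\<bar> * \<bar>q x\<bar> \<le> \<bar>B\<bar> * (t + e x / t)" using B[OF x] by (intro mult_mono) auto
    then show ?thesis by (simp add: abs_mult mult.commute)
  qed
  have int_bd: "integrable M (\<lambda>x. \<bar>B\<bar> * (t + e x / t))" for t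
    by (intro integrable_mult_right Bochner_Integration.integrable_add integrable_const integrable_divide e)
  show int: "integrable M (\<lambda>x. q x * b x)"
  proof (rule Bochner_Integration.integrable_bound[OF int_bd[of 1]])
    show "(\<lambda>x. q x * b x) \<in> borel_measurable M" by (rule borel_measurable_times[OF q b])
    show "AE x in M. norm (q x * b x) \<le> norm (\<bar>B\<bar> * (1 + e x / 1))"
      using qb[where t=1] by (intro AE_I2) (smt (verit) real_norm_def zero_less_one)
  qed
  assume t: "0 < t"
  have "\<bar>\<integral>x. q x * b x \<partial>M\<bar> \<le> (\<integral>x. \<bar>q x * b x\<bar> \<partial>M)" by (rule integral_abs_bound)
  also have "\<dots> \<le> (\<integral>x. \<bar>B\<bar> * (t + e x / t) \<partial>M)"
    by (intro integral_mono integrable_abs int int_bd qb t)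
  also have "\<dots> = \<bar>B\<bar> * (t * measure M (space M) + (\<integral>x. e x \<partial>M) / t)"
    using e by (simp add: Bochner_Integration.integral_add)
  finally show "\<bar>\<integral>x. q x * b x \<partial>M\<bar> \<le> \<bar>B\<bar> * (t * measure M (space M) + (\<integral>x. e x \<partial>M) / t)" .
qed

text \<open>Young's inequality with a free parameter stands in for the Cauchy-Schwarz inequality: the first summand is made small by the
  choice of the parameter, the second by the convergence.\<close>

lemma integral_tendsto_0_of_square:
  fixes q :: "nat \<Rightarrow> 'a \<Rightarrow> real"
  assumes fin: "finite_measure M" and q: "\<And>k. q k \<in> borel_measurable M" and b: "b \<in> borel_measurable M"
    and bd: "\<And>x. x \<in> space M \<Longrightarrow> \<bar>b x\<bar> \<le> B"
    and le: "\<And>k x. x \<in> space M \<Longrightarrow> (q k x)\<^sup>2 \<le> e k x" and e: "\<And>k. integrable M (e k)"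
    and lim: "(\<lambda>k. \<integral>x. e k x \<partial>M) \<longlonglongrightarrow> 0"
  shows "(\<lambda>k. \<integral>x. q k x * b x \<partial>M) \<longlonglongrightarrow> 0"
proof -
  have I: "\<bar>\<integral>x. q k x * b x \<partial>M\<bar> \<le> \<bar>B\<bar> * (t * measure M (space M) + (\<integral>x. e k x \<partial>M) / t)"
    if "t > 0" for k t
    by (rule integral_mult_bounded[OF fin q b bd le e that])
  show "(\<lambda>k. \<integral>x. q k x * b x \<partial>M) \<longlonglongrightarrow> 0"
  proof (rule LIMSEQ_I)
    fix r :: real assume r: "r > 0"
    define m where "m = \<bar>B\<bar> * measure M (space M) + 1"
    have m: "m > 0" by (simp add: m_def add_nonneg_pos)
    define t where "t = r / (2 * m)"
    have t: "t > 0" using r m by (simp add: t_def)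
    have "(\<lambda>k. \<bar>B\<bar> * ((\<integral>x. e k x \<partial>M) / t)) \<longlonglongrightarrow> \<bar>B\<bar> * (0 / t)"
      by (intro tendsto_intros lim) (use t in auto)
    then have "(\<lambda>k. \<bar>B\<bar> * ((\<integral>x. e k x \<partial>M) / t)) \<longlonglongrightarrow> 0" by simp
    from LIMSEQ_D[OF this, of "r / 2"] r obtain N where N: "\<And>k. k \<ge> N \<Longrightarrow> \<bar>\<bar>B\<bar> * ((\<integral>x. e k x \<partial>M) / t)\<bar> < r / 2"
      by auto
    have "norm ((\<integral>x. q k x * b x \<partial>M) - 0) < r" if k: "k \<ge> N" for k
    proof -
      have "\<bar>\<integral>x. q k x * b x \<partial>M\<bar> \<le> \<bar>B\<bar> * measure M (space M) * t + \<bar>B\<bar> * ((\<integral>x. e k x \<partial>M) / t)"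
        using I[OF t, of k] by (simp add: algebra_simps)
      moreover have "\<bar>B\<bar> * measure M (space M) * t \<le> r / 2"
      proof -
        have "\<bar>B\<bar> * measure M (space M) * t \<le> m * t" using t by (intro mult_right_mono) (auto simp: m_def)
        also have "\<dots> = r / 2" using m by (simp add: t_def)
        finally show ?thesis .
      qed
      moreover have "\<bar>B\<bar> * ((\<integral>x. e k x \<partial>M) / t) < r / 2"
        using N[OF k] by (rule order.strict_trans1[OF abs_ge_self])
      ultimately have "\<bar>\<integral>x. q k x * b x \<partial>M\<bar> < r" by linarith
      then show ?thesis by simp
    qed
    then show "\<exists>N. \<forall>k\<ge>N. norm ((\<integral>x. q k x * b x \<partial>M) - 0) < r" by blast
  qed
qed

section \<open>Physical gradients of piecewise smooth velocities\<close>

lemma C1_vector_has_derivative: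
  fixes w :: "real^'d \<Rightarrow> real^'d"
  assumes d: "\<And>c. (\<lambda>y. w y $ c) differentiable (at x)"
  shows "w differentiable (at x)" and "grad w x $ a $ c = pd a (\<lambda>y. w y $ c) x"
proof -
  define D where "D h = (\<chi> c. \<Sum>i\<in>UNIV. h $ i * pd i (\<lambda>y. w y $ c) x)" for h :: "real^'d"
  have comp: "((\<lambda>y. w y \<bullet> axis c 1) has_derivative (\<lambda>h. D h \<bullet> axis c 1)) (at x)" for c
    using has_derivative_pd[OF d[of c]] by (simp add: inner_axis D_def)
  have W: "(w has_derivative D) (at x)"
  proof (rule has_derivative_componentwise_within[THEN iffD2], rule ballI)
    fix b :: "real^'d" assume "b \<in> Basis"
    then obtain c where "b = axis c 1" by (auto simp: Basis_vec_def)
    then show "((\<lambda>y. w y \<bullet> b) has_derivative (\<lambda>h. D h \<bullet> b)) (at x)" using comp by simp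
  qed
  then show "w differentiable (at x)" by (auto simp: differentiable_def)
  have "frechet_derivative w (at x) = D" using frechet_derivative_at[OF W] by simp
  then show "grad w x $ a $ c = pd a (\<lambda>y. w y $ c) x"
    by (simp add: grad_def jacobian_def transpose_def matrix_def D_def axis_def if_distrib[of "\<lambda>x. x * _"] cong: if_cong)
qed

lemma inner_matrix: "(A :: real^'n^'m) \<bullet> B = (\<Sum>i\<in>UNIV. \<Sum>j\<in>UNIV. A $ i $ j * B $ i $ j)"
  by (simp add: inner_vec_def)

lemma matrix_nth_le_norm: "\<bar>(A :: real^'n^'m) $ i $ j\<bar> \<le> norm A"
  using component_le_norm_cart[of "A $ i" j] Finite_Cartesian_Product.norm_nth_le[of A i] by linarith

lemma Ck_on_1_component:
  fixes w :: "real^'d \<Rightarrow> real^'d"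
  assumes "open U" "Ck_on 1 w U" shows "C1 U (\<lambda>y. w y $ c)"
proof -
  have d: "w differentiable (at x)" if "x \<in> U" for x
    using assms that by (auto simp: One_nat_def differentiable_on_eq_differentiable_at)
  have D: "((\<lambda>y. w y $ c) has_derivative (\<lambda>h. frechet_derivative w (at x) h $ c)) (at x)" if "x \<in> U" for x
    using d[OF that] by (intro bounded_linear.has_derivative[OF bounded_linear_vec_nth]) (simp add: frechet_derivative_works)
  have pd: "pd i (\<lambda>y. w y $ c) x = frechet_derivative w (at x) (axis i 1) $ c" if "x \<in> U" for x i
    by (rule pd_eqI[OF D[OF that]])
  have cont: "continuous_on U (\<lambda>x. frechet_derivative w (at x) (axis i 1) $ c)" for i
    using assms by (intro bounded_linear.continuous_on[OF bounded_linear_vec_nth]) (auto simp: One_nat_def)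
  have "continuous_on U (pd i (\<lambda>y. w y $ c))" for i
    by (rule continuous_on_eq[OF cont[of i]]) (simp add: pd)
  then show ?thesis using D by (auto simp: C1_def differentiable_def)
qed

context curved_box
begin

lemma vint_sum:
  assumes fin: "\<And>k. finite (Z k)" and f: "\<And>a. a \<in> I \<Longrightarrow> BM Z (f a)"
  shows "vint Z (\<lambda>x. \<Sum>a\<in>I. f a x) = (\<Sum>a\<in>I. vint Z (f a))"
  using f
proof (induction I rule: infinite_finite_induct)
  case (insert a I)
  have "BM Z (\<lambda>x. \<Sum>a\<in>I. f a x)" by (rule BM_sum) (use insert in auto)
  then show ?case using insert vint_add[where f="f a" and g="\<lambda>x. \<Sum>a\<in>I. f a x", OF fin] by simp
qed (simp_all add: vint_def)

lemma C1_comp_F: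
  assumes T: "open T" "F ` Q \<subseteq> T" and w: "C1 T w"
  shows PW_comp_F: "PW Z (\<lambda>x. w (F x))" and phd_comp_F: "x \<in> Q \<Longrightarrow> phd a (\<lambda>x. w (F x)) x = pd a w (F x)"
proof -
  define S' where "S' = S \<inter> F -` T"
  have S': "open S'" unfolding S'_def
    using continuous_on_open_vimage[OF open_S, THEN iffD1, rule_format, OF continuous_F T(1)] by (simp add: Int_commute)
  have QS: "Q \<subseteq> S'" using T(2) box_subset_S by (auto simp: S'_def)
  have D: "((\<lambda>x. w (F x)) has_derivative (\<lambda>h. \<Sum>b\<in>UNIV. (J x *v h) $ b * pd b w (F x))) (at x)" if "x \<in> S'" for x
  proof -
    have "(w has_derivative (\<lambda>h. \<Sum>b\<in>UNIV. h $ b * pd b w (F x))) (at (F x))"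
      using that by (intro has_derivative_pd C1_differentiable[OF w]) (simp add: S'_def)
    from diff_chain_at[OF F_has_derivative this] that show ?thesis by (simp add: o_def S'_def)
  qed
  have pd: "pd i (\<lambda>x. w (F x)) x = (\<Sum>b\<in>UNIV. J x $ b $ i * pd b w (F x))" if "x \<in> S'" for x i
    using pd_eqI[OF D[OF that], of i] by (simp add: matrix_vector_mult_basis column_def)
  have cF: "continuous_on S' F" using continuous_F by (rule continuous_on_subset) (auto simp: S'_def)
  have cont: "continuous_on S' (\<lambda>x. \<Sum>b\<in>UNIV. J x $ b $ i * pd b w (F x))" for i
  proof (intro continuous_on_sum continuous_on_mult)
    show "continuous_on S' (\<lambda>x. J x $ b $ i)" for b
      by (rule continuous_on_subset[OF C1_continuous_on[OF C1_J]]) (auto simp: S'_def)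
    show "continuous_on S' (\<lambda>x. pd b w (F x))" for b
      by (rule continuous_on_compose2[OF C1_continuous_pd[OF w] cF]) (auto simp: S'_def)
  qed
  have "continuous_on S' (pd i (\<lambda>x. w (F x)))" for i
    by (rule continuous_on_eq[OF cont[of i]]) (simp add: pd)
  then have "C1 S' (\<lambda>x. w (F x))" using D by (auto simp: C1_def differentiable_def)
  then show "PW Z (\<lambda>x. w (F x))" by (rule PW_C1[OF _ QS])
  show "phd a (\<lambda>x. w (F x)) x = pd a w (F x)" if "x \<in> Q"
  proof -
    have x: "x \<in> S'" "x \<in> S" using that QS by (auto simp: S'_def)
    have "phd a (\<lambda>x. w (F x)) x = (\<Sum>i\<in>UNIV. \<Sum>b\<in>UNIV. pd b w (F x) * (J x $ b $ i * K x $ i $ a))"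
      by (simp add: phd_def pd[OF x(1)] sum_distrib_right sum_distrib_left mult_ac)
    also have "\<dots> = (\<Sum>b\<in>UNIV. pd b w (F x) * (\<Sum>i\<in>UNIV. J x $ b $ i * K x $ i $ a))"
      by (subst sum.swap) (simp add: sum_distrib_left)
    also have "\<dots> = pd a w (F x)" by (simp add: JK_nth[OF x(2)] if_distrib[of "\<lambda>x. _ * x"] cong: if_cong)
    finally show ?thesis .
  qed
qed

lemma
  assumes fin: "\<And>k. finite (Z k)" and u: "\<And>c. PW Z (\<lambda>x. u (F x) $ c)" and x: "x \<in> Off Z"
  shows velocity_differentiable: "u differentiable (at (F x))"
    and grad_F: "grad u (F x) $ a $ c = phd a (\<lambda>x. u (F x) $ c) x"
proof -
  have xb: "x \<in> box lo hi" using x O_subset(1) by blast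
  have d: "(\<lambda>y. u y $ c) differentiable (at (F x))" "pd a (\<lambda>y. u y $ c) (F x) = phd a (\<lambda>x. u (F x) $ c) x" for a c
    using physical_derivative[where w="\<lambda>y. u y $ c", OF xb PW_differentiable[OF u[of c] x] open_O[OF fin] x] by simp_all
  show "u differentiable (at (F x))" "grad u (F x) $ a $ c = phd a (\<lambda>x. u (F x) $ c) x"
    using C1_vector_has_derivative[OF d(1)] d(2) by auto
qed

lemma divergence_F:
  assumes fin: "\<And>k. finite (Z k)" and u: "\<And>c. PW Z (\<lambda>x. u (F x) $ c)" and x: "x \<in> Off Z"
  shows "divergence u (F x) = (\<Sum>a\<in>UNIV. phd a (\<lambda>x. u (F x) $ a) x)"
  by (simp add: divergence_def trace_def grad_F[OF assms])

text \<open>The hypothesis on the divergence holds almost everywhere in the physical domain; it enters only through integrals, so no null sets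
  have to be pulled back.\<close>

lemma vint_divergence_free:
  assumes fin: "\<And>k. finite (Z k)" and u: "\<And>c. PW Z (\<lambda>x. u (F x) $ c)"
    and div: "AE x in lebesgue_on \<Omega>. divergence u x = 0" and f: "BM Z f"
  shows "vint Z (\<lambda>x. (\<Sum>a\<in>UNIV. phd a (\<lambda>x. u (F x) $ a) x) * f x) = 0"
proof -
  have "vint Z (\<lambda>x. (\<Sum>a\<in>UNIV. phd a (\<lambda>x. u (F x) $ a) x) * f x)
     = (LINT y|lebesgue_on \<Omega>. divergence u y * f (G y))"
  proof (rule integral_Omega[symmetric, OF fin])
    show "BM Z (\<lambda>x. (\<Sum>a\<in>UNIV. phd a (\<lambda>x. u (F x) $ a) x) * f x)"
      by (intro BM_mult BM_sum BM_phd u f)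
    show "divergence u (F x) * f (G (F x)) = (\<Sum>a\<in>UNIV. phd a (\<lambda>x. u (F x) $ a) x) * f x" if "x \<in> Off Z" for x
      using divergence_F[OF fin u that] G_F[OF subsetD[OF O_subset(2) that]] by simp
  qed
  also have "\<dots> = 0"
    by (rule integral_eq_zero_AE) (use div in \<open>eventually_elim, simp\<close>)
  finally show ?thesis .
qed

lemma finite_measure_Omega: "finite_measure (lebesgue_on \<Omega>)"
proof (rule finite_measureI)
  have "\<Omega> \<in> lmeasurable" by (intro lmeasurable_open bounded_Omega open_Omega)
  then show "emeasure (lebesgue_on \<Omega>) (space (lebesgue_on \<Omega>)) \<noteq> \<infinity>"
    by (simp add: emeasure_restrict_space fmeasurable_def top.not_eq_extremum del: emeasure_completion)
qed

lemma finite_measure_face: "finite_measure (face_measure F lo hi i s)"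
proof -
  have "integrable (face_measure F lo hi i s) (\<lambda>x. 1::real)"
    by (rule integrable_face_measure_continuous[OF continuous_on_const]) simp
  then have "emeasure (face_measure F lo hi i s) (space (face_measure F lo hi i s)) < \<infinity>"
    by (simp add: integrable_iff_bounded)
  then show ?thesis by (intro finite_measureI) auto
qed

lemma sets_Omega: "\<Omega> \<in> sets lebesgue" using open_Omega by auto

text \<open>Both the weak gradient and the pointwise gradient of the continuous, piecewise smooth \<open>u\<close> satisfy the same integration by
  parts formula against test functions, so their traces have the same integrals.\<close>

lemma weak_divergence_zero:
  assumes fin: "\<And>k. finite (Z k)" and u: "\<And>c. PW Z (\<lambda>x. u (F x) $ c)"
    and div: "AE x in lebesgue_on \<Omega>. divergence u x = 0"
    and Gr: "square_integrable (lebesgue_on \<Omega>) Gr" and weak: "weak_grad \<Omega> u Gr"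
    and \<phi>: "test_function \<Omega> \<phi>"
  shows "(LINT x|lebesgue_on \<Omega>. trace (Gr x) * \<phi> x) = 0"
proof -
  let ?v = "\<lambda>c x. u (F x) $ c"
  have C1: "C1 UNIV \<phi>" using \<phi> Ck_on_1_iff_C1[OF open_UNIV] by (auto simp: test_function_def)
  obtain Kc where Kc: "compact Kc" "Kc \<subseteq> \<Omega>" "\<And>x. x \<notin> Kc \<Longrightarrow> \<phi> x = 0" using \<phi> by (auto simp: test_function_def)
  have P: "PW Z (\<lambda>x. \<phi> (F x))" and dP: "\<And>x a. x \<in> Q \<Longrightarrow> phd a (\<lambda>x. \<phi> (F x)) x = pd a \<phi> (F x)"
    using PW_comp_F[OF open_UNIV _ C1] phd_comp_F[OF open_UNIV _ C1] by auto
  have intb: "integrable (lebesgue_on \<Omega>) (\<lambda>x. Gr x $ i $ i * \<phi> x)" for i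
  proof -
    have bd: "\<exists>B. \<forall>x. \<bar>\<phi> x\<bar> \<le> B"
    proof -
      have "bounded (\<phi> ` Kc)" using C1_continuous_on[OF C1] Kc(1)
        by (intro compact_imp_bounded compact_continuous_image) (auto intro: continuous_on_subset)
      then obtain B where B: "\<And>x. x \<in> Kc \<Longrightarrow> \<bar>\<phi> x\<bar> \<le> B" by (auto simp: bounded_iff)
      have "\<bar>\<phi> x\<bar> \<le> \<bar>B\<bar>" for x using B[of x] Kc(3)[of x] by (cases "x \<in> Kc") auto
      then show ?thesis by blast
    qed
    then obtain B where B: "\<And>x. \<bar>\<phi> x\<bar> \<le> B" by blast
    have mG: "(\<lambda>x. Gr x $ i $ i) \<in> borel_measurable (lebesgue_on \<Omega>)"
    proof -
      have "Gr \<in> borel_measurable (lebesgue_on \<Omega>)" using Gr by (simp add: square_integrable_def)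
      then show ?thesis
        by (rule measurable_compose, intro borel_measurable_continuous_onI)
          (intro bounded_linear.continuous_on[OF bounded_linear_vec_nth] continuous_on_id)
    qed
    show ?thesis
    proof (rule integrable_mult_bounded[OF finite_measure_Omega mG, where B=B and e="\<lambda>x. (norm (Gr x))\<^sup>2"])
      show "\<phi> \<in> borel_measurable (lebesgue_on \<Omega>)"
        by (rule continuous_imp_measurable_on_sets_lebesgue[OF continuous_on_subset[OF C1_continuous_on[OF C1]] sets_Omega]) simp
      show "\<bar>\<phi> x\<bar> \<le> B" for x by (rule B)
      show "(Gr x $ i $ i)\<^sup>2 \<le> (norm (Gr x))\<^sup>2" for x
        using power_mono[OF matrix_nth_le_norm[of "Gr x" i i], of 2] by simp
      show "integrable (lebesgue_on \<Omega>) (\<lambda>x. (norm (Gr x))\<^sup>2)"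
        using Gr by (simp add: square_integrable_def)
    qed
  qed
  have phi_boundary: "\<phi> (F (face_point i (end_coord i s) y)) = 0" if y: "y \<in> face i" for i s y
  proof (rule Kc(3))
    let ?x = "face_point i (end_coord i s) y"
    have x: "?x \<in> Q" by (rule face_point_end_Q[OF y])
    have nb: "?x \<notin> box lo hi"
    proof
      assume "?x \<in> box lo hi"
      then have "lo $ i < ?x $ i \<and> ?x $ i < hi $ i" unfolding mem_box_cart by blast
      then show False by (cases s) auto
    qed
    have "F ?x \<notin> \<Omega>"
    proof
      assume "F ?x \<in> \<Omega>"
      then obtain z where z: "z \<in> box lo hi" "F ?x = F z" by (auto simp: phys_domain_def)
      then have "?x = z" using inj_onD[OF inj_F z(2) x] subsetD[OF box_subset_cbox z(1)] by blast
      with z nb show False by simp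
    qed
    then show "F ?x \<notin> Kc" using Kc(2) by blast
  qed
  have "(\<Sum>i\<in>UNIV. \<Sum>s\<in>UNIV. fint i s (\<lambda>x. \<Sum>c\<in>UNIV. (\<phi> (F x) * ?v c x) * nrm i s x $ c)) = 0"
    unfolding fint_def
    by (intro sum.neutral ballI integral_eq_zero_AE AE_I2) (auto simp: indicator_def phi_boundary)
  then have "0 = vint Z (\<lambda>x. \<Sum>c\<in>UNIV. phd c (\<lambda>x. \<phi> (F x) * ?v c x) x)"
    using divergence_theorem[where V="\<lambda>c x. \<phi> (F x) * ?v c x", OF fin PW_mult[OF P u]] by simp
  also have "\<dots> = vint Z (\<lambda>x. (\<Sum>c\<in>UNIV. ?v c x * pd c \<phi> (F x)) + (\<Sum>c\<in>UNIV. phd c (?v c) x) * \<phi> (F x))"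
  proof (rule vint_cong)
    fix x assume x: "x \<in> Off Z"
    have "phd c (\<lambda>x. \<phi> (F x) * ?v c x) x = ?v c x * pd c \<phi> (F x) + phd c (?v c) x * \<phi> (F x)" for c
      using dP[OF subsetD[OF O_subset(2) x], of c]
      by (subst phd_mult[OF PW_differentiable[OF P x] PW_differentiable[OF u x]]) (simp add: mult_ac)
    then show "(\<Sum>c\<in>UNIV. phd c (\<lambda>x. \<phi> (F x) * ?v c x) x)
       = (\<Sum>c\<in>UNIV. ?v c x * pd c \<phi> (F x)) + (\<Sum>c\<in>UNIV. phd c (?v c) x) * \<phi> (F x)"
      by (simp add: sum.distrib sum_distrib_right)
  qed
  also have "\<dots> = vint Z (\<lambda>x. \<Sum>c\<in>UNIV. ?v c x * pd c \<phi> (F x)) + vint Z (\<lambda>x. (\<Sum>c\<in>UNIV. phd c (?v c) x) * \<phi> (F x))"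
  proof (rule vint_add[OF fin])
    have "BM Z (\<lambda>x. pd c \<phi> (F x))" for c
      by (rule BM_cong[OF BM_phd[OF P, of c]]) (use dP O_subset(2) in \<open>auto simp: subset_iff\<close>)
    then show "BM Z (\<lambda>x. \<Sum>c\<in>UNIV. ?v c x * pd c \<phi> (F x))"
      by (intro BM_sum BM_mult PW_BM[OF u])
    show "BM Z (\<lambda>x. (\<Sum>c\<in>UNIV. phd c (?v c) x) * \<phi> (F x))"
      by (intro BM_sum BM_mult BM_phd u PW_BM[OF P])
  qed
  also have "vint Z (\<lambda>x. (\<Sum>c\<in>UNIV. phd c (?v c) x) * \<phi> (F x)) = 0"
    by (rule vint_divergence_free[OF fin u div PW_BM[OF P]])
  also have "vint Z (\<lambda>x. \<Sum>c\<in>UNIV. ?v c x * pd c \<phi> (F x)) = (\<Sum>c\<in>UNIV. LINT x|lebesgue_on \<Omega>. u x $ c * frechet_derivative \<phi> (at x) (axis c 1))"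
  proof -
    have b: "BM Z (\<lambda>x. ?v c x * pd c \<phi> (F x))" for c
    proof (intro BM_mult PW_BM[OF u])
      show "BM Z (\<lambda>x. pd c \<phi> (F x))"
        by (rule BM_cong[OF BM_phd[OF P, of c]]) (use dP O_subset(2) in \<open>auto simp: subset_iff\<close>)
    qed
    have "vint Z (\<lambda>x. \<Sum>c\<in>UNIV. ?v c x * pd c \<phi> (F x)) = (\<Sum>c\<in>UNIV. vint Z (\<lambda>x. ?v c x * pd c \<phi> (F x)))"
      by (rule vint_sum[OF fin b])
    also have "\<dots> = (\<Sum>c\<in>UNIV. LINT x|lebesgue_on \<Omega>. u x $ c * frechet_derivative \<phi> (at x) (axis c 1))"
      by (intro sum.cong refl integral_Omega[OF fin b, symmetric]) (simp add: pd_def)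
    finally show ?thesis .
  qed
  also have "\<dots> + 0 = (\<Sum>c\<in>UNIV. - (LINT x|lebesgue_on \<Omega>. Gr x $ c $ c * \<phi> x))"
    using weak \<phi> unfolding weak_grad_def by (simp only: add_0_right)
  finally have "(\<Sum>c\<in>UNIV. (LINT x|lebesgue_on \<Omega>. Gr x $ c $ c * \<phi> x)) = 0"
    by (simp add: sum_negf)
  then show ?thesis
    unfolding trace_def sum_distrib_right using intb by (subst Bochner_Integration.integral_sum) auto
qed

end

section \<open>Vanishing convection\<close>

lemma trace_diff_le: "\<bar>trace (A - B :: real^'n^'n)\<bar> \<le> real CARD('n) * norm (A - B)"
proof -
  have "\<bar>trace (A - B)\<bar> \<le> (\<Sum>i\<in>UNIV. \<bar>(A - B) $ i $ i\<bar>)" unfolding trace_def by (rule sum_abs)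
  also have "\<dots> \<le> (\<Sum>i\<in>(UNIV::'n set). norm (A - B))" by (intro sum_mono matrix_nth_le_norm)
  finally show ?thesis by simp
qed

lemma borel_measurable_component:
  fixes f :: "'a \<Rightarrow> real^'n"
  assumes "f \<in> borel_measurable M" shows "(\<lambda>x. f x $ c) \<in> borel_measurable M"
  by (rule measurable_compose[OF assms borel_measurable_continuous_onI])
    (intro bounded_linear.continuous_on[OF bounded_linear_vec_nth] continuous_on_id)

lemma borel_measurable_matrix_component:
  fixes f :: "'a \<Rightarrow> real^'n^'m"
  assumes "f \<in> borel_measurable M" shows "(\<lambda>x. f x $ a $ c) \<in> borel_measurable M"
  by (rule measurable_compose[OF assms borel_measurable_continuous_onI])
    (intro bounded_linear.continuous_on[OF bounded_linear_vec_nth] continuous_on_id)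

lemma integrable_norm_diff_square:
  fixes f g :: "'a \<Rightarrow> 'b::euclidean_space"
  assumes "f \<in> borel_measurable M" "g \<in> borel_measurable M"
    and "integrable M (\<lambda>x. (norm (f x))\<^sup>2)" "integrable M (\<lambda>x. (norm (g x))\<^sup>2)"
  shows "integrable M (\<lambda>x. (norm (f x - g x))\<^sup>2)"
proof (rule Bochner_Integration.integrable_bound)
  show "integrable M (\<lambda>x. 2 * (norm (f x))\<^sup>2 + 2 * (norm (g x))\<^sup>2)"
    by (intro Bochner_Integration.integrable_add integrable_mult_right assms)
  show "(\<lambda>x. (norm (f x - g x))\<^sup>2) \<in> borel_measurable M"
    using assms(1,2) by measurable
  show "AE x in M. norm ((norm (f x - g x))\<^sup>2) \<le> norm (2 * (norm (f x))\<^sup>2 + 2 * (norm (g x))\<^sup>2)"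
  proof (rule AE_I2)
    fix x
    have "(norm (f x - g x))\<^sup>2 \<le> (norm (f x) + norm (g x))\<^sup>2"
      by (intro power_mono norm_triangle_ineq4) simp
    also have "\<dots> \<le> 2 * (norm (f x))\<^sup>2 + 2 * (norm (g x))\<^sup>2"
      using sum_squares_bound[of "norm (f x)" "norm (g x)"] by (simp add: power2_sum)
    finally show "norm ((norm (f x - g x))\<^sup>2) \<le> norm (2 * (norm (f x))\<^sup>2 + 2 * (norm (g x))\<^sup>2)" by simp
  qed
qed

context curved_box
begin

lemma closure_Omega: "closure \<Omega> \<subseteq> F ` Q"
  unfolding phys_domain_def
  by (rule closure_minimal[OF image_mono[OF box_subset_cbox] compact_imp_closed[OF compact_FQ]])

lemma norm_unit_normal: "norm (unit_normal F lo hi i s x) \<le> 1"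
  by (simp add: unit_normal_def norm_sgn)

text \<open>Extension from test functions to functions that are continuous up to the boundary, by dominated convergence.\<close>

lemma trace_Gr_orthogonal:
  assumes fin: "\<And>k. finite (Z k)" and u: "\<And>c. PW Z (\<lambda>x. u (F x) $ c)"
    and div: "AE x in lebesgue_on \<Omega>. divergence u x = 0"
    and Gr: "square_integrable (lebesgue_on \<Omega>) Gr" and weak: "weak_grad \<Omega> u Gr"
    and \<psi>: "continuous_on (F ` Q) \<psi>" "\<And>x. x \<in> F ` Q \<Longrightarrow> 0 \<le> \<psi> x"
  shows "(LINT x|lebesgue_on \<Omega>. trace (Gr x) * \<psi> x) = 0"
proof -
  interpret finite_measure "lebesgue_on \<Omega>" by (rule finite_measure_Omega)
  obtain \<phi> where \<phi>: "\<And>n. test_function \<Omega> (\<phi> n)" "\<And>n x. x \<in> \<Omega> \<Longrightarrow> 0 \<le> \<phi> n x \<and> \<phi> n x \<le> \<psi> x"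
    "\<And>x. x \<in> \<Omega> \<Longrightarrow> (\<lambda>n. \<phi> n x) \<longlonglongrightarrow> \<psi> x"
    using test_function_approximation[OF open_Omega bounded_Omega continuous_on_subset[OF \<psi>(1) closure_Omega]]
      \<psi>(2) closure_Omega by blast
  have "bounded (\<psi> ` F ` Q)" by (intro compact_imp_bounded compact_continuous_image \<psi>(1) compact_FQ)
  then obtain B where B: "\<And>x. x \<in> F ` Q \<Longrightarrow> \<bar>\<psi> x\<bar> \<le> B" by (auto simp: bounded_iff)
  have sub: "\<Omega> \<subseteq> F ` Q" unfolding phys_domain_def by (rule image_mono[OF box_subset_cbox])
  have mGr: "(\<lambda>x. trace (Gr x)) \<in> borel_measurable (lebesgue_on \<Omega>)"
    unfolding trace_def using Gr
    by (intro borel_measurable_sum borel_measurable_matrix_component) (simp add: square_integrable_def)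
  have int: "integrable (lebesgue_on \<Omega>) (\<lambda>x. trace (Gr x) * B)"
  proof (rule integrable_mult_bounded[OF finite_measure_Omega mGr, where B="\<bar>B\<bar>" and e="\<lambda>x. (real CARD('d))\<^sup>2 * (norm (Gr x))\<^sup>2"])
    show "(trace (Gr x))\<^sup>2 \<le> (real CARD('d))\<^sup>2 * (norm (Gr x))\<^sup>2" for x
      using power_mono[OF trace_diff_le[of "Gr x" 0], of 2] by (simp add: power_mult_distrib)
    show "integrable (lebesgue_on \<Omega>) (\<lambda>x. (real CARD('d))\<^sup>2 * (norm (Gr x))\<^sup>2)"
      using Gr by (simp add: square_integrable_def)
  qed auto
  have "(\<lambda>n. LINT x|lebesgue_on \<Omega>. trace (Gr x) * \<phi> n x) \<longlonglongrightarrow> (LINT x|lebesgue_on \<Omega>. trace (Gr x) * \<psi> x)"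
  proof (rule integral_dominated_convergence[where w="\<lambda>x. norm (trace (Gr x) * B)"])
    show "(\<lambda>x. trace (Gr x) * \<psi> x) \<in> borel_measurable (lebesgue_on \<Omega>)"
      by (intro borel_measurable_times mGr continuous_imp_measurable_on_sets_lebesgue[OF continuous_on_subset[OF \<psi>(1) sub] sets_Omega])
    show "(\<lambda>x. trace (Gr x) * \<phi> n x) \<in> borel_measurable (lebesgue_on \<Omega>)" for n
    proof (intro borel_measurable_times mGr continuous_imp_measurable_on_sets_lebesgue sets_Omega)
      show "continuous_on \<Omega> (\<phi> n)"
        using \<phi>(1)[of n] Ck_on_1_iff_C1[OF open_UNIV, of "\<phi> n"]
        by (intro continuous_on_subset[OF C1_continuous_on[of UNIV]]) (auto simp: test_function_def)
    qed
    show "integrable (lebesgue_on \<Omega>) (\<lambda>x. norm (trace (Gr x) * B))" using int by (rule integrable_norm)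
    show "AE x in lebesgue_on \<Omega>. (\<lambda>n. trace (Gr x) * \<phi> n x) \<longlonglongrightarrow> trace (Gr x) * \<psi> x"
      by (intro AE_I2 tendsto_mult tendsto_const \<phi>(3)) simp
    show "AE x in lebesgue_on \<Omega>. norm (trace (Gr x) * \<phi> n x) \<le> norm (trace (Gr x) * B)" for n
    proof (rule AE_I2)
      fix x assume "x \<in> space (lebesgue_on \<Omega>)"
      then have x: "x \<in> \<Omega>" by simp
      then have "\<bar>\<phi> n x\<bar> \<le> \<bar>B\<bar>" using \<phi>(2)[OF x, of n] B[of x] sub by auto
      then show "norm (trace (Gr x) * \<phi> n x) \<le> norm (trace (Gr x) * B)"
        by (simp add: abs_mult mult_left_mono)
    qed
  qed
  moreover have "(LINT x|lebesgue_on \<Omega>. trace (Gr x) * \<phi> n x) = 0" for n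
    by (rule weak_divergence_zero[OF fin u div Gr weak \<phi>(1)])
  ultimately show ?thesis by (simp add: LIMSEQ_const_iff)
qed

text \<open>With \<open>\<psi> = |u|\<^sup>2 / 2\<close> the integrand is \<open>u \<bullet> \<nabla>\<psi>\<close>.  For the smooth fields \<open>w\<^sub>k\<close> approximating \<open>u\<close> the divergence theorem gives
  \<open>\<integral> w\<^sub>k \<bullet> \<nabla>\<psi> + \<integral> (div w\<^sub>k) \<psi> = \<integral>\<^sub>\<partial> (w\<^sub>k \<bullet> n) \<psi>\<close>.  In the limit the second term becomes the integral of the trace of the weak
  gradient against \<open>\<psi>\<close>, which is zero, and the right-hand side vanishes because the trace is tangential.\<close>

lemma convection_zero:
  assumes fin: "\<And>k. finite (Z k)" and u: "\<And>c. PW Z (\<lambda>x. u (F x) $ c)"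
    and div: "AE x in lebesgue_on \<Omega>. divergence u x = 0"
    and tr: "has_trace F lo hi u g"
    and gn: "\<And>i s. AE x in face_measure F lo hi i s. g x \<bullet> unit_normal F lo hi i s x = 0"
  shows "convection_form \<Omega> u u u = 0"
proof -
  let ?\<Omega> = "lebesgue_on \<Omega>"
  let ?v = "\<lambda>c x. u (F x) $ c"
  let ?n = "unit_normal F lo hi"
  let ?\<mu> = "face_measure F lo hi"
  define psi where "psi x = (1/2) * (\<Sum>c\<in>UNIV. ?v c x * ?v c x)" for x
  have psiPW: "PW Z psi" unfolding psi_def by (intro PW_mult PW_const PW_sum u)
  \<comment> \<open>\<open>|u|\<^sup>2 / 2\<close> as a function on the closure of the physical domain\<close>
  define \<Psi> where "\<Psi> y = indicator (F ` Q) y * psi (G y)" for y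
  have \<Psi>F: "\<Psi> (F x) = psi x" if "x \<in> Q" for x using that by (simp add: \<Psi>_def)
  have cont\<Psi>: "continuous_on (F ` Q) \<Psi>"
  proof (rule continuous_on_eq)
    show "continuous_on (F ` Q) (\<lambda>y. psi (G y))"
      by (rule continuous_on_compose2[OF PW_continuous[OF psiPW] continuous_G]) auto
  qed (simp add: \<Psi>_def)
  obtain B where B: "\<And>x. x \<in> Q \<Longrightarrow> \<bar>psi x\<bar> \<le> B"
    using compact_imp_bounded[OF compact_continuous_image[OF PW_continuous[OF psiPW] compact_cbox]] by (auto simp: bounded_iff)
  have \<Psi>bd: "\<bar>\<Psi> y\<bar> \<le> \<bar>B\<bar>" for y
    using B[of "G y"] by (cases "y \<in> F ` Q") (auto simp: \<Psi>_def)
  have \<Psi>pos: "0 \<le> \<Psi> y" for y by (simp add: \<Psi>_def psi_def sum_nonneg)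
  define P where "P c y = indicator (Off Z) (G y) * phd c psi (G y)" for c y
  have PF: "P c (F x) = phd c psi x" if "x \<in> Off Z" for c x
    using that G_F[OF subsetD[OF O_subset(2) that]] by (simp add: P_def)
  have "\<exists>B. \<forall>y. \<bar>P c y\<bar> \<le> B" for c
  proof -
    obtain C where "\<And>x. x \<in> Off Z \<Longrightarrow> \<bar>phd c psi x\<bar> \<le> C" using BM_phd[OF psiPW, of c] by (auto simp: BM_iff)
    then have "\<bar>P c y\<bar> \<le> \<bar>C\<bar>" for y by (cases "G y \<in> Off Z") (auto simp: P_def intro: order_trans[OF _ abs_ge_self])
    then show ?thesis by blast
  qed
  then obtain PB where PB: "\<And>c y. \<bar>P c y\<bar> \<le> PB c" by metis
  have mP: "P c \<in> borel_measurable ?\<Omega>" for c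
    using integrable_Omega[OF fin BM_phd[OF psiPW] PF] by (rule borel_measurable_integrable)
  have sub: "\<Omega> \<subseteq> F ` Q" unfolding phys_domain_def by (rule image_mono[OF box_subset_cbox])
  have m\<Psi>: "\<Psi> \<in> borel_measurable ?\<Omega>"
    by (rule continuous_imp_measurable_on_sets_lebesgue[OF continuous_on_subset[OF cont\<Psi> sub] sets_Omega])
  obtain Gr w where Gr: "square_integrable ?\<Omega> Gr" "weak_grad \<Omega> u Gr"
    and w: "\<And>k::nat. \<exists>U. open U \<and> F ` Q \<subseteq> U \<and> Ck_on 1 (w k) U"
    and lim1: "(\<lambda>k. LINT x|?\<Omega>. (norm (w k x - u x))\<^sup>2 + (norm (grad (w k) x - Gr x))\<^sup>2) \<longlonglongrightarrow> 0"
    and lim2: "(\<lambda>k. boundary_integral F lo hi (\<lambda>n x. (norm (w k x - g x))\<^sup>2)) \<longlonglongrightarrow> 0"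
    using tr unfolding has_trace_def by blast
  obtain U where U: "\<And>k. open (U k)" "\<And>k. F ` Q \<subseteq> U k" "\<And>k. Ck_on 1 (w k) (U k)" using w by metis
  have C1w: "C1 (U k) (\<lambda>y. w k y $ c)" for k c by (rule Ck_on_1_component[OF U(1,3)])
  have wPW: "PW Z (\<lambda>x. w k (F x) $ c)" for k c by (rule PW_comp_F[OF U(1,2) C1w])
  have gradw: "grad (w k) y $ a $ c = pd a (\<lambda>y. w k y $ c) y" if "y \<in> U k" for k y a c
    by (rule C1_vector_has_derivative(2)[OF C1_differentiable[OF C1w that]])
  have sq_u: "square_integrable ?\<Omega> u" using tr by (simp add: has_trace_def H1_def)
  have cw: "continuous_on (F ` Q) (w k)" for k
  proof -
    have "continuous_on (F ` Q) (\<lambda>y. \<chi> c. w k y $ c)"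
      by (rule continuous_on_vec_lambda) (rule continuous_on_subset[OF C1_continuous_on[OF C1w] U(2)])
    then show ?thesis by simp
  qed
  have cg: "continuous_on (F ` Q) (grad (w k))" for k
  proof -
    have "continuous_on (F ` Q) (\<lambda>y. \<chi> a c. pd a (\<lambda>y. w k y $ c) y)"
      by (intro continuous_on_vec_lambda) (rule continuous_on_subset[OF C1_continuous_pd[OF C1w] U(2)])
    then show ?thesis
      by (rule continuous_on_eq) (use U(2)[of k] gradw in \<open>auto simp: vec_eq_iff subset_iff\<close>)
  qed
  have sq_cont: "square_integrable ?\<Omega> f" if f: "continuous_on (F ` Q) f" for f :: "real^'d \<Rightarrow> 'z::euclidean_space"
  proof -
    have m: "f \<in> borel_measurable ?\<Omega>"
      by (rule continuous_imp_measurable_on_sets_lebesgue[OF continuous_on_subset[OF f sub] sets_Omega])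
    have "bounded (f ` F ` Q)" by (intro compact_imp_bounded compact_continuous_image f compact_FQ)
    then obtain C where C: "\<And>x. x \<in> F ` Q \<Longrightarrow> norm (f x) \<le> C" by (auto simp: bounded_iff)
    have "integrable ?\<Omega> (\<lambda>x. (norm (f x))\<^sup>2)"
    proof (rule finite_measure.integrable_const_bound[OF finite_measure_Omega, where B="C\<^sup>2"])
      show "AE x in ?\<Omega>. norm ((norm (f x))\<^sup>2) \<le> C\<^sup>2"
        using C sub by (intro AE_I2) (auto intro!: power_mono)
    qed (use m in simp)
    then show ?thesis using m by (simp add: square_integrable_def)
  qed
  define E where "E k x = (norm (w k x - u x))\<^sup>2 + (norm (grad (w k) x - Gr x))\<^sup>2" for k x
  have intE: "integrable ?\<Omega> (E k)" for k
    unfolding E_def using sq_cont[OF cw] sq_cont[OF cg] sq_u Gr(1)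
    by (intro Bochner_Integration.integrable_add integrable_norm_diff_square) (auto simp: square_integrable_def)
  have limE: "(\<lambda>k. \<integral>x. E k x \<partial>?\<Omega>) \<longlonglongrightarrow> 0" using lim1 by (simp add: E_def)
  have mGr: "(\<lambda>x. Gr x $ a $ c) \<in> borel_measurable ?\<Omega>" "(\<lambda>x. u x $ c) \<in> borel_measurable ?\<Omega>" for a c
    using Gr(1) sq_u by (auto simp: square_integrable_def intro: borel_measurable_matrix_component borel_measurable_component)
  have mw: "(\<lambda>x. grad (w k) x $ a $ c) \<in> borel_measurable ?\<Omega>" "(\<lambda>x. w k x $ c) \<in> borel_measurable ?\<Omega>" for k a c
    using sq_cont[OF cw] sq_cont[OF cg] by (auto simp: square_integrable_def intro: borel_measurable_matrix_component borel_measurable_component)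
  have sqM: "integrable ?\<Omega> (\<lambda>x. trace (A x) * \<Psi> x)" if A: "square_integrable ?\<Omega> A" for A :: "real^'d \<Rightarrow> real^'d^'d"
  proof (rule integrable_mult_bounded[OF finite_measure_Omega _ m\<Psi>, where B="\<bar>B\<bar>" and e="\<lambda>x. (real CARD('d))\<^sup>2 * (norm (A x))\<^sup>2"])
    show "(\<lambda>x. trace (A x)) \<in> borel_measurable ?\<Omega>" unfolding trace_def
      using A by (intro borel_measurable_sum borel_measurable_matrix_component) (simp add: square_integrable_def)
    show "(trace (A x))\<^sup>2 \<le> (real CARD('d))\<^sup>2 * (norm (A x))\<^sup>2" for x
      using power_mono[OF trace_diff_le[of "A x" 0], of 2] by (simp add: power_mult_distrib)
    show "integrable ?\<Omega> (\<lambda>x. (real CARD('d))\<^sup>2 * (norm (A x))\<^sup>2)"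
      using A by (simp add: square_integrable_def)
  qed (rule \<Psi>bd)
  have sqV: "integrable ?\<Omega> (\<lambda>x. A x $ c * P c x)" if A: "square_integrable ?\<Omega> A" for A :: "real^'d \<Rightarrow> real^'d" and c
  proof (rule integrable_mult_bounded[OF finite_measure_Omega _ mP, where B="PB c" and e="\<lambda>x. (norm (A x))\<^sup>2"])
    show "(\<lambda>x. A x $ c) \<in> borel_measurable ?\<Omega>"
      using A by (intro borel_measurable_component) (simp add: square_integrable_def)
    show "(A x $ c)\<^sup>2 \<le> (norm (A x))\<^sup>2" for x
      using power_mono[OF component_le_norm_cart[of "A x" c], of 2] by simp
    show "integrable ?\<Omega> (\<lambda>x. (norm (A x))\<^sup>2)" using A by (simp add: square_integrable_def)
  qed (rule PB)
  define a where "a k = (\<integral>x. trace (grad (w k) x) * \<Psi> x \<partial>?\<Omega>)" for k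
  define b where "b k c = (\<integral>x. w k x $ c * P c x \<partial>?\<Omega>)" for k c
  have lima: "a \<longlonglongrightarrow> (\<integral>x. trace (Gr x) * \<Psi> x \<partial>?\<Omega>)"
  proof -
    have "(\<lambda>k. \<integral>x. trace (grad (w k) x - Gr x) * \<Psi> x \<partial>?\<Omega>) \<longlonglongrightarrow> 0"
    proof (rule integral_tendsto_0_of_square[OF finite_measure_Omega _ m\<Psi>, where B="\<bar>B\<bar>" and e="\<lambda>k x. (real CARD('d))\<^sup>2 * E k x"])
      show "(\<lambda>x. trace (grad (w k) x - Gr x)) \<in> borel_measurable ?\<Omega>" for k
        unfolding trace_def vector_minus_component by (intro borel_measurable_sum borel_measurable_diff mGr mw)
      show "(trace (grad (w k) x - Gr x))\<^sup>2 \<le> (real CARD('d))\<^sup>2 * E k x" for k x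
      proof -
        have "(trace (grad (w k) x - Gr x))\<^sup>2 \<le> (real CARD('d))\<^sup>2 * (norm (grad (w k) x - Gr x))\<^sup>2"
          using power_mono[OF trace_diff_le[of "grad (w k) x" "Gr x"], of 2] by (simp add: power_mult_distrib)
        also have "\<dots> \<le> (real CARD('d))\<^sup>2 * E k x" unfolding E_def by (intro mult_left_mono) auto
        finally show ?thesis .
      qed
      show "integrable ?\<Omega> (\<lambda>x. (real CARD('d))\<^sup>2 * E k x)" for k by (intro integrable_mult_right intE)
      show "(\<lambda>k. \<integral>x. (real CARD('d))\<^sup>2 * E k x \<partial>?\<Omega>) \<longlonglongrightarrow> 0"
        using tendsto_mult_right[OF limE, of "(real CARD('d))\<^sup>2"] by simp
    qed (rule \<Psi>bd)
    moreover have "(\<integral>x. trace (grad (w k) x - Gr x) * \<Psi> x \<partial>?\<Omega>) = a k - (\<integral>x. trace (Gr x) * \<Psi> x \<partial>?\<Omega>)" for k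
      unfolding a_def trace_sub left_diff_distrib
      by (rule Bochner_Integration.integral_diff[OF sqM[OF sq_cont[OF cg]] sqM[OF Gr(1)]])
    ultimately show ?thesis using LIM_zero_cancel[of a] by simp
  qed
  have limb: "(\<lambda>k. b k c) \<longlonglongrightarrow> (\<integral>x. u x $ c * P c x \<partial>?\<Omega>)" for c
  proof -
    have "(\<lambda>k. \<integral>x. (w k x - u x) $ c * P c x \<partial>?\<Omega>) \<longlonglongrightarrow> 0"
    proof (rule integral_tendsto_0_of_square[OF finite_measure_Omega _ mP _ _ intE limE, where B="PB c"])
      show "(\<lambda>x. (w k x - u x) $ c) \<in> borel_measurable ?\<Omega>" for k
        unfolding vector_minus_component by (intro borel_measurable_diff mGr mw)
      show "((w k x - u x) $ c)\<^sup>2 \<le> E k x" for k x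
      proof -
        have "((w k x - u x) $ c)\<^sup>2 \<le> (norm (w k x - u x))\<^sup>2"
          using power_mono[OF component_le_norm_cart[of "w k x - u x" c], of 2] by simp
        then show ?thesis by (simp add: E_def add_increasing2)
      qed
    qed (rule PB)
    moreover have "(\<integral>x. (w k x - u x) $ c * P c x \<partial>?\<Omega>) = b k c - (\<integral>x. u x $ c * P c x \<partial>?\<Omega>)" for k
      unfolding b_def vector_minus_component left_diff_distrib
      by (rule Bochner_Integration.integral_diff[OF sqV[OF sq_cont[OF cw]] sqV[OF sq_u]])
    ultimately show ?thesis using LIM_zero_cancel[of "\<lambda>k. b k c"] by simp
  qed
  define bd where "bd k i s = (\<integral>x. (w k x \<bullet> ?n i s x) * \<Psi> x \<partial>?\<mu> i s)" for k i s
  have contV: "continuous_on Q (\<lambda>x. \<Sum>c\<in>UNIV. (w k (F x) $ c * psi x) * nrm i s x $ c)" for k i s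
    by (intro continuous_on_sum continuous_on_mult PW_continuous[OF wPW] PW_continuous[OF psiPW] continuous_nrm)
  have bd: "bd k i s = fint i s (\<lambda>x. \<Sum>c\<in>UNIV. (w k (F x) $ c * psi x) * nrm i s x $ c)" for k i s
    unfolding bd_def
    by (rule integral_face_measure_continuous[OF contV])
      (simp add: unit_normal_F \<Psi>F inner_vec_def sum_distrib_right sum_distrib_left mult_ac)
  have ab: "a k + (\<Sum>c\<in>UNIV. b k c) = (\<Sum>i\<in>UNIV. \<Sum>s\<in>UNIV. bd k i s)" for k
  proof -
    have "(\<Sum>i\<in>UNIV. \<Sum>s\<in>UNIV. bd k i s) = vint Z (\<lambda>x. \<Sum>c\<in>UNIV. phd c (\<lambda>x. w k (F x) $ c * psi x) x)"
      unfolding bd using divergence_theorem[where V="\<lambda>c x. w k (F x) $ c * psi x", OF fin PW_mult[OF wPW psiPW]] by simp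
    also have "\<dots> = vint Z (\<lambda>x. (\<Sum>c\<in>UNIV. phd c (\<lambda>x. w k (F x) $ c) x) * psi x + (\<Sum>c\<in>UNIV. w k (F x) $ c * phd c psi x))"
    proof (rule vint_cong)
      fix x assume x: "x \<in> Off Z"
      show "(\<Sum>c\<in>UNIV. phd c (\<lambda>x. w k (F x) $ c * psi x) x) =
         (\<Sum>c\<in>UNIV. phd c (\<lambda>x. w k (F x) $ c) x) * psi x + (\<Sum>c\<in>UNIV. w k (F x) $ c * phd c psi x)"
        by (simp add: phd_mult[OF PW_differentiable[OF wPW x] PW_differentiable[OF psiPW x]] sum.distrib sum_distrib_right)
    qed
    also have "\<dots> = vint Z (\<lambda>x. (\<Sum>c\<in>UNIV. phd c (\<lambda>x. w k (F x) $ c) x) * psi x) + vint Z (\<lambda>x. \<Sum>c\<in>UNIV. w k (F x) $ c * phd c psi x)"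
      by (intro vint_add[OF fin] BM_mult BM_sum BM_phd wPW psiPW PW_BM[OF wPW] PW_BM[OF psiPW])
    also have "vint Z (\<lambda>x. (\<Sum>c\<in>UNIV. phd c (\<lambda>x. w k (F x) $ c) x) * psi x) = a k"
      unfolding a_def
    proof (rule integral_Omega[symmetric, OF fin])
      show "BM Z (\<lambda>x. (\<Sum>c\<in>UNIV. phd c (\<lambda>x. w k (F x) $ c) x) * psi x)"
        by (intro BM_mult BM_sum BM_phd wPW PW_BM[OF psiPW])
      show "trace (grad (w k) (F x)) * \<Psi> (F x) = (\<Sum>c\<in>UNIV. phd c (\<lambda>x. w k (F x) $ c) x) * psi x" if "x \<in> Off Z" for x
      proof -
        have x: "x \<in> Q" using that O_subset(2) by blast
        then have "F x \<in> U k" using U(2) by blast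
        then show ?thesis
          by (simp add: trace_def gradw phd_comp_F[OF U(1,2) C1w x] \<Psi>F[OF x])
      qed
    qed
    also have "vint Z (\<lambda>x. \<Sum>c\<in>UNIV. w k (F x) $ c * phd c psi x) = (\<Sum>c\<in>UNIV. vint Z (\<lambda>x. w k (F x) $ c * phd c psi x))"
      by (intro vint_sum[OF fin] BM_mult BM_phd psiPW PW_BM[OF wPW])
    also have "\<dots> = (\<Sum>c\<in>UNIV. b k c)"
      unfolding b_def
      by (intro sum.cong refl integral_Omega[symmetric, OF fin] BM_mult BM_phd psiPW PW_BM[OF wPW]) (simp add: PF)
    finally show ?thesis by simp
  qed
  have limbd: "(\<lambda>k. bd k i s) \<longlonglongrightarrow> 0" for i s
  proof -
    have mN: "(\<lambda>x. ?n i s x $ c) \<in> borel_measurable (?\<mu> i s)" for c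
      using integrable_face_measure_continuous[OF continuous_nrm[of i s c], of "\<lambda>x. ?n i s x $ c"] unit_normal_F
      by (intro borel_measurable_integrable) auto
    have mwf: "(\<lambda>x. w k x $ c) \<in> borel_measurable (?\<mu> i s)" for k c
      using integrable_face_measure_continuous[OF PW_continuous[OF wPW[of k c]], of "\<lambda>x. w k x $ c"]
      by (intro borel_measurable_integrable) auto
    have m\<Psi>f: "\<Psi> \<in> borel_measurable (?\<mu> i s)"
      using integrable_face_measure_continuous[OF PW_continuous[OF psiPW], of \<Psi>] \<Psi>F
      by (intro borel_measurable_integrable) auto
    have g: "square_integrable (?\<mu> i s) g" using tr by (simp add: has_trace_def)
    then have mg: "(\<lambda>x. g x $ c) \<in> borel_measurable (?\<mu> i s)" for c
      by (intro borel_measurable_component) (simp add: square_integrable_def)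
    have mwv: "w k \<in> borel_measurable (?\<mu> i s)" for k
      using borel_measurable_vec_lambda[of "\<lambda>x c. w k x $ c", OF mwf[of k]] by simp
    have iw: "integrable (?\<mu> i s) (\<lambda>x. (norm (w k x))\<^sup>2)" for k
    proof (rule integrable_face_measure_continuous)
      show "continuous_on Q (\<lambda>x. (norm (w k (F x)))\<^sup>2)"
        by (intro continuous_intros continuous_on_compose2[OF cw continuous_F_Q]) auto
    qed simp
    define e where "e k x = (norm (w k x - g x))\<^sup>2" for k x
    have ie: "integrable (?\<mu> i s) (e k)" for k
      unfolding e_def using g mwv iw by (intro integrable_norm_diff_square) (auto simp: square_integrable_def)
    have lime: "(\<lambda>k. \<integral>x. e k x \<partial>?\<mu> i s) \<longlonglongrightarrow> 0"
    proof (rule real_tendsto_sandwich[OF _ _ tendsto_const lim2])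
      show "\<forall>\<^sub>F k in sequentially. 0 \<le> (\<integral>x. e k x \<partial>?\<mu> i s)"
        by (intro always_eventually allI integral_nonneg_AE AE_I2) (simp add: e_def)
      have "(\<integral>x. e k x \<partial>?\<mu> i s) \<le> boundary_integral F lo hi (\<lambda>n x. (norm (w k x - g x))\<^sup>2)" for k
      proof -
        have pos: "0 \<le> (\<integral>x. (norm (w k x - g x))\<^sup>2 \<partial>?\<mu> i s)" for i s
          by (intro integral_nonneg_AE AE_I2) simp
        have "(\<integral>x. (norm (w k x - g x))\<^sup>2 \<partial>?\<mu> i s) \<le> (\<Sum>s\<in>UNIV. \<integral>x. (norm (w k x - g x))\<^sup>2 \<partial>?\<mu> i s)"
          by (rule member_le_sum) (use pos in auto)
        also have "\<dots> \<le> (\<Sum>i\<in>UNIV. \<Sum>s\<in>UNIV. \<integral>x. (norm (w k x - g x))\<^sup>2 \<partial>?\<mu> i s)"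
          by (rule member_le_sum[where f="\<lambda>i. \<Sum>s\<in>UNIV. \<integral>x. (norm (w k x - g x))\<^sup>2 \<partial>?\<mu> i s"])
            (use pos in \<open>auto intro: sum_nonneg\<close>)
        finally show ?thesis by (simp add: e_def boundary_integral_def)
      qed
      then show "\<forall>\<^sub>F k in sequentially. (\<integral>x. e k x \<partial>?\<mu> i s) \<le> boundary_integral F lo hi (\<lambda>n x. (norm (w k x - g x))\<^sup>2)"
        by (intro always_eventually allI)
    qed
    have mq: "(\<lambda>x. (w k x - g x) \<bullet> ?n i s x) \<in> borel_measurable (?\<mu> i s)" for k
      unfolding inner_vec_def vector_minus_component inner_real_def
      by (intro borel_measurable_sum borel_measurable_times borel_measurable_diff mwf mg mN)
    have "(\<lambda>k. \<integral>x. ((w k x - g x) \<bullet> ?n i s x) * \<Psi> x \<partial>?\<mu> i s) \<longlonglongrightarrow> 0"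
    proof (rule integral_tendsto_0_of_square[OF finite_measure_face mq m\<Psi>f _ _ ie lime])
      show "((w k x - g x) \<bullet> ?n i s x)\<^sup>2 \<le> e k x" for k x
      proof -
        have "\<bar>(w k x - g x) \<bullet> ?n i s x\<bar> \<le> norm (w k x - g x) * norm (?n i s x)" by (rule Cauchy_Schwarz_ineq2)
        also have "\<dots> \<le> norm (w k x - g x)" using norm_unit_normal[of i s x] by (simp add: mult_left_le)
        finally have "\<bar>(w k x - g x) \<bullet> ?n i s x\<bar>\<^sup>2 \<le> (norm (w k x - g x))\<^sup>2" by (intro power_mono) auto
        then show ?thesis by (simp add: e_def)
      qed
    qed (rule \<Psi>bd)
    moreover have "(\<integral>x. ((w k x - g x) \<bullet> ?n i s x) * \<Psi> x \<partial>?\<mu> i s) = bd k i s" for k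
      unfolding bd_def
    proof (rule integral_cong_AE)
      show "(\<lambda>x. (w k x - g x) \<bullet> ?n i s x * \<Psi> x) \<in> borel_measurable (?\<mu> i s)"
        by (intro borel_measurable_times mq m\<Psi>f)
      show "(\<lambda>x. (w k x \<bullet> ?n i s x) * \<Psi> x) \<in> borel_measurable (?\<mu> i s)"
        unfolding inner_vec_def inner_real_def
        by (intro borel_measurable_times borel_measurable_sum mwf mN m\<Psi>f)
      show "AE x in ?\<mu> i s. (w k x - g x) \<bullet> ?n i s x * \<Psi> x = (w k x \<bullet> ?n i s x) * \<Psi> x"
        using gn[of i s] by eventually_elim (simp add: inner_diff_left)
    qed
    ultimately show ?thesis by simp
  qed
  have lim0: "(\<lambda>k. a k + (\<Sum>c\<in>UNIV. b k c)) \<longlonglongrightarrow> (\<Sum>i\<in>(UNIV::'d set). \<Sum>s\<in>(UNIV::bool set). 0)"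
    unfolding ab by (intro tendsto_sum limbd)
  have lim1': "(\<lambda>k. a k + (\<Sum>c\<in>UNIV. b k c)) \<longlonglongrightarrow>
      (\<integral>x. trace (Gr x) * \<Psi> x \<partial>?\<Omega>) + (\<Sum>c\<in>UNIV. \<integral>x. u x $ c * P c x \<partial>?\<Omega>)"
    by (intro tendsto_add tendsto_sum lima limb)
  have "(\<integral>x. trace (Gr x) * \<Psi> x \<partial>?\<Omega>) + (\<Sum>c\<in>UNIV. \<integral>x. u x $ c * P c x \<partial>?\<Omega>) = 0"
    using LIMSEQ_unique[OF lim1' lim0] by simp
  moreover have "(\<integral>x. trace (Gr x) * \<Psi> x \<partial>?\<Omega>) = 0"
    by (rule trace_Gr_orthogonal[OF fin u div Gr cont\<Psi>]) (rule \<Psi>pos)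
  ultimately have zero: "(\<Sum>c\<in>UNIV. \<integral>x. u x $ c * P c x \<partial>?\<Omega>) = 0" by simp
  have bm: "BM Z (\<lambda>x. ?v c x * phd c psi x)" for c by (intro BM_mult BM_phd psiPW PW_BM[OF u])
  have "(\<Sum>c\<in>UNIV. \<integral>x. u x $ c * P c x \<partial>?\<Omega>) = (\<Sum>c\<in>UNIV. vint Z (\<lambda>x. ?v c x * phd c psi x))"
    by (intro sum.cong refl integral_Omega[OF fin bm]) (simp add: PF)
  also have "\<dots> = vint Z (\<lambda>x. \<Sum>c\<in>UNIV. ?v c x * phd c psi x)" by (rule vint_sum[symmetric, OF fin bm])
  also have "\<dots> = (LINT x|?\<Omega>. outer (u x) (u x) \<bullet> grad u x)"
  proof (rule integral_Omega[symmetric, OF fin BM_sum[OF bm]])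
    fix x assume x: "x \<in> Off Z"
    note d = PW_differentiable[OF u x]
    have "phd a psi x = (\<Sum>c\<in>UNIV. ?v c x * phd a (?v c) x)" for a
    proof -
      have "phd a psi x = (1/2) * phd a (\<lambda>x. \<Sum>c\<in>UNIV. ?v c x * ?v c x) x"
        unfolding psi_def by (rule phd_cmult) (rule PW_differentiable[OF PW_sum[OF PW_mult[OF u u]] x])
      also have "phd a (\<lambda>x. \<Sum>c\<in>UNIV. ?v c x * ?v c x) x = (\<Sum>c\<in>UNIV. phd a (\<lambda>x. ?v c x * ?v c x) x)"
        by (rule phd_sum) (rule PW_differentiable[OF PW_mult[OF u u] x])
      also have "\<dots> = (\<Sum>c\<in>UNIV. 2 * (?v c x * phd a (?v c) x))"
        by (intro sum.cong refl) (simp add: phd_mult[OF d d])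
      finally show ?thesis by (simp add: sum_distrib_left[symmetric])
    qed
    then show "outer (u (F x)) (u (F x)) \<bullet> grad u (F x) = (\<Sum>c\<in>UNIV. ?v c x * phd c psi x)"
      by (simp add: inner_matrix outer_def grad_F[OF fin u x] sum_distrib_left mult.assoc)
  qed
  finally show ?thesis using zero by (simp add: convection_form_def)
qed

end

section \<open>An inequality of Korn type\<close>

context curved_box
begin

text \<open>Bounded Borel functions on the closed box.  Unlike continuous ones they include integrands that are given facet by facet.\<close>

definition FM :: "(real^'d \<Rightarrow> real) \<Rightarrow> bool" where
  "FM g \<longleftrightarrow> (\<lambda>x. indicator Q x * g x) \<in> borel_measurable borel \<and> (\<exists>B. \<forall>x\<in>Q. \<bar>g x\<bar> \<le> B)"

lemma FM_continuous: assumes "continuous_on Q g" shows "FM g"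
proof -
  have "bounded (g ` Q)" by (intro compact_imp_bounded compact_continuous_image assms compact_cbox)
  then show ?thesis unfolding FM_def
    using borel_measurable_continuous_on_indicator[OF _ assms] by (auto simp: bounded_iff)
qed

lemma FM_PW: "PW Z g \<Longrightarrow> FM g" by (rule FM_continuous[OF PW_continuous])

lemma FM_const [simp]: "FM (\<lambda>x. c)" by (rule FM_continuous[OF continuous_on_const])

lemma FM_mult: assumes "FM f" "FM g" shows "FM (\<lambda>x. f x * g x)"
proof -
  obtain A B where AB: "\<And>x. x \<in> Q \<Longrightarrow> \<bar>f x\<bar> \<le> A" "\<And>x. x \<in> Q \<Longrightarrow> \<bar>g x\<bar> \<le> B"
    using assms by (auto simp: FM_def)
  have "(\<lambda>x. (indicator Q x * f x) * (indicator Q x * g x)) \<in> borel_measurable borel"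
    by (rule borel_measurable_times[OF conjunct1[OF assms(1)[unfolded FM_def]] conjunct1[OF assms(2)[unfolded FM_def]]])
  moreover have "(indicator Q x * f x) * (indicator Q x * g x) = indicator Q x * (f x * g x)" for x
    by (auto simp: indicator_def)
  moreover have "\<bar>f x * g x\<bar> \<le> A * B" if "x \<in> Q" for x
    using AB[OF that] unfolding abs_mult by (intro mult_mono) auto
  ultimately show ?thesis by (auto simp: FM_def)
qed

lemma FM_add: assumes "FM f" "FM g" shows "FM (\<lambda>x. f x + g x)"
proof -
  obtain A B where AB: "\<And>x. x \<in> Q \<Longrightarrow> \<bar>f x\<bar> \<le> A" "\<And>x. x \<in> Q \<Longrightarrow> \<bar>g x\<bar> \<le> B"
    using assms by (auto simp: FM_def)
  have "(\<lambda>x. indicator Q x * f x + indicator Q x * g x) \<in> borel_measurable borel"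
    using assms unfolding FM_def by (intro borel_measurable_add) auto
  moreover have "\<bar>f x + g x\<bar> \<le> A + B" if "x \<in> Q" for x
    using AB[OF that] by (intro order_trans[OF abs_triangle_ineq add_mono])
  ultimately show ?thesis by (auto simp: FM_def distrib_left)
qed

lemma FM_sum: "(\<And>a. a \<in> I \<Longrightarrow> FM (f a)) \<Longrightarrow> FM (\<lambda>x. \<Sum>a\<in>I. f a x)"
  by (induction I rule: infinite_finite_induct) (auto intro: FM_add)

lemma FM_power: "FM f \<Longrightarrow> FM (\<lambda>x. f x ^ n)"
  by (induction n) (auto intro: FM_mult)

lemma FM_indicator: "A \<in> sets borel \<Longrightarrow> FM (\<lambda>x. indicator A x)"
  unfolding FM_def by (intro conjI borel_measurable_times borel_measurable_indicator) (auto simp: indicator_def intro!: exI[of _ 1])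

lemma integrable_FM:
  assumes "FM g"
  shows "integrable (slice_measure i) (\<lambda>y. indicator (face i) y * g (face_point i (end_coord i s) y))"
proof -
  obtain B where "\<And>x. x \<in> Q \<Longrightarrow> \<bar>g x\<bar> \<le> B" using assms by (auto simp: FM_def)
  then show ?thesis by (rule integrable_face[OF conjunct1[OF assms[unfolded FM_def]]])
qed

lemma FM_dens: "FM (dens i)" by (rule FM_continuous[OF continuous_dens])

lemma integrable_fint:
  "FM g \<Longrightarrow> integrable (slice_measure i) (\<lambda>y. indicator (face i) y *
     (dens i (face_point i (end_coord i s) y) * g (face_point i (end_coord i s) y)))"
  by (rule integrable_FM[OF FM_mult[OF FM_dens]])

lemma fint_mono:
  assumes fin: "\<And>k. finite (Z k)" and f: "FM f" and g: "FM g"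
    and le: "\<And>y. y \<in> face i \<Longrightarrow> (\<And>k. k \<noteq> i \<Longrightarrow> y k \<notin> Z k) \<Longrightarrow>
      f (face_point i (end_coord i s) y) \<le> g (face_point i (end_coord i s) y)"
  shows "fint i s f \<le> fint i s g"
  unfolding fint_def
proof (rule integral_mono_AE[OF integrable_fint[OF f] integrable_fint[OF g]])
  have "AE y in slice_measure i. \<forall>k. k \<noteq> i \<longrightarrow> y k \<notin> Z k" by (rule AE_slice_coordinates[OF fin])
  then show "AE y in slice_measure i.
    indicator (face i) y * (dens i (face_point i (end_coord i s) y) * f (face_point i (end_coord i s) y))
    \<le> indicator (face i) y * (dens i (face_point i (end_coord i s) y) * g (face_point i (end_coord i s) y))"
  proof eventually_elim
    case (elim y)
    show ?case
    proof (cases "y \<in> face i")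
      case True
      have "f (face_point i (end_coord i s) y) \<le> g (face_point i (end_coord i s) y)"
        by (rule le[OF True]) (use elim in blast)
      from mult_left_mono[OF this dens_nonneg] show ?thesis
        by (simp only: indicator_simps(1)[OF True] mult_1)
    qed simp
  qed
qed

lemma fint_nonneg: "(\<And>x. x \<in> Q \<Longrightarrow> 0 \<le> g x) \<Longrightarrow> 0 \<le> fint i s g"
proof -
  assume g: "\<And>x. x \<in> Q \<Longrightarrow> 0 \<le> g x"
  have "0 \<le> indicator (face i) y * (dens i (face_point i (end_coord i s) y) * g (face_point i (end_coord i s) y))" for y
  proof (cases "y \<in> face i")
    case True
    from mult_nonneg_nonneg[OF dens_nonneg g[OF face_point_end_Q[OF True, of s]]]
    show ?thesis by (simp only: indicator_simps(1)[OF True] mult_1)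
  qed simp
  then show ?thesis unfolding fint_def by (intro integral_nonneg_AE AE_I2)
qed

lemma fint_cmult: "fint i s (\<lambda>x. c * g x) = c * fint i s g"
proof -
  have "indicator (face i) y * (dens i (face_point i (end_coord i s) y) * (c * g (face_point i (end_coord i s) y)))
    = c * (indicator (face i) y * (dens i (face_point i (end_coord i s) y) * g (face_point i (end_coord i s) y)))" for y
    by simp
  then show ?thesis unfolding fint_def by (simp only: integral_mult_right_zero)
qed

lemma fint_add: "FM f \<Longrightarrow> FM g \<Longrightarrow> fint i s (\<lambda>x. f x + g x) = fint i s f + fint i s g"
  unfolding fint_def distrib_left
  by (intro Bochner_Integration.integral_add integrable_fint)

definition sgrad :: "('d \<Rightarrow> real^'d \<Rightarrow> real) \<Rightarrow> 'd \<Rightarrow> 'd \<Rightarrow> real^'d \<Rightarrow> real" where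
  "sgrad v a c x = (phd a (v c) x + phd c (v a) x) / 2"

lemma BM_sgrad: "(\<And>c. PW Z (v c)) \<Longrightarrow> BM Z (sgrad v a c)"
proof -
  assume v: "\<And>c. PW Z (v c)"
  have "BM Z (\<lambda>x. (1/2) * (phd a (v c) x + phd c (v a) x))" by (intro BM_mult BM_const BM_add BM_phd v)
  then show ?thesis by (rule BM_cong) (simp add: sgrad_def)
qed

text \<open>Integrate the divergence of \<open>V = (x \<bullet> v) v + |v|\<^sup>2 x / 2\<close>.  In it the full gradient of \<open>v\<close> appears only in the
  combination \<open>x\<^sub>a v\<^sub>c (\<partial>\<^sub>c v\<^sub>a + \<partial>\<^sub>a v\<^sub>c)\<close>, that is, through the symmetric gradient, and in the divergence, which is zero.  The remaining
  term is a positive multiple of \<open>|v|\<^sup>2\<close>.  The constant depends only on the dimension and the size of the domain.\<close>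

lemma korn_inequality:
  "\<exists>C>0. \<forall>Z v. (\<forall>k. finite (Z k)) \<longrightarrow> (\<forall>c. PW Z (v c)) \<longrightarrow>
     (\<forall>f. BM Z f \<longrightarrow> vint Z (\<lambda>x. (\<Sum>a\<in>UNIV. phd a (v a) x) * f x) = 0) \<longrightarrow>
     vint Z (\<lambda>x. \<Sum>c\<in>UNIV. (v c x)\<^sup>2) \<le>
       C * (vint Z (\<lambda>x. \<Sum>a\<in>UNIV. \<Sum>c\<in>UNIV. (sgrad v a c x)\<^sup>2)
          + (\<Sum>i\<in>UNIV. \<Sum>s\<in>UNIV. fint i s (\<lambda>x. \<Sum>c\<in>UNIV. (v c x)\<^sup>2)))"
proof -
  have "bounded (F ` Q)" by (rule compact_imp_bounded[OF compact_FQ])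
  then obtain R0 where R0: "\<And>x. x \<in> Q \<Longrightarrow> norm (F x) \<le> R0" by (auto simp: bounded_iff)
  define R where "R = max 1 R0"
  have R: "R \<ge> 1" "\<And>x. x \<in> Q \<Longrightarrow> norm (F x) \<le> R" using R0 by (auto simp: R_def intro: max.coboundedI2)
  define n where "n = real CARD('d)"
  have n: "n \<ge> 1" using zero_less_card_finite[where 'a='d] by (simp add: n_def Suc_le_eq)
  define C where "C = 2 * n * R\<^sup>2 + 2 * R"
  have korn: "vint Z (\<lambda>x. \<Sum>c\<in>UNIV. (v c x)\<^sup>2) \<le>
       C * (vint Z (\<lambda>x. \<Sum>a\<in>UNIV. \<Sum>c\<in>UNIV. (sgrad v a c x)\<^sup>2)
          + (\<Sum>i\<in>UNIV. \<Sum>s\<in>UNIV. fint i s (\<lambda>x. \<Sum>c\<in>UNIV. (v c x)\<^sup>2)))"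
    if fin: "\<And>k. finite (Z k)" and v: "\<And>c. PW Z (v c)"
      and div: "\<And>f. BM Z f \<Longrightarrow> vint Z (\<lambda>x. (\<Sum>a\<in>UNIV. phd a (v a) x) * f x) = 0" for Z v
  proof -
    let ?X = "\<lambda>a x. F x $ a"
    define q where "q x = (\<Sum>c\<in>UNIV. (v c x)\<^sup>2)" for x
    define p where "p x = (\<Sum>a\<in>UNIV. ?X a x * v a x)" for x
    define s2 where "s2 x = (\<Sum>a\<in>UNIV. \<Sum>c\<in>UNIV. (sgrad v a c x)\<^sup>2)" for x
    have X: "PW Z (?X a)" for a by (rule PW_C1S[OF C1_F])
    have qPW: "PW Z q" unfolding q_def by (intro PW_sum PW_power v)
    have pPW: "PW Z p" unfolding p_def by (intro PW_sum PW_mult v X)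
    \<comment> \<open>the multiplier field \<open>(x \<bullet> v) v + |v|\<^sup>2 x / 2\<close> in parametric coordinates\<close>
    define V where "V c x = p x * v c x + (1/2) * (q x * ?X c x)" for c x
    have V: "PW Z (V c)" for c unfolding V_def by (intro PW_add PW_mult PW_const pPW v qPW X)
    have s2B: "BM Z s2" unfolding s2_def by (intro BM_sum BM_power BM_sgrad v)
    have divV: "(\<Sum>c\<in>UNIV. phd c (V c) x) = (1 + n / 2) * q x
        + 2 * (\<Sum>a\<in>UNIV. \<Sum>c\<in>UNIV. ?X a x * v c x * sgrad v a c x) + (\<Sum>c\<in>UNIV. phd c (v c) x) * p x"
      if x: "x \<in> Off Z" for x
    proof -
      have xS: "x \<in> S" using x O_subset(3) by blast
      note d = PW_differentiable[OF v x] PW_differentiable[OF X x] PW_differentiable[OF qPW x] PW_differentiable[OF pPW x]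
      have dp: "phd c p x = v c x + (\<Sum>a\<in>UNIV. ?X a x * phd c (v a) x)" for c
      proof -
        have "phd c p x = (\<Sum>a\<in>UNIV. phd c (\<lambda>x. ?X a x * v a x) x)"
          unfolding p_def by (rule phd_sum) (rule PW_differentiable[OF PW_mult[OF X v] x])
        also have "\<dots> = (\<Sum>a\<in>UNIV. (if c = a then v a x else 0) + ?X a x * phd c (v a) x)"
          by (intro sum.cong refl) (simp add: phd_mult[OF d(2) d(1)] phd_F[OF xS])
        finally show ?thesis by (simp add: sum.distrib)
      qed
      have dq: "phd c q x = 2 * (\<Sum>a\<in>UNIV. v a x * phd c (v a) x)" for c
      proof -
        have "phd c q x = (\<Sum>a\<in>UNIV. phd c (\<lambda>x. v a x * v a x) x)"
          unfolding q_def power2_eq_square by (rule phd_sum) (rule PW_differentiable[OF PW_mult[OF v v] x])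
        then show ?thesis by (simp add: phd_mult[OF d(1) d(1)] sum_distrib_left mult.commute)
      qed
      have dV: "phd c (V c) x = (v c x)\<^sup>2 + (\<Sum>a\<in>UNIV. ?X a x * v c x * phd c (v a) x) + p x * phd c (v c) x
         + (\<Sum>a\<in>UNIV. ?X c x * v a x * phd c (v a) x) + (1/2) * q x" for c
      proof -
        have "phd c (V c) x = phd c (\<lambda>x. p x * v c x) x + phd c (\<lambda>x. (1/2) * (q x * ?X c x)) x"
          unfolding V_def
          by (rule phd_add) (rule PW_differentiable[OF PW_mult[OF pPW v] x],
              rule PW_differentiable[OF PW_mult[OF PW_const PW_mult[OF qPW X]] x])
        also have "phd c (\<lambda>x. (1/2) * (q x * ?X c x)) x = (1/2) * phd c (\<lambda>x. q x * ?X c x) x"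
          by (rule phd_cmult[OF PW_differentiable[OF PW_mult[OF qPW X] x]])
        finally show ?thesis
          by (simp add: phd_mult[OF d(4) d(1)] phd_mult[OF d(3) d(2)] dp dq phd_F[OF xS] power2_eq_square
              distrib_left distrib_right sum_distrib_left sum_distrib_right mult_ac)
      qed
      have 1: "(\<Sum>c\<in>UNIV. \<Sum>a\<in>UNIV. ?X a x * v c x * phd c (v a) x) = (\<Sum>a\<in>UNIV. \<Sum>c\<in>UNIV. ?X a x * v c x * phd c (v a) x)"
        by (rule sum.swap)
      have 2: "(\<Sum>a\<in>UNIV. \<Sum>c\<in>UNIV. ?X a x * v c x * phd c (v a) x) + (\<Sum>c\<in>UNIV. \<Sum>a\<in>UNIV. ?X c x * v a x * phd c (v a) x)
          = 2 * (\<Sum>a\<in>UNIV. \<Sum>c\<in>UNIV. ?X a x * v c x * sgrad v a c x)"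
        unfolding sum.distrib[symmetric] sum_distrib_left
        by (intro sum.cong refl) (simp add: sgrad_def field_simps)
      have "(\<Sum>c\<in>UNIV. phd c (V c) x) = q x + (\<Sum>c\<in>UNIV. \<Sum>a\<in>UNIV. ?X a x * v c x * phd c (v a) x)
          + (\<Sum>c\<in>UNIV. phd c (v c) x) * p x + (\<Sum>c\<in>UNIV. \<Sum>a\<in>UNIV. ?X c x * v a x * phd c (v a) x) + n / 2 * q x"
        unfolding dV by (simp add: sum.distrib q_def n_def sum_distrib_left sum_distrib_right mult_ac)
      then show ?thesis using 1 2 by (simp add: algebra_simps)
    qed
    have pt: "(n / 2 + 1 / 2) * q x - 2 * n * R\<^sup>2 * s2 x + (\<Sum>c\<in>UNIV. phd c (v c) x) * p x \<le> (\<Sum>c\<in>UNIV. phd c (V c) x)"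
      if x: "x \<in> Off Z" for x
    proof -
      have XR: "(?X a x)\<^sup>2 \<le> R\<^sup>2" for a
        using order_trans[OF component_le_norm_cart[of "F x" a] R(2)[OF subsetD[OF O_subset(2) x]]]
          power_mono[of "\<bar>?X a x\<bar>" R 2] by simp
      have t: "- (1 / (2 * n) * (v c x)\<^sup>2) - 2 * n * (R\<^sup>2 * (sgrad v a c x)\<^sup>2) \<le> 2 * (?X a x * v c x * sgrad v a c x)" for a c
      proof -
        let ?a = "v c x" and ?b = "?X a x * sgrad v a c x"
        have "0 \<le> (?a + 2 * n * ?b)\<^sup>2 / (2 * n)" using n by simp
        also have "\<dots> = 1 / (2 * n) * ?a\<^sup>2 + 2 * (?a * ?b) + 2 * n * ?b\<^sup>2"
          using n by (simp add: power2_eq_square field_simps)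
        finally have "- (1 / (2 * n) * ?a\<^sup>2) - 2 * n * ?b\<^sup>2 \<le> 2 * (?a * ?b)" by simp
        moreover have "2 * n * ?b\<^sup>2 \<le> 2 * n * (R\<^sup>2 * (sgrad v a c x)\<^sup>2)"
          unfolding power_mult_distrib using n XR[of a] by (intro mult_left_mono mult_right_mono) auto
        ultimately show ?thesis by (simp add: mult_ac)
      qed
      have "(\<Sum>a\<in>UNIV. \<Sum>c\<in>UNIV. - (1 / (2 * n) * (v c x)\<^sup>2) - 2 * n * (R\<^sup>2 * (sgrad v a c x)\<^sup>2))
          \<le> (\<Sum>a\<in>UNIV. \<Sum>c\<in>UNIV. 2 * (?X a x * v c x * sgrad v a c x))"
        by (intro sum_mono t)
      moreover have "(\<Sum>a\<in>(UNIV::'d set). \<Sum>c\<in>UNIV. - (1 / (2 * n) * (v c x)\<^sup>2) - 2 * n * (R\<^sup>2 * (sgrad v a c x)\<^sup>2))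
          = - (1/2) * q x - 2 * n * R\<^sup>2 * s2 x"
        using n by (simp add: sum_subtractf sum_negf q_def s2_def sum_distrib_left[symmetric] sum_divide_distrib[symmetric] n_def[symmetric])
      ultimately have "- (1/2) * q x - 2 * n * R\<^sup>2 * s2 x \<le> 2 * (\<Sum>a\<in>UNIV. \<Sum>c\<in>UNIV. ?X a x * v c x * sgrad v a c x)"
        by (simp add: sum_distrib_left)
      then show ?thesis unfolding divV[OF x] by (simp add: algebra_simps)
    qed
    let ?d = "\<lambda>x. (\<Sum>c\<in>UNIV. phd c (v c) x) * p x"
    have dB: "BM Z ?d" by (intro BM_mult BM_sum BM_phd v PW_BM[OF pPW])
    have qB: "BM Z q" by (rule PW_BM[OF qPW])
    have "(n / 2 + 1 / 2) * vint Z q + (- 2 * n * R\<^sup>2) * vint Z s2 + vint Z ?d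
        = vint Z (\<lambda>x. ((n / 2 + 1 / 2) * q x + (- 2 * n * R\<^sup>2) * s2 x) + ?d x)"
      using qB s2B dB by (simp only: vint_add[OF fin] vint_cmult BM_add BM_mult BM_const)
    also have "\<dots> \<le> vint Z (\<lambda>x. \<Sum>c\<in>UNIV. phd c (V c) x)"
    proof (rule vint_mono[OF fin])
      show "BM Z (\<lambda>x. ((n / 2 + 1 / 2) * q x + (- 2 * n * R\<^sup>2) * s2 x) + ?d x)"
        by (intro BM_add BM_mult BM_const qB s2B dB BM_sum BM_phd v PW_BM[OF pPW])
      show "BM Z (\<lambda>x. \<Sum>c\<in>UNIV. phd c (V c) x)" by (intro BM_sum BM_phd V)
    qed (use pt in \<open>simp add: algebra_simps\<close>)
    also have "\<dots> = (\<Sum>i\<in>UNIV. \<Sum>s\<in>UNIV. fint i s (\<lambda>x. \<Sum>c\<in>UNIV. V c x * nrm i s x $ c))"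
      by (rule divergence_theorem[OF fin V])
    also have "\<dots> \<le> (\<Sum>i\<in>UNIV. \<Sum>s\<in>UNIV. fint i s (\<lambda>x. (2 * R) * q x))"
    proof (intro sum_mono fint_mono[where Z="\<lambda>_. {}"])
      fix i s
      show "FM (\<lambda>x. \<Sum>c\<in>UNIV. V c x * nrm i s x $ c)"
        by (intro FM_continuous continuous_on_sum continuous_on_mult PW_continuous[OF V] continuous_nrm)
      show "FM (\<lambda>x. 2 * R * q x)" by (intro FM_mult FM_const FM_PW[OF qPW])
      fix y assume "y \<in> face i"
      define x where "x = face_point i (end_coord i s) y"
      have x: "x \<in> Q" unfolding x_def by (rule face_point_end_Q[OF \<open>y \<in> face i\<close>])
      define w :: "real^'d" where "w = (\<chi> c. v c x)"
      have q: "q x = (norm w)\<^sup>2" unfolding q_def w_def power2_norm_eq_inner inner_vec_def by (simp add: power2_eq_square)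
      have p: "p x = F x \<bullet> w" by (simp add: p_def w_def inner_vec_def)
      let ?N = "nrm i s x"
      have N: "norm ?N = 1" by (rule norm_nrm[OF box_in_S(2)[OF x]])
      have "(\<Sum>c\<in>UNIV. V c x * ?N $ c) = (F x \<bullet> w) * (w \<bullet> ?N) + (1/2) * ((norm w)\<^sup>2 * (F x \<bullet> ?N))"
      proof -
        have "(\<Sum>c\<in>UNIV. V c x * ?N $ c) = (\<Sum>c\<in>UNIV. p x * (w $ c * ?N $ c) + (1/2) * (q x * (F x $ c * ?N $ c)))"
          by (intro sum.cong refl) (simp add: V_def w_def algebra_simps)
        also have "\<dots> = p x * (w \<bullet> ?N) + (1/2) * (q x * (F x \<bullet> ?N))"
          by (simp add: inner_vec_def sum.distrib sum_distrib_left)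
        finally show ?thesis unfolding p q .
      qed
      also have "\<dots> \<le> (R * norm w) * norm w + (1/2) * ((norm w)\<^sup>2 * R)"
      proof (intro add_mono mult_left_mono)
        have "\<bar>F x \<bullet> w\<bar> \<le> R * norm w"
          using Cauchy_Schwarz_ineq2[of "F x" w] mult_right_mono[OF R(2)[OF x], of "norm w"] by simp
        moreover have "\<bar>w \<bullet> ?N\<bar> \<le> norm w" using Cauchy_Schwarz_ineq2[of w ?N] N by simp
        ultimately have "\<bar>F x \<bullet> w\<bar> * \<bar>w \<bullet> ?N\<bar> \<le> (R * norm w) * norm w" by (intro mult_mono) auto
        then show "(F x \<bullet> w) * (w \<bullet> ?N) \<le> (R * norm w) * norm w"
          by (metis abs_ge_self abs_mult order_trans)
        show "F x \<bullet> ?N \<le> R" using Cauchy_Schwarz_ineq2[of "F x" ?N] N R(2)[OF x] by simp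
      qed auto
      also have "\<dots> \<le> 2 * R * q x" using R(1) unfolding q by (simp add: power2_eq_square field_simps)
      finally show "(\<Sum>c\<in>UNIV. V c (face_point i (end_coord i s) y) * nrm i s (face_point i (end_coord i s) y) $ c)
          \<le> 2 * R * q (face_point i (end_coord i s) y)" unfolding x_def .
    qed simp
    also have "\<dots> = (2 * R) * (\<Sum>i\<in>UNIV. \<Sum>s\<in>UNIV. fint i s q)"
      by (simp add: fint_cmult sum_distrib_left)
    finally have main: "(n / 2 + 1 / 2) * vint Z q \<le> 2 * n * R\<^sup>2 * vint Z s2 + (2 * R) * (\<Sum>i\<in>UNIV. \<Sum>s\<in>UNIV. fint i s q)"
      using div[OF PW_BM[OF pPW]] by simp
    have pos: "0 \<le> vint Z q" "0 \<le> vint Z s2" "0 \<le> (\<Sum>i\<in>UNIV. \<Sum>s\<in>UNIV. fint i s q)"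
      by (auto intro!: vint_nonneg sum_nonneg fint_nonneg simp: q_def s2_def)
    have "1 * vint Z q \<le> (n / 2 + 1 / 2) * vint Z q" using n pos(1) by (intro mult_right_mono) auto
    also note main
    also have "2 * n * R\<^sup>2 * vint Z s2 + (2 * R) * (\<Sum>i\<in>UNIV. \<Sum>s\<in>UNIV. fint i s q)
        \<le> C * vint Z s2 + C * (\<Sum>i\<in>UNIV. \<Sum>s\<in>UNIV. fint i s q)"
    proof (intro add_mono mult_right_mono pos)
      show "2 * n * R\<^sup>2 \<le> C" using R(1) unfolding C_def by linarith
      have "0 \<le> 2 * n * R\<^sup>2" using n by simp
      then show "2 * R \<le> C" unfolding C_def by linarith
    qed
    finally show ?thesis unfolding q_def s2_def by (simp add: distrib_left)
  qed
  have "C > 0" using R(1) n unfolding C_def by (intro add_nonneg_pos) simp_all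
  then show ?thesis
    by (intro exI[of _ C] conjI allI impI korn) simp_all
qed

end

section \<open>Inverse inequalities on boxes\<close>

text \<open>Polynomials of degree at most \<open>n\<close> in each variable separately: the property of restrictions to lines on which the trace
  inequality depends.\<close>

definition SP :: "nat \<Rightarrow> (real^'d \<Rightarrow> real) \<Rightarrow> bool" where
  "SP n g \<longleftrightarrow> (\<forall>i y. \<exists>p. degree p \<le> n \<and> (\<forall>t. g (face_point i t y) = poly p t))"

text \<open>Sums of products of univariate polynomials of degree at most \<open>n\<close>, the form in which spline functions are given on a cell.\<close>

definition TP :: "nat \<Rightarrow> (real^'d \<Rightarrow> real) \<Rightarrow> bool" where
  "TP n g \<longleftrightarrow> (\<exists>N (p :: nat \<Rightarrow> 'd \<Rightarrow> real poly). (\<forall>q<N. \<forall>i. degree (p q i) \<le> n) \<and>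
      g = (\<lambda>x. \<Sum>q<N. \<Prod>i\<in>UNIV. poly (p q i) (x $ i)))"

lemma SP_const: "SP n (\<lambda>x. c)"
  unfolding SP_def by (intro allI exI[of _ "[:c:]"]) simp

lemma SP_add: assumes "SP n f" "SP n g" shows "SP n (\<lambda>x. f x + g x)"
  unfolding SP_def
proof (intro allI)
  fix i y
  obtain p where p: "degree p \<le> n" "\<And>t. f (face_point i t y) = poly p t" using assms(1) unfolding SP_def by blast
  obtain q where q: "degree q \<le> n" "\<And>t. g (face_point i t y) = poly q t" using assms(2) unfolding SP_def by blast
  show "\<exists>p. degree p \<le> n \<and> (\<forall>t. f (face_point i t y) + g (face_point i t y) = poly p t)"
    using p q by (intro exI[of _ "p + q"]) (simp add: degree_add_le)
qed

lemma SP_cmult: assumes "SP n f" shows "SP n (\<lambda>x. c * f x)"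
  unfolding SP_def
proof (intro allI)
  fix i y
  obtain p where p: "degree p \<le> n" "\<And>t. f (face_point i t y) = poly p t" using assms(1) unfolding SP_def by blast
  show "\<exists>p. degree p \<le> n \<and> (\<forall>t. c * f (face_point i t y) = poly p t)"
    using p order_trans[OF degree_smult_le p(1), of c] by (intro exI[of _ "smult c p"]) simp
qed

lemma SP_sum: "(\<And>a. a \<in> I \<Longrightarrow> SP n (f a)) \<Longrightarrow> SP n (\<lambda>x. \<Sum>a\<in>I. f a x)"
  by (induction I rule: infinite_finite_induct) (auto intro: SP_add SP_const)

lemma TP_E:
  assumes "TP n g"
  obtains N and p :: "nat \<Rightarrow> 'd::finite \<Rightarrow> real poly"
  where "\<And>q i. q < N \<Longrightarrow> degree (p q i) \<le> n" "g = (\<lambda>x. \<Sum>q<N. \<Prod>i\<in>UNIV. poly (p q i) (x $ i))"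
proof -
  from assms obtain N and p :: "nat \<Rightarrow> 'd::finite \<Rightarrow> real poly"
    where p: "(\<forall>q<N. \<forall>i. degree (p q i) \<le> n) \<and> g = (\<lambda>x. \<Sum>q<N. \<Prod>i\<in>UNIV. poly (p q i) (x $ i))"
    unfolding TP_def by (elim exE)
  show ?thesis by (rule that[OF _ conjunct2[OF p]]) (use conjunct1[OF p] in simp)
qed

lemma TP_imp_SP: assumes "TP n g" shows "SP n g"
proof -
  obtain N and p :: "nat \<Rightarrow> 'a \<Rightarrow> real poly" where p: "\<And>q i. q < N \<Longrightarrow> degree (p q i) \<le> n"
    and g: "g = (\<lambda>x. \<Sum>q<N. \<Prod>i\<in>UNIV. poly (p q i) (x $ i))"
    by (rule TP_E[OF assms]) (rule that, assumption, assumption)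
  have "SP n (\<lambda>x. \<Prod>k\<in>UNIV. poly (p q k) (x $ k))" if "q < N" for q
    unfolding SP_def
  proof (intro allI)
    fix i y
    let ?c = "\<Prod>k\<in>UNIV - {i}. poly (p q k) (y k)"
    have "(\<Prod>k\<in>UNIV. poly (p q k) (face_point i t y $ k)) = poly (smult ?c (p q i)) t" for t
      by (subst prod.remove[of UNIV i]) (auto simp: mult.commute intro!: prod.cong)
    then show "\<exists>p'. degree p' \<le> n \<and> (\<forall>t. (\<Prod>k\<in>UNIV. poly (p q k) (face_point i t y $ k)) = poly p' t)"
      using order_trans[OF degree_smult_le p[OF that, of i], of ?c] by (intro exI[of _ "smult ?c (p q i)"]) simp
  qed
  then show ?thesis unfolding g by (intro SP_sum) auto
qed

lemma C1_poly_nth: "C1 S (\<lambda>x :: real^'d. poly p (x $ k))"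
proof (induction p)
  case (pCons a p)
  have "C1 S (\<lambda>x :: real^'d. a + x $ k * poly p (x $ k))" by (intro C1_add C1_mult C1_const C1_nth pCons)
  then show ?case by simp
qed simp

lemma pd_poly_nth: "pd i (\<lambda>x :: real^'d. poly p (x $ k)) x = (if i = k then poly (pderiv p) (x $ k) else 0)"
proof -
  have "((\<lambda>x :: real^'d. poly p (x $ k)) has_derivative (\<lambda>h. poly (pderiv p) (x $ k) * h $ k)) (at x)"
    using diff_chain_at[OF bounded_linear_imp_has_derivative[OF bounded_linear_vec_nth[of k]], of "poly p" _ x]
      poly_DERIV[of p "x $ k"] by (simp add: has_field_derivative_def o_def)
  from pd_eqI[OF this, of i] show ?thesis by (auto simp: axis_def)
qed

lemma C1_TP: assumes "TP n g" shows "C1 S g"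
proof -
  obtain N and p :: "nat \<Rightarrow> 'a \<Rightarrow> real poly"
    where g: "g = (\<lambda>x. \<Sum>q<N. \<Prod>i\<in>UNIV. poly (p q i) (x $ i))" 
    by (rule TP_E[OF assms]) (rule that, assumption)
  show ?thesis unfolding g by (intro C1_sum C1_prod C1_poly_nth)
qed

lemma TP_pd: assumes "TP n g" shows "TP n (pd i g)"
proof -
  obtain N and p :: "nat \<Rightarrow> 'a \<Rightarrow> real poly" where p: "\<And>q i. q < N \<Longrightarrow> degree (p q i) \<le> n"
    and g: "g = (\<lambda>x. \<Sum>q<N. \<Prod>i\<in>UNIV. poly (p q i) (x $ i))"
    by (rule TP_E[OF assms]) (rule that, assumption, assumption)
  define p' where "p' q k = (if k = i then pderiv (p q k) else p q k)" for q k
  note d = C1_differentiable[OF C1_poly_nth UNIV_I]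
  have "pd i g x = (\<Sum>q<N. \<Prod>k\<in>UNIV. poly (p' q k) (x $ k))" for x
  proof -
    have sum: "pd i g x = (\<Sum>q<N. pd i (\<lambda>x. \<Prod>k\<in>UNIV. poly (p q k) (x $ k)) x)"
      unfolding g by (rule pd_sum) (intro differentiable_prod d)
    have "pd i (\<lambda>x. \<Prod>k\<in>UNIV. poly (p q k) (x $ k)) x = (\<Prod>k\<in>UNIV. poly (p' q k) (x $ k))" for q
    proof -
      have "pd i (\<lambda>x. \<Prod>k\<in>UNIV. poly (p q k) (x $ k)) x
        = (\<Sum>k\<in>UNIV. pd i (\<lambda>x. poly (p q k) (x $ k)) x * (\<Prod>b\<in>UNIV - {k}. poly (p q b) (x $ b)))"
        by (rule pd_prod) (rule d)
      also have "\<dots> = (\<Sum>k\<in>UNIV. if k = i then poly (pderiv (p q i)) (x $ i) * (\<Prod>b\<in>UNIV - {i}. poly (p q b) (x $ b)) else 0)"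
        by (intro sum.cong refl) (auto simp: pd_poly_nth)
      also have "\<dots> = (\<Prod>k\<in>UNIV. poly (p' q k) (x $ k))"
        by (subst prod.remove[of UNIV i]) (auto simp: p'_def intro!: prod.cong)
      finally show ?thesis .
    qed
    then show ?thesis unfolding sum by simp
  qed
  then have "pd i g = (\<lambda>x. \<Sum>q<N. \<Prod>k\<in>UNIV. poly (p' q k) (x $ k))" by auto
  moreover have "degree (p' q k) \<le> n" if "q < N" for q k
    using p[OF that, of k] by (auto simp: p'_def degree_pderiv)
  ultimately show ?thesis
    unfolding TP_def by (intro exI[of _ N] exI[of _ p'] conjI allI impI)
qed

locale pbox =
  fixes a b :: "real^'d"
  assumes a_less_b: "\<And>i. a $ i < b $ i"
begin

definition sect :: "'d \<Rightarrow> ('d \<Rightarrow> real) set" where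
  "sect i = (\<Pi>\<^sub>E k\<in>-{i}. {a $ k .. b $ k})"

abbreviation (input) "endc i s \<equiv> (if s then b $ i else a $ i)"

definition cint :: "(real^'d \<Rightarrow> real) \<Rightarrow> real" where
  "cint f = (LBINT x. indicator (cbox a b) x * f x)"

definition cface :: "'d \<Rightarrow> bool \<Rightarrow> (real^'d \<Rightarrow> real) \<Rightarrow> real" where
  "cface i s f = (\<integral>y. indicator (sect i) y * f (face_point i (endc i s) y) \<partial>slice_measure i)"

lemma sect_sets [measurable]: "sect i \<in> sets (slice_measure i)"
  unfolding sect_def by (rule sets_PiM_I_finite) auto

lemma emeasure_sect_finite: "emeasure (slice_measure i) (sect i) < \<infinity>"
proof -
  interpret product_sigma_finite "\<lambda>_::'d. lborel :: real measure" ..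
  have "emeasure (slice_measure i) (sect i) = (\<Prod>k\<in>-{i}. emeasure lborel {a $ k .. b $ k})"
    unfolding sect_def by (rule emeasure_PiM) auto
  also have "\<dots> < \<infinity>"
    using less_imp_le[OF a_less_b] by (simp add: prod_ennreal)
  finally show ?thesis .
qed

lemma face_point_cbox: "y \<in> sect i \<Longrightarrow> t \<in> {a $ i .. b $ i} \<Longrightarrow> face_point i t y \<in> cbox a b"
  by (auto simp: sect_def mem_box_cart PiE_iff)

lemma indicator_face_point:
  assumes "y \<in> space (slice_measure i)"
  shows "indicator (cbox a b) (face_point i t y) = (indicator (sect i) y * indicator {a $ i .. b $ i} t :: real)"
proof -
  have "face_point i t y \<in> cbox a b \<longleftrightarrow> y \<in> sect i \<and> t \<in> {a $ i .. b $ i}"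
  proof
    assume f: "face_point i t y \<in> cbox a b"
    then have k: "a $ k \<le> face_point i t y $ k \<and> face_point i t y $ k \<le> b $ k" for k
      unfolding mem_box_cart by blast
    show "y \<in> sect i \<and> t \<in> {a $ i .. b $ i}"
      unfolding sect_def PiE_iff
    proof (intro conjI ballI)
      show "y k \<in> {a $ k .. b $ k}" if "k \<in> - {i}" for k using k[of k] that by simp
      show "y \<in> extensional (- {i})" using assms by (auto simp: space_PiM PiE_iff)
      show "t \<in> {a $ i .. b $ i}" using k[of i] by simp
    qed
  qed (auto intro: face_point_cbox)
  then show ?thesis by (auto simp: indicator_def)
qed

lemma endc_in: "endc i s \<in> {a $ i .. b $ i}" using less_imp_le[OF a_less_b[of i]] by auto

lemma integrable_cint:
  fixes f :: "real^'d \<Rightarrow> real"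
  assumes "continuous_on (cbox a b) f" shows "integrable lborel (\<lambda>x. indicator (cbox a b) x * f x)"
  using borel_integrable_compact[OF compact_cbox assms] by simp

lemma integrable_cface:
  fixes f :: "real^'d \<Rightarrow> real"
  assumes f: "continuous_on (cbox a b) f" and t: "t \<in> {a $ i .. b $ i}"
  shows "integrable (slice_measure i) (\<lambda>y. indicator (sect i) y * f (face_point i t y))"
proof -
  let ?f = "\<lambda>y. (\<lambda>x. indicator (cbox a b) x *\<^sub>R f x) (face_point i t y)"
  have "bounded (f ` cbox a b)" by (intro compact_imp_bounded compact_continuous_image f compact_cbox)
  then obtain B where B: "\<And>x. x \<in> cbox a b \<Longrightarrow> \<bar>f x\<bar> \<le> B" by (auto simp: bounded_iff)
  have "(\<lambda>x. indicator (cbox a b) x *\<^sub>R f x) \<in> borel_measurable borel"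
    by (rule borel_measurable_continuous_on_indicator[OF _ f]) simp
  then have m: "?f \<in> borel_measurable (slice_measure i)"
    by (rule measurable_compose[OF measurable_face_point])
  have "integrable (slice_measure i) (\<lambda>y. indicator (sect i) y *\<^sub>R ?f y)"
  proof (intro integrableI_bounded_set_indicator[where B=B] AE_I2 impI m)
    show "norm (?f y) \<le> B" if "y \<in> sect i" for y
      using B face_point_cbox[OF that t] by simp
  qed (use emeasure_sect_finite in auto)
  moreover have "indicator (sect i) y *\<^sub>R ?f y = indicator (sect i) y * f (face_point i t y)" for y
    using face_point_cbox[OF _ t] by (auto simp: indicator_def)
  ultimately show ?thesis by (simp only:)
qed

lemma cint_slices:
  assumes "continuous_on (cbox a b) f"
  shows "cint f = (\<integral>y. indicator (sect i) y * (LBINT t. indicator {a $ i .. b $ i} t * f (face_point i t y)) \<partial>slice_measure i)" (is "_ = ?r")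
    and "integrable (slice_measure i) (\<lambda>y. indicator (sect i) y * (LBINT t. indicator {a $ i .. b $ i} t * f (face_point i t y)))"
proof -
  note int = integrable_cint[OF assms]
  have eq: "(LBINT t. indicator (cbox a b) (face_point i t y) * f (face_point i t y))
      = indicator (sect i) y * (LBINT t. indicator {a $ i .. b $ i} t * f (face_point i t y))" if "y \<in> space (slice_measure i)" for y
    unfolding indicator_face_point[OF that] mult.assoc by (rule integral_mult_right_zero)
  show "cint f = ?r"
    unfolding cint_def integral_slices(1)[OF int, of i]
    by (rule Bochner_Integration.integral_cong[OF refl eq])
  show "integrable (slice_measure i) (\<lambda>y. indicator (sect i) y * (LBINT t. indicator {a $ i .. b $ i} t * f (face_point i t y)))"
    using integral_slices(2)[OF int, of i]
    by (rule Bochner_Integration.integrable_cong[OF refl, THEN iffD1, rotated]) (rule eq)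
qed

lemma cint_mono:
  assumes "continuous_on (cbox a b) f" "continuous_on (cbox a b) g" "\<And>x. x \<in> cbox a b \<Longrightarrow> f x \<le> g x"
  shows "cint f \<le> cint g"
  unfolding cint_def using assms
  by (intro integral_mono integrable_cint) (auto simp: indicator_def)

lemma cface_mono:
  assumes "continuous_on (cbox a b) f" "continuous_on (cbox a b) g" "\<And>x. x \<in> cbox a b \<Longrightarrow> f x \<le> g x"
  shows "cface i s f \<le> cface i s g"
  unfolding cface_def
proof (intro integral_mono integrable_cface assms endc_in)
  fix y
  show "indicator (sect i) y * f (face_point i (endc i s) y) \<le> indicator (sect i) y * g (face_point i (endc i s) y)"
    using assms(3)[OF face_point_cbox[OF _ endc_in]] by (cases "y \<in> sect i") simp_all
qed

lemma cint_cmult: "cint (\<lambda>x. c * f x) = c * cint f"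
  unfolding cint_def by (subst integral_mult_right_zero[symmetric]) (simp add: mult_ac)

lemma cface_cmult: "cface i s (\<lambda>x. c * f x) = c * cface i s f"
  unfolding cface_def by (subst integral_mult_right_zero[symmetric]) (simp add: mult_ac)

lemma cint_add:
  assumes "continuous_on (cbox a b) f" "continuous_on (cbox a b) g"
  shows "cint (\<lambda>x. f x + g x) = cint f + cint g"
  unfolding cint_def distrib_left
  by (intro Bochner_Integration.integral_add integrable_cint assms)

lemma cface_add:
  assumes "continuous_on (cbox a b) f" "continuous_on (cbox a b) g"
  shows "cface i s (\<lambda>x. f x + g x) = cface i s f + cface i s g"
  unfolding cface_def distrib_left
  by (intro Bochner_Integration.integral_add integrable_cface assms endc_in)

lemma cint_sum:
  assumes "\<And>m. m \<in> I \<Longrightarrow> continuous_on (cbox a b) (f m)"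
  shows "cint (\<lambda>x. \<Sum>m\<in>I. f m x) = (\<Sum>m\<in>I. cint (f m))"
  unfolding cint_def sum_distrib_left
  by (intro Bochner_Integration.integral_sum integrable_cint assms)

lemma cface_sum:
  assumes "\<And>m. m \<in> I \<Longrightarrow> continuous_on (cbox a b) (f m)"
  shows "cface i s (\<lambda>x. \<Sum>m\<in>I. f m x) = (\<Sum>m\<in>I. cface i s (f m))"
  unfolding cface_def sum_distrib_left
  by (intro Bochner_Integration.integral_sum integrable_cface assms endc_in)

lemma cint_nonneg: "(\<And>x. x \<in> cbox a b \<Longrightarrow> 0 \<le> f x) \<Longrightarrow> 0 \<le> cint f"
  unfolding cint_def by (intro integral_nonneg_AE AE_I2) (auto simp: indicator_def)

lemma LBINT_interval_poly:
  fixes p :: "real poly" assumes "l \<le> u"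
  shows "(LBINT t. indicator {l..u} t * (poly p t)\<^sup>2) = integral {l..u} (\<lambda>t. (poly p t)\<^sup>2)"
    and "integrable lborel (\<lambda>t. indicator {l..u} t * (poly p t)\<^sup>2)"
proof -
  have c: "continuous_on {l..u} (\<lambda>t. (poly p t)\<^sup>2)" by (intro continuous_intros)
  show i: "integrable lborel (\<lambda>t. indicator {l..u} t * (poly p t)\<^sup>2)"
    using borel_integrable_atLeastAtMost'[OF c] by (simp add: set_integrable_def)
  show "(LBINT t. indicator {l..u} t * (poly p t)\<^sup>2) = integral {l..u} (\<lambda>t. (poly p t)\<^sup>2)"
    using set_borel_integral_eq_integral(2)[of "{l..u}" "\<lambda>t. (poly p t)\<^sup>2"] i
    by (simp add: set_integrable_def set_lebesgue_integral_def)
qed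

end

text \<open>The univariate inequalities on every line in direction \<open>i\<close>, integrated over the lines.\<close>

lemma SP_inverse_inequalities:
  "\<exists>c>0. \<forall>a b :: real^'d. (\<forall>i. a $ i < b $ i) \<longrightarrow>
     (\<forall>g i s. SP n g \<longrightarrow> continuous_on (cbox a b) g \<longrightarrow>
        pbox.cface a b i s (\<lambda>x. (g x)\<^sup>2) \<le> c / (b $ i - a $ i) * pbox.cint a b (\<lambda>x. (g x)\<^sup>2)) \<and>
     (\<forall>g i. TP n g \<longrightarrow>
        pbox.cint a b (\<lambda>x. (pd i g x)\<^sup>2) \<le> c / (b $ i - a $ i)\<^sup>2 * pbox.cint a b (\<lambda>x. (g x)\<^sup>2))"
proof -
  obtain c where c: "c > 0" and ineq: "\<And>p a b t. degree p \<le> n \<Longrightarrow> a < b \<Longrightarrow> t \<in> {a..b::real} \<Longrightarrow>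
     (poly p t)\<^sup>2 \<le> c / (b - a) * integral {a..b} (\<lambda>t. (poly p t)\<^sup>2) \<and>
     (poly (pderiv p) t)\<^sup>2 \<le> c / (b - a) ^ 3 * integral {a..b} (\<lambda>t. (poly p t)\<^sup>2)"
    using poly_inverse_inequality[of n] by blast
  show ?thesis
  proof (intro exI[of _ c] conjI allI impI c)
    fix a b :: "real^'d" and g :: "real^'d \<Rightarrow> real" and i s
    assume ab: "\<forall>i. a $ i < b $ i" and g: "SP n g" "continuous_on (cbox a b) g"
    interpret pbox a b using ab by unfold_locales blast
    let ?l = "b $ i - a $ i"
    have cg: "continuous_on (cbox a b) (\<lambda>x. (g x)\<^sup>2)" by (intro continuous_intros g)
    let ?I = "\<lambda>y. indicator (sect i) y * (LBINT t. indicator {a $ i .. b $ i} t * (g (face_point i t y))\<^sup>2)"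
    have "cface i s (\<lambda>x. (g x)\<^sup>2) \<le> (\<integral>y. c / ?l * ?I y \<partial>slice_measure i)"
      unfolding cface_def
    proof (intro integral_mono integrable_cface cg endc_in integrable_mult_right cint_slices(2))
      fix y
      obtain p where p: "degree p \<le> n" "\<And>t. g (face_point i t y) = poly p t" using g(1) unfolding SP_def by blast
      have "(g (face_point i (endc i s) y))\<^sup>2 \<le> c / ?l * (LBINT t. indicator {a $ i .. b $ i} t * (g (face_point i t y))\<^sup>2)"
        unfolding p(2) LBINT_interval_poly(1)[OF less_imp_le[OF a_less_b]]
        using ineq[OF p(1) a_less_b endc_in] by blast
      then show "indicator (sect i) y * (g (face_point i (endc i s) y))\<^sup>2 \<le> c / ?l * ?I y"
        by (cases "y \<in> sect i") simp_all
    qed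
    also have "\<dots> = c / ?l * cint (\<lambda>x. (g x)\<^sup>2)"
      unfolding cint_slices(1)[OF cg, of i] by (rule integral_mult_right_zero)
    finally show "cface i s (\<lambda>x. (g x)\<^sup>2) \<le> c / ?l * cint (\<lambda>x. (g x)\<^sup>2)" .
  next
    fix a b :: "real^'d" and g :: "real^'d \<Rightarrow> real" and i
    assume ab: "\<forall>i. a $ i < b $ i" and g: "TP n g"
    interpret pbox a b using ab by unfold_locales blast
    let ?l = "b $ i - a $ i"
    have l: "?l > 0" using a_less_b[of i] by simp
    have cg: "continuous_on (cbox a b) (\<lambda>x. (g x)\<^sup>2)"
      by (intro continuous_intros C1_continuous_on[OF C1_TP[OF g]])
    have cdg: "continuous_on (cbox a b) (\<lambda>x. (pd i g x)\<^sup>2)"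
      by (intro continuous_intros C1_continuous_pd[OF C1_TP[OF g]])
    let ?I = "\<lambda>g y. indicator (sect i) y * (LBINT t. indicator {a $ i .. b $ i} t * (g (face_point i t y))\<^sup>2)"
    have "cint (\<lambda>x. (pd i g x)\<^sup>2) = (\<integral>y. ?I (pd i g) y \<partial>slice_measure i)"
      by (rule cint_slices(1)[OF cdg])
    also have "\<dots> \<le> (\<integral>y. c / ?l\<^sup>2 * ?I g y \<partial>slice_measure i)"
    proof (intro integral_mono cint_slices(2)[OF cdg] integrable_mult_right cint_slices(2)[OF cg])
      fix y
      obtain p where p: "degree p \<le> n" "\<And>t. g (face_point i t y) = poly p t"
        using TP_imp_SP[OF g] unfolding SP_def by blast
      have dp: "pd i g (face_point i t y) = poly (pderiv p) t" for t
      proof -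
        have "DERIV (\<lambda>t. g (face_point i t y)) t :> pd i g (face_point i t y)"
          by (rule DERIV_face_point[OF C1_differentiable[OF C1_TP[OF g] UNIV_I]])
        moreover have "DERIV (\<lambda>t. g (face_point i t y)) t :> poly (pderiv p) t"
          unfolding p(2) by (rule poly_DERIV)
        ultimately show ?thesis by (rule DERIV_unique)
      qed
      let ?i = "integral {a $ i .. b $ i} (\<lambda>t. (poly p t)\<^sup>2)"
      have "integral {a $ i .. b $ i} (\<lambda>t. (poly (pderiv p) t)\<^sup>2) \<le> integral {a $ i .. b $ i} (\<lambda>t. c / ?l ^ 3 * ?i)"
        by (intro integral_le integrable_continuous_real continuous_intros)
          (use ineq[OF p(1) a_less_b] in blast)
      also have "\<dots> = c / ?l\<^sup>2 * ?i" using l by (simp add: power3_eq_cube power2_eq_square)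
      finally have "(LBINT t. indicator {a $ i .. b $ i} t * (pd i g (face_point i t y))\<^sup>2)
         \<le> c / ?l\<^sup>2 * (LBINT t. indicator {a $ i .. b $ i} t * (g (face_point i t y))\<^sup>2)"
        unfolding p(2) dp LBINT_interval_poly(1)[OF less_imp_le[OF a_less_b]] .
      then show "?I (pd i g) y \<le> c / ?l\<^sup>2 * ?I g y" by (cases "y \<in> sect i") simp_all
    qed
    also have "\<dots> = c / ?l\<^sup>2 * cint (\<lambda>x. (g x)\<^sup>2)"
      unfolding cint_slices(1)[OF cg, of i] by (rule integral_mult_right_zero)
    finally show "cint (\<lambda>x. (pd i g x)\<^sup>2) \<le> c / ?l\<^sup>2 * cint (\<lambda>x. (g x)\<^sup>2)" .
  qed
qed

text \<open>The functions \<open>S0\<close> satisfy a trace inequality because they are polynomial, the functions \<open>S1\<close> are close to them; the difference is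
  controlled on the face and in the box by \<open>W\<close>, which obeys a trace inequality of its own.\<close>

lemma (in pbox) perturbed_trace_inequality:
  fixes S0 S1 :: "'m \<Rightarrow> real^'d \<Rightarrow> real"
  assumes "finite I"
    and S: "\<And>m. m \<in> I \<Longrightarrow> continuous_on (cbox a b) (S1 m)"
    and S0: "\<And>m. m \<in> I \<Longrightarrow> continuous_on (cbox a b) (S0 m)"
    and W: "continuous_on (cbox a b) W"
    and close: "\<And>m x. m \<in> I \<Longrightarrow> x \<in> cbox a b \<Longrightarrow> (S1 m x - S0 m x)\<^sup>2 \<le> E * W x" and E: "0 \<le> E"
    and tr: "\<And>m. m \<in> I \<Longrightarrow> cface i s (\<lambda>x. (S0 m x)\<^sup>2) \<le> T * cint (\<lambda>x. (S0 m x)\<^sup>2)"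
    and trW: "cface i s W \<le> T * cint W" and T: "0 \<le> T"
  shows "cface i s (\<lambda>x. \<Sum>m\<in>I. (S1 m x)\<^sup>2) \<le>
      T * (4 * cint (\<lambda>x. \<Sum>m\<in>I. (S1 m x)\<^sup>2) + 6 * real (card I) * E * cint W)"
proof -
  have sq: "p\<^sup>2 \<le> 2 * q\<^sup>2 + 2 * (p - q)\<^sup>2" for p q :: real
    using zero_le_power2[of "p - 2 * q"] by (simp add: power2_eq_square algebra_simps)
  have one: "cface i s (\<lambda>x. (S1 m x)\<^sup>2) \<le> T * (4 * cint (\<lambda>x. (S1 m x)\<^sup>2) + 6 * E * cint W)" if m: "m \<in> I" for m
  proof -
    have c: "continuous_on (cbox a b) (\<lambda>x. (S1 m x)\<^sup>2)" "continuous_on (cbox a b) (\<lambda>x. (S0 m x)\<^sup>2)"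
      by (intro continuous_intros S S0 m)+
    have "cface i s (\<lambda>x. (S1 m x)\<^sup>2) \<le> cface i s (\<lambda>x. 2 * (S0 m x)\<^sup>2 + (2 * E) * W x)"
    proof (rule cface_mono[OF c(1)])
      show "continuous_on (cbox a b) (\<lambda>x. 2 * (S0 m x)\<^sup>2 + 2 * E * W x)" by (intro continuous_intros S0 W m)
      show "(S1 m x)\<^sup>2 \<le> 2 * (S0 m x)\<^sup>2 + 2 * E * W x" if "x \<in> cbox a b" for x
        using sq[of "S1 m x" "S0 m x"] close[OF m that] by linarith
    qed
    also have "\<dots> = 2 * cface i s (\<lambda>x. (S0 m x)\<^sup>2) + 2 * E * cface i s W"
      using c W by (subst cface_add) (auto simp: cface_cmult intro!: continuous_intros)
    also have "\<dots> \<le> 2 * (T * cint (\<lambda>x. (S0 m x)\<^sup>2)) + 2 * E * (T * cint W)"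
      using tr[OF m] trW E by (intro add_mono mult_left_mono) auto
    finally have A: "cface i s (\<lambda>x. (S1 m x)\<^sup>2) \<le> 2 * (T * cint (\<lambda>x. (S0 m x)\<^sup>2)) + 2 * E * (T * cint W)" .
    have "cint (\<lambda>x. (S0 m x)\<^sup>2) \<le> cint (\<lambda>x. 2 * (S1 m x)\<^sup>2 + (2 * E) * W x)"
    proof (rule cint_mono[OF c(2)])
      show "continuous_on (cbox a b) (\<lambda>x. 2 * (S1 m x)\<^sup>2 + 2 * E * W x)" by (intro continuous_intros S W m)
      show "(S0 m x)\<^sup>2 \<le> 2 * (S1 m x)\<^sup>2 + 2 * E * W x" if "x \<in> cbox a b" for x
        using sq[of "S0 m x" "S1 m x"] close[OF m that] by (simp add: power2_commute)
    qed
    also have "\<dots> = 2 * cint (\<lambda>x. (S1 m x)\<^sup>2) + 2 * E * cint W"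
      using c W by (subst cint_add) (auto simp: cint_cmult intro!: continuous_intros)
    finally have "cint (\<lambda>x. (S0 m x)\<^sup>2) \<le> 2 * cint (\<lambda>x. (S1 m x)\<^sup>2) + 2 * E * cint W" .
    from mult_left_mono[OF this T] A show ?thesis by (simp add: algebra_simps)
  qed
  have "cface i s (\<lambda>x. \<Sum>m\<in>I. (S1 m x)\<^sup>2) = (\<Sum>m\<in>I. cface i s (\<lambda>x. (S1 m x)\<^sup>2))"
    by (rule cface_sum) (intro continuous_intros S)
  also have "\<dots> \<le> (\<Sum>m\<in>I. T * (4 * cint (\<lambda>x. (S1 m x)\<^sup>2) + 6 * E * cint W))"
    by (intro sum_mono one)
  also have "\<dots> = T * (4 * (\<Sum>m\<in>I. cint (\<lambda>x. (S1 m x)\<^sup>2)) + 6 * real (card I) * E * cint W)"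
    by (simp add: sum_distrib_left[symmetric] sum.distrib algebra_simps)
  also have "(\<Sum>m\<in>I. cint (\<lambda>x. (S1 m x)\<^sup>2)) = cint (\<lambda>x. \<Sum>m\<in>I. (S1 m x)\<^sup>2)"
    by (rule cint_sum[symmetric]) (intro continuous_intros S)
  finally show ?thesis .
qed

section \<open>Decomposition into cells\<close>

lemma knot_interval:
  fixes xs :: "real list"
  assumes sorted: "sorted_wrt (<) xs" and ne: "xs \<noteq> []" and t: "hd xs < t" "t < last xs" "t \<notin> set xs"
  shows "\<exists>m. Suc m < length xs \<and> xs ! m < t \<and> t < xs ! Suc m \<and>
    (\<forall>m'. Suc m' < length xs \<longrightarrow> xs ! m' \<le> t \<longrightarrow> t \<le> xs ! Suc m' \<longrightarrow> m' = m)"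
proof -
  have mono: "xs ! i \<le> xs ! j" if "i \<le> j" "j < length xs" for i j
    using sorted_wrt_nth_less[OF sorted, of i j] that by (cases "i = j") auto
  define A where "A = {m. m < length xs \<and> xs ! m < t}"
  have A: "finite A" "0 \<in> A" using ne t(1) by (auto simp: A_def hd_conv_nth)
  define m where "m = Max A"
  have mA: "m \<in> A" unfolding m_def using A by (intro Max_in) auto
  then have m: "m < length xs" "xs ! m < t" by (auto simp: A_def)
  have Sm: "Suc m < length xs"
  proof (rule ccontr)
    assume "\<not> Suc m < length xs"
    then have "m = length xs - 1" using m by simp
    then show False using m t(2) ne by (simp add: last_conv_nth)
  qed
  have "\<not> xs ! Suc m < t"
  proof
    assume "xs ! Suc m < t"
    then have "Suc m \<in> A" using Sm by (simp add: A_def)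
    then have "Suc m \<le> m" unfolding m_def using A by (intro Max_ge) auto
    then show False by simp
  qed
  moreover have "xs ! Suc m \<noteq> t" using t(3) Sm nth_mem by blast
  ultimately have lt: "t < xs ! Suc m" by simp
  have "m' = m" if m': "Suc m' < length xs" "xs ! m' \<le> t" "t \<le> xs ! Suc m'" for m'
  proof (rule linorder_cases[of m' m])
    assume "m' < m"
    then have "xs ! Suc m' \<le> xs ! m" using m by (intro mono) auto
    then show ?thesis using m m' by simp
  next
    assume "m < m'"
    then have "xs ! Suc m \<le> xs ! m'" using m' by (intro mono) auto
    then show ?thesis using lt m' by simp
  qed
  then show ?thesis using Sm m lt by blast
qed

locale mesh = curved_box F lo hi S
  for F :: "real^'d \<Rightarrow> real^'d" and lo hi S +
  fixes \<zeta> :: "'d \<Rightarrow> real list"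
  assumes knots: "knots lo hi \<zeta>"
begin

abbreviation (input) skel :: "'d \<Rightarrow> real set" where "skel \<equiv> \<lambda>k. set (\<zeta> k)"
abbreviation (input) "clo \<equiv> cell_lo \<zeta>"
abbreviation (input) "chi \<equiv> cell_hi \<zeta>"

lemma finite_skel: "finite (skel k)" by simp

lemma knots_facts:
  "2 \<le> length (\<zeta> k)" "sorted_wrt (<) (\<zeta> k)" "\<zeta> k ! 0 = lo $ k" "\<zeta> k ! (length (\<zeta> k) - 1) = hi $ k" "\<zeta> k \<noteq> []"
proof -
  have *: "2 \<le> length (\<zeta> k)" "sorted_wrt (<) (\<zeta> k)" "hd (\<zeta> k) = lo $ k" "last (\<zeta> k) = hi $ k"
    using knots by (auto simp: knots_def)
  then show "\<zeta> k \<noteq> []" by auto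
  with * show "2 \<le> length (\<zeta> k)" "sorted_wrt (<) (\<zeta> k)" "\<zeta> k ! 0 = lo $ k" "\<zeta> k ! (length (\<zeta> k) - 1) = hi $ k"
    by (auto simp: hd_conv_nth last_conv_nth)
qed

lemma knot_mono: "i \<le> j \<Longrightarrow> j < length (\<zeta> k) \<Longrightarrow> \<zeta> k ! i \<le> \<zeta> k ! j"
  using sorted_wrt_nth_less[OF knots_facts(2), of i j k] by (cases "i = j") auto

lemma cell_lo_less_hi: "j \<in> cells \<zeta> \<Longrightarrow> clo j $ k < chi j $ k"
  using sorted_wrt_nth_less[OF knots_facts(2)[of k], of "j k" "Suc (j k)"]
  by (auto simp: cells_def cell_lo_def cell_hi_def)

lemma pbox_cell: "j \<in> cells \<zeta> \<Longrightarrow> pbox (clo j) (chi j)"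
  by (intro pbox.intro cell_lo_less_hi)

lemma cell_bounds: "j \<in> cells \<zeta> \<Longrightarrow> lo $ k \<le> clo j $ k" "j \<in> cells \<zeta> \<Longrightarrow> chi j $ k \<le> hi $ k"
proof -
  assume "j \<in> cells \<zeta>"
  then have "Suc (j k) < length (\<zeta> k)" by (auto simp: cells_def)
  then have "\<zeta> k ! 0 \<le> \<zeta> k ! j k" "\<zeta> k ! Suc (j k) \<le> \<zeta> k ! (length (\<zeta> k) - 1)"
    by (intro knot_mono; simp)+
  then show "lo $ k \<le> clo j $ k" "chi j $ k \<le> hi $ k"
    unfolding knots_facts(3,4) by (simp_all only: cell_lo_def cell_hi_def vec_lambda_beta)
qed

lemma cell_subset: "j \<in> cells \<zeta> \<Longrightarrow> cbox (clo j) (chi j) \<subseteq> Q"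
  unfolding subset_iff mem_box_cart using cell_bounds by (meson order_trans)

lemma cell_subset_S: "j \<in> cells \<zeta> \<Longrightarrow> cbox (clo j) (chi j) \<subseteq> S"
  using cell_subset box_subset_S by blast

lemma finite_cells: "finite (cells \<zeta>)"
proof (rule finite_subset)
  show "cells \<zeta> \<subseteq> (\<Pi>\<^sub>E i\<in>UNIV. {..<length (\<zeta> i)})"
    by (auto simp: cells_def intro: Suc_lessD)
qed (intro finite_PiE; simp)

lemma curved_box_cell: "j \<in> cells \<zeta> \<Longrightarrow> curved_box F (clo j) (chi j) S"
  using card open_S C1_F C1_pd_F det_nz inj_on_subset[OF inj_F cell_subset] cell_lo_less_hi cell_subset_S
  by unfold_locales auto

lemma knot_interval_coord:
  assumes "lo $ k < t" "t < hi $ k" "t \<notin> skel k"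
  shows "\<exists>m. Suc m < length (\<zeta> k) \<and> \<zeta> k ! m < t \<and> t < \<zeta> k ! Suc m \<and>
    (\<forall>m'. Suc m' < length (\<zeta> k) \<longrightarrow> \<zeta> k ! m' \<le> t \<longrightarrow> t \<le> \<zeta> k ! Suc m' \<longrightarrow> m' = m)"
  using knots assms by (intro knot_interval knots_facts) (auto simp: knots_def)

lemma cell_of:
  assumes "x \<in> Off skel"
  shows "\<exists>j\<in>cells \<zeta>. x \<in> box (clo j) (chi j) \<and> (\<forall>j'\<in>cells \<zeta>. x \<in> cbox (clo j') (chi j') \<longrightarrow> j' = j)"
proof -
  have "\<forall>k. \<exists>m. Suc m < length (\<zeta> k) \<and> \<zeta> k ! m < x $ k \<and> x $ k < \<zeta> k ! Suc m \<and>
    (\<forall>m'. Suc m' < length (\<zeta> k) \<longrightarrow> \<zeta> k ! m' \<le> x $ k \<longrightarrow> x $ k \<le> \<zeta> k ! Suc m' \<longrightarrow> m' = m)"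
    using assms by (intro allI knot_interval_coord) (auto simp: off_skeleton_def mem_box_cart)
  then obtain j where j: "\<And>k. Suc (j k) < length (\<zeta> k)" "\<And>k. \<zeta> k ! j k < x $ k" "\<And>k. x $ k < \<zeta> k ! Suc (j k)"
    "\<And>k m'. Suc m' < length (\<zeta> k) \<Longrightarrow> \<zeta> k ! m' \<le> x $ k \<Longrightarrow> x $ k \<le> \<zeta> k ! Suc m' \<Longrightarrow> m' = j k"
    by metis
  show ?thesis
  proof (intro bexI[of _ j] conjI ballI impI)
    show "j \<in> cells \<zeta>" using j(1) by (simp add: cells_def)
    show "x \<in> box (clo j) (chi j)" using j(2,3) by (simp add: mem_box_cart cell_lo_def cell_hi_def)
    fix j' assume "j' \<in> cells \<zeta>" "x \<in> cbox (clo j') (chi j')"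
    then show "j' = j" by (intro ext j(4)) (auto simp: cells_def mem_box_cart cell_lo_def cell_hi_def)
  qed
qed

definition adj :: "'d \<Rightarrow> bool \<Rightarrow> ('d \<Rightarrow> nat) set" where
  "adj i s = {j \<in> cells \<zeta>. if s then Suc (Suc (j i)) = length (\<zeta> i) else j i = 0}"

lemma adj_cells: "j \<in> adj i s \<Longrightarrow> j \<in> cells \<zeta>" by (simp add: adj_def)

lemma finite_adj: "finite (adj i s)" unfolding adj_def using finite_cells by simp

lemma boundary_facets_adj: "boundary_facets \<zeta> = {(j, i, s). j \<in> adj i s}"
  by (auto simp: boundary_facets_def adj_def)

lemma adj_end: "j \<in> adj i s \<Longrightarrow> (if s then chi j $ i else clo j $ i) = end_coord i s"
proof -
  assume "j \<in> adj i s"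
  then have "if s then Suc (j i) = length (\<zeta> i) - 1 else j i = 0" by (auto simp: adj_def split: if_splits)
  then show ?thesis using knots_facts[of i] by (auto simp: cell_lo_def cell_hi_def split: if_splits)
qed

lemma adj_cell_of:
  assumes y: "y \<in> face i" and off: "\<And>k. k \<noteq> i \<Longrightarrow> y k \<notin> skel k"
  shows "\<exists>j\<in>adj i s. face_point i (end_coord i s) y \<in> cbox (clo j) (chi j) \<and>
    (\<forall>k. k \<noteq> i \<longrightarrow> clo j $ k < y k \<and> y k < chi j $ k) \<and>
    (\<forall>j'\<in>adj i s. (\<forall>k. k \<noteq> i \<longrightarrow> clo j' $ k \<le> y k \<and> y k \<le> chi j' $ k) \<longrightarrow> j' = j)"
proof -
  have ends: "lo $ k \<in> skel k" "hi $ k \<in> skel k" for k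
    using knots_facts[of k] nth_mem[of 0 "\<zeta> k"] nth_mem[of "length (\<zeta> k) - 1" "\<zeta> k"] by auto
  have "\<forall>k. \<exists>m. k \<noteq> i \<longrightarrow> Suc m < length (\<zeta> k) \<and> \<zeta> k ! m < y k \<and> y k < \<zeta> k ! Suc m \<and>
    (\<forall>m'. Suc m' < length (\<zeta> k) \<longrightarrow> \<zeta> k ! m' \<le> y k \<longrightarrow> y k \<le> \<zeta> k ! Suc m' \<longrightarrow> m' = m)"
  proof
    fix k
    show "\<exists>m. k \<noteq> i \<longrightarrow> Suc m < length (\<zeta> k) \<and> \<zeta> k ! m < y k \<and> y k < \<zeta> k ! Suc m \<and>
      (\<forall>m'. Suc m' < length (\<zeta> k) \<longrightarrow> \<zeta> k ! m' \<le> y k \<longrightarrow> y k \<le> \<zeta> k ! Suc m' \<longrightarrow> m' = m)"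
    proof (cases "k = i")
      case False
      then have "y k \<in> {lo $ k .. hi $ k}" "y k \<noteq> lo $ k" "y k \<noteq> hi $ k"
        using y off[OF False] ends[of k] by (auto simp: face_def PiE_iff)
      then have "lo $ k < y k" "y k < hi $ k" by auto
      from knot_interval_coord[OF this off[OF False]] show ?thesis by (elim exE) (rule exI, rule impI)
    qed simp
  qed
  then obtain j0 where j0: "\<And>k. k \<noteq> i \<Longrightarrow> Suc (j0 k) < length (\<zeta> k)" "\<And>k. k \<noteq> i \<Longrightarrow> \<zeta> k ! j0 k < y k"
    "\<And>k. k \<noteq> i \<Longrightarrow> y k < \<zeta> k ! Suc (j0 k)"
    "\<And>k m'. k \<noteq> i \<Longrightarrow> Suc m' < length (\<zeta> k) \<Longrightarrow> \<zeta> k ! m' \<le> y k \<Longrightarrow> y k \<le> \<zeta> k ! Suc m' \<Longrightarrow> m' = j0 k"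
    by metis
  define j where "j = j0(i := if s then length (\<zeta> i) - 2 else 0)"
  have jadj: "j \<in> adj i s" using j0(1) knots_facts(1)[of i] by (auto simp: adj_def cells_def j_def)
  show ?thesis
  proof (intro bexI[OF _ jadj] conjI ballI allI impI)
    have k: "clo j $ k < y k \<and> y k < chi j $ k" if "k \<noteq> i" for k
      using j0(2,3)[OF that] that by (simp add: cell_lo_def cell_hi_def j_def)
    then show "clo j $ k < y k" "y k < chi j $ k" if "k \<noteq> i" for k using that by blast+
    have e: "clo j $ i \<le> end_coord i s \<and> end_coord i s \<le> chi j $ i"
      using adj_end[OF jadj] cell_lo_less_hi[OF adj_cells[OF jadj], of i] by (auto split: if_splits)
    show "face_point i (end_coord i s) y \<in> cbox (clo j) (chi j)"
      unfolding mem_box_cart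
    proof
      fix k
      show "clo j $ k \<le> face_point i (end_coord i s) y $ k \<and> face_point i (end_coord i s) y $ k \<le> chi j $ k"
        using k[of k] e by (cases "k = i") auto
    qed
    fix j' assume j': "j' \<in> adj i s" and "\<forall>k. k \<noteq> i \<longrightarrow> clo j' $ k \<le> y k \<and> y k \<le> chi j' $ k"
    then have j'2: "\<And>k. k \<noteq> i \<Longrightarrow> clo j' $ k \<le> y k \<and> y k \<le> chi j' $ k" by blast
    show "j' = j"
    proof
      fix k
      show "j' k = j k"
      proof (cases "k = i")
        case True
        then show ?thesis using j' by (auto simp: adj_def j_def split: if_splits)
      next
        case False
        have "j' k = j0 k" using j'2[OF False] adj_cells[OF j']
          by (intro j0(4)[OF False]) (auto simp: cells_def cell_lo_def cell_hi_def)
        then show ?thesis using False by (simp add: j_def)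
      qed
    qed
  qed
qed

abbreviation (input) cI :: "('d \<Rightarrow> nat) \<Rightarrow> (real^'d \<Rightarrow> real) \<Rightarrow> real" where
  "cI j \<equiv> pbox.cint (clo j) (chi j)"
abbreviation (input) cF :: "('d \<Rightarrow> nat) \<Rightarrow> 'd \<Rightarrow> bool \<Rightarrow> (real^'d \<Rightarrow> real) \<Rightarrow> real" where
  "cF j \<equiv> pbox.cface (clo j) (chi j)"

text \<open>The cells overlap in a null set only, and almost every point of the box lies in the interior of exactly one of them.\<close>

lemma sum_cint:
  assumes g: "BM skel g" and gj: "\<And>j. j \<in> cells \<zeta> \<Longrightarrow> continuous_on (cbox (clo j) (chi j)) (gj j)"
    and eq: "\<And>j x. j \<in> cells \<zeta> \<Longrightarrow> x \<in> Off skel \<Longrightarrow> x \<in> box (clo j) (chi j) \<Longrightarrow> g x = gj j x"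
  shows "(\<Sum>j\<in>cells \<zeta>. cI j (gj j)) = (LBINT x. indicator (Off skel) x * g x)"
proof -
  have int: "integrable lborel (\<lambda>x. indicator (cbox (clo j) (chi j)) x * gj j x)" if "j \<in> cells \<zeta>" for j
    by (rule pbox.integrable_cint[OF pbox_cell[OF that] gj[OF that]])
  have "(\<Sum>j\<in>cells \<zeta>. cI j (gj j)) = (LBINT x. \<Sum>j\<in>cells \<zeta>. indicator (cbox (clo j) (chi j)) x * gj j x)"
    by (subst Bochner_Integration.integral_sum[OF int]) (simp_all add: pbox.cint_def[OF pbox_cell])
  also have "\<dots> = (LBINT x. indicator (Off skel) x * g x)"
  proof (rule integral_cong_AE)
    show "(\<lambda>x. \<Sum>j\<in>cells \<zeta>. indicator (cbox (clo j) (chi j)) x * gj j x) \<in> borel_measurable lborel"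
      by (intro borel_measurable_sum borel_measurable_integrable int)
    show "(\<lambda>x. indicator (Off skel) x * g x) \<in> borel_measurable lborel"
      by (rule borel_measurable_integrable[OF integrable_BM[OF finite_skel g]])
    have "AE x in lebesgue. x \<notin> Q - Off skel"
      by (rule AE_not_in[OF negligible_skeleton[OF finite_skel, unfolded negligible_iff_null_sets]])
    then have "AE x in lborel. x \<notin> Q - Off skel" by (simp only: AE_completion_iff)
    then show "AE x in lborel. (\<Sum>j\<in>cells \<zeta>. indicator (cbox (clo j) (chi j)) x * gj j x) = indicator (Off skel) x * g x"
    proof eventually_elim
      case (elim x)
      show ?case
      proof (cases "x \<in> Off skel")
        case True
        from cell_of[OF True] obtain j where j: "j \<in> cells \<zeta>" "x \<in> box (clo j) (chi j)"
          "\<forall>j'\<in>cells \<zeta>. x \<in> cbox (clo j') (chi j') \<longrightarrow> j' = j"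
          by (elim bexE conjE)
        have "(\<Sum>j\<in>cells \<zeta>. indicator (cbox (clo j) (chi j)) x * gj j x) = (\<Sum>j'\<in>cells \<zeta>. if j' = j then gj j x else 0)"
        proof (intro sum.cong refl)
          fix j' assume j': "j' \<in> cells \<zeta>"
          show "indicator (cbox (clo j') (chi j')) x * gj j' x = (if j' = j then gj j x else 0)"
          proof (cases "j' = j")
            case True
            then show ?thesis using subsetD[OF box_subset_cbox j(2)] by simp
          next
            case False
            then have "x \<notin> cbox (clo j') (chi j')" using j(3) j' by blast
            then show ?thesis using False by simp
          qed
        qed
        then show ?thesis using True finite_cells j(1) eq[OF j(1) True j(2)] by simp
      next
        case False
        then have "x \<notin> Q" using elim by simp
        then have "indicator (cbox (clo j) (chi j)) x = (0::real)" if "j \<in> cells \<zeta>" for j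
          using cell_subset[OF that] by (auto simp: indicator_def)
        then show ?thesis using False by simp
      qed
    qed
  qed
  finally show ?thesis .
qed

text \<open>As for volumes: almost every point of a face of the box lies on exactly one facet.\<close>

lemma sum_cface:
  assumes g: "FM g" and gj: "\<And>j. j \<in> adj i s \<Longrightarrow> continuous_on (cbox (clo j) (chi j)) (gj j)"
    and eq: "\<And>j y. j \<in> adj i s \<Longrightarrow> y \<in> face i \<Longrightarrow> (\<And>k. k \<noteq> i \<Longrightarrow> y k \<notin> skel k) \<Longrightarrow>
      (\<And>k. k \<noteq> i \<Longrightarrow> clo j $ k < y k \<and> y k < chi j $ k) \<Longrightarrow>
      g (face_point i (end_coord i s) y) = gj j (face_point i (end_coord i s) y)"
  shows "(\<Sum>j\<in>adj i s. cF j i s (gj j)) = (\<integral>y. indicator (face i) y * g (face_point i (end_coord i s) y) \<partial>slice_measure i)"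
proof -
  let ?c = "end_coord i s"
  have cF: "cF j i s f = (\<integral>y. indicator (pbox.sect (clo j) (chi j) i) y * f (face_point i ?c y) \<partial>slice_measure i)" if "j \<in> adj i s" for j f
    unfolding pbox.cface_def[OF pbox_cell[OF adj_cells[OF that]]] adj_end[OF that] ..
  have int: "integrable (slice_measure i) (\<lambda>y. indicator (pbox.sect (clo j) (chi j) i) y * gj j (face_point i ?c y))" if j: "j \<in> adj i s" for j
    using pbox.integrable_cface[OF pbox_cell[OF adj_cells[OF j]] gj[OF j] pbox.endc_in[OF pbox_cell[OF adj_cells[OF j]], where i=i and s=s]]
    unfolding adj_end[OF j] .
  have sect: "pbox.sect (clo j) (chi j) i = (\<Pi>\<^sub>E k\<in>-{i}. {clo j $ k .. chi j $ k})" if "j \<in> adj i s" for j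
    by (rule pbox.sect_def[OF pbox_cell[OF adj_cells[OF that]]])
  have "(\<Sum>j\<in>adj i s. cF j i s (gj j)) = (\<integral>y. (\<Sum>j\<in>adj i s. indicator (pbox.sect (clo j) (chi j) i) y * gj j (face_point i ?c y)) \<partial>slice_measure i)"
    by (subst Bochner_Integration.integral_sum[OF int]) (simp_all add: cF cong: sum.cong)
  also have "\<dots> = (\<integral>y. indicator (face i) y * g (face_point i ?c y) \<partial>slice_measure i)"
  proof (rule integral_cong_AE)
    show "(\<lambda>y. \<Sum>j\<in>adj i s. indicator (pbox.sect (clo j) (chi j) i) y * gj j (face_point i ?c y)) \<in> borel_measurable (slice_measure i)"
      by (intro borel_measurable_sum borel_measurable_integrable int)
    show "(\<lambda>y. indicator (face i) y * g (face_point i ?c y)) \<in> borel_measurable (slice_measure i)"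
      by (rule borel_measurable_integrable[OF integrable_FM[OF g]])
    have "AE y in slice_measure i. \<forall>k. k \<noteq> i \<longrightarrow> y k \<notin> skel k" by (rule AE_slice_coordinates[OF finite_skel])
    then show "AE y in slice_measure i. (\<Sum>j\<in>adj i s. indicator (pbox.sect (clo j) (chi j) i) y * gj j (face_point i ?c y))
        = indicator (face i) y * g (face_point i ?c y)"
    proof eventually_elim
      case (elim y)
      show ?case
      proof (cases "y \<in> face i")
        case True
        have "\<exists>j\<in>adj i s. face_point i ?c y \<in> cbox (clo j) (chi j) \<and>
          (\<forall>k. k \<noteq> i \<longrightarrow> clo j $ k < y k \<and> y k < chi j $ k) \<and>
          (\<forall>j'\<in>adj i s. (\<forall>k. k \<noteq> i \<longrightarrow> clo j' $ k \<le> y k \<and> y k \<le> chi j' $ k) \<longrightarrow> j' = j)"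
          by (rule adj_cell_of[OF True]) (use elim in blast)
        then obtain j where j: "j \<in> adj i s" "\<forall>k. k \<noteq> i \<longrightarrow> clo j $ k < y k \<and> y k < chi j $ k"
          "\<forall>j'\<in>adj i s. (\<forall>k. k \<noteq> i \<longrightarrow> clo j' $ k \<le> y k \<and> y k \<le> chi j' $ k) \<longrightarrow> j' = j"
          by (elim bexE conjE)
        have "y \<in> extensional (- {i})" by (rule conjunct2[OF True[unfolded face_def PiE_iff]])
        have iff: "y \<in> pbox.sect (clo j') (chi j') i \<longleftrightarrow> j' = j" if j': "j' \<in> adj i s" for j'
        proof
          assume "y \<in> pbox.sect (clo j') (chi j') i"
          then have "\<forall>k. k \<noteq> i \<longrightarrow> clo j' $ k \<le> y k \<and> y k \<le> chi j' $ k"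
            unfolding sect[OF j'] PiE_iff by simp
          then show "j' = j" using bspec[OF j(3) j'] by (rule rev_mp)
        next
          assume "j' = j"
          moreover have "y \<in> pbox.sect (clo j) (chi j) i"
            unfolding sect[OF j(1)] PiE_iff
          proof (intro conjI ballI)
            show "y k \<in> {clo j $ k .. chi j $ k}" if "k \<in> - {i}" for k
              using spec[OF j(2), of k] that by simp
          qed fact
          ultimately show "y \<in> pbox.sect (clo j') (chi j') i" by simp
        qed
        then have "(\<Sum>j'\<in>adj i s. indicator (pbox.sect (clo j') (chi j') i) y * gj j' (face_point i ?c y))
            = (\<Sum>j'\<in>adj i s. if j' = j then gj j (face_point i ?c y) else 0)"
          by (intro sum.cong refl) (simp only: indicator_def of_bool_def, simp add: iff)
        also have "\<dots> = gj j (face_point i ?c y)" using j(1) finite_adj by simp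
        also have "\<dots> = g (face_point i ?c y)"
          by (rule eq[symmetric, OF j(1) True]) (use elim j(2) in blast)+
        finally show ?thesis using True by simp
      next
        case False
        have "y \<notin> pbox.sect (clo j) (chi j) i" if j: "j \<in> adj i s" for j
        proof
          assume y: "y \<in> pbox.sect (clo j) (chi j) i"
          have "y \<in> face i"
            unfolding face_def PiE_iff
          proof (intro conjI ballI)
            show "y \<in> extensional (- {i})" by (rule conjunct2[OF y[unfolded sect[OF j] PiE_iff]])
            show "y k \<in> {lo $ k .. hi $ k}" if "k \<in> - {i}" for k
              using bspec[OF conjunct1[OF y[unfolded sect[OF j] PiE_iff]] that]
                cell_bounds[OF adj_cells[OF j], of k] by simp
          qed
          with False show False by simp
        qed
        then show ?thesis using False by simp
      qed
    qed
  qed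
  finally show ?thesis .
qed

lemma boundary_facet_sum_eq:
  assumes gh: "continuous_on Q gh" and eq: "\<And>x. x \<in> Q \<Longrightarrow> f (F x) = gh x"
  shows "boundary_facet_sum F \<zeta> f = (\<Sum>i\<in>UNIV. \<Sum>s\<in>UNIV. fint i s gh)"
proof -
  have cell: "(LINT x|face_measure F (clo j) (chi j) i s. f x) = cF j i s (\<lambda>x. dens i x * gh x)" if j: "j \<in> adj i s" for i s j
  proof -
    interpret c: curved_box F "clo j" "chi j" S by (rule curved_box_cell[OF adj_cells[OF j]])
    interpret p: pbox "clo j" "chi j" by (rule pbox_cell[OF adj_cells[OF j]])
    have sub: "cbox (clo j) (chi j) \<subseteq> Q" by (rule cell_subset[OF adj_cells[OF j]])
    have "(LINT x|face_measure F (clo j) (chi j) i s. f x) = c.fint i s gh"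
      by (rule c.integral_face_measure_continuous[OF continuous_on_subset[OF gh sub]]) (use eq sub in blast)
    then show ?thesis unfolding c.fint_def p.cface_def c.face_def p.sect_def .
  qed
  have "boundary_facet_sum F \<zeta> f = (\<Sum>(j, i, s)\<in>boundary_facets \<zeta>. cF j i s (\<lambda>x. dens i x * gh x))"
    unfolding boundary_facet_sum_def by (intro sum.cong refl) (auto simp: boundary_facets_adj cell)
  also have "\<dots> = (\<Sum>(i, s)\<in>UNIV. \<Sum>j\<in>adj i s. cF j i s (\<lambda>x. dens i x * gh x))"
  proof -
    have "(\<Sum>(i, s)\<in>UNIV. \<Sum>j\<in>adj i s. cF j i s (\<lambda>x. dens i x * gh x))
       = (\<Sum>((i, s), j)\<in>Sigma UNIV (\<lambda>(i, s). adj i s). cF j i s (\<lambda>x. dens i x * gh x))"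
      by (subst sum.Sigma[symmetric]) (auto simp: finite_adj split_beta)
    also have "\<dots> = (\<Sum>(j, i, s)\<in>boundary_facets \<zeta>. cF j i s (\<lambda>x. dens i x * gh x))"
      by (rule sum.reindex_bij_witness[where i="\<lambda>(j, i, s). ((i, s), j)" and j="\<lambda>((i, s), j). (j, i, s)"])
        (auto simp: boundary_facets_adj)
    finally show ?thesis by simp
  qed
  also have "\<dots> = (\<Sum>(i, s)\<in>UNIV. fint i s gh)"
  proof (intro sum.cong refl, clarify)
    fix i s
    have d: "continuous_on Q (\<lambda>x. dens i x * gh x)" by (intro continuous_on_mult continuous_dens gh)
    show "(\<Sum>j\<in>adj i s. cF j i s (\<lambda>x. dens i x * gh x)) = fint i s gh"
      unfolding fint_def
      by (rule sum_cface[OF FM_continuous[OF d]])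
        (auto intro: continuous_on_subset[OF d cell_subset[OF adj_cells]])
  qed
  also have "\<dots> = (\<Sum>i\<in>UNIV. \<Sum>s\<in>UNIV. fint i s gh)"
    unfolding UNIV_Times_UNIV[symmetric] sum.cartesian_product[symmetric] ..
  finally show ?thesis .
qed

end

section \<open>The local trace inequality on a curved cell\<close>

context curved_box
begin

lemma continuous_Q_bounded:
  fixes f :: "real^'d \<Rightarrow> real"
  assumes "continuous_on Q f" shows "\<exists>B>0. \<forall>x\<in>Q. \<bar>f x\<bar> \<le> B"
proof -
  have "bounded (f ` Q)" by (intro compact_imp_bounded compact_continuous_image assms compact_cbox)
  then obtain B where B: "\<And>x. x \<in> Q \<Longrightarrow> \<bar>f x\<bar> \<le> B" by (auto simp: bounded_iff)
  show ?thesis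
  proof (intro exI[of _ "\<bar>B\<bar> + 1"] conjI ballI)
    show "\<bar>f x\<bar> \<le> \<bar>B\<bar> + 1" if "x \<in> Q" for x using B[OF that] by linarith
  qed simp
qed

lemma finite_family_bound:
  assumes "finite I" "\<And>m. m \<in> I \<Longrightarrow> \<exists>B>0::real. \<forall>x\<in>A. P m x B"
    and mono: "\<And>m x B B'. P m x B \<Longrightarrow> B \<le> B' \<Longrightarrow> P m x B'"
  shows "\<exists>B>0. \<forall>m\<in>I. \<forall>x\<in>A. P m x B"
  using assms(1,2)
proof induction
  case empty show ?case by (intro exI[of _ 1]) simp
next
  case (insert m I)
  obtain B1 where B1: "B1 > 0" "\<forall>x\<in>A. P m x B1" using insert.prems by blast
  obtain B2 where B2: "B2 > 0" "\<forall>m\<in>I. \<forall>x\<in>A. P m x B2" using insert by blast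
  show ?case
  proof (intro exI[of _ "max B1 B2"] conjI ballI)
    show "0 < max B1 B2" using B1 by simp
    fix m' x assume m': "m' \<in> insert m I" and x: "x \<in> A"
    show "P m' x (max B1 B2)"
    proof (cases "m' = m")
      case True
      show ?thesis unfolding True by (rule mono[OF bspec[OF B1(2) x]]) simp
    next
      case False
      then have "m' \<in> I" using m' by simp
      show ?thesis by (rule mono[OF bspec[OF bspec[OF B2(2) \<open>m' \<in> I\<close>] x]]) simp
    qed
  qed
qed

lemma continuous_C1S: "C1 S f \<Longrightarrow> continuous_on Q f"
  by (rule continuous_on_subset[OF C1_continuous_on box_subset_S])

lemma continuous_pd_C1S: "C1 S f \<Longrightarrow> continuous_on Q (pd i f)"
  by (rule continuous_on_subset[OF C1_continuous_pd box_subset_S])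

lemma mean_value_Q:
  assumes f: "C1 S f" and x: "x \<in> Q" and y: "y \<in> Q"
  shows "\<exists>\<xi>\<in>Q. dist \<xi> y \<le> dist x y \<and> f x - f y = (\<Sum>i\<in>UNIV. (x - y) $ i * pd i f \<xi>)"
proof -
  let ?l = "\<lambda>t. y + t *\<^sub>R (x - y)"
  have lQ: "?l t \<in> Q" if "0 \<le> t" "t \<le> 1" for t
  proof -
    have "?l t = (1 - t) *\<^sub>R y + t *\<^sub>R x" by (simp add: algebra_simps)
    then show ?thesis using convexD[OF convex_box(1) y x, of "1 - t" t] that by simp
  qed
  have D: "DERIV (\<lambda>t. f (?l t)) t :> (\<Sum>i\<in>UNIV. (x - y) $ i * pd i f (?l t))" if "0 \<le> t" "t \<le> 1" for t
  proof -
    have l: "(?l has_derivative (\<lambda>h. h *\<^sub>R (x - y))) (at t)" by (auto intro!: derivative_eq_intros)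
    have "(f has_derivative (\<lambda>h. \<Sum>i\<in>UNIV. h $ i * pd i f (?l t))) (at (?l t))"
      by (rule has_derivative_pd[OF C1_differentiable[OF f box_in_S(2)[OF lQ[OF that]]]])
    note d = diff_chain_at[OF l this]
    have e: "(\<lambda>h. \<Sum>i\<in>UNIV. h $ i * pd i f (?l t)) \<circ> (\<lambda>h. h *\<^sub>R (x - y)) = (*) (\<Sum>i\<in>UNIV. (x - y) $ i * pd i f (?l t))"
      by (rule ext) (simp add: o_def sum_distrib_left mult_ac vector_scaleR_component del: vector_minus_component)
    show ?thesis using d unfolding has_field_derivative_def e by (simp add: o_def)
  qed
  have "\<exists>z>0. z < 1 \<and> f (?l 1) - f (?l 0) = (1 - 0) * (\<Sum>i\<in>UNIV. (x - y) $ i * pd i f (?l z))"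
    by (rule MVT2) (use D in auto)
  then obtain z where z: "0 < z" "z < 1" "f x - f y = (\<Sum>i\<in>UNIV. (x - y) $ i * pd i f (?l z))" by auto
  show ?thesis
  proof (intro bexI[of _ "?l z"] conjI)
    show "?l z \<in> Q" using z by (intro lQ) auto
    have "dist (?l z) y = z * dist x y" using z by (simp add: dist_norm)
    also have "\<dots> \<le> 1 * dist x y" using z by (intro mult_right_mono) auto
    finally show "dist (?l z) y \<le> dist x y" by simp
  qed (rule z(3))
qed

lemma C1_lipschitz:
  assumes f: "C1 S f" shows "\<exists>L>0. \<forall>x\<in>Q. \<forall>y\<in>Q. \<bar>f x - f y\<bar> \<le> L * norm (x - y)"
proof -
  obtain B where B: "B > 0" "\<And>i x. x \<in> Q \<Longrightarrow> \<bar>pd i f x\<bar> \<le> B"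
  proof -
    have "\<exists>B>0. \<forall>i\<in>UNIV. \<forall>x\<in>Q. \<bar>pd i f x\<bar> \<le> B"
      by (rule finite_family_bound[where P="\<lambda>i x B. \<bar>pd i f x\<bar> \<le> B"])
        (auto intro: continuous_Q_bounded[OF continuous_pd_C1S[OF f]])
    then show ?thesis using that by blast
  qed
  show ?thesis
  proof (intro exI[of _ "real CARD('d) * B"] conjI ballI)
    show "0 < real CARD('d) * B" using B(1) by simp
    fix x y assume x: "x \<in> Q" and y: "y \<in> Q"
    obtain \<xi> where \<xi>: "\<xi> \<in> Q" "f x - f y = (\<Sum>i\<in>UNIV. (x - y) $ i * pd i f \<xi>)"
      using mean_value_Q[OF f x y] by blast
    have "\<bar>f x - f y\<bar> \<le> (\<Sum>i\<in>UNIV. \<bar>(x - y) $ i * pd i f \<xi>\<bar>)" unfolding \<xi>(2) by (rule sum_abs)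
    also have "\<dots> \<le> (\<Sum>i\<in>(UNIV::'d set). norm (x - y) * B)"
      unfolding abs_mult using B(2)[OF \<xi>(1)] by (intro sum_mono mult_mono component_le_norm_cart) auto
    finally show "\<bar>f x - f y\<bar> \<le> real CARD('d) * B * norm (x - y)" by (simp add: mult_ac)
  qed
qed

text \<open>For nearby points a first order expansion with the inverse Jacobian gives the bound.  Pairs at distance at least \<open>\<delta>\<close> form a
  compact set on which injectivity keeps \<open>|F x - F y|\<close> away from zero.\<close>

lemma F_lower_lipschitz: "\<exists>\<kappa>>0. \<forall>x\<in>Q. \<forall>y\<in>Q. \<kappa> * norm (x - y) \<le> norm (F x - F y)"
proof -
  define n where "n = real CARD('d)"
  have n: "n \<ge> 1" using zero_less_card_finite[where 'a='d] by (simp add: n_def Suc_le_eq)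
  obtain B where B: "B > 0" "\<And>i a x. x \<in> Q \<Longrightarrow> \<bar>K x $ i $ a\<bar> \<le> B"
  proof -
    have "\<exists>B>0. \<forall>ia\<in>(UNIV :: ('d \<times> 'd) set). \<forall>x\<in>Q. \<bar>K x $ fst ia $ snd ia\<bar> \<le> B"
      by (rule finite_family_bound[where P="\<lambda>ia x B. \<bar>K x $ fst ia $ snd ia\<bar> \<le> B"])
        (auto intro: continuous_Q_bounded[OF continuous_C1S[OF C1_K]])
    then show ?thesis using that by force
  qed
  define \<epsilon> where "\<epsilon> = 1 / (2 * (n * n * n * B))"
  have eps: "\<epsilon> > 0" using n B(1) by (simp add: \<epsilon>_def)
  have uc: "\<exists>\<delta>>0. \<forall>x\<in>Q. \<forall>y\<in>Q. dist x y < \<delta> \<longrightarrow> \<bar>pd i (\<lambda>x. F x $ a) x - pd i (\<lambda>x. F x $ a) y\<bar> < \<epsilon>" for i a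
  proof -
    have "uniformly_continuous_on Q (pd i (\<lambda>x. F x $ a))"
      by (rule compact_uniformly_continuous[OF continuous_pd_C1S[OF C1_F] compact_cbox])
    then show ?thesis using eps unfolding uniformly_continuous_on_def dist_real_def by blast
  qed
  then obtain d where d: "\<And>i a. d i a > 0"
    "\<And>i a x y. x \<in> Q \<Longrightarrow> y \<in> Q \<Longrightarrow> dist x y < d i a \<Longrightarrow> \<bar>pd i (\<lambda>x. F x $ a) x - pd i (\<lambda>x. F x $ a) y\<bar> < \<epsilon>"
    by metis
  define \<delta> where "\<delta> = Min (range (\<lambda>ia. d (fst ia) (snd ia)))"
  have \<delta>: "\<delta> > 0" "\<And>i a. \<delta> \<le> d i a"
  proof -
    show "\<delta> > 0" unfolding \<delta>_def using d(1) by (subst Min_gr_iff) auto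
    show "\<delta> \<le> d i a" for i a unfolding \<delta>_def
      by (rule Min_le) (auto intro: range_eqI[where x="(i, a)"])
  qed
  have near: "norm (x - y) \<le> 2 * (n * n * B) * norm (F x - F y)" if x: "x \<in> Q" and y: "y \<in> Q" and xy: "dist x y < \<delta>" for x y
  proof -
    let ?N = "norm (x - y)"
    have xk: "(x - y) $ k = (\<Sum>a\<in>UNIV. K y $ k $ a * (\<Sum>i\<in>UNIV. J y $ a $ i * (x - y) $ i))" for k
    proof -
      have "(x - y) $ k = (\<Sum>i\<in>UNIV. (\<Sum>a\<in>UNIV. K y $ k $ a * J y $ a $ i) * (x - y) $ i)"
        unfolding KJ_nth[OF box_in_S(2)[OF y]] by (simp add: if_distrib[of "\<lambda>z. z * _"] cong: if_cong)
      also have "\<dots> = (\<Sum>i\<in>UNIV. \<Sum>a\<in>UNIV. K y $ k $ a * (J y $ a $ i * (x - y) $ i))"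
        by (simp add: sum_distrib_right mult.assoc del: vector_minus_component)
      also have "\<dots> = (\<Sum>a\<in>UNIV. K y $ k $ a * (\<Sum>i\<in>UNIV. J y $ a $ i * (x - y) $ i))"
        by (subst sum.swap) (simp only: sum_distrib_left)
      finally show ?thesis .
    qed
    have lin: "\<bar>\<Sum>i\<in>UNIV. J y $ a $ i * (x - y) $ i\<bar> \<le> norm (F x - F y) + n * (?N * \<epsilon>)" for a
    proof -
      obtain \<xi> where \<xi>: "\<xi> \<in> Q" "dist \<xi> y \<le> dist x y"
        "F x $ a - F y $ a = (\<Sum>i\<in>UNIV. (x - y) $ i * pd i (\<lambda>x. F x $ a) \<xi>)"
        using mean_value_Q[OF C1_F x y] by blast
      have "(\<Sum>i\<in>UNIV. J y $ a $ i * (x - y) $ i) = (F x - F y) $ a -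
          (\<Sum>i\<in>UNIV. (x - y) $ i * (pd i (\<lambda>x. F x $ a) \<xi> - pd i (\<lambda>x. F x $ a) y))"
        using \<xi>(3) by (simp add: J_def right_diff_distrib sum_subtractf mult.commute)
      then have "\<bar>\<Sum>i\<in>UNIV. J y $ a $ i * (x - y) $ i\<bar> \<le> \<bar>(F x - F y) $ a\<bar> +
          \<bar>\<Sum>i\<in>UNIV. (x - y) $ i * (pd i (\<lambda>x. F x $ a) \<xi> - pd i (\<lambda>x. F x $ a) y)\<bar>" by linarith
      also have "\<dots> \<le> norm (F x - F y) + (\<Sum>i\<in>(UNIV::'d set). ?N * \<epsilon>)"
      proof (intro add_mono component_le_norm_cart order_trans[OF sum_abs sum_mono])
        fix i :: 'd
        have "dist \<xi> y < d i a" using \<xi>(2) xy \<delta>(2)[of i a] by linarith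
        from d(2)[OF \<xi>(1) y this]
        show "\<bar>(x - y) $ i * (pd i (\<lambda>x. F x $ a) \<xi> - pd i (\<lambda>x. F x $ a) y)\<bar> \<le> ?N * \<epsilon>"
          unfolding abs_mult by (intro mult_mono component_le_norm_cart) auto
      qed
      finally show ?thesis by (simp add: n_def)
    qed
    have "?N \<le> (\<Sum>k\<in>UNIV. \<bar>(x - y) $ k\<bar>)" by (rule norm_le_l1_cart)
    also have "\<dots> \<le> (\<Sum>k\<in>(UNIV::'d set). \<Sum>a\<in>(UNIV::'d set). B * (norm (F x - F y) + n * (?N * \<epsilon>)))"
    proof (intro sum_mono)
      fix k :: 'd
      have "\<bar>(x - y) $ k\<bar> \<le> (\<Sum>a\<in>UNIV. \<bar>K y $ k $ a * (\<Sum>i\<in>UNIV. J y $ a $ i * (x - y) $ i)\<bar>)"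
        unfolding xk[of k] by (rule sum_abs)
      also have "\<dots> \<le> (\<Sum>a\<in>(UNIV::'d set). B * (norm (F x - F y) + n * (?N * \<epsilon>)))"
        unfolding abs_mult using B lin y by (intro sum_mono mult_mono) auto
      finally show "\<bar>(x - y) $ k\<bar> \<le> (\<Sum>a\<in>(UNIV::'d set). B * (norm (F x - F y) + n * (?N * \<epsilon>)))" .
    qed
    also have "\<dots> = n * n * B * norm (F x - F y) + ?N * (n * n * n * B * \<epsilon>)"
      by (simp add: n_def algebra_simps)
    also have "n * n * n * B * \<epsilon> = 1 / 2" using n B(1) by (simp add: \<epsilon>_def)
    finally show ?thesis by simp
  qed
  define A where "A = {p \<in> Q \<times> Q. \<delta> \<le> dist (fst p) (snd p)}"
  have compA: "compact A"
  proof -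
    have "A = (Q \<times> Q) \<inter> {p. \<delta> \<le> dist (fst p) (snd p)}" by (auto simp: A_def)
    moreover have "closed {p :: (real^'d) \<times> (real^'d). \<delta> \<le> dist (fst p) (snd p)}"
      by (intro closed_Collect_le continuous_intros)
    ultimately show ?thesis by (simp add: compact_Int_closed compact_Times)
  qed
  have contA: "continuous_on A (\<lambda>p. norm (F (fst p) - F (snd p)))"
    by (intro continuous_intros continuous_on_compose2[OF continuous_F_Q]) (auto simp: A_def)
  have "\<exists>m>0. \<forall>p\<in>A. m \<le> norm (F (fst p) - F (snd p))"
  proof (cases "A = {}")
    case True then show ?thesis by (intro exI[of _ 1]) simp
  next
    case False
    obtain p where p: "p \<in> A" "\<forall>q\<in>A. norm (F (fst p) - F (snd p)) \<le> norm (F (fst q) - F (snd q))"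
      using continuous_attains_inf[OF compA False contA] by blast
    have "fst p \<in> Q" "snd p \<in> Q" "fst p \<noteq> snd p" using p(1) \<delta>(1) by (auto simp: A_def)
    then have "F (fst p) \<noteq> F (snd p)" using inj_onD[OF inj_F] by blast
    then have "0 < norm (F (fst p) - F (snd p))" by simp
    then show ?thesis using p(2) by blast
  qed
  then obtain m where m: "m > 0" "\<And>x y. (x, y) \<in> A \<Longrightarrow> m \<le> norm (F x - F y)" by force
  obtain D where D: "\<And>x. x \<in> Q \<Longrightarrow> norm x \<le> D" using bounded_cbox[of lo hi] by (auto simp: bounded_iff)
  have D0: "D \<ge> 0" using D[of lo] less_imp_le[OF lo_less_hi] by (force simp: mem_box_cart intro: order_trans[OF norm_ge_zero])
  define \<kappa> where "\<kappa> = min (1 / (2 * (n * n * B))) (m / (2 * D + 1))"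
  have \<kappa>: "\<kappa> > 0" using n B(1) m(1) D0 by (simp add: \<kappa>_def)
  have "\<kappa> * norm (x - y) \<le> norm (F x - F y)" if x: "x \<in> Q" and y: "y \<in> Q" for x y
  proof (cases "dist x y < \<delta>")
    case True
    have "\<kappa> * norm (x - y) \<le> 1 / (2 * (n * n * B)) * (2 * (n * n * B) * norm (F x - F y))"
      using near[OF x y True] \<kappa> by (intro mult_mono) (auto simp: \<kappa>_def)
    also have "\<dots> = norm (F x - F y)" using n B(1) by simp
    finally show ?thesis .
  next
    case False
    then have "m \<le> norm (F x - F y)" using x y by (intro m(2)) (simp add: A_def)
    moreover have "norm (x - y) \<le> 2 * D + 1" using norm_triangle_ineq4[of x y] D[OF x] D[OF y] by linarith
    then have "\<kappa> * norm (x - y) \<le> m / (2 * D + 1) * (2 * D + 1)"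
      using \<kappa> m(1) D0 by (intro mult_mono) (auto simp: \<kappa>_def)
    then have "\<kappa> * norm (x - y) \<le> m" using D0 by simp
    ultimately show ?thesis by linarith
  qed
  then show ?thesis using \<kappa> by blast
qed

lemma measure_image_le:
  assumes D: "\<And>x. x \<in> Q \<Longrightarrow> \<bar>det (J x)\<bar> \<le> D" and sub: "cbox a b \<subseteq> Q"
  shows "measure lebesgue (F ` cbox a b) \<le> D * measure lebesgue (cbox a b)"
proof -
  have subS: "cbox a b \<subseteq> S" using sub box_subset_S by (rule order_trans)
  have c: "continuous_on (cbox a b) (\<lambda>x. \<bar>det (J x)\<bar>)"
    by (intro continuous_intros continuous_on_subset[OF continuous_det_J sub])
  have ai: "(\<lambda>x. \<bar>det (matrix (\<lambda>h. J x *v h))\<bar> * 1) absolutely_integrable_on cbox a b"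
    using absolutely_integrable_continuous[OF c] by simp
  have der: "(F has_derivative (\<lambda>h. J x *v h)) (at x within cbox a b)" if "x \<in> cbox a b" for x
    by (rule has_derivative_at_withinI[OF F_has_derivative[OF subsetD[OF subS that]]])
  have S: "cbox a b \<in> sets lebesgue" by simp
  have "integral (F ` cbox a b) (\<lambda>x. 1) = integral (cbox a b) (\<lambda>x. \<bar>det (matrix (\<lambda>h. J x *v h))\<bar> * 1)"
    by (rule change_of_variables_vec(2)[where f="\<lambda>_. 1", OF card S der inj_on_subset[OF inj_F sub] ai])
  also have "\<dots> \<le> integral (cbox a b) (\<lambda>x. D)"
    using D sub by (intro integral_le set_lebesgue_integral_eq_integral(1)[OF ai] integrable_const) auto
  also have "\<dots> = D * measure lebesgue (cbox a b)" by simp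
  finally have "integral (F ` cbox a b) (\<lambda>x. 1) \<le> D * measure lebesgue (cbox a b)" .
  moreover have "F ` cbox a b \<in> lmeasurable"
    by (intro lmeasurable_compact compact_continuous_image continuous_on_subset[OF continuous_F_Q sub] compact_cbox)
  ultimately show ?thesis by (simp add: lmeasure_integral)
qed

text \<open>Entries of \<open>J / det J\<close>, the matrix of the Piola transform that recovers a velocity from its pullback.\<close>

definition velocity_coeff :: "'d \<Rightarrow> 'd \<Rightarrow> real^'d \<Rightarrow> real" where
  "velocity_coeff c b x = J x $ c $ b / det (J x)"

lemma C1_velocity_coeff: "C1 S (velocity_coeff c b)"
  unfolding velocity_coeff_def using det_J_nz by (intro C1_divide C1_J C1_det) auto

text \<open>The velocity whose pullback is \<open>P\<close>.\<close>

definition vel :: "('d \<Rightarrow> real^'d \<Rightarrow> real) \<Rightarrow> 'd \<Rightarrow> real^'d \<Rightarrow> real" where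
  "vel P c x = (\<Sum>b\<in>UNIV. velocity_coeff c b x * P b x)"

lemma C1_vel: "(\<And>b. C1 S (P b)) \<Longrightarrow> C1 S (vel P c)"
  unfolding vel_def by (intro C1_sum C1_mult C1_velocity_coeff)

lemma continuous_sgrad:
  assumes "\<And>c. C1 S (v c)" shows "continuous_on Q (sgrad v a c)"
proof -
  have "continuous_on Q (phd a (v c))" for a c
    unfolding phd_def by (intro continuous_on_sum continuous_on_mult continuous_pd_C1S assms continuous_C1S C1_K)
  then show ?thesis unfolding sgrad_def by (intro continuous_intros) auto
qed

lemma square_diff_bound:
  fixes p q :: "'e::finite \<Rightarrow> real" and r :: "'e \<Rightarrow> 'e \<Rightarrow> real"
  shows "((\<Sum>b\<in>UNIV. \<bar>p b\<bar>) + (\<Sum>i\<in>UNIV. \<Sum>b\<in>UNIV. \<bar>r i b\<bar>))\<^sup>2 \<le>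
     2 * (real CARD('e))\<^sup>2 * ((\<Sum>b\<in>UNIV. (p b)\<^sup>2) + (\<Sum>i\<in>UNIV. \<Sum>b\<in>UNIV. (r i b)\<^sup>2))"
proof -
  let ?n = "real CARD('e)"
  have n: "?n \<ge> 1" using zero_less_card_finite[where 'a='e] by (simp add: Suc_le_eq)
  let ?p = "\<Sum>b\<in>UNIV. \<bar>p b\<bar>" and ?r = "\<Sum>i\<in>UNIV. \<Sum>b\<in>UNIV. \<bar>r i b\<bar>"
  let ?p2 = "\<Sum>b\<in>UNIV. (p b)\<^sup>2" and ?r2 = "\<Sum>i\<in>UNIV. \<Sum>b\<in>UNIV. (r i b)\<^sup>2"
  have p0: "0 \<le> ?p2" by (intro sum_nonneg) simp
  have "?p\<^sup>2 \<le> ?p2 * ?n" using sum_squared_le_sum_of_squares[of "\<lambda>b. \<bar>p b\<bar>" UNIV] by simp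
  also have "\<dots> \<le> ?p2 * ?n\<^sup>2" using n p0 by (intro mult_left_mono) (auto simp: power2_eq_square)
  finally have 1: "?p\<^sup>2 \<le> ?p2 * ?n\<^sup>2" .
  have "?r = (\<Sum>ib\<in>(UNIV :: ('e \<times> 'e) set). \<bar>r (fst ib) (snd ib)\<bar>)" and
    r2: "?r2 = (\<Sum>ib\<in>(UNIV :: ('e \<times> 'e) set). (r (fst ib) (snd ib))\<^sup>2)"
    by (simp_all add: sum.cartesian_product UNIV_Times_UNIV[symmetric] case_prod_beta del: UNIV_Times_UNIV)
  then have "?r\<^sup>2 \<le> ?r2 * real CARD('e \<times> 'e)"
    using sum_squared_le_sum_of_squares[of "\<lambda>ib. \<bar>r (fst ib) (snd ib)\<bar>" UNIV] by simp
  then have 2: "?r\<^sup>2 \<le> ?r2 * ?n\<^sup>2" by (simp add: power2_eq_square)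
  have "(?p + ?r)\<^sup>2 \<le> 2 * ?p\<^sup>2 + 2 * ?r\<^sup>2"
    using zero_le_power2[of "?p - ?r"] by (simp add: power2_eq_square algebra_simps)
  also have "\<dots> \<le> 2 * (?p2 * ?n\<^sup>2) + 2 * (?r2 * ?n\<^sup>2)" using 1 2 by linarith
  finally show ?thesis by (simp add: algebra_simps)
qed

text \<open>\<open>\<nabla>\<^sup>s u\<close> is a linear combination of the \<open>\<partial>\<^sub>i P\<^sub>\<beta>\<close> with Lipschitz coefficients \<open>T\<close> plus a term of order zero in \<open>P\<close>.  Evaluating \<open>T\<close>
  at the corner \<open>a\<close> leaves a polynomial \<open>S0\<close>, and \<open>|\<nabla>\<^sup>s u - S0|\<^sup>2\<close> is bounded by a multiple of
  \<open>W = |P|\<^sup>2 + h\<^sup>2 |\<nabla>P|\<^sup>2\<close>, whose integral is bounded by that of \<open>|P|\<^sup>2\<close> by the inverse inequality.\<close>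

lemma local_trace_inequality:
  assumes c1: "0 < c1"
  shows "\<exists>Cl>0. \<forall>a b h. (\<forall>i. a $ i < b $ i) \<longrightarrow> cbox a b \<subseteq> Q \<longrightarrow> 0 < h \<longrightarrow>
     (\<forall>i. c1 * h \<le> b $ i - a $ i \<and> b $ i - a $ i \<le> c2 * h) \<longrightarrow>
     (\<forall>P i s. (\<forall>\<beta>. TP n (P \<beta>)) \<longrightarrow>
        h * pbox.cface a b i s (\<lambda>x. \<Sum>\<alpha>\<in>UNIV. \<Sum>c\<in>UNIV. (sgrad (vel P) \<alpha> c x)\<^sup>2) \<le>
        Cl * (pbox.cint a b (\<lambda>x. \<Sum>\<alpha>\<in>UNIV. \<Sum>c\<in>UNIV. (sgrad (vel P) \<alpha> c x)\<^sup>2)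
           + pbox.cint a b (\<lambda>x. \<Sum>\<beta>\<in>UNIV. (P \<beta> x)\<^sup>2)))"
proof -
  obtain c where c: "c > 0" and inv: "\<And>a b :: real^'d. (\<forall>i. a $ i < b $ i) \<Longrightarrow>
     (\<forall>g i s. SP n g \<longrightarrow> continuous_on (cbox a b) g \<longrightarrow>
        pbox.cface a b i s (\<lambda>x. (g x)\<^sup>2) \<le> c / (b $ i - a $ i) * pbox.cint a b (\<lambda>x. (g x)\<^sup>2)) \<and>
     (\<forall>g i. TP n g \<longrightarrow>
        pbox.cint a b (\<lambda>x. (pd i g x)\<^sup>2) \<le> c / (b $ i - a $ i)\<^sup>2 * pbox.cint a b (\<lambda>x. (g x)\<^sup>2))"
    using SP_inverse_inequalities[where 'd='d, of n] by (elim exE conjE) (rule that, assumption, blast)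
  define m where "m = real CARD('d)"
  have m: "m \<ge> 1" using zero_less_card_finite[where 'a='d] by (simp add: m_def Suc_le_eq)
  let ?M = velocity_coeff
  define A where "A \<alpha> \<gamma> \<beta> x = (\<Sum>i\<in>UNIV. pd i (?M \<gamma> \<beta>) x * K x $ i $ \<alpha>)" for \<alpha> \<gamma> \<beta> x
  define T where "T \<alpha> \<gamma> i \<beta> x = ?M \<gamma> \<beta> x * K x $ i $ \<alpha>" for \<alpha> \<gamma> i \<beta> x
  have cA: "continuous_on Q (A \<alpha> \<gamma> \<beta>)" for \<alpha> \<gamma> \<beta>
    unfolding A_def by (intro continuous_on_sum continuous_on_mult continuous_pd_C1S C1_velocity_coeff continuous_C1S C1_K)
  have cT: "C1 S (T \<alpha> \<gamma> i \<beta>)" for \<alpha> \<gamma> i \<beta>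
    unfolding T_def by (intro C1_mult C1_velocity_coeff C1_K)
  obtain A0 where A0: "A0 > 0" "\<And>\<alpha> \<gamma> \<beta> x. x \<in> Q \<Longrightarrow> \<bar>A \<alpha> \<gamma> \<beta> x\<bar> \<le> A0"
  proof -
    have "\<exists>B>0. \<forall>q\<in>(UNIV :: ('d \<times> 'd \<times> 'd) set). \<forall>x\<in>Q. \<bar>A (fst q) (fst (snd q)) (snd (snd q)) x\<bar> \<le> B"
      by (rule finite_family_bound[where P="\<lambda>q x B. \<bar>A (fst q) (fst (snd q)) (snd (snd q)) x\<bar> \<le> B"])
        (auto intro: continuous_Q_bounded[OF cA])
    then obtain B where "B > 0" "\<forall>q\<in>(UNIV :: ('d \<times> 'd \<times> 'd) set). \<forall>x\<in>Q. \<bar>A (fst q) (fst (snd q)) (snd (snd q)) x\<bar> \<le> B" by blast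
    then show ?thesis by (intro that[of B]) auto
  qed
  obtain L where L: "L > 0" "\<And>\<alpha> \<gamma> i \<beta> x y. x \<in> Q \<Longrightarrow> y \<in> Q \<Longrightarrow> \<bar>T \<alpha> \<gamma> i \<beta> x - T \<alpha> \<gamma> i \<beta> y\<bar> \<le> L * norm (x - y)"
  proof -
    let ?t = "\<lambda>q::'d \<times> 'd \<times> 'd \<times> 'd. T (fst q) (fst (snd q)) (fst (snd (snd q))) (snd (snd (snd q)))"
    have "\<exists>B>0. \<forall>q\<in>UNIV. \<forall>x\<in>Q. \<forall>y\<in>Q. \<bar>?t q x - ?t q y\<bar> \<le> B * norm (x - y)"
    proof (rule finite_family_bound[where P="\<lambda>q x B. \<forall>y\<in>Q. \<bar>?t q x - ?t q y\<bar> \<le> B * norm (x - y)"])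
      show "\<exists>B>0. \<forall>x\<in>Q. \<forall>y\<in>Q. \<bar>?t q x - ?t q y\<bar> \<le> B * norm (x - y)" for q by (rule C1_lipschitz[OF cT])
      fix q x and B B' :: real assume *: "\<forall>y\<in>Q. \<bar>?t q x - ?t q y\<bar> \<le> B * norm (x - y)" "B \<le> B'"
      show "\<forall>y\<in>Q. \<bar>?t q x - ?t q y\<bar> \<le> B' * norm (x - y)"
      proof
        fix y assume "y \<in> Q"
        then have "\<bar>?t q x - ?t q y\<bar> \<le> B * norm (x - y)" using *(1) by blast
        also have "\<dots> \<le> B' * norm (x - y)" using *(2) by (intro mult_right_mono) auto
        finally show "\<bar>?t q x - ?t q y\<bar> \<le> B' * norm (x - y)" .
      qed
    qed simp
    then obtain B where B: "B > 0" "\<forall>q\<in>UNIV. \<forall>x\<in>Q. \<forall>y\<in>Q. \<bar>?t q x - ?t q y\<bar> \<le> B * norm (x - y)" by blast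
    have "\<bar>T \<alpha> \<gamma> i \<beta> x - T \<alpha> \<gamma> i \<beta> y\<bar> \<le> B * norm (x - y)" if "x \<in> Q" "y \<in> Q" for \<alpha> \<gamma> i \<beta> x y
      using B(2)[THEN bspec[where x="(\<alpha>, \<gamma>, i, \<beta>)"], OF UNIV_I] that by simp
    then show ?thesis by (intro that[of B] B(1)) auto
  qed
  define B1 where "B1 = max A0 (L * (m * \<bar>c2\<bar>))"
  have B1: "B1 > 0" "A0 \<le> B1" "L * (m * \<bar>c2\<bar>) \<le> B1" using A0(1) by (auto simp: B1_def)
  define E where "E = B1\<^sup>2 * (2 * m\<^sup>2)"
  have E: "E \<ge> 0" by (simp add: E_def)
  define Cw where "Cw = 1 + m * (c / c1\<^sup>2)"
  have Cw: "Cw \<ge> 0" using c c1 m by (simp add: Cw_def)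
  \<comment> \<open>the perturbation argument gives factors \<open>4\<close> and \<open>6 m\<^sup>2 E Cw\<close>; their sum bounds both\<close>
  define Cl where "Cl = c / c1 * (4 + 6 * m\<^sup>2 * E * Cw)"
  have "0 \<le> 6 * m\<^sup>2 * E * Cw" using E Cw by (intro mult_nonneg_nonneg) auto
  then have "0 < 4 + 6 * m\<^sup>2 * E * Cw" by linarith
  then have Cl: "Cl > 0" unfolding Cl_def using c c1 by (intro mult_pos_pos divide_pos_pos)
  have main: "h * pbox.cface a b i s (\<lambda>x. \<Sum>\<alpha>\<in>UNIV. \<Sum>c\<in>UNIV. (sgrad (vel P) \<alpha> c x)\<^sup>2) \<le>
        Cl * (pbox.cint a b (\<lambda>x. \<Sum>\<alpha>\<in>UNIV. \<Sum>c\<in>UNIV. (sgrad (vel P) \<alpha> c x)\<^sup>2)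
           + pbox.cint a b (\<lambda>x. \<Sum>\<beta>\<in>UNIV. (P \<beta> x)\<^sup>2))"
    if ab: "\<forall>i. a $ i < b $ i" and sub: "cbox a b \<subseteq> Q" and h: "0 < h"
      and len: "\<And>i. c1 * h \<le> b $ i - a $ i" "\<And>i. b $ i - a $ i \<le> c2 * h"
      and P: "\<And>\<beta>. TP n (P \<beta>)" for a b h P i s
  proof -
    interpret pbox a b using ab by unfold_locales blast
    have C1P: "C1 R (P \<beta>)" "C1 R (pd k (P \<beta>))" for R \<beta> k by (intro C1_TP[OF P] C1_TP[OF TP_pd[OF P]])+
    have cP: "continuous_on (cbox a b) (P \<beta>)" "continuous_on (cbox a b) (pd k (P \<beta>))" for \<beta> k
      by (intro C1_continuous_on C1P)+
    have aQ: "a \<in> Q" using sub less_imp_le[OF ab[rule_format]] by (auto simp: mem_box_cart subset_iff)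
    define W where "W x = (\<Sum>\<beta>\<in>UNIV. (P \<beta> x)\<^sup>2) + (\<Sum>k\<in>UNIV. \<Sum>\<beta>\<in>UNIV. (h * pd k (P \<beta>) x)\<^sup>2)" for x
    define D0 where "D0 \<alpha> \<gamma> x = (\<Sum>k\<in>UNIV. \<Sum>\<beta>\<in>UNIV. T \<alpha> \<gamma> k \<beta> a * pd k (P \<beta>) x)" for \<alpha> \<gamma> x
    define S0 where "S0 = (\<lambda>(\<alpha>, \<gamma>) x. (1/2) * (D0 \<alpha> \<gamma> x + D0 \<gamma> \<alpha> x))"
    define S1 where "S1 = (\<lambda>(\<alpha>, \<gamma>). sgrad (vel P) \<alpha> \<gamma>)"
    have SPD: "SP n (D0 \<alpha> \<gamma>)" for \<alpha> \<gamma>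
      unfolding D0_def by (intro SP_sum SP_cmult TP_imp_SP TP_pd P)
    have SPS: "SP n (S0 q)" for q
      unfolding S0_def by (cases q) (simp only: prod.case, intro SP_cmult SP_add SPD)
    have cD: "continuous_on (cbox a b) (D0 \<alpha> \<gamma>)" for \<alpha> \<gamma>
      unfolding D0_def by (intro continuous_on_sum continuous_on_mult continuous_on_const cP)
    have cS0: "continuous_on (cbox a b) (S0 q)" for q
      unfolding S0_def by (cases q) (simp only: prod.case, intro continuous_on_mult continuous_on_add continuous_on_const cD)
    have cS1: "continuous_on (cbox a b) (S1 q)" for q
      unfolding S1_def by (cases q) (simp only: prod.case, intro continuous_on_subset[OF continuous_sgrad sub] C1_vel C1P)
    have cW: "continuous_on (cbox a b) W"
      unfolding W_def by (intro continuous_on_add continuous_on_sum continuous_on_power continuous_on_mult continuous_on_const cP)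
    have phd: "phd \<alpha> (vel P \<gamma>) x = (\<Sum>\<beta>\<in>UNIV. A \<alpha> \<gamma> \<beta> x * P \<beta> x) + (\<Sum>k\<in>UNIV. \<Sum>\<beta>\<in>UNIV. T \<alpha> \<gamma> k \<beta> x * pd k (P \<beta>) x)"
      if x: "x \<in> cbox a b" for \<alpha> \<gamma> x
    proof -
      have xS: "x \<in> S" using sub box_subset_S x by blast
      note d = C1_differentiable[OF C1_velocity_coeff xS] C1_differentiable[OF C1P(1) xS]
      have "pd k (vel P \<gamma>) x = (\<Sum>\<beta>\<in>UNIV. pd k (?M \<gamma> \<beta>) x * P \<beta> x + ?M \<gamma> \<beta> x * pd k (P \<beta>) x)" for k
        unfolding vel_def by (subst pd_sum) (auto intro!: differentiable_mult d simp: pd_mult d)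
      then have "phd \<alpha> (vel P \<gamma>) x = (\<Sum>k\<in>UNIV. \<Sum>\<beta>\<in>UNIV. pd k (?M \<gamma> \<beta>) x * K x $ k $ \<alpha> * P \<beta> x)
          + (\<Sum>k\<in>UNIV. \<Sum>\<beta>\<in>UNIV. T \<alpha> \<gamma> k \<beta> x * pd k (P \<beta>) x)"
        by (simp add: phd_def T_def sum_distrib_left sum.distrib distrib_left mult_ac)
      moreover have "(\<Sum>k\<in>UNIV. \<Sum>\<beta>\<in>UNIV. pd k (?M \<gamma> \<beta>) x * K x $ k $ \<alpha> * P \<beta> x) = (\<Sum>\<beta>\<in>UNIV. A \<alpha> \<gamma> \<beta> x * P \<beta> x)"
        by (subst sum.swap) (simp add: A_def sum_distrib_right)
      ultimately show ?thesis by simp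
    qed
    have diff: "\<bar>phd \<alpha> (vel P \<gamma>) x - D0 \<alpha> \<gamma> x\<bar> \<le> B1 * ((\<Sum>\<beta>\<in>UNIV. \<bar>P \<beta> x\<bar>) + (\<Sum>k\<in>UNIV. \<Sum>\<beta>\<in>UNIV. \<bar>h * pd k (P \<beta>) x\<bar>))"
      if x: "x \<in> cbox a b" for \<alpha> \<gamma> x
    proof -
      have xQ: "x \<in> Q" using sub x by blast
      have "norm (x - a) \<le> (\<Sum>k\<in>UNIV. \<bar>(x - a) $ k\<bar>)" by (rule norm_le_l1_cart)
      also have "\<dots> \<le> (\<Sum>k\<in>(UNIV::'d set). \<bar>c2\<bar> * h)"
      proof (rule sum_mono)
        fix k
        have "a $ k \<le> x $ k" "x $ k \<le> b $ k" using x unfolding mem_box_cart by blast+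
        then have "\<bar>(x - a) $ k\<bar> \<le> c2 * h" using len(2)[of k] by simp
        also have "\<dots> \<le> \<bar>c2\<bar> * h" using h by (intro mult_right_mono) auto
        finally show "\<bar>(x - a) $ k\<bar> \<le> \<bar>c2\<bar> * h" .
      qed
      finally have nx: "norm (x - a) \<le> m * \<bar>c2\<bar> * h" by (simp add: m_def)
      have Tx: "\<bar>T \<alpha> \<gamma> k \<beta> x - T \<alpha> \<gamma> k \<beta> a\<bar> \<le> B1 * h" for k \<beta>
      proof -
        have "\<bar>T \<alpha> \<gamma> k \<beta> x - T \<alpha> \<gamma> k \<beta> a\<bar> \<le> L * norm (x - a)" by (rule L(2)[OF xQ aQ])
        also have "\<dots> \<le> L * (m * \<bar>c2\<bar> * h)" using L(1) nx by (intro mult_left_mono) auto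
        also have "\<dots> = L * (m * \<bar>c2\<bar>) * h" by simp
        also have "\<dots> \<le> B1 * h" using B1(3) h by (intro mult_right_mono) auto
        finally show ?thesis .
      qed
      have "phd \<alpha> (vel P \<gamma>) x - D0 \<alpha> \<gamma> x = (\<Sum>\<beta>\<in>UNIV. A \<alpha> \<gamma> \<beta> x * P \<beta> x)
          + (\<Sum>k\<in>UNIV. \<Sum>\<beta>\<in>UNIV. (T \<alpha> \<gamma> k \<beta> x - T \<alpha> \<gamma> k \<beta> a) * pd k (P \<beta>) x)"
        unfolding phd[OF x] D0_def by (simp add: left_diff_distrib sum_subtractf)
      then have "\<bar>phd \<alpha> (vel P \<gamma>) x - D0 \<alpha> \<gamma> x\<bar> \<le> \<bar>\<Sum>\<beta>\<in>UNIV. A \<alpha> \<gamma> \<beta> x * P \<beta> x\<bar>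
          + \<bar>\<Sum>k\<in>UNIV. \<Sum>\<beta>\<in>UNIV. (T \<alpha> \<gamma> k \<beta> x - T \<alpha> \<gamma> k \<beta> a) * pd k (P \<beta>) x\<bar>"
        by (simp only: abs_triangle_ineq)
      also have "\<dots> \<le> (\<Sum>\<beta>\<in>UNIV. B1 * \<bar>P \<beta> x\<bar>) + (\<Sum>k\<in>UNIV. \<Sum>\<beta>\<in>UNIV. B1 * \<bar>h * pd k (P \<beta>) x\<bar>)"
      proof (rule add_mono; rule order_trans[OF sum_abs sum_mono])
        show "\<bar>A \<alpha> \<gamma> \<beta> x * P \<beta> x\<bar> \<le> B1 * \<bar>P \<beta> x\<bar>" for \<beta>
          unfolding abs_mult using A0(2)[OF xQ, of \<alpha> \<gamma> \<beta>] B1(2) by (intro mult_right_mono) auto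
        show "\<bar>\<Sum>\<beta>\<in>UNIV. (T \<alpha> \<gamma> k \<beta> x - T \<alpha> \<gamma> k \<beta> a) * pd k (P \<beta>) x\<bar> \<le> (\<Sum>\<beta>\<in>UNIV. B1 * \<bar>h * pd k (P \<beta>) x\<bar>)" for k
        proof (rule order_trans[OF sum_abs sum_mono])
          fix \<beta>
          have "\<bar>T \<alpha> \<gamma> k \<beta> x - T \<alpha> \<gamma> k \<beta> a\<bar> * \<bar>pd k (P \<beta>) x\<bar> \<le> (B1 * h) * \<bar>pd k (P \<beta>) x\<bar>"
            using Tx[of k \<beta>] by (intro mult_right_mono) auto
          then show "\<bar>(T \<alpha> \<gamma> k \<beta> x - T \<alpha> \<gamma> k \<beta> a) * pd k (P \<beta>) x\<bar> \<le> B1 * \<bar>h * pd k (P \<beta>) x\<bar>"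
            using h by (simp add: abs_mult)
        qed
      qed
      finally show ?thesis by (simp add: sum_distrib_left distrib_left)
    qed
    have close: "(S1 q x - S0 q x)\<^sup>2 \<le> E * W x" if x: "x \<in> cbox a b" for q x
    proof -
      obtain \<alpha> \<gamma> where q: "q = (\<alpha>, \<gamma>)" by (cases q)
      let ?e = "B1 * ((\<Sum>\<beta>\<in>UNIV. \<bar>P \<beta> x\<bar>) + (\<Sum>k\<in>UNIV. \<Sum>\<beta>\<in>UNIV. \<bar>h * pd k (P \<beta>) x\<bar>))"
      have mean: "\<bar>d\<bar> \<le> e" if "d = (1/2) * d1 + (1/2) * d2" "\<bar>d1\<bar> \<le> e" "\<bar>d2\<bar> \<le> e" for d d1 d2 e :: real
        using that by linarith
      have "S1 q x - S0 q x = (1/2) * (phd \<alpha> (vel P \<gamma>) x - D0 \<alpha> \<gamma> x) + (1/2) * (phd \<gamma> (vel P \<alpha>) x - D0 \<gamma> \<alpha> x)"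
        by (simp add: S1_def S0_def q sgrad_def field_simps)
      then have "\<bar>S1 q x - S0 q x\<bar> \<le> ?e" by (rule mean[OF _ diff[OF x] diff[OF x]])
      then have "\<bar>S1 q x - S0 q x\<bar>\<^sup>2 \<le> ?e\<^sup>2" by (intro power_mono) auto
      also have "\<dots> = B1\<^sup>2 * ((\<Sum>\<beta>\<in>UNIV. \<bar>P \<beta> x\<bar>) + (\<Sum>k\<in>UNIV. \<Sum>\<beta>\<in>UNIV. \<bar>h * pd k (P \<beta>) x\<bar>))\<^sup>2"
        by (rule power_mult_distrib)
      also have "\<dots> \<le> B1\<^sup>2 * (2 * m\<^sup>2 * W x)"
        unfolding W_def m_def by (intro mult_left_mono square_diff_bound) simp
      finally show ?thesis by (simp add: E_def mult_ac)
    qed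
    have ci: "c / (b $ k - a $ k) \<le> c / (c1 * h)" for k
      using len(1)[of k] c c1 h ab[rule_format, of k] by (intro divide_left_mono) auto
    have tr: "cface i s (\<lambda>x. (g x)\<^sup>2) \<le> c / (c1 * h) * cint (\<lambda>x. (g x)\<^sup>2)"
      if g: "SP n g" "continuous_on (cbox a b) g" for g
    proof -
      have "cface i s (\<lambda>x. (g x)\<^sup>2) \<le> c / (b $ i - a $ i) * cint (\<lambda>x. (g x)\<^sup>2)"
        using conjunct1[OF inv[OF ab]] g by blast
      also have "\<dots> \<le> c / (c1 * h) * cint (\<lambda>x. (g x)\<^sup>2)"
        by (intro mult_right_mono ci cint_nonneg) simp
      finally show ?thesis .
    qed
    have ch: "continuous_on (cbox a b) (\<lambda>x. (h * pd k (P \<beta>) x)\<^sup>2)" "continuous_on (cbox a b) (\<lambda>x. (P \<beta> x)\<^sup>2)" for k \<beta>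
      by (intro continuous_on_power continuous_on_mult continuous_on_const cP)+
    have chs: "continuous_on (cbox a b) (\<lambda>x. \<Sum>\<beta>\<in>UNIV. (P \<beta> x)\<^sup>2)"
      "continuous_on (cbox a b) (\<lambda>x. \<Sum>\<beta>\<in>UNIV. (h * pd k (P \<beta>) x)\<^sup>2)"
      "continuous_on (cbox a b) (\<lambda>x. \<Sum>k\<in>UNIV. \<Sum>\<beta>\<in>UNIV. (h * pd k (P \<beta>) x)\<^sup>2)" for k
      by (intro continuous_on_sum ch)+
    have cintW: "cint W = (\<Sum>\<beta>\<in>UNIV. cint (\<lambda>x. (P \<beta> x)\<^sup>2)) + (\<Sum>k\<in>UNIV. \<Sum>\<beta>\<in>UNIV. cint (\<lambda>x. (h * pd k (P \<beta>) x)\<^sup>2))"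
      unfolding W_def using ch chs by (simp add: cint_add cint_sum)
    have cfaceW: "cface i s W = (\<Sum>\<beta>\<in>UNIV. cface i s (\<lambda>x. (P \<beta> x)\<^sup>2)) + (\<Sum>k\<in>UNIV. \<Sum>\<beta>\<in>UNIV. cface i s (\<lambda>x. (h * pd k (P \<beta>) x)\<^sup>2))"
      unfolding W_def using ch chs by (simp add: cface_add cface_sum)
    have trW: "cface i s W \<le> c / (c1 * h) * cint W"
      unfolding cintW cfaceW distrib_left sum_distrib_left
      by (intro add_mono sum_mono tr SP_cmult TP_imp_SP TP_pd P continuous_on_mult continuous_on_const cP)
    let ?p = "cint (\<lambda>x. \<Sum>\<beta>\<in>UNIV. (P \<beta> x)\<^sup>2)"
    let ?s = "cint (\<lambda>x. \<Sum>q\<in>UNIV. (S1 q x)\<^sup>2)"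
    have p: "?p = (\<Sum>\<beta>\<in>UNIV. cint (\<lambda>x. (P \<beta> x)\<^sup>2))" by (rule cint_sum[OF ch(2)])
    have Wp: "cint W \<le> Cw * ?p"
    proof -
      have "cint (\<lambda>x. (h * pd k (P \<beta>) x)\<^sup>2) \<le> c / c1\<^sup>2 * cint (\<lambda>x. (P \<beta> x)\<^sup>2)" for k \<beta>
      proof -
        let ?l = "b $ k - a $ k"
        have l: "0 < ?l" using ab by simp
        have "cint (\<lambda>x. (h * pd k (P \<beta>) x)\<^sup>2) = h\<^sup>2 * cint (\<lambda>x. (pd k (P \<beta>) x)\<^sup>2)"
          by (simp add: power_mult_distrib cint_cmult)
        also have "\<dots> \<le> h\<^sup>2 * (c / ?l\<^sup>2 * cint (\<lambda>x. (P \<beta> x)\<^sup>2))"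
          using conjunct2[OF inv[OF ab]] P[of \<beta>] by (intro mult_left_mono) auto
        also have "\<dots> = (h\<^sup>2 * c / ?l\<^sup>2) * cint (\<lambda>x. (P \<beta> x)\<^sup>2)" by simp
        also have "\<dots> \<le> c / c1\<^sup>2 * cint (\<lambda>x. (P \<beta> x)\<^sup>2)"
        proof (rule mult_right_mono[OF _ cint_nonneg])
          have "(c1 * h)\<^sup>2 \<le> ?l\<^sup>2" using len(1)[of k] c1 h by (intro power_mono) auto
          then have "c * (c1 * h)\<^sup>2 \<le> c * ?l\<^sup>2" using c by (intro mult_left_mono) auto
          then show "h\<^sup>2 * c / ?l\<^sup>2 \<le> c / c1\<^sup>2" using c1 l by (simp add: field_simps power_mult_distrib)
        qed simp
        finally show ?thesis .
      qed
      then have "cint W \<le> (\<Sum>\<beta>\<in>UNIV. cint (\<lambda>x. (P \<beta> x)\<^sup>2)) + (\<Sum>k\<in>(UNIV::'d set). \<Sum>\<beta>\<in>UNIV. c / c1\<^sup>2 * cint (\<lambda>x. (P \<beta> x)\<^sup>2))"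
        unfolding cintW by (intro add_mono order_refl sum_mono)
      also have "\<dots> = ?p + m * (c / c1\<^sup>2 * ?p)"
        unfolding p m_def by (simp only: sum_distrib_left sum_constant)
      also have "\<dots> = Cw * ?p" by (simp add: Cw_def distrib_right)
      finally show ?thesis .
    qed
    have "cface i s (\<lambda>x. \<Sum>q\<in>UNIV. (S1 q x)\<^sup>2) \<le> c / (c1 * h) * (4 * ?s + 6 * real (card (UNIV :: ('d \<times> 'd) set)) * E * cint W)"
      by (rule perturbed_trace_inequality[OF finite cS1 cS0 cW close E tr[OF SPS cS0] trW]) (use c c1 h in auto)
    also have "real (card (UNIV :: ('d \<times> 'd) set)) = m\<^sup>2" by (simp add: m_def power2_eq_square)
    finally have "h * cface i s (\<lambda>x. \<Sum>q\<in>UNIV. (S1 q x)\<^sup>2) \<le> h * (c / (c1 * h) * (4 * ?s + 6 * m\<^sup>2 * E * cint W))"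
      using h by (intro mult_left_mono) auto
    also have "\<dots> = c / c1 * (4 * ?s + 6 * m\<^sup>2 * E * cint W)" using h c1 by simp
    also have "\<dots> \<le> c / c1 * (4 * ?s + 6 * m\<^sup>2 * E * (Cw * ?p))"
      using c c1 E m Wp by (intro mult_left_mono add_left_mono) auto
    also have "\<dots> \<le> c / c1 * ((4 + 6 * m\<^sup>2 * E * Cw) * ?s + (4 + 6 * m\<^sup>2 * E * Cw) * ?p)"
    proof (intro mult_left_mono add_mono)
      have s0: "0 \<le> ?s" "0 \<le> ?p" by (intro cint_nonneg sum_nonneg; simp)+
      have k0: "0 \<le> 6 * m\<^sup>2 * E * Cw" using E Cw by simp
      show "4 * ?s \<le> (4 + 6 * m\<^sup>2 * E * Cw) * ?s" using s0 k0 by (intro mult_right_mono) auto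
      have "6 * m\<^sup>2 * E * (Cw * ?p) = (6 * m\<^sup>2 * E * Cw) * ?p" by simp
      also have "\<dots> \<le> (4 + 6 * m\<^sup>2 * E * Cw) * ?p" using s0 by (intro mult_right_mono) auto
      finally show "6 * m\<^sup>2 * E * (Cw * ?p) \<le> (4 + 6 * m\<^sup>2 * E * Cw) * ?p" .
      show "0 \<le> c / c1" using c c1 by simp
    qed
    also have "\<dots> = Cl * (?s + ?p)" by (simp add: Cl_def algebra_simps)
    finally have fin: "h * cface i s (\<lambda>x. \<Sum>q\<in>UNIV. (S1 q x)\<^sup>2) \<le> Cl * (?s + ?p)" .
    have "(\<Sum>q\<in>UNIV. (S1 q x)\<^sup>2) = (\<Sum>\<alpha>\<in>UNIV. \<Sum>c\<in>UNIV. (sgrad (vel P) \<alpha> c x)\<^sup>2)" for x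
      by (simp add: S1_def sum.cartesian_product UNIV_Times_UNIV[symmetric] case_prod_beta del: UNIV_Times_UNIV)
    then show ?thesis using fin by simp
  qed
  show ?thesis by (intro exI[of _ Cl] conjI allI impI Cl main) auto
qed

end

section \<open>Sizes of the cells\<close>

lemma cube_in_cball:
  fixes x :: "real^'d"
  assumes "0 \<le> r"
  shows "cbox (x - (\<chi> i. r / real CARD('d))) (x + (\<chi> i. r / real CARD('d))) \<subseteq> cball x r"
proof
  fix y assume y: "y \<in> cbox (x - (\<chi> i. r / real CARD('d))) (x + (\<chi> i. r / real CARD('d)))"
  have "norm (y - x) \<le> (\<Sum>i\<in>UNIV. \<bar>(y - x) $ i\<bar>)" by (rule norm_le_l1_cart)
  also have "\<dots> \<le> (\<Sum>i\<in>(UNIV::'d set). r / real CARD('d))"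
  proof (rule sum_mono)
    fix i
    have "x $ i - r / real CARD('d) \<le> y $ i \<and> y $ i \<le> x $ i + r / real CARD('d)"
      using y by (auto simp: mem_box_cart)
    then show "\<bar>(y - x) $ i\<bar> \<le> r / real CARD('d)" by (simp add: abs_le_iff)
  qed
  also have "\<dots> = r" by simp
  finally show "y \<in> cball x r" by (simp add: dist_norm norm_minus_commute)
qed

context curved_box
begin

text \<open>An edge cannot be longer than a multiple of the diameter of the element, because \<open>F\<close> stretches distances by at least a
  constant factor.  It cannot be much shorter either: the element contains a ball of radius proportional to \<open>h\<close>, whose volume is at most a constant times the
  product of the edge lengths, and all other edges are at most of order \<open>h\<close>.\<close>

lemma cell_sizes:
  assumes C: "0 < C" and \<sigma>: "0 < \<sigma>"
  shows "\<exists>c1>0. \<exists>c2>0. \<exists>H>0. \<forall>\<zeta> h. knots lo hi \<zeta> \<longrightarrow> 0 < h \<longrightarrow> quasi_uniform F \<zeta> C h \<longrightarrow> shape_regular F \<zeta> \<sigma> \<longrightarrow>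
    h \<le> H \<and> (\<forall>j\<in>cells \<zeta>. \<forall>k. c1 * h \<le> cell_hi \<zeta> j $ k - cell_lo \<zeta> j $ k \<and> cell_hi \<zeta> j $ k - cell_lo \<zeta> j $ k \<le> c2 * h)"
proof -
  obtain \<kappa> where \<kappa>: "\<kappa> > 0" "\<forall>x\<in>Q. \<forall>y\<in>Q. \<kappa> * norm (x - y) \<le> norm (F x - F y)"
    using F_lower_lipschitz by (elim exE conjE)
  obtain D where D: "D > 0" "\<forall>x\<in>Q. \<bar>det (J x)\<bar> \<le> D"
    using continuous_Q_bounded[OF continuous_det_J] by (elim exE conjE)
  define N where "N = CARD('d)"
  have N: "N > 0" unfolding N_def by (rule zero_less_card_finite)
  then have Nr: "real N > 0" by simp
  define c2 where "c2 = 1 / (\<kappa> * C)"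
  have c2: "c2 > 0" using \<kappa>(1) C by (simp add: c2_def)
  define X where "X = (2 * (C / \<sigma>) / real N) ^ N"
  have X: "X > 0" unfolding X_def using C \<sigma> Nr by (intro zero_less_power divide_pos_pos mult_pos_pos) auto
  define c1 where "c1 = X / (D * c2 ^ (N - 1))"
  have c1: "c1 > 0" unfolding c1_def using X D(1) c2 by (intro divide_pos_pos mult_pos_pos zero_less_power)
  define H where "H = diameter (F ` Q) / C + 1"
  have H: "H > 0" unfolding H_def using C diameter_ge_0[OF compact_imp_bounded[OF compact_FQ]]
    by (intro add_nonneg_pos divide_nonneg_pos) auto
  have "h \<le> H \<and> (\<forall>j\<in>cells \<zeta>. \<forall>k. c1 * h \<le> cell_hi \<zeta> j $ k - cell_lo \<zeta> j $ k \<and> cell_hi \<zeta> j $ k - cell_lo \<zeta> j $ k \<le> c2 * h)"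
    if knots: "knots lo hi \<zeta>" and h: "0 < h" and qu: "quasi_uniform F \<zeta> C h" and sr: "shape_regular F \<zeta> \<sigma>" for \<zeta> h
  proof -
    interpret mesh F lo hi S \<zeta> by unfold_locales (rule knots)
    have comp: "compact (element F \<zeta> j)" and sub: "element F \<zeta> j \<subseteq> F ` Q" if "j \<in> cells \<zeta>" for j
      unfolding element_def using cell_subset[OF that]
      by (auto intro!: compact_continuous_image continuous_on_subset[OF continuous_F_Q])
    have diam: "C * h \<le> diameter (element F \<zeta> j)" "diameter (element F \<zeta> j) \<le> h / C" if "j \<in> cells \<zeta>" for j
      using qu that by (auto simp: quasi_uniform_def)
    have upper: "chi j $ k - clo j $ k \<le> c2 * h" if j: "j \<in> cells \<zeta>" for j k
    proof -
      define q where "q = clo j + axis k (chi j $ k - clo j $ k)"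
      have lt: "\<And>i. clo j $ i < chi j $ i" by (rule cell_lo_less_hi[OF j])
      have p: "clo j \<in> cbox (clo j) (chi j)" using less_imp_le[OF lt] by (simp add: mem_box_cart)
      have qq: "q \<in> cbox (clo j) (chi j)"
        unfolding mem_box_cart q_def using less_imp_le[OF lt] by (auto simp: axis_def)
      have "q - clo j = (chi j $ k - clo j $ k) *\<^sub>R axis k 1" by (simp add: q_def vec_eq_iff axis_def)
      then have "norm (q - clo j) = \<bar>chi j $ k - clo j $ k\<bar>" by (simp only: norm_scaleR norm_axis_1 mult_1_right)
      then have "norm (q - clo j) = chi j $ k - clo j $ k" using lt[of k] by simp
      then have "\<kappa> * (chi j $ k - clo j $ k) \<le> norm (F q - F (clo j))"
        using \<kappa>(2)[rule_format, OF subsetD[OF cell_subset[OF j] qq] subsetD[OF cell_subset[OF j] p]] by simp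
      also have "\<dots> \<le> diameter (element F \<zeta> j)"
        unfolding dist_norm[symmetric]
        by (intro diameter_bounded_bound[OF compact_imp_bounded[OF comp[OF j]]]) (simp_all add: element_def p qq)
      also have "\<dots> \<le> h / C" by (rule diam[OF j])
      finally show ?thesis using \<kappa>(1) C by (simp add: c2_def field_simps)
    qed
    have lower: "c1 * h \<le> chi j $ k - clo j $ k" if j: "j \<in> cells \<zeta>" for j k
    proof -
      define l where "l i = chi j $ i - clo j $ i" for i
      have l: "l i > 0" "l i \<le> c2 * h" for i using cell_lo_less_hi[OF j, of i] upper[OF j, of i] by (auto simp: l_def)
      define r where "r = C * h / \<sigma>"
      have r: "r > 0" using C h \<sigma> by (simp add: r_def)
      obtain x where x: "cball x (diameter (element F \<zeta> j) / \<sigma>) \<subseteq> element F \<zeta> j"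
        using sr j by (auto simp: shape_regular_def)
      have "r \<le> diameter (element F \<zeta> j) / \<sigma>"
        unfolding r_def using diam(1)[OF j] \<sigma> by (intro divide_right_mono) auto
      then have xr: "cball x r \<subseteq> element F \<zeta> j" using x subset_cball by (meson order_trans)
      let ?e = "(\<chi> i. r / real CARD('d)) :: real^'d"
      have sub2: "cbox (x - ?e) (x + ?e) \<subseteq> element F \<zeta> j" by (rule order_trans[OF cube_in_cball[OF less_imp_le[OF r]] xr])
      have "x \<in> cbox (x - ?e) (x + ?e)" "clo j \<in> cbox (clo j) (chi j)"
        using r less_imp_le[OF cell_lo_less_hi[OF j]] by (simp_all add: mem_box_cart)
      then have ne: "cbox (x - ?e) (x + ?e) \<noteq> {}" "cbox (clo j) (chi j) \<noteq> {}" by blast+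
      have m1: "measure lebesgue (cbox (x - ?e) (x + ?e)) = (2 * r / real N) ^ N"
        using content_cbox_cart[OF ne(1)] by (simp add: measure_completion N_def)
      have m2: "measure lebesgue (cbox (clo j) (chi j)) = (\<Prod>i\<in>UNIV. l i)"
        using content_cbox_cart[OF ne(2)] by (simp add: measure_completion l_def)
      have "X * h ^ N = (2 * r / real N) ^ N"
        unfolding X_def power_mult_distrib[symmetric] by (simp add: r_def mult_ac)
      also have "\<dots> \<le> measure lebesgue (element F \<zeta> j)"
        unfolding m1[symmetric]
        by (intro measure_mono_fmeasurable sub2 lmeasurable_compact comp[OF j]) auto
      also have "\<dots> \<le> D * (\<Prod>i\<in>UNIV. l i)"
        unfolding element_def m2[symmetric]
        by (rule measure_image_le[OF _ cell_subset[OF j]]) (use D(2) in blast)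
      also have "(\<Prod>i\<in>UNIV. l i) = l k * (\<Prod>i\<in>UNIV - {k}. l i)" by (rule prod.remove) auto
      also have "\<dots> \<le> l k * (\<Prod>i\<in>UNIV - {k}. c2 * h)"
        using l by (intro mult_left_mono prod_mono) (auto intro: less_imp_le)
      also have "\<dots> = l k * (c2 * h) ^ (N - 1)" by (simp add: N_def card_Diff_singleton)
      finally have "X * h ^ N \<le> D * (l k * (c2 * h) ^ (N - 1))" using D(1) by simp
      moreover have "h ^ N = h * h ^ (N - 1)" using N by (simp flip: power_Suc)
      ultimately have "(X * h) * h ^ (N - 1) \<le> (D * c2 ^ (N - 1) * l k) * h ^ (N - 1)"
        by (simp add: power_mult_distrib mult_ac)
      then have "X * h \<le> D * c2 ^ (N - 1) * l k" using h by (simp add: mult_le_cancel_right)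
      moreover have "0 < D * c2 ^ (N - 1)" using D(1) c2 by simp
      ultimately have "X * h / (D * c2 ^ (N - 1)) \<le> l k" by (simp add: pos_divide_le_eq mult_ac)
      then show ?thesis by (simp add: c1_def l_def)
    qed
    have "Suc 0 < length (\<zeta> i)" for i using knots_facts(1)[of i] by linarith
    then have j0: "(\<lambda>_. 0) \<in> cells \<zeta>" unfolding cells_def by blast
    have "C * h \<le> diameter (F ` Q)"
      using diam(1)[OF j0] diameter_subset[OF sub[OF j0] compact_imp_bounded[OF compact_FQ]] by linarith
    then have "h \<le> diameter (F ` Q) / C" using C by (simp add: pos_le_divide_eq mult.commute)
    then have "h \<le> H" by (simp add: H_def)
    moreover have "\<forall>j\<in>cells \<zeta>. \<forall>k. c1 * h \<le> chi j $ k - clo j $ k \<and> chi j $ k - clo j $ k \<le> c2 * h"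
      by (intro ballI allI conjI upper lower)
    ultimately show ?thesis ..
  qed
  then show ?thesis by (intro exI[of _ c1] exI[of _ c2] exI[of _ H] conjI[OF c1] conjI[OF c2] conjI[OF H] allI impI)
qed

end

section \<open>Discrete velocities and the global trace inequality\<close>

lemma knot_cover:
  fixes xs :: "real list"
  assumes len: "2 \<le> length xs" and t: "xs ! 0 \<le> t" "t \<le> xs ! (length xs - 1)"
  shows "\<exists>m. Suc m < length xs \<and> xs ! m \<le> t \<and> t \<le> xs ! Suc m"
proof -
  define m where "m = (LEAST m. t \<le> xs ! Suc m)"
  have P: "t \<le> xs ! Suc (length xs - 2)" using t(2) len by (simp add: Suc_diff_Suc numeral_2_eq_2)
  have m: "t \<le> xs ! Suc m" "m \<le> length xs - 2"
    unfolding m_def by (rule LeastI[of "\<lambda>m. t \<le> xs ! Suc m", OF P], rule Least_le[of "\<lambda>m. t \<le> xs ! Suc m", OF P])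
  have "xs ! m \<le> t"
  proof (cases m)
    case 0 then show ?thesis using t(1) by simp
  next
    case (Suc m')
    then have "\<not> t \<le> xs ! Suc m'" using not_less_Least[of m' "\<lambda>m. t \<le> xs ! Suc m"] by (simp add: m_def)
    then show ?thesis using Suc by simp
  qed
  then show ?thesis using m len by (intro exI[of _ m]) auto
qed

context mesh
begin

lemma cells_cover: "Q \<subseteq> (\<Union>j\<in>cells \<zeta>. cbox (clo j) (chi j))"
proof
  fix x assume x: "x \<in> Q"
  have "\<forall>k. \<exists>m. Suc m < length (\<zeta> k) \<and> \<zeta> k ! m \<le> x $ k \<and> x $ k \<le> \<zeta> k ! Suc m"
    using x by (intro allI knot_cover knots_facts(1)) (auto simp: knots_facts mem_box_cart simp del: One_nat_def)
  then obtain j where j: "\<And>k. Suc (j k) < length (\<zeta> k)" "\<And>k. \<zeta> k ! j k \<le> x $ k" "\<And>k. x $ k \<le> \<zeta> k ! Suc (j k)"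
    by metis
  show "x \<in> (\<Union>j\<in>cells \<zeta>. cbox (clo j) (chi j))"
    using j by (intro UN_I[of j]) (auto simp: cells_def mem_box_cart cell_lo_def cell_hi_def)
qed

lemma cell_box_Off: "j \<in> cells \<zeta> \<Longrightarrow> box (clo j) (chi j) \<subseteq> Off skel"
proof
  fix x assume j: "j \<in> cells \<zeta>" and x: "x \<in> box (clo j) (chi j)"
  have *: "\<zeta> k ! j k < x $ k" "x $ k < \<zeta> k ! Suc (j k)" "Suc (j k) < length (\<zeta> k)" for k
    using x j by (auto simp: mem_box_cart cell_lo_def cell_hi_def cells_def)
  have "x $ k \<notin> set (\<zeta> k)" for k
  proof
    assume "x $ k \<in> set (\<zeta> k)"
    then obtain m where m: "m < length (\<zeta> k)" "\<zeta> k ! m = x $ k" by (auto simp: in_set_conv_nth)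
    show False
    proof (cases "m \<le> j k")
      case True
      then have "\<zeta> k ! m \<le> \<zeta> k ! j k" using * by (intro knot_mono) (auto intro: Suc_lessD)
      then show False using *(1)[of k] m by simp
    next
      case False
      then have "\<zeta> k ! Suc (j k) \<le> \<zeta> k ! m" using m by (intro knot_mono) auto
      then show False using *(2)[of k] m by simp
    qed
  qed
  moreover have "x \<in> box lo hi"
    unfolding mem_box_cart
  proof
    fix k
    have "clo j $ k < x $ k" "x $ k < chi j $ k" using x by (auto simp: mem_box_cart)
    then show "lo $ k < x $ k \<and> x $ k < hi $ k" using cell_bounds[OF j, of k] by linarith
  qed
  ultimately show "x \<in> Off skel" by (simp add: off_skeleton_def)
qed

text \<open>The pullback is a spline, hence a tensor product polynomial on every closed cell, and \<open>u\<close> is recovered from it by the Piola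
  transform.\<close>

lemma velocity_pieces:
  assumes sp: "\<And>c. (\<lambda>x. pullback F u x $ c) \<in> tensor_spline_space lo hi (kk c) (rr c) \<zeta>"
    and deg: "\<And>c i. kk c i \<le> n"
  shows "\<exists>P. (\<forall>j\<in>cells \<zeta>. \<forall>b. TP n (P j b)) \<and>
    (\<forall>j\<in>cells \<zeta>. \<forall>x\<in>cbox (clo j) (chi j). \<forall>c. u (F x) $ c = vel (P j) c x)"
proof -
  have "\<forall>b. \<exists>Pb. \<forall>j\<in>cells \<zeta>. TP n (Pb j) \<and> (\<forall>x\<in>cbox (clo j) (chi j). pullback F u x $ b = Pb j x)"
  proof
    fix b
    obtain N and f :: "nat \<Rightarrow> 'd \<Rightarrow> real \<Rightarrow> real" where
      f: "\<forall>q<N. \<forall>i. f q i \<in> spline_space (kk b i) (rr b i) (\<zeta> i)"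
      and eq: "\<forall>x\<in>Q. pullback F u x $ b = (\<Sum>q<N. \<Prod>i\<in>UNIV. f q i (x $ i))"
      using sp[of b] unfolding tensor_spline_space_def mem_Collect_eq by (elim exE conjE)
    have "\<forall>q i. \<exists>p :: nat \<Rightarrow> real poly. q < N \<longrightarrow> (\<forall>m. Suc m < length (\<zeta> i) \<longrightarrow>
        degree (p m) \<le> kk b i \<and> (\<forall>t\<in>{\<zeta> i ! m .. \<zeta> i ! Suc m}. f q i t = poly (p m) t))"
    proof (intro allI)
      fix q i
      show "\<exists>p :: nat \<Rightarrow> real poly. q < N \<longrightarrow> (\<forall>m. Suc m < length (\<zeta> i) \<longrightarrow>
        degree (p m) \<le> kk b i \<and> (\<forall>t\<in>{\<zeta> i ! m .. \<zeta> i ! Suc m}. f q i t = poly (p m) t))"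
      proof (cases "q < N")
        case True
        then have "f q i \<in> spline_space (kk b i) (rr b i) (\<zeta> i)" using f by blast
        then show ?thesis unfolding spline_space_def mem_Collect_eq by (elim exE conjE) (rule exI, rule impI)
      qed simp
    qed
    then obtain p :: "nat \<Rightarrow> 'd \<Rightarrow> nat \<Rightarrow> real poly" where p:
      "\<And>q i m. q < N \<Longrightarrow> Suc m < length (\<zeta> i) \<Longrightarrow> degree (p q i m) \<le> kk b i"
      "\<And>q i m t. q < N \<Longrightarrow> Suc m < length (\<zeta> i) \<Longrightarrow> t \<in> {\<zeta> i ! m .. \<zeta> i ! Suc m} \<Longrightarrow> f q i t = poly (p q i m) t"
      by metis
    show "\<exists>Pb. \<forall>j\<in>cells \<zeta>. TP n (Pb j) \<and> (\<forall>x\<in>cbox (clo j) (chi j). pullback F u x $ b = Pb j x)"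
    proof (intro exI[of _ "\<lambda>j x. \<Sum>q<N. \<Prod>i\<in>UNIV. poly (p q i (j i)) (x $ i)"] ballI conjI)
      fix j assume j: "j \<in> cells \<zeta>"
      then have jl: "Suc (j i) < length (\<zeta> i)" for i by (auto simp: cells_def)
      show "TP n (\<lambda>x. \<Sum>q<N. \<Prod>i\<in>UNIV. poly (p q i (j i)) (x $ i))"
        unfolding TP_def
        by (intro exI[of _ N] exI[of _ "\<lambda>q i. p q i (j i)"] conjI allI impI order_trans[OF p(1)[OF _ jl] deg] refl)
      fix x assume x: "x \<in> cbox (clo j) (chi j)"
      then have "pullback F u x $ b = (\<Sum>q<N. \<Prod>i\<in>UNIV. f q i (x $ i))" using eq cell_subset[OF j] by blast
      also have "\<dots> = (\<Sum>q<N. \<Prod>i\<in>UNIV. poly (p q i (j i)) (x $ i))"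
        using x by (intro sum.cong prod.cong refl p(2) jl) (auto simp: mem_box_cart cell_lo_def cell_hi_def)
      finally show "pullback F u x $ b = (\<Sum>q<N. \<Prod>i\<in>UNIV. poly (p q i (j i)) (x $ i))" .
    qed
  qed
  then obtain P where P: "\<And>b j. j \<in> cells \<zeta> \<Longrightarrow> TP n (P b j)"
    "\<And>b j x. j \<in> cells \<zeta> \<Longrightarrow> x \<in> cbox (clo j) (chi j) \<Longrightarrow> pullback F u x $ b = P b j x"
    by metis
  have "u (F x) $ c = vel (\<lambda>b. P b j) c x" if j: "j \<in> cells \<zeta>" and x: "x \<in> cbox (clo j) (chi j)" for j x c
  proof -
    have xS: "x \<in> S" using cell_subset_S[OF j] x by blast
    have "velocity_coeff c b x * P b j x = J x $ c $ b * (K x *v u (F x)) $ b" for b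
      using det_J_nz[OF xS] by (simp add: P(2)[OF j x, symmetric] pullback_def jacobian_F[OF xS] velocity_coeff_def K_def)
    then have "vel (\<lambda>b. P b j) c x = (J x *v (K x *v u (F x))) $ c"
      by (simp add: vel_def matrix_vector_mult_def)
    also have "\<dots> = u (F x) $ c" by (simp add: matrix_vector_mul_assoc JK[OF xS])
    finally show ?thesis by simp
  qed
  then show ?thesis using P(1) by (intro exI[of _ "\<lambda>j b. P b j"]) blast
qed

end

locale piecewise_velocity = mesh F lo hi S \<zeta>
  for F :: "real^'d \<Rightarrow> real^'d" and lo hi S \<zeta> +
  fixes n :: nat and P :: "('d \<Rightarrow> nat) \<Rightarrow> 'd \<Rightarrow> real^'d \<Rightarrow> real" and v :: "'d \<Rightarrow> real^'d \<Rightarrow> real"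
  assumes TP_P: "\<And>j b. j \<in> cells \<zeta> \<Longrightarrow> TP n (P j b)"
    and v_eq: "\<And>j x c. j \<in> cells \<zeta> \<Longrightarrow> x \<in> cbox (cell_lo \<zeta> j) (cell_hi \<zeta> j) \<Longrightarrow> v c x = vel (P j) c x"
begin

lemma C1_piece: "j \<in> cells \<zeta> \<Longrightarrow> C1 S (vel (P j) c)"
  by (rule C1_vel, rule C1_TP, erule TP_P)

lemma continuous_v: "continuous_on Q (v c)"
proof (rule continuous_on_subset[OF _ cells_cover])
  show "continuous_on (\<Union>j\<in>cells \<zeta>. cbox (clo j) (chi j)) (v c)"
  proof (rule continuous_on_closed_Union[OF finite_cells closed_cbox])
    fix j assume j: "j \<in> cells \<zeta>"
    have "continuous_on (cbox (clo j) (chi j)) (vel (P j) c)"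
      by (rule continuous_on_subset[OF continuous_C1S[OF C1_piece[OF j]] cell_subset[OF j]])
    then show "continuous_on (cbox (clo j) (chi j)) (v c)"
      by (rule continuous_on_eq) (simp add: v_eq[OF j])
  qed
qed

lemma piece_box:
  assumes j: "j \<in> cells \<zeta>" and x: "x \<in> box (clo j) (chi j)"
  shows "v c differentiable (at x)" "pd i (v c) x = pd i (vel (P j) c) x" "sgrad v a c x = sgrad (vel (P j)) a c x"
proof -
  have eq: "v c y = vel (P j) c y" if "y \<in> box (clo j) (chi j)" for c y
    by (rule v_eq[OF j subsetD[OF box_subset_cbox that]])
  have pd: "pd i (v c) x = pd i (vel (P j) c) x" for i c by (rule pd_cong(1)[OF open_box x eq])
  then show "pd i (v c) x = pd i (vel (P j) c) x" .
  have "x \<in> S" using subsetD[OF cell_subset_S[OF j] subsetD[OF box_subset_cbox x]] .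
  then show "v c differentiable (at x)"
    using pd_cong(2)[OF open_box x, of "v c" "vel (P j) c"] eq C1_differentiable[OF C1_piece[OF j]] by blast
  show "sgrad v a c x = sgrad (vel (P j)) a c x" unfolding sgrad_def phd_def pd ..
qed

lemma Off_cover: "Off skel \<subseteq> (\<Union>j\<in>cells \<zeta>. box (clo j) (chi j))"
  by (rule subsetI, drule cell_of) (elim bexE conjE, rule UN_I)

text \<open>Continuity comes from gluing: the pieces agree with the same function \<open>v\<close> on closed cells that cover the box.\<close>

lemma PW_v: "PW skel (v c)"
  unfolding PW_def C1_def
proof (intro conjI allI ballI)
  show "continuous_on Q (v c)" by (rule continuous_v)
  fix i
  show "v c differentiable (at x)" if x: "x \<in> Off skel" for x
  proof -
    obtain j where "j \<in> cells \<zeta>" "x \<in> box (clo j) (chi j)" using subsetD[OF Off_cover x] by (elim UN_E)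
    then show ?thesis by (rule piece_box)
  qed
  show "continuous_on (Off skel) (pd i (v c))"
  proof (rule continuous_on_subset[OF _ Off_cover], rule continuous_on_open_UN)
    fix j assume j: "j \<in> cells \<zeta>"
    have "continuous_on (box (clo j) (chi j)) (pd i (vel (P j) c))"
      by (rule continuous_on_subset[OF continuous_pd_C1S[OF C1_piece[OF j]] order_trans[OF box_subset_cbox cell_subset[OF j]]])
    then show "continuous_on (box (clo j) (chi j)) (pd i (v c))"
      by (rule continuous_on_eq) (simp add: piece_box(2)[OF j])
  qed (rule open_box)
  have "bounded (pd i (v c) ` (\<Union>j\<in>cells \<zeta>. box (clo j) (chi j)))"
    unfolding image_UN
  proof (intro bounded_UN[OF finite_cells] ballI)
    fix j assume j: "j \<in> cells \<zeta>"
    have "bounded (pd i (vel (P j) c) ` Q)"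
      by (intro compact_imp_bounded compact_continuous_image continuous_pd_C1S C1_piece[OF j] compact_cbox)
    moreover have "pd i (v c) ` box (clo j) (chi j) \<subseteq> pd i (vel (P j) c) ` Q"
    proof (rule image_subsetI)
      fix x assume x: "x \<in> box (clo j) (chi j)"
      show "pd i (v c) x \<in> pd i (vel (P j) c) ` Q"
        unfolding piece_box(2)[OF j x] by (intro imageI subsetD[OF cell_subset[OF j]] subsetD[OF box_subset_cbox x])
    qed
    ultimately show "bounded (pd i (v c) ` box (clo j) (chi j))" by (rule bounded_subset)
  qed
  then show "bounded (pd i (v c) ` Off skel)" by (rule bounded_subset) (intro image_mono Off_cover)
qed

text \<open>The boundary values of the symmetric gradient taken from inside.  The pieces of different cells may disagree where facets meet,
  where this sum has no meaning; that set is null.\<close>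

definition bsgrad :: "'d \<Rightarrow> bool \<Rightarrow> 'd \<Rightarrow> 'd \<Rightarrow> real^'d \<Rightarrow> real" where
  "bsgrad i s a c x = (\<Sum>j\<in>adj i s. indicator (cbox (clo j) (chi j)) x * sgrad (vel (P j)) a c x)"

lemma FM_bsgrad: "FM (bsgrad i s a c)"
  unfolding bsgrad_def
  by (intro FM_sum FM_mult FM_indicator FM_continuous continuous_sgrad C1_piece adj_cells) auto

lemma bsgrad_eq:
  assumes j: "j \<in> adj i s" and y: "y \<in> face i" and off: "\<And>k. k \<noteq> i \<Longrightarrow> y k \<notin> skel k"
    and lt: "\<And>k. k \<noteq> i \<Longrightarrow> clo j $ k < y k \<and> y k < chi j $ k"
  shows "bsgrad i s a c (face_point i (end_coord i s) y) = sgrad (vel (P j)) a c (face_point i (end_coord i s) y)"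
proof -
  define x where "x = face_point i (end_coord i s) y"
  have "\<exists>j0\<in>adj i s. face_point i (end_coord i s) y \<in> cbox (clo j0) (chi j0) \<and>
      (\<forall>k. k \<noteq> i \<longrightarrow> clo j0 $ k < y k \<and> y k < chi j0 $ k) \<and>
      (\<forall>j'\<in>adj i s. (\<forall>k. k \<noteq> i \<longrightarrow> clo j' $ k \<le> y k \<and> y k \<le> chi j' $ k) \<longrightarrow> j' = j0)"
    by (rule adj_cell_of[OF y off])
  then obtain j0 where j0: "j0 \<in> adj i s" "x \<in> cbox (clo j0) (chi j0)"
      "\<forall>j'\<in>adj i s. (\<forall>k. k \<noteq> i \<longrightarrow> clo j' $ k \<le> y k \<and> y k \<le> chi j' $ k) \<longrightarrow> j' = j0"
    unfolding x_def by (elim bexE conjE)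
  have "\<forall>k. k \<noteq> i \<longrightarrow> clo j $ k \<le> y k \<and> y k \<le> chi j $ k" using lt by (intro allI impI) (simp add: less_imp_le)
  then have jj: "j = j0" by (rule mp[OF bspec[OF j0(3) j]])
  have only: "j' = j" if j': "j' \<in> adj i s" "x \<in> cbox (clo j') (chi j')" for j'
  proof -
    have "clo j' $ k \<le> y k \<and> y k \<le> chi j' $ k" if "k \<noteq> i" for k
      using j'(2)[unfolded mem_box_cart, rule_format, of k] that by (simp add: x_def face_point_def)
    then have "\<forall>k. k \<noteq> i \<longrightarrow> clo j' $ k \<le> y k \<and> y k \<le> chi j' $ k" by (intro allI impI)
    then have "j' = j0" by (rule mp[OF bspec[OF j0(3) j'(1)]])
    then show ?thesis using jj by simp
  qed
  have "bsgrad i s a c x = (\<Sum>j'\<in>adj i s. if j' = j then sgrad (vel (P j)) a c x else 0)"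
    unfolding bsgrad_def
  proof (intro sum.cong refl)
    fix j' assume j': "j' \<in> adj i s"
    show "indicator (cbox (clo j') (chi j')) x * sgrad (vel (P j')) a c x = (if j' = j then sgrad (vel (P j)) a c x else 0)"
    proof (cases "j' = j")
      case True
      then show ?thesis using j0(2) jj by simp
    next
      case False
      then have "x \<notin> cbox (clo j') (chi j')" using only[OF j'] by (rule contrapos_nn)
      then show ?thesis using False by simp
    qed
  qed
  also have "\<dots> = sgrad (vel (P j)) a c x" using j finite_adj by simp
  finally show ?thesis by (simp add: x_def)
qed

lemma cint_le_vint:
  assumes g: "BM skel g" and g0: "\<And>x. x \<in> Off skel \<Longrightarrow> 0 \<le> g x"
    and \<delta>: "\<delta> > 0" "\<And>x. x \<in> Q \<Longrightarrow> \<delta> \<le> \<bar>det (J x)\<bar>"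
  shows "(LBINT x. indicator (Off skel) x * g x) \<le> vint skel g / \<delta>"
proof -
  have "(LBINT x. indicator (Off skel) x * g x) \<le> (LBINT x. indicator (Off skel) x * (\<bar>det (J x)\<bar> * g x) / \<delta>)"
  proof (rule integral_mono[OF integrable_BM[OF finite_skel g] integrable_divide[OF integrable_vint[OF finite_skel g]]])
    fix x
    show "indicator (Off skel) x * g x \<le> indicator (Off skel) x * (\<bar>det (J x)\<bar> * g x) / \<delta>"
    proof (cases "x \<in> Off skel")
      case True
      have "\<delta> * g x \<le> \<bar>det (J x)\<bar> * g x" using g0[OF True] \<delta>(2)[OF subsetD[OF O_subset(2) True]] by (intro mult_right_mono)
      then show ?thesis using True \<delta>(1) by (simp add: pos_le_divide_eq mult.commute)
    qed simp
  qed
  then show ?thesis by (simp add: vint_def)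
qed

text \<open>Sum of the local inequalities over the cells along the boundary.  The pullback \<open>u\<close> is bounded pointwise by the velocity through the
  entries of \<open>det J K\<close>.\<close>

lemma discrete_trace_inequality:
  assumes h: "0 < h"
    and loc: "\<And>j i s. j \<in> cells \<zeta> \<Longrightarrow>
       h * cF j i s (\<lambda>x. \<Sum>\<alpha>\<in>UNIV. \<Sum>c\<in>UNIV. (sgrad (vel (P j)) \<alpha> c x)\<^sup>2) \<le>
       Cl * (cI j (\<lambda>x. \<Sum>\<alpha>\<in>UNIV. \<Sum>c\<in>UNIV. (sgrad (vel (P j)) \<alpha> c x)\<^sup>2) + cI j (\<lambda>x. \<Sum>\<beta>\<in>UNIV. (P j \<beta> x)\<^sup>2))"
    and Cl: "0 < Cl" and Dm: "0 < Dm" "\<And>i x. x \<in> Q \<Longrightarrow> dens i x \<le> Dm"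
    and \<delta>: "0 < \<delta>" "\<And>x. x \<in> Q \<Longrightarrow> \<delta> \<le> \<bar>det (J x)\<bar>"
    and B: "0 < B" "\<And>b c x. x \<in> Q \<Longrightarrow> \<bar>det (J x) * K x $ b $ c\<bar> \<le> B"
  shows "h * (\<Sum>i\<in>UNIV. \<Sum>s\<in>UNIV. fint i s (\<lambda>x. \<Sum>a\<in>UNIV. \<Sum>c\<in>UNIV. (bsgrad i s a c x)\<^sup>2)) \<le>
    2 * real CARD('d) * Dm * Cl / \<delta> * (1 + (real CARD('d))\<^sup>2 * B\<^sup>2) *
    (vint skel (\<lambda>x. \<Sum>a\<in>UNIV. \<Sum>c\<in>UNIV. (sgrad v a c x)\<^sup>2) + vint skel (\<lambda>x. \<Sum>c\<in>UNIV. (v c x)\<^sup>2))"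
proof -
  let ?m = "real CARD('d)"
  define SS where "SS x = (\<Sum>a\<in>UNIV. \<Sum>c\<in>UNIV. (sgrad v a c x)\<^sup>2)" for x
  define VV where "VV x = (\<Sum>c\<in>UNIV. (v c x)\<^sup>2)" for x
  define u where "u b x = (\<Sum>c\<in>UNIV. (det (J x) * K x $ b $ c) * v c x)" for b x
  define UU where "UU x = (\<Sum>b\<in>UNIV. (u b x)\<^sup>2)" for x
  define SJ where "SJ j x = (\<Sum>a\<in>UNIV. \<Sum>c\<in>UNIV. (sgrad (vel (P j)) a c x)\<^sup>2)" for j x
  define PJ where "PJ j x = (\<Sum>\<beta>\<in>UNIV. (P j \<beta> x)\<^sup>2)" for j x
  have BMS: "BM skel SS" unfolding SS_def by (intro BM_sum BM_power BM_sgrad PW_v)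
  have BMV: "BM skel VV" unfolding VV_def by (intro BM_sum BM_power PW_BM PW_v)
  have BMU: "BM skel UU" unfolding UU_def u_def by (intro BM_sum BM_power BM_mult BM_det BM_K PW_BM PW_v)
  have cSJ: "continuous_on (cbox (clo j) (chi j)) (SJ j)" if j: "j \<in> cells \<zeta>" for j
    unfolding SJ_def by (intro continuous_on_sum continuous_on_power continuous_on_subset[OF continuous_sgrad cell_subset[OF j]] C1_piece[OF j])
  have cPJ: "continuous_on (cbox (clo j) (chi j)) (PJ j)" if j: "j \<in> cells \<zeta>" for j
    unfolding PJ_def by (intro continuous_on_sum continuous_on_power C1_continuous_on[OF C1_TP[OF TP_P[OF j]]])
  have sumS: "(\<Sum>j\<in>cells \<zeta>. cI j (SJ j)) = (LBINT x. indicator (Off skel) x * SS x)"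
    by (rule sum_cint[OF BMS cSJ]) (simp_all add: SS_def SJ_def piece_box(3))
  have uP: "u b x = P j b x" if j: "j \<in> cells \<zeta>" and x: "x \<in> box (clo j) (chi j)" for j b x
  proof -
    have xc: "x \<in> cbox (clo j) (chi j)" by (rule subsetD[OF box_subset_cbox x])
    have xS: "x \<in> S" by (rule subsetD[OF cell_subset_S[OF j] xc])
    have "u b x = (\<Sum>c\<in>UNIV. \<Sum>\<beta>\<in>UNIV. K x $ b $ c * J x $ c $ \<beta> * P j \<beta> x)"
      unfolding u_def using det_J_nz[OF xS]
      by (simp add: v_eq[OF j xc] vel_def velocity_coeff_def sum_distrib_left mult_ac)
    also have "\<dots> = (\<Sum>\<beta>\<in>UNIV. (\<Sum>c\<in>UNIV. K x $ b $ c * J x $ c $ \<beta>) * P j \<beta> x)"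
      by (subst sum.swap) (simp add: sum_distrib_right)
    also have "\<dots> = (\<Sum>\<beta>\<in>UNIV. if \<beta> = b then P j b x else 0)"
      by (intro sum.cong refl) (simp add: KJ_nth[OF xS])
    finally show ?thesis by simp
  qed
  have sumP: "(\<Sum>j\<in>cells \<zeta>. cI j (PJ j)) = (LBINT x. indicator (Off skel) x * UU x)"
    by (rule sum_cint[OF BMU cPJ]) (simp_all add: UU_def PJ_def uP)
  have UV: "UU x \<le> ?m\<^sup>2 * B\<^sup>2 * VV x" if x: "x \<in> Q" for x
  proof -
    have "(u b x)\<^sup>2 \<le> ?m * B\<^sup>2 * VV x" for b
    proof -
      have "(u b x)\<^sup>2 \<le> (\<Sum>c\<in>UNIV. (det (J x) * K x $ b $ c * v c x)\<^sup>2) * ?m"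
        unfolding u_def using sum_squared_le_sum_of_squares[of "\<lambda>c. det (J x) * K x $ b $ c * v c x" UNIV] by simp
      also have "(\<Sum>c\<in>UNIV. (det (J x) * K x $ b $ c * v c x)\<^sup>2) \<le> (\<Sum>c\<in>UNIV. B\<^sup>2 * (v c x)\<^sup>2)"
      proof (rule sum_mono)
        fix c
        have "(det (J x) * K x $ b $ c)\<^sup>2 \<le> B\<^sup>2" using B(2)[OF x, of b c] B(1) by (simp add: abs_le_square_iff[symmetric])
        then show "(det (J x) * K x $ b $ c * v c x)\<^sup>2 \<le> B\<^sup>2 * (v c x)\<^sup>2"
          unfolding power_mult_distrib[of _ "v c x"] by (intro mult_right_mono) auto
      qed
      also have "\<dots> = B\<^sup>2 * VV x" by (simp add: VV_def sum_distrib_left)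
      finally show ?thesis by (simp add: mult_ac)
    qed
    then have "UU x \<le> (\<Sum>b\<in>(UNIV::'d set). ?m * B\<^sup>2 * VV x)" unfolding UU_def by (intro sum_mono)
    also have "\<dots> = ?m\<^sup>2 * B\<^sup>2 * VV x" by (simp add: power2_eq_square)
    finally show ?thesis .
  qed
  have vU: "vint skel UU \<le> ?m\<^sup>2 * B\<^sup>2 * vint skel VV"
    unfolding vint_cmult[symmetric]
    by (intro vint_mono[OF finite_skel BMU] BM_mult BM_const BMV UV subsetD[OF O_subset(2)])
  have nn: "0 \<le> vint skel SS" "0 \<le> vint skel VV"
    by (intro vint_nonneg; simp add: SS_def VV_def sum_nonneg)+
  have cI0: "0 \<le> cI j (SJ j)" "0 \<le> cI j (PJ j)" if "j \<in> cells \<zeta>" for j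
    by (rule pbox.cint_nonneg[OF pbox_cell[OF that]]; simp add: SJ_def PJ_def sum_nonneg)+
  define E where "E = Dm * (Cl * ((1 + ?m\<^sup>2 * B\<^sup>2) / \<delta> * (vint skel SS + vint skel VV)))"
  have one: "h * fint i s (\<lambda>x. \<Sum>a\<in>UNIV. \<Sum>c\<in>UNIV. (bsgrad i s a c x)\<^sup>2) \<le> E" for i s
  proof -
    define bb where "bb x = (\<Sum>a\<in>UNIV. \<Sum>c\<in>UNIV. (bsgrad i s a c x)\<^sup>2)" for x
    have FMb: "FM bb" unfolding bb_def by (intro FM_sum FM_power FM_bsgrad)
    have bb0: "0 \<le> bb x" for x by (simp add: bb_def sum_nonneg)
    have "fint i s bb \<le> (\<integral>y. Dm * (indicator (face i) y * bb (face_point i (end_coord i s) y)) \<partial>slice_measure i)"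
      unfolding fint_def
    proof (rule integral_mono[OF integrable_fint[OF FMb] integrable_mult_right[OF integrable_FM[OF FMb]]])
      fix y
      define x where "x = face_point i (end_coord i s) y"
      show "indicator (face i) y * (dens i (face_point i (end_coord i s) y) * bb (face_point i (end_coord i s) y))
        \<le> Dm * (indicator (face i) y * bb (face_point i (end_coord i s) y))"
      proof (cases "y \<in> face i")
        case True
        then have "x \<in> Q" unfolding x_def by (rule face_point_end_Q)
        then have "dens i x * bb x \<le> Dm * bb x" by (intro mult_right_mono Dm(2) bb0)
        then show ?thesis using True unfolding x_def[symmetric] by simp
      qed simp
    qed
    also have "\<dots> = Dm * (\<Sum>j\<in>adj i s. cF j i s (SJ j))"
    proof -
      have "(\<Sum>j\<in>adj i s. cF j i s (SJ j)) = (\<integral>y. indicator (face i) y * bb (face_point i (end_coord i s) y) \<partial>slice_measure i)"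
      proof (rule sum_cface[OF FMb])
        show "continuous_on (cbox (clo j) (chi j)) (SJ j)" if "j \<in> adj i s" for j by (rule cSJ[OF adj_cells[OF that]])
        fix j y assume *: "j \<in> adj i s" "y \<in> face i" "\<And>k. k \<noteq> i \<Longrightarrow> y k \<notin> skel k"
          "\<And>k. k \<noteq> i \<Longrightarrow> clo j $ k < y k \<and> y k < chi j $ k"
        show "bb (face_point i (end_coord i s) y) = SJ j (face_point i (end_coord i s) y)"
          unfolding bb_def SJ_def by (intro sum.cong refl arg_cong[where f="\<lambda>t. t\<^sup>2"] bsgrad_eq *)
      qed
      then show ?thesis by simp
    qed
    finally have "h * fint i s bb \<le> h * (Dm * (\<Sum>j\<in>adj i s. cF j i s (SJ j)))" using h by (intro mult_left_mono) auto
    also have "\<dots> = Dm * (\<Sum>j\<in>adj i s. h * cF j i s (SJ j))" by (simp add: sum_distrib_left mult_ac)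
    also have "\<dots> \<le> Dm * (\<Sum>j\<in>adj i s. Cl * (cI j (SJ j) + cI j (PJ j)))"
      using Dm(1) loc[OF adj_cells, folded SJ_def PJ_def] by (intro mult_left_mono sum_mono) auto
    also have "\<dots> \<le> Dm * (\<Sum>j\<in>cells \<zeta>. Cl * (cI j (SJ j) + cI j (PJ j)))"
      using Dm(1) Cl cI0 by (intro mult_left_mono sum_mono2 finite_cells) (auto simp: adj_def intro!: mult_nonneg_nonneg add_nonneg_nonneg)
    also have "(\<Sum>j\<in>cells \<zeta>. Cl * (cI j (SJ j) + cI j (PJ j))) =
        Cl * ((LBINT x. indicator (Off skel) x * SS x) + (LBINT x. indicator (Off skel) x * UU x))"
      by (simp only: sum_distrib_left[symmetric] sum.distrib sumS sumP)
    also have "Dm * \<dots> \<le> E"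
    proof -
      have "(LBINT x. indicator (Off skel) x * SS x) \<le> vint skel SS / \<delta>"
        by (rule cint_le_vint[OF BMS _ \<delta>]) (auto simp: SS_def sum_nonneg)
      moreover have "(LBINT x. indicator (Off skel) x * UU x) \<le> vint skel UU / \<delta>"
        by (rule cint_le_vint[OF BMU _ \<delta>]) (auto simp: UU_def sum_nonneg)
      moreover have "vint skel UU / \<delta> \<le> ?m\<^sup>2 * B\<^sup>2 * vint skel VV / \<delta>" using vU \<delta>(1) by (intro divide_right_mono) auto
      moreover have "vint skel SS / \<delta> + ?m\<^sup>2 * B\<^sup>2 * vint skel VV / \<delta> \<le> (1 + ?m\<^sup>2 * B\<^sup>2) / \<delta> * (vint skel SS + vint skel VV)"
      proof -
        have "0 \<le> ?m\<^sup>2 * B\<^sup>2 * vint skel SS + vint skel VV" using nn by simp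
        then have "vint skel SS + ?m\<^sup>2 * B\<^sup>2 * vint skel VV \<le> (1 + ?m\<^sup>2 * B\<^sup>2) * (vint skel SS + vint skel VV)"
          by (simp add: algebra_simps)
        then have "(vint skel SS + ?m\<^sup>2 * B\<^sup>2 * vint skel VV) / \<delta> \<le> (1 + ?m\<^sup>2 * B\<^sup>2) * (vint skel SS + vint skel VV) / \<delta>"
          using \<delta>(1) by (intro divide_right_mono) auto
        then show ?thesis by (simp only: add_divide_distrib[symmetric] times_divide_eq_left)
      qed
      ultimately have "(LBINT x. indicator (Off skel) x * SS x) + (LBINT x. indicator (Off skel) x * UU x)
          \<le> (1 + ?m\<^sup>2 * B\<^sup>2) / \<delta> * (vint skel SS + vint skel VV)" by linarith
      then show ?thesis unfolding E_def using Dm(1) Cl by (intro mult_left_mono) auto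
    qed
    finally show ?thesis unfolding bb_def .
  qed
  have "h * (\<Sum>i\<in>UNIV. \<Sum>s\<in>UNIV. fint i s (\<lambda>x. \<Sum>a\<in>UNIV. \<Sum>c\<in>UNIV. (bsgrad i s a c x)\<^sup>2))
      = (\<Sum>i\<in>UNIV. \<Sum>s\<in>UNIV. h * fint i s (\<lambda>x. \<Sum>a\<in>UNIV. \<Sum>c\<in>UNIV. (bsgrad i s a c x)\<^sup>2))"
    by (simp only: sum_distrib_left)
  also have "\<dots> \<le> (\<Sum>i\<in>(UNIV::'d set). \<Sum>s\<in>(UNIV::bool set). E)" by (intro sum_mono one)
  also have "\<dots> = 2 * ?m * E" by (simp add: card_UNIV_bool)
  also have "\<dots> = 2 * ?m * Dm * Cl / \<delta> * (1 + ?m\<^sup>2 * B\<^sup>2) * (vint skel SS + vint skel VV)" by (simp add: E_def)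
  finally show ?thesis unfolding SS_def VV_def .
qed

text \<open>Near an inner point of a boundary facet the domain coincides with the image of a single cell, on which the symmetric gradient is
  that of one smooth piece; the continuous inverse of \<open>F\<close> transfers the limit.\<close>

lemma boundary_limit:
  assumes u: "\<And>x c. x \<in> Q \<Longrightarrow> u (F x) $ c = v c x"
    and y: "y \<in> face i" and off: "\<And>k. k \<noteq> i \<Longrightarrow> y k \<notin> skel k"
  shows "Lim (at (F (face_point i (end_coord i s) y)) within \<Omega>) (sym_grad u) =
    (\<chi> a c. bsgrad i s a c (face_point i (end_coord i s) y))"
proof -
  define x where "x = face_point i (end_coord i s) y"
  have "\<exists>j\<in>adj i s. face_point i (end_coord i s) y \<in> cbox (clo j) (chi j) \<and>
      (\<forall>k. k \<noteq> i \<longrightarrow> clo j $ k < y k \<and> y k < chi j $ k) \<and>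
      (\<forall>j'\<in>adj i s. (\<forall>k. k \<noteq> i \<longrightarrow> clo j' $ k \<le> y k \<and> y k \<le> chi j' $ k) \<longrightarrow> j' = j)"
    by (rule adj_cell_of[OF y off])
  then obtain j where j: "j \<in> adj i s" "\<forall>k. k \<noteq> i \<longrightarrow> clo j $ k < y k \<and> y k < chi j $ k"
    by (elim bexE conjE)
  have jc: "j \<in> cells \<zeta>" by (rule adj_cells[OF j(1)])
  have xQ: "x \<in> Q" unfolding x_def by (rule face_point_end_Q[OF y])
  have xi: "x $ i = end_coord i s" and xk: "\<And>k. k \<noteq> i \<Longrightarrow> x $ k = y k" by (simp_all add: x_def face_point_def)
  define M where "M z = (\<chi> a c. sgrad (vel (P j)) a c z)" for z
  have cM: "continuous_on Q M" unfolding M_def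
    by (intro continuous_on_vec_lambda continuous_sgrad C1_piece[OF jc])
  have GQ: "G ` (F ` Q) \<subseteq> Q" by auto
  have tG: "(G \<longlongrightarrow> x) (at (F x) within F ` Q)"
    using continuous_G xQ by (auto simp: continuous_on_def)
  have cMG: "continuous_on (F ` Q) (\<lambda>z. M (G z))"
    by (rule continuous_on_compose2[OF cM continuous_G GQ])
  then have tM: "((\<lambda>z. M (G z)) \<longlongrightarrow> M x) (at (F x) within F ` Q)"
    using xQ by (auto simp: continuous_on_def)
  have \<Omega>F: "\<Omega> \<subseteq> F ` Q" unfolding phys_domain_def by (intro image_mono box_subset_cbox)
  \<comment> \<open>an open set around the facet point that meets the box within the cell \<open>j\<close> only\<close>
  define N where "N = {z :: real^'d. \<forall>k. (k \<noteq> i \<longrightarrow> clo j $ k < z $ k \<and> z $ k < chi j $ k)} \<inter>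
    (if s then {z. clo j $ i < z $ i} else {z. z $ i < chi j $ i})"
  have openN: "open N"
  proof -
    have "{z :: real^'d. \<forall>k. (k \<noteq> i \<longrightarrow> clo j $ k < z $ k \<and> z $ k < chi j $ k)}
        = (\<Inter>k\<in>-{i}. {z. clo j $ k < z $ k} \<inter> {z. z $ k < chi j $ k})" by auto
    moreover have o: "open {z :: real^'d. c < z $ k}" "open {z :: real^'d. z $ k < c}" for c k
      by (intro open_Collect_less continuous_intros)+
    ultimately show ?thesis unfolding N_def
      by (auto intro!: open_Int open_INT o simp del: Collect_conj_eq)
  qed
  have e: "end_coord i s = (if s then chi j $ i else clo j $ i)" by (rule adj_end[OF j(1), symmetric])
  have xN: "x \<in> N"
  proof -
    have "clo j $ i < chi j $ i" by (rule cell_lo_less_hi[OF jc])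
    then have "if s then clo j $ i < x $ i else x $ i < chi j $ i" unfolding xi e by simp
    then show ?thesis using j(2) xk unfolding N_def by (simp split: if_splits)
  qed
  have Nbox: "z \<in> box (clo j) (chi j)" if z: "z \<in> N" "z \<in> box lo hi" for z
    unfolding mem_box_cart
  proof
    fix k
    show "clo j $ k < z $ k \<and> z $ k < chi j $ k"
    proof (cases "k = i")
      case False
      then show ?thesis using z(1) by (simp add: N_def)
    next
      case True
      have "lo $ i < z $ i" "z $ i < hi $ i" using z(2) by (auto simp: mem_box_cart)
      then show ?thesis using z(1) e unfolding True N_def by (cases s) auto
    qed
  qed
  have PWu: "PW skel (\<lambda>x. u (F x) $ c)" for c by (rule PW_cong[OF finite_skel PW_v u])
  have sg: "sym_grad u (F z) = M z" if z: "z \<in> box (clo j) (chi j)" for z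
  proof -
    have zO: "z \<in> Off skel" by (rule subsetD[OF cell_box_Off[OF jc] z])
    have pdv: "pd b (\<lambda>x. u (F x) $ c) z = pd b (v c) z" for b c
      by (rule pd_cong(1)[OF open_O[OF finite_skel] zO]) (rule u, rule subsetD[OF O_subset(2)])
    have "sym_grad u (F z) $ a $ c = M z $ a $ c" for a c
    proof -
      have "sym_grad u (F z) $ a $ c = (phd a (\<lambda>x. u (F x) $ c) z + phd c (\<lambda>x. u (F x) $ a) z) / 2"
        unfolding sym_grad_def by (simp add: grad_F[OF finite_skel PWu zO] transpose_def)
      also have "\<dots> = sgrad v a c z" by (simp add: sgrad_def phd_def pdv)
      finally show ?thesis by (simp add: M_def piece_box(3)[OF jc z])
    qed
    then show ?thesis by (simp add: vec_eq_iff)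
  qed
  have "eventually (\<lambda>z. G z \<in> N) (at (F x) within \<Omega>)"
    by (rule topological_tendstoD[OF tendsto_within_subset[OF tG \<Omega>F] openN xN])
  moreover have "eventually (\<lambda>z. z \<in> \<Omega>) (at (F x) within \<Omega>)"
    by (simp add: eventually_at_filter)
  ultimately have "eventually (\<lambda>z. M (G z) = sym_grad u z) (at (F x) within \<Omega>)"
  proof eventually_elim
    case (elim z)
    then obtain w where w: "w \<in> box lo hi" "z = F w" unfolding phys_domain_def by blast
    have Gz: "G z = w" unfolding w(2) by (rule G_F[OF subsetD[OF box_subset_cbox w(1)]])
    then have "w \<in> box (clo j) (chi j)" using elim(1) w(1) by (intro Nbox) simp_all
    then show ?case using sg w(2) Gz by simp
  qed
  then have lim: "(sym_grad u \<longlongrightarrow> M x) (at (F x) within \<Omega>)"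
    by (rule Lim_transform_eventually[OF tendsto_within_subset[OF tM \<Omega>F]])
  have cl: "closure (box lo hi) = Q"
  proof (rule closure_box)
    have "(lo + hi) /\<^sub>R 2 \<in> box lo hi" using lo_less_hi by (simp add: mem_box_cart)
    then show "box lo hi \<noteq> {}" by blast
  qed
  have "F ` closure (box lo hi) \<subseteq> closure \<Omega>"
    unfolding phys_domain_def
    by (rule image_closure_subset[OF _ closed_closure closure_subset]) (simp only: cl continuous_F_Q)
  then have "F x \<in> closure \<Omega>" unfolding cl using xQ by blast
  moreover have "F x \<notin> \<Omega>"
  proof
    assume "F x \<in> \<Omega>"
    then obtain w where w: "w \<in> box lo hi" "F w = F x" unfolding phys_domain_def by force
    then have "w = x" using inj_onD[OF inj_F] xQ subsetD[OF box_subset_cbox] by blast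
    then have "x \<in> box lo hi" using w by simp
    then have "lo $ i < x $ i" "x $ i < hi $ i" by (auto simp: mem_box_cart)
    then show False unfolding xi by (cases s) auto
  qed
  ultimately have "F x islimpt \<Omega>" by (auto simp: closure_def)
  then have "Lim (at (F x) within \<Omega>) (sym_grad u) = M x"
    by (intro tendsto_Lim lim) (simp add: trivial_limit_within)
  moreover have "M x = (\<chi> a c. bsgrad i s a c x)"
    unfolding M_def x_def by (simp add: vec_eq_iff bsgrad_eq[OF j(1) y off] j(2))
  ultimately show ?thesis unfolding x_def by simp
qed

end

section \<open>Coercivity\<close>

lemma Ck_on_continuous: "Ck_on m f U \<Longrightarrow> continuous_on U f"
  by (cases m) (auto intro: differentiable_imp_continuous_on)

lemma Ck_on_Suc_component:
  fixes f :: "real^'d \<Rightarrow> real^'e"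
  assumes U: "open U" and f: "Ck_on (Suc m) f U"
  shows "C1 U (\<lambda>x. f x $ a)" and "x \<in> U \<Longrightarrow> pd b (\<lambda>x. f x $ a) x = frechet_derivative f (at x) (axis b 1) $ a"
proof -
  note fS = iffD1[OF Ck_on.simps(2) f]
  have d: "f differentiable (at x)" if x: "x \<in> U" for x
    using bspec[OF conjunct1[OF fS, unfolded differentiable_on_def] x] unfolding at_within_open[OF x U] .
  have D: "((\<lambda>x. f x $ a) has_derivative (\<lambda>h. frechet_derivative f (at x) h $ a)) (at x)" if "x \<in> U" for x
    by (rule bounded_linear.has_derivative[OF bounded_linear_vec_nth iffD1[OF frechet_derivative_works d[OF that]]])
  show pd: "pd b (\<lambda>x. f x $ a) x = frechet_derivative f (at x) (axis b 1) $ a" if "x \<in> U" for x b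
    by (rule pd_eqI[OF D[OF that]])
  show "C1 U (\<lambda>x. f x $ a)"
    unfolding C1_def
  proof (intro conjI ballI allI)
    show "(\<lambda>x. f x $ a) differentiable (at x)" if "x \<in> U" for x using D[OF that] by (rule differentiableI)
    fix i
    have "Ck_on m (\<lambda>x. frechet_derivative f (at x) (axis i 1)) U" by (rule spec[OF conjunct2[OF fS]])
    then have "continuous_on U (\<lambda>x. frechet_derivative f (at x) (axis i 1) $ a)"
      by (intro continuous_on_component Ck_on_continuous)
    then show "continuous_on U (pd i (\<lambda>x. f x $ a))" by (rule continuous_on_eq) (simp add: pd)
  qed
qed

text \<open>The Jacobian determinant stays nonzero in an open neighbourhood of the box, which serves as \<open>S\<close>.\<close>

lemma parametrization_curved_box:
  fixes F :: "real^'d \<Rightarrow> real^'d"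
  assumes card: "CARD('d) \<in> {2, 3}" and par: "parametrization (m + 2) F lo hi"
  shows "\<exists>S. curved_box F lo hi S"
proof -
  from par have lt: "\<forall>i. lo $ i < hi $ i" and ex: "\<exists>U. open U \<and> cbox lo hi \<subseteq> U \<and> Ck_on (m + 2) F U"
    and inj: "inj_on F (cbox lo hi)" and nz: "\<forall>x\<in>cbox lo hi. det (jacobian F (at x)) \<noteq> 0"
    unfolding parametrization_def by blast+
  from ex obtain U where U: "open U" "cbox lo hi \<subseteq> U" "Ck_on (m + 2) F U" by (elim exE conjE)
  have F2: "Ck_on (Suc (Suc m)) F U" using U(3) by (simp only: add_2_eq_Suc')
  note C1F = Ck_on_Suc_component[OF U(1) F2]
  have C1pd: "C1 U (pd b (\<lambda>x. F x $ a))" for a b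
  proof (rule C1_cong[OF U(1)])
    have "Ck_on (Suc m) (\<lambda>x. frechet_derivative F (at x) (axis b 1)) U"
      by (rule spec[OF conjunct2[OF iffD1[OF Ck_on.simps(2) F2]]])
    then show "C1 U (\<lambda>x. frechet_derivative F (at x) (axis b 1) $ a)" by (rule Ck_on_Suc_component(1)[OF U(1)])
  qed (rule C1F(2))
  let ?d = "\<lambda>x. det ((\<chi> a b. pd b (\<lambda>x. F x $ a) x) :: real^'d^'d)"
  define S where "S = U \<inter> ?d -` (- {0})"
  have "continuous_on U ?d" by (rule C1_continuous_on, rule C1_det_matrix) (simp add: C1pd)
  then have openS: "open S" unfolding S_def by (rule continuous_open_preimage[OF _ U(1)]) auto
  have sub: "S \<subseteq> U" by (simp add: S_def)
  have "cbox lo hi \<subseteq> S"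
  proof
    fix x assume x: "x \<in> cbox lo hi"
    then have xU: "x \<in> U" using U(2) by blast
    have "jacobian F (at x) = (\<chi> a b. pd b (\<lambda>x. F x $ a) x)"
      by (simp add: jacobian_def matrix_def C1F(2)[OF xU])
    from bspec[OF nz x, unfolded this] show "x \<in> S" using xU by (simp add: S_def)
  qed
  then have "curved_box F lo hi S"
    using card lt openS C1_subset[OF C1F(1) sub] C1_subset[OF C1pd sub] inj
    by unfold_locales (auto simp: S_def)
  then show ?thesis by blast
qed

lemma stab_weight_nonneg:
  assumes "0 < h" "0 < \<nu>" "0 \<le> \<gamma>" shows "0 \<le> stab_weight \<alpha>' h \<nu> \<gamma> n w"
proof -
  have "0 \<le> min (norm w * h / \<nu>) 1" using assms by simp
  then show ?thesis unfolding stab_weight_def using assms by (intro mult_nonneg_nonneg zero_le_power) auto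
qed

lemma J_form_self:
  assumes "0 < h" "0 < \<nu>" "0 \<le> \<gamma>"
  shows "J_form \<alpha>' F lo hi \<zeta> h \<nu> \<gamma> u u = interior_facet_sum F \<zeta> (\<lambda>j i x.
         (norm (sqrt (stab_weight \<alpha>' h \<nu> \<gamma> (unit_normal F lo hi i True x) (u x)) *\<^sub>R
                jump_normal_deriv \<alpha>' F lo hi \<zeta> u j i x))\<^sup>2)"
  unfolding J_form_def by (simp add: power_mult_distrib stab_weight_nonneg[OF assms] power2_norm_eq_inner)

lemma interior_facet_sum_nonneg:
  assumes "\<And>j i x. 0 \<le> f j i x" shows "0 \<le> interior_facet_sum F \<zeta> f"
  unfolding interior_facet_sum_def by (intro sum_nonneg) (auto intro!: integral_nonneg_AE assms)

lemma weighted_young_double_sum: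
  fixes s :: "'e::finite \<Rightarrow> 'e \<Rightarrow> real" and n w :: "'e \<Rightarrow> real"
  assumes e: "0 < e" and n: "(\<Sum>a\<in>UNIV. (n a)\<^sup>2) = 1"
  shows "2 * (\<Sum>c\<in>UNIV. \<Sum>a\<in>UNIV. s a c * n a * w c) \<le>
    e * (\<Sum>a\<in>UNIV. \<Sum>c\<in>UNIV. (s a c)\<^sup>2) + (1 / e) * (\<Sum>c\<in>UNIV. (w c)\<^sup>2)"
proof -
  have young: "2 * (s a c * n a * w c) \<le> e * (s a c)\<^sup>2 + (1 / e) * ((n a)\<^sup>2 * (w c)\<^sup>2)" for a c
  proof -
    have "0 \<le> (e * s a c - n a * w c)\<^sup>2 / e" using e by simp
    also have "\<dots> = e * (s a c)\<^sup>2 + (1 / e) * ((n a)\<^sup>2 * (w c)\<^sup>2) - 2 * (s a c * n a * w c)"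
      using e by (simp add: power2_eq_square field_simps)
    finally show ?thesis by linarith
  qed
  have "2 * (\<Sum>c\<in>UNIV. \<Sum>a\<in>UNIV. s a c * n a * w c) \<le>
      (\<Sum>c\<in>UNIV. \<Sum>a\<in>UNIV. e * (s a c)\<^sup>2 + (1 / e) * ((n a)\<^sup>2 * (w c)\<^sup>2))"
    unfolding sum_distrib_left by (intro sum_mono young)
  also have "\<dots> = e * (\<Sum>c\<in>UNIV. \<Sum>a\<in>UNIV. (s a c)\<^sup>2) + (1 / e) * (\<Sum>c\<in>UNIV. (\<Sum>a\<in>UNIV. (n a)\<^sup>2) * (w c)\<^sup>2)"
    unfolding sum_distrib_left sum_distrib_right sum.distrib ..
  also have "(\<Sum>c\<in>UNIV. \<Sum>a\<in>UNIV. (s a c)\<^sup>2) = (\<Sum>a\<in>UNIV. \<Sum>c\<in>UNIV. (s a c)\<^sup>2)" by (rule sum.swap)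
  finally show ?thesis by (simp add: n)
qed

context curved_box
begin

lemma sym_grad_F:
  assumes fin: "\<And>k. finite (Z k)" and u: "\<And>c. PW Z (\<lambda>x. u (F x) $ c)" and x: "x \<in> Off Z"
  shows "sym_grad u (F x) $ a $ c = sgrad (\<lambda>c x. u (F x) $ c) a c x"
  unfolding sym_grad_def sgrad_def by (simp add: grad_F[OF fin u x] transpose_def)

lemma integral_face_FM:
  assumes fin: "\<And>k. finite (Z k)" and gh: "FM gh"
    and eq: "\<And>y. y \<in> face i \<Longrightarrow> (\<And>k. k \<noteq> i \<Longrightarrow> y k \<notin> Z k) \<Longrightarrow>
       f (F (face_point i (end_coord i s) y)) = gh (face_point i (end_coord i s) y)"
  shows "(LINT x|face_measure F lo hi i s. f x) = fint i s gh"
proof -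
  from gh obtain B where B: "\<forall>x\<in>Q. \<bar>gh x\<bar> \<le> B" unfolding FM_def by (elim conjE exE)
  show ?thesis by (rule integral_face_measure[OF fin conjunct1[OF gh[unfolded FM_def]] bspec[OF B] eq])
qed

end

text \<open>Both sides of the coercivity estimate in terms of the same four numbers: \<open>A\<close> is the energy of the symmetric gradient, \<open>\<Gamma>\<close> the
  boundary integral of \<open>|u|\<^sup>2\<close>, \<open>X\<close> the consistency term and \<open>Jt\<close> the stabilization.\<close>

lemma (in piecewise_velocity) A_stb_energy:
  fixes \<alpha>' :: nat
  assumes u: "\<And>x c. u (F x) $ c = v c x"
    and tr: "has_trace F lo hi u g"
    and gn: "\<And>i s. AE x in face_measure F lo hi i s. g x \<bullet> unit_normal F lo hi i s x = 0"
    and div: "AE x in lebesgue_on \<Omega>. divergence u x = 0"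
    and pos: "0 < h" "0 < \<nu>" "0 \<le> \<gamma>"
  defines "A \<equiv> vint skel (\<lambda>x. \<Sum>a\<in>UNIV. \<Sum>c\<in>UNIV. (sgrad v a c x)\<^sup>2)"
    and "\<Gamma> \<equiv> \<Sum>i\<in>UNIV. \<Sum>s\<in>UNIV. fint i s (\<lambda>x. \<Sum>c\<in>UNIV. (v c x)\<^sup>2)"
    and "X \<equiv> \<Sum>i\<in>UNIV. \<Sum>s\<in>UNIV. fint i s (\<lambda>x. \<Sum>c\<in>UNIV. \<Sum>a\<in>UNIV. bsgrad i s a c x * nrm i s x $ a * v c x)"
    and "Jt \<equiv> J_form \<alpha>' F lo hi \<zeta> h \<nu> \<gamma> u u"
  shows "A_stb \<alpha>' F lo hi \<zeta> h \<nu> \<gamma> CNit u u = 2 * \<nu> * A - 4 * \<nu> * X + 2 * \<nu> * (CNit / h) * \<Gamma> + Jt"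
    and "energy_norm_sq \<alpha>' F lo hi \<zeta> h \<nu> \<gamma> CNit u = 2 * \<nu> * A + 2 * \<nu> * (CNit / h) * \<Gamma> + Jt"
    and "0 \<le> Jt"
proof -
  have uv: "(\<lambda>x. u (F x) $ c) = v c" for c by (rule ext) (rule u)
  have PWu: "PW skel (\<lambda>x. u (F x) $ c)" for c unfolding uv by (rule PW_v)
  have conv: "convection_form \<Omega> u u u = 0" by (rule convection_zero[OF finite_skel PWu div tr gn])
  have sg: "sym_grad u (F x) $ a $ c = sgrad v a c x" if "x \<in> Off skel" for x a c
    using sym_grad_F[OF finite_skel PWu that] unfolding uv .
  have BMS: "BM skel (\<lambda>x. \<Sum>a\<in>UNIV. \<Sum>c\<in>UNIV. (sgrad v a c x)\<^sup>2)"
    by (intro BM_sum BM_power BM_sgrad PW_v)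
  have vol: "(LINT x|lebesgue_on \<Omega>. sym_grad u x \<bullet> sym_grad u x) = A"
    unfolding A_def
    by (rule integral_Omega[OF finite_skel BMS]) (simp add: inner_matrix sg power2_eq_square)
  have nn: "(\<Sum>c\<in>UNIV. (v c x)\<^sup>2) = u (F x) \<bullet> u (F x)" for x
    by (simp add: inner_vec_def u power2_eq_square)
  have cV: "continuous_on Q (\<lambda>x. \<Sum>c\<in>UNIV. (v c x)\<^sup>2)" by (intro continuous_on_sum continuous_on_power continuous_v)
  have bnd: "(LINT x|face_measure F lo hi i s. u x \<bullet> u x) = fint i s (\<lambda>x. \<Sum>c\<in>UNIV. (v c x)\<^sup>2)" for i s
    by (rule integral_face_measure_continuous[OF cV]) (simp add: nn)
  have bfs: "boundary_facet_sum F \<zeta> (\<lambda>x. (norm (u x))\<^sup>2) = \<Gamma>"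
    unfolding \<Gamma>_def by (rule boundary_facet_sum_eq[OF cV]) (simp add: nn power2_norm_eq_inner)
  have mix: "(LINT x|face_measure F lo hi i s. normal_sym_grad \<Omega> u (unit_normal F lo hi i s x) x \<bullet> u x)
     = fint i s (\<lambda>x. \<Sum>c\<in>UNIV. \<Sum>a\<in>UNIV. bsgrad i s a c x * nrm i s x $ a * v c x)" for i s
  proof (rule integral_face_FM[OF finite_skel])
    show "FM (\<lambda>x. \<Sum>c\<in>UNIV. \<Sum>a\<in>UNIV. bsgrad i s a c x * nrm i s x $ a * v c x)"
      by (intro FM_sum FM_mult FM_bsgrad FM_continuous continuous_nrm continuous_v)
    fix y assume y: "y \<in> face i" and off: "\<And>k. k \<noteq> i \<Longrightarrow> y k \<notin> skel k"
    define x where "x = face_point i (end_coord i s) y"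
    have xQ: "x \<in> Q" unfolding x_def by (rule face_point_end_Q[OF y])
    have L: "Lim (at (F x) within \<Omega>) (sym_grad u) = (\<chi> a c. bsgrad i s a c x)"
      unfolding x_def by (rule boundary_limit[OF u y off])
    have "normal_sym_grad \<Omega> u (unit_normal F lo hi i s (F x)) (F x) \<bullet> u (F x) =
        (\<Sum>c\<in>UNIV. \<Sum>a\<in>UNIV. bsgrad i s a c x * nrm i s x $ a * v c x)"
      unfolding normal_sym_grad_def L unit_normal_F[OF xQ]
      by (simp add: inner_vec_def vector_matrix_mult_def u sum_distrib_left mult_ac)
    then show "normal_sym_grad \<Omega> u (unit_normal F lo hi i s (F (face_point i (end_coord i s) y))) (F (face_point i (end_coord i s) y))
        \<bullet> u (F (face_point i (end_coord i s) y)) =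
        (\<Sum>c\<in>UNIV. \<Sum>a\<in>UNIV. bsgrad i s a c (face_point i (end_coord i s) y) * nrm i s (face_point i (end_coord i s) y) $ a
          * v c (face_point i (end_coord i s) y))"
      unfolding x_def .
  qed
  have mixX: "boundary_integral F lo hi (\<lambda>n x. (2 * \<nu>) *\<^sub>R normal_sym_grad \<Omega> u n x \<bullet> u x) = 2 * \<nu> * X"
    unfolding boundary_integral_def X_def by (simp add: mix sum_distrib_left)
  have bndG: "boundary_integral F lo hi (\<lambda>n x. (2 * \<nu> * (CNit / h)) *\<^sub>R u x \<bullet> u x) = 2 * \<nu> * (CNit / h) * \<Gamma>"
  proof -
    have "boundary_integral F lo hi (\<lambda>n x. (2 * \<nu> * (CNit / h)) *\<^sub>R u x \<bullet> u x) =
        (\<Sum>i\<in>UNIV. \<Sum>s\<in>UNIV. (2 * \<nu> * (CNit / h)) * fint i s (\<lambda>x. \<Sum>c\<in>UNIV. (v c x)\<^sup>2))"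
      unfolding boundary_integral_def inner_scaleR_left integral_mult_right_zero bnd ..
    then show ?thesis by (simp only: \<Gamma>_def sum_distrib_left)
  qed
  have vol2: "(LINT x|lebesgue_on \<Omega>. (2 * \<nu>) *\<^sub>R sym_grad u x \<bullet> sym_grad u x) = 2 * \<nu> * A"
    unfolding inner_scaleR_left integral_mult_right_zero vol ..
  show "A_stb \<alpha>' F lo hi \<zeta> h \<nu> \<gamma> CNit u u = 2 * \<nu> * A - 4 * \<nu> * X + 2 * \<nu> * (CNit / h) * \<Gamma> + Jt"
    unfolding A_stb_def A_form_def Let_def conv mixX bndG vol2 Jt_def by simp
  show "energy_norm_sq \<alpha>' F lo hi \<zeta> h \<nu> \<gamma> CNit u = 2 * \<nu> * A + 2 * \<nu> * (CNit / h) * \<Gamma> + Jt"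
    unfolding energy_norm_sq_def vol bfs Jt_def J_form_self[OF pos] ..
  show "0 \<le> Jt" unfolding Jt_def J_form_self[OF pos] by (rule interior_facet_sum_nonneg) simp
qed

context curved_box
begin

lemma trace_constants:
  obtains Dm \<delta> B where "0 < Dm" "\<And>i x. x \<in> Q \<Longrightarrow> dens i x \<le> Dm"
    "0 < \<delta>" "\<And>x. x \<in> Q \<Longrightarrow> \<delta> \<le> \<bar>det (J x)\<bar>"
    "0 < B" "\<And>b c x. x \<in> Q \<Longrightarrow> \<bar>det (J x) * K x $ b $ c\<bar> \<le> B"
proof -
  have "\<exists>B>0. \<forall>i\<in>UNIV. \<forall>x\<in>Q. \<bar>dens i x\<bar> \<le> B"
    by (rule finite_family_bound[where P="\<lambda>i x B. \<bar>dens i x\<bar> \<le> B"]) (auto intro: continuous_Q_bounded[OF continuous_dens])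
  then obtain Dm where Dm: "0 < Dm" "\<forall>i\<in>UNIV. \<forall>x\<in>Q. \<bar>dens i x\<bar> \<le> Dm" by (elim exE conjE)
  have dens: "dens i x \<le> Dm" if "x \<in> Q" for i x using Dm(2)[rule_format, OF UNIV_I that] by (rule order_trans[OF abs_ge_self])
  have c: "continuous_on Q (\<lambda>x. det (J x) * K x $ b $ c)" for b c
    by (intro continuous_on_mult continuous_det_J continuous_C1S C1_K)
  have "\<exists>B>0. \<forall>bc\<in>(UNIV :: ('d \<times> 'd) set). \<forall>x\<in>Q. \<bar>det (J x) * K x $ fst bc $ snd bc\<bar> \<le> B"
    by (rule finite_family_bound[where P="\<lambda>bc x B. \<bar>det (J x) * K x $ fst bc $ snd bc\<bar> \<le> B"])
      (auto intro: continuous_Q_bounded[OF c])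
  then obtain B where B: "0 < B" "\<forall>bc\<in>(UNIV :: ('d \<times> 'd) set). \<forall>x\<in>Q. \<bar>det (J x) * K x $ fst bc $ snd bc\<bar> \<le> B"
    by (elim exE conjE)
  have Bb: "\<bar>det (J x) * K x $ b $ c\<bar> \<le> B" if "x \<in> Q" for b c x
    using bspec[OF bspec[OF B(2) UNIV_I[of "(b, c)"]] that] by simp
  have cd: "continuous_on Q (\<lambda>x. \<bar>det (J x)\<bar>)" by (intro continuous_on_rabs continuous_det_J)
  have "lo \<in> Q" using less_imp_le[OF lo_less_hi] by (simp add: mem_box_cart)
  then have "Q \<noteq> {}" by blast
  from continuous_attains_inf[OF compact_cbox this cd]
  obtain p where p: "p \<in> Q" "\<forall>x\<in>Q. \<bar>det (J p)\<bar> \<le> \<bar>det (J x)\<bar>" by (elim bexE)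
  have "0 < \<bar>det (J p)\<bar>" using det_J_nz[OF box_in_S(2)[OF p(1)]] by simp
  from that[OF Dm(1) dens this bspec[OF p(2)] B(1) Bb] show thesis .
qed

text \<open>The trace and Korn inequalities combine to \<open>h T \<le> C3 (A + \<Gamma>/h)\<close> for the boundary integral \<open>T\<close> of \<open>|\<nabla>\<^sup>s u|\<^sup>2\<close>; the bound
  \<open>h \<le> H\<close> turns \<open>\<Gamma>\<close> into \<open>\<Gamma>/h\<close>.  Young's inequality with weight \<open>h / (2 C3)\<close> then gives
  \<open>2 X \<le> A/2 + (1/2 + 2 C3) \<Gamma>/h\<close>, and half of the penalty term outweighs the second summand as soon as its constant is at least \<open>1 + 4 C3\<close>.\<close>

theorem coercivity:
  assumes C: "0 < C" and \<sigma>: "0 < \<sigma>"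
  shows "\<exists>C0>0. \<forall>CNit\<ge>C0. \<forall>\<zeta> h \<nu> \<gamma>.
           knots lo hi \<zeta> \<and> 0 < h \<and> quasi_uniform F \<zeta> C h \<and> shape_regular F \<zeta> \<sigma> \<and>
           0 < \<nu> \<and> 0 \<le> \<gamma> \<longrightarrow>
           (\<forall>u\<in>div_free_velocity_space k' \<alpha>' F lo hi \<zeta>.
              A_stb \<alpha>' F lo hi \<zeta> h \<nu> \<gamma> CNit u u
                \<ge> (1/2) * energy_norm_sq \<alpha>' F lo hi \<zeta> h \<nu> \<gamma> CNit u)"
proof -
  obtain CK where CK: "CK > 0" and korn: "\<forall>Z v. (\<forall>k. finite (Z k)) \<longrightarrow> (\<forall>c. PW Z (v c)) \<longrightarrow>
     (\<forall>f. BM Z f \<longrightarrow> vint Z (\<lambda>x. (\<Sum>a\<in>UNIV. phd a (v a) x) * f x) = 0) \<longrightarrow>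
     vint Z (\<lambda>x. \<Sum>c\<in>UNIV. (v c x)\<^sup>2) \<le>
       CK * (vint Z (\<lambda>x. \<Sum>a\<in>UNIV. \<Sum>c\<in>UNIV. (sgrad v a c x)\<^sup>2)
          + (\<Sum>i\<in>UNIV. \<Sum>s\<in>UNIV. fint i s (\<lambda>x. \<Sum>c\<in>UNIV. (v c x)\<^sup>2)))"
    using korn_inequality by (elim exE conjE)
  obtain c1 c2 H where c1: "c1 > 0" and H: "H > 0" and sizes: "\<forall>\<zeta> h. knots lo hi \<zeta> \<longrightarrow> 0 < h \<longrightarrow>
      quasi_uniform F \<zeta> C h \<longrightarrow> shape_regular F \<zeta> \<sigma> \<longrightarrow>
    h \<le> H \<and> (\<forall>j\<in>cells \<zeta>. \<forall>k. c1 * h \<le> cell_hi \<zeta> j $ k - cell_lo \<zeta> j $ k \<and> cell_hi \<zeta> j $ k - cell_lo \<zeta> j $ k \<le> c2 * h)"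
    using cell_sizes[OF C \<sigma>] by (elim exE conjE)
  obtain Cl where Cl: "Cl > 0" and loc: "\<forall>a b h. (\<forall>i. a $ i < b $ i) \<longrightarrow> cbox a b \<subseteq> Q \<longrightarrow> 0 < h \<longrightarrow>
     (\<forall>i. c1 * h \<le> b $ i - a $ i \<and> b $ i - a $ i \<le> c2 * h) \<longrightarrow>
     (\<forall>P i s. (\<forall>\<beta>. TP (k' + 1) (P \<beta>)) \<longrightarrow>
        h * pbox.cface a b i s (\<lambda>x. \<Sum>\<alpha>\<in>UNIV. \<Sum>c\<in>UNIV. (sgrad (vel P) \<alpha> c x)\<^sup>2) \<le>
        Cl * (pbox.cint a b (\<lambda>x. \<Sum>\<alpha>\<in>UNIV. \<Sum>c\<in>UNIV. (sgrad (vel P) \<alpha> c x)\<^sup>2)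
           + pbox.cint a b (\<lambda>x. \<Sum>\<beta>\<in>UNIV. (P \<beta> x)\<^sup>2)))"
    using local_trace_inequality[OF c1, where ?c2.0=c2 and n="k' + 1"] by (elim exE conjE)
  obtain Dm \<delta> B where Dm: "0 < Dm" "\<And>i x. x \<in> Q \<Longrightarrow> dens i x \<le> Dm"
    and \<delta>: "0 < \<delta>" "\<And>x. x \<in> Q \<Longrightarrow> \<delta> \<le> \<bar>det (J x)\<bar>"
    and B: "0 < B" "\<And>b c x. x \<in> Q \<Longrightarrow> \<bar>det (J x) * K x $ b $ c\<bar> \<le> B"
  proof (rule trace_constants)
    fix Dm \<delta> B assume *: "0 < Dm" "\<And>i x. x \<in> Q \<Longrightarrow> dens i x \<le> Dm"
      "0 < \<delta>" "\<And>x. x \<in> Q \<Longrightarrow> \<delta> \<le> \<bar>det (J x)\<bar>"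
      "0 < B" "\<And>b c x. x \<in> Q \<Longrightarrow> \<bar>det (J x) * K x $ b $ c\<bar> \<le> B"
    show thesis by (rule that[OF *])
  qed
  let ?m = "real CARD('d)"
  define C2 where "C2 = 2 * ?m * Dm * Cl / \<delta> * (1 + ?m\<^sup>2 * B\<^sup>2)"
  have "0 < ?m" using zero_less_card_finite[where 'a='d] by simp
  moreover have "0 < 1 + ?m\<^sup>2 * B\<^sup>2" by (intro add_pos_nonneg) auto
  ultimately have C2: "C2 > 0" unfolding C2_def using Dm(1) Cl \<delta>(1)
    by (intro mult_pos_pos divide_pos_pos) auto
  define C3 where "C3 = C2 * (1 + CK) * (1 + H)"
  have C3: "C3 > 0" unfolding C3_def using C2 CK H by (intro mult_pos_pos add_pos_pos) auto
  have main: "A_stb \<alpha>' F lo hi \<zeta> h \<nu> \<gamma> CNit u u \<ge> (1/2) * energy_norm_sq \<alpha>' F lo hi \<zeta> h \<nu> \<gamma> CNit u"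
    if CN: "1 + 4 * C3 \<le> CNit" and kn: "knots lo hi \<zeta>" and h: "0 < h" and qu: "quasi_uniform F \<zeta> C h"
      and sr: "shape_regular F \<zeta> \<sigma>" and nu: "0 < \<nu>" and ga: "0 \<le> \<gamma>"
      and u: "u \<in> div_free_velocity_space k' \<alpha>' F lo hi \<zeta>" for CNit \<zeta> h \<nu> \<gamma> u
  proof -
    interpret mesh F lo hi S \<zeta> by unfold_locales (rule kn)
    have hH: "h \<le> H" and sz: "\<forall>j\<in>cells \<zeta>. \<forall>k. c1 * h \<le> chi j $ k - clo j $ k \<and> chi j $ k - clo j $ k \<le> c2 * h"
      using sizes[rule_format, OF kn h qu sr] by blast+
    from u have uH: "u \<in> H1n F lo hi" and sp: "\<And>c. (\<lambda>x. pullback F u x $ c) \<in> tensor_spline_space lo hi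
        (\<lambda>i. if i = c then k' + 1 else k') (\<lambda>i. if i = c then \<alpha>' + 1 else \<alpha>') \<zeta>"
      and div: "AE x in lebesgue_on \<Omega>. divergence u x = 0"
      unfolding div_free_velocity_space_def velocity_space_def by blast+
    from uH obtain g where tr: "has_trace F lo hi u g"
      and gn: "\<forall>i s. AE x in face_measure F lo hi i s. g x \<bullet> unit_normal F lo hi i s x = 0"
      unfolding H1n_def mem_Collect_eq by (elim exE conjE)
    have "\<exists>P. (\<forall>j\<in>cells \<zeta>. \<forall>b. TP (k' + 1) (P j b)) \<and>
        (\<forall>j\<in>cells \<zeta>. \<forall>x\<in>cbox (clo j) (chi j). \<forall>c. u (F x) $ c = vel (P j) c x)"
      by (rule velocity_pieces[OF sp]) simp
    then obtain P where P: "\<forall>j\<in>cells \<zeta>. \<forall>b. TP (k' + 1) (P j b)"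
      "\<forall>j\<in>cells \<zeta>. \<forall>x\<in>cbox (clo j) (chi j). \<forall>c. u (F x) $ c = vel (P j) c x" by (elim exE conjE)
    define v where "v c x = u (F x) $ c" for c x
    have uv: "u (F x) $ c = v c x" for x c by (simp add: v_def)
    interpret piecewise_velocity F lo hi S \<zeta> "k' + 1" P v
    proof
      show "TP (k' + 1) (P j b)" if "j \<in> cells \<zeta>" for j b using P(1) that by blast
      show "v c x = vel (P j) c x" if "j \<in> cells \<zeta>" "x \<in> cbox (clo j) (chi j)" for j x c
        using P(2) that unfolding v_def by blast
    qed
    define A where "A = vint skel (\<lambda>x. \<Sum>a\<in>UNIV. \<Sum>c\<in>UNIV. (sgrad v a c x)\<^sup>2)"
    define V where "V = vint skel (\<lambda>x. \<Sum>c\<in>UNIV. (v c x)\<^sup>2)"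
    define \<Gamma> where "\<Gamma> = (\<Sum>i\<in>UNIV. \<Sum>s\<in>UNIV. fint i s (\<lambda>x. \<Sum>c\<in>UNIV. (v c x)\<^sup>2))"
    define T where "T = (\<Sum>i\<in>UNIV. \<Sum>s\<in>UNIV. fint i s (\<lambda>x. \<Sum>a\<in>UNIV. \<Sum>c\<in>UNIV. (bsgrad i s a c x)\<^sup>2))"
    define X where "X = (\<Sum>i\<in>UNIV. \<Sum>s\<in>UNIV. fint i s (\<lambda>x. \<Sum>c\<in>UNIV. \<Sum>a\<in>UNIV. bsgrad i s a c x * nrm i s x $ a * v c x))"
    define Jt where "Jt = J_form \<alpha>' F lo hi \<zeta> h \<nu> \<gamma> u u"
    note hyps = uv tr gn[rule_format] div h nu ga
    note en = A_stb_energy(1,2)[OF hyps, where CNit=CNit and \<alpha>'=\<alpha>', folded A_def \<Gamma>_def X_def Jt_def]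
    note Jt0 = A_stb_energy(3)[OF hyps, where \<alpha>'=\<alpha>', folded Jt_def]
    have A0: "0 \<le> A" unfolding A_def by (intro vint_nonneg sum_nonneg) simp
    have \<Gamma>0: "0 \<le> \<Gamma>" unfolding \<Gamma>_def by (intro sum_nonneg fint_nonneg) simp
    have uvf: "(\<lambda>x. u (F x) $ c) = v c" for c by (rule ext) (rule uv)
    have PWu: "PW skel (\<lambda>x. u (F x) $ c)" for c unfolding uvf by (rule PW_v)
    have div0: "vint skel (\<lambda>x. (\<Sum>a\<in>UNIV. phd a (v a) x) * f x) = 0" if "BM skel f" for f
      using vint_divergence_free[OF finite_skel PWu div that] unfolding uvf .
    have VA: "V \<le> CK * (A + \<Gamma>)"
      unfolding V_def A_def \<Gamma>_def by (rule korn[rule_format, OF finite_skel PW_v div0])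
    have hT: "h * T \<le> C2 * (A + V)"
      unfolding T_def A_def V_def C2_def
    proof (rule discrete_trace_inequality[OF h _ Cl Dm \<delta> B])
      fix j i s assume j: "j \<in> cells \<zeta>"
      show "h * cF j i s (\<lambda>x. \<Sum>\<alpha>\<in>UNIV. \<Sum>c\<in>UNIV. (sgrad (vel (P j)) \<alpha> c x)\<^sup>2) \<le>
       Cl * (cI j (\<lambda>x. \<Sum>\<alpha>\<in>UNIV. \<Sum>c\<in>UNIV. (sgrad (vel (P j)) \<alpha> c x)\<^sup>2) + cI j (\<lambda>x. \<Sum>\<beta>\<in>UNIV. (P j \<beta> x)\<^sup>2))"
        by (rule loc[rule_format, OF cell_lo_less_hi[OF j] cell_subset[OF j] h sz[rule_format, OF j] TP_P[OF j]])
    qed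
    define Gh where "Gh = \<Gamma> / h"
    have Gh: "\<Gamma> = h * Gh" "0 \<le> Gh" using h \<Gamma>0 by (simp_all add: Gh_def)
    have "\<Gamma> \<le> H * Gh" unfolding Gh(1) using hH Gh(2) by (intro mult_right_mono)
    then have "V \<le> CK * (A + H * Gh)" using VA CK by (meson add_left_mono less_imp_le mult_left_mono order_trans)
    then have "A + V \<le> (1 + CK) * (1 + H) * (A + Gh)"
    proof -
      assume V: "V \<le> CK * (A + H * Gh)"
      have "0 \<le> CK * H * A + H * A + Gh + H * Gh + CK * Gh" using CK H A0 Gh(2) by simp
      then show ?thesis using V by (simp add: algebra_simps)
    qed
    then have "C2 * (A + V) \<le> C3 * (A + Gh)" unfolding C3_def mult.assoc using C2
      by (intro mult_left_mono) (auto simp: mult.assoc)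
    then have T: "h * T \<le> C3 * (A + Gh)" using hT by linarith
    \<comment> \<open>the weight for which the trace term costs half of \<open>A\<close>\<close>
    define e where "e = h / (2 * C3)"
    have e: "e > 0" using h C3 by (simp add: e_def)
    have "2 * X \<le> e * T + (1 / e) * \<Gamma>"
      unfolding X_def T_def \<Gamma>_def sum_distrib_left sum.distrib[symmetric]
    proof (intro sum_mono)
      fix i s
      let ?X = "\<lambda>x. \<Sum>c\<in>UNIV. \<Sum>a\<in>UNIV. bsgrad i s a c x * nrm i s x $ a * v c x"
      let ?T = "\<lambda>x. \<Sum>a\<in>UNIV. \<Sum>c\<in>UNIV. (bsgrad i s a c x)\<^sup>2"
      let ?V = "\<lambda>x. \<Sum>c\<in>UNIV. (v c x)\<^sup>2"
      have FMX: "FM ?X" by (intro FM_sum FM_mult FM_bsgrad FM_continuous continuous_nrm continuous_v)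
      have FMT: "FM ?T" by (intro FM_sum FM_power FM_bsgrad)
      have FMV: "FM ?V" by (intro FM_sum FM_power FM_continuous continuous_v)
      have "2 * fint i s ?X = fint i s (\<lambda>x. 2 * ?X x)" by (rule fint_cmult[symmetric])
      also have "\<dots> \<le> fint i s (\<lambda>x. e * ?T x + (1 / e) * ?V x)"
      proof (rule fint_mono[OF finite_skel FM_mult[OF FM_const FMX] FM_add[OF FM_mult[OF FM_const FMT] FM_mult[OF FM_const FMV]]])
        fix y assume y: "y \<in> face i"
        define x where "x = face_point i (end_coord i s) y"
        have "x \<in> S" unfolding x_def by (rule box_in_S(2)[OF face_point_end_Q[OF y]])
        then have "norm (nrm i s x) = 1" by (rule norm_nrm)
        then have "(\<Sum>a\<in>UNIV. (nrm i s x $ a)\<^sup>2) = 1" by (simp add: norm_vec_def L2_set_def)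
        from weighted_young_double_sum[OF e this]
        have "2 * ?X x \<le> e * ?T x + (1 / e) * ?V x" .
        then show "2 * ?X (face_point i (end_coord i s) y) \<le> e * ?T (face_point i (end_coord i s) y) + (1 / e) * ?V (face_point i (end_coord i s) y)"
          unfolding x_def .
      qed
      also have "\<dots> = e * fint i s ?T + (1 / e) * fint i s ?V"
        unfolding fint_add[OF FM_mult[OF FM_const FMT] FM_mult[OF FM_const FMV]] fint_cmult ..
      finally show "2 * fint i s ?X \<le> e * fint i s ?T + (1 / e) * fint i s ?V" .
    qed
    moreover have "e * T \<le> (1/2) * (A + Gh)"
    proof -
      have "e * T = (h * T) / (2 * C3)" by (simp add: e_def)
      also have "\<dots> \<le> C3 * (A + Gh) / (2 * C3)" using T C3 by (intro divide_right_mono) auto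
      also have "\<dots> = (1/2) * (A + Gh)" using C3 by simp
      finally show ?thesis .
    qed
    moreover have "(1 / e) * \<Gamma> = 2 * C3 * Gh" using h C3 by (simp add: e_def Gh_def)
    ultimately have X: "2 * X \<le> (1/2) * A + (1/2 + 2 * C3) * Gh" by (simp add: distrib_right)
    have "(1 + 4 * C3) * Gh \<le> CNit * Gh" using CN Gh(2) by (intro mult_right_mono)
    then have "(1/2) * A + (1/2) * (CNit * Gh) \<le> A - 2 * X + CNit * Gh" using X by (simp add: distrib_right)
    then have "2 * \<nu> * ((1/2) * A + (1/2) * (CNit * Gh)) \<le> 2 * \<nu> * (A - 2 * X + CNit * Gh)"
      using nu by (intro mult_left_mono) auto
    moreover have "2 * \<nu> * (CNit / h) * \<Gamma> = 2 * \<nu> * (CNit * Gh)" by (simp add: Gh_def)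
    ultimately show ?thesis unfolding en(1,2) using Jt0 by (simp add: algebra_simps)
  qed
  show ?thesis
    by (intro exI[of _ "1 + 4 * C3"] conjI allI impI ballI; (elim conjE)?) (use C3 in simp, rule main)
qed

end

theorem lemma2:
  fixes F :: "real^'d \<Rightarrow> real^'d" and lo hi :: "real^'d"
    and k' \<alpha>' :: nat and C \<sigma> :: real
  assumes "CARD('d) \<in> {2, 3}"
    and "1 \<le> k'"
    and "parametrization (\<alpha>' + 2) F lo hi"
    and "0 < C" and "0 < \<sigma>"
  shows "\<exists>C0>0. \<forall>CNit\<ge>C0. \<exists>Ccoer>0. \<forall>\<zeta> h \<nu> \<gamma>.
           knots lo hi \<zeta> \<and> 0 < h \<and> quasi_uniform F \<zeta> C h \<and> shape_regular F \<zeta> \<sigma> \<and>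
           0 < \<nu> \<and> 0 \<le> \<gamma> \<longrightarrow>
           (\<forall>u\<in>div_free_velocity_space k' \<alpha>' F lo hi \<zeta>.
              A_stb \<alpha>' F lo hi \<zeta> h \<nu> \<gamma> CNit u u
                \<ge> Ccoer * energy_norm_sq \<alpha>' F lo hi \<zeta> h \<nu> \<gamma> CNit u)"
proof -
  obtain S where "curved_box F lo hi S" using parametrization_curved_box[OF assms(1,3)] by (elim exE)
  then interpret curved_box F lo hi S .
  obtain C0 where C0: "C0 > 0" "\<forall>CNit\<ge>C0. \<forall>\<zeta> h \<nu> \<gamma>.
           knots lo hi \<zeta> \<and> 0 < h \<and> quasi_uniform F \<zeta> C h \<and> shape_regular F \<zeta> \<sigma> \<and>
           0 < \<nu> \<and> 0 \<le> \<gamma> \<longrightarrow>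
           (\<forall>u\<in>div_free_velocity_space k' \<alpha>' F lo hi \<zeta>.
              A_stb \<alpha>' F lo hi \<zeta> h \<nu> \<gamma> CNit u u
                \<ge> (1/2) * energy_norm_sq \<alpha>' F lo hi \<zeta> h \<nu> \<gamma> CNit u)"
    using coercivity[OF assms(4,5), where k'=k' and \<alpha>'=\<alpha>'] by (elim exE conjE)
  show ?thesis
  proof (rule exI[of _ C0], rule conjI[OF C0(1)], intro allI impI)
    fix CNit assume "C0 \<le> CNit"
    note CN = mp[OF spec[OF C0(2)] this]
    show "\<exists>Ccoer>0. \<forall>\<zeta> h \<nu> \<gamma>.
           knots lo hi \<zeta> \<and> 0 < h \<and> quasi_uniform F \<zeta> C h \<and> shape_regular F \<zeta> \<sigma> \<and>
           0 < \<nu> \<and> 0 \<le> \<gamma> \<longrightarrow>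
           (\<forall>u\<in>div_free_velocity_space k' \<alpha>' F lo hi \<zeta>.
              A_stb \<alpha>' F lo hi \<zeta> h \<nu> \<gamma> CNit u u
                \<ge> Ccoer * energy_norm_sq \<alpha>' F lo hi \<zeta> h \<nu> \<gamma> CNit u)"
      by (rule exI[of _ "1/2"], rule conjI[OF _ CN]) simp
  qed
qed

end
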